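(* Let $k\ge1$, let $M$ be a closed $2k$-manifold, and let $\Omega_M$ be the identity matrix of size $\beta_k(M)$ if there is $x\in H_k(M;\mathbb{Z}_2)$ with $x\cap_M x=1$, and otherwise the direct sum of $\beta_k(M)/2$ copies of $\begin{pmatrix}0&1\\1&0\end{pmatrix}$. If $[n]^{*k+1}$ has an almost embedding to $M$, then there is a $\beta_k(M)\times\binom{n}{2}^{k+1}$ matrix $Y$ over $\mathbb{Z}_2$ such that $Y^T\Omega_M Y$ is an $(n,k)$-matrix.
   Context: $\beta_k(M)=\dim H_k(M;\mathbb{Z}_2)$ (it is even in the second case); $\cap_M$ is the mod 2 intersection form. $[n]^{*k+1}$ is the $k$-complex with vertex set $[k+1]\times[n]$ whose $k$-faces are spanned by one vertex $(i,a_i)$ from each $\{i\}\times[n]$. A map $f:K\to M$ from a complex is an almost embedding if $f\sigma\cap f\tau=\emptyset$ for any vertex-disjoint faces $\sigma,\tau$ of $K$. A $k$-octahedron $P=P_1*\dots*P_{k+1}$ ($P_i\subset[n]$ 2-element subsets) is the set of $k$-faces spanned by $(1,a_1),\dots,(k+1,a_{k+1})$, $a_i\in P_i$; there are $\binom n2^{k+1}$ of them, indexing the columns of $Y$. $P,Q$ are vertex-disjoint if $P_i\cap Q_i=\emptyset$ for all $i$; $\oplus$ is symmetric difference. An $(n,k)$-matrix is a symmetric $\mathbb{Z}_2$-matrix $A$ indexed by $k$-octahedra with $A_{P,Q}=0$ for vertex-disjoint $P,Q$, $A_{P,Q}=A_{X,Q}+A_{Y,Q}$ whenever $P=X\oplus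 Y$, and $\sum A_{P,Q}=1$ over unordered pairs $\{P,Q\}$ with $P_i,Q_i\subset[3]$, $P_i\cap Q_i=\{1\}$ for all $i$.
   Formalization: The formal theorem assumes n ≥ 3; for n ≤ 2 no pairs of octahedra with P_i∩Q_i={1} exist, so the sum in the definition of an (n,k)-matrix is empty and cannot equal 1 (for example k=1, n=2, M=S²). *)

theory Defs
  imports
    "HOL-Homology.Homology"
    "HOL-Library.Z2"
    "Jordan_Normal_Form.VS_Connect"
begin

section \<open>Singular homology with mod 2 coefficients\<close>

text \<open>
  HOL-Homology has integral coefficients only.  Its singular simplices and faces are reused here;
  chains, relative cycles and homology classes copy its definitions with \<^typ>\<open>int\<close> replaced by
  the field \<^typ>\<open>bit\<close>, so that the signs in the boundary disappear.
\<close>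

type_synonym 'a simplex = "(nat \<Rightarrow> real) \<Rightarrow> 'a"
type_synonym 'a chain2 = "'a simplex \<Rightarrow>\<^sub>0 bit"
type_synonym 'a cochain2 = "'a simplex \<Rightarrow> bit"

definition singular_chain2 :: "nat \<Rightarrow> 'a topology \<Rightarrow> 'a chain2 \<Rightarrow> bool" where
  "singular_chain2 p X c \<longleftrightarrow> Poly_Mapping.keys c \<subseteq> singular_simplex_set p X"

definition chain_boundary2 :: "nat \<Rightarrow> 'a chain2 \<Rightarrow> 'a chain2" where
  "chain_boundary2 p c =
     (if p = 0 then 0
      else \<Sum>\<sigma>\<in>Poly_Mapping.keys c. \<Sum>i\<le>p.
             Poly_Mapping.single (singular_face p i \<sigma>) (Poly_Mapping.lookup c \<sigma>))"

definition singular_cycle2 :: "nat \<Rightarrow> 'a topology \<Rightarrow> 'a chain2 \<Rightarrow> bool" where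
  "singular_cycle2 p X c \<longleftrightarrow> singular_chain2 p X c \<and> chain_boundary2 p c = 0"

definition singular_relboundary2 :: "nat \<Rightarrow> 'a topology \<Rightarrow> 'a set \<Rightarrow> 'a chain2 \<Rightarrow> bool" where
  "singular_relboundary2 p X S c \<longleftrightarrow>
     (\<exists>d. singular_chain2 (Suc p) X d \<and>
          singular_chain2 p (subtopology X S) (chain_boundary2 (Suc p) d - c))"

abbreviation singular_boundary2 :: "nat \<Rightarrow> 'a topology \<Rightarrow> 'a chain2 \<Rightarrow> bool" where
  "singular_boundary2 p X \<equiv> singular_relboundary2 p X {}"

definition homology_class2 :: "nat \<Rightarrow> 'a topology \<Rightarrow> 'a chain2 \<Rightarrow> 'a chain2 set" where
  "homology_class2 p X c = {d. singular_boundary2 p X (c - d)}"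

text \<open>
  The quotient vector space of cycles by boundaries, as a module record over
  \<^term>\<open>class_ring :: bit ring\<close>; the ring multiplication and unit of the record play no role.
\<close>

definition homology2 :: "nat \<Rightarrow> 'a topology \<Rightarrow> (bit, 'a chain2 set) module" where
  "homology2 p X =
     \<lparr> carrier = homology_class2 p X ` {c. singular_cycle2 p X c},
       mult = undefined, one = undefined,
       zero = homology_class2 p X 0,
       add = (\<lambda>A B. {a + b | a b. a \<in> A \<and> b \<in> B}),
       smult = (\<lambda>r A. \<Union>a\<in>A. homology_class2 p X (Poly_Mapping.map ((*) r) a)) \<rparr>"

definition betti2 :: "nat \<Rightarrow> 'a topology \<Rightarrow> nat" where
  "betti2 p X = vectorspace.dim (class_ring :: bit ring) (homology2 p X)"


section \<open>Closed manifolds and the mod 2 intersection form\<close>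

text \<open>
  Topological manifolds, not assumed connected.  Second countability is automatic for a compact
  locally Euclidean space.
\<close>

definition closed_manifold :: "nat \<Rightarrow> 'a topology \<Rightarrow> bool" where
  "closed_manifold n X \<longleftrightarrow>
     compact_space X \<and> Hausdorff_space X \<and>
     (\<forall>x\<in>topspace X. \<exists>U. openin X U \<and> x \<in> U \<and>
        subtopology X U homeomorphic_space Euclidean_space n)"

text \<open>
  A mod 2 fundamental cycle restricts to the generator of
  \<open>H\<^sub>n(X, X - {x}; \<int>\<^sub>2) \<cong> \<int>\<^sub>2\<close>, i.e. to its only nonzero element, at every point \<open>x\<close>.
\<close>

definition fundamental_cycle2 :: "nat \<Rightarrow> 'a topology \<Rightarrow> 'a chain2 \<Rightarrow> bool" where
  "fundamental_cycle2 n X \<mu> \<longleftrightarrow>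
     singular_cycle2 n X \<mu> \<and>
     (\<forall>x\<in>topspace X. \<not> singular_relboundary2 n X (topspace X - {x}) \<mu>)"

text \<open>
  A \<open>p\<close>-cochain of \<open>X\<close> is a function on all maps, of which only the values on singular
  \<open>p\<close>-simplices of \<open>X\<close> matter.
\<close>

definition singular_cocycle2 :: "nat \<Rightarrow> 'a topology \<Rightarrow> 'a cochain2 \<Rightarrow> bool" where
  "singular_cocycle2 p X \<phi> \<longleftrightarrow>
     (\<forall>\<sigma>. singular_simplex (Suc p) X \<sigma> \<longrightarrow> (\<Sum>i\<le>Suc p. \<phi> (singular_face (Suc p) i \<sigma>)) = 0)"

text \<open>
  Since points of \<^term>\<open>standard_simplex p\<close> vanish beyond coordinate \<open>p\<close>, the front face
  \<open>[v\<^sub>0,\<dots>,v\<^sub>p]\<close> of a simplex is just a restriction; the back \<open>q\<close>-face of a \<open>(p + q)\<close>-simplex is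
  \<open>[v\<^sub>p,\<dots>,v\<^bsub>p+q\<^esub>]\<close>.
\<close>

definition front_face :: "nat \<Rightarrow> 'a simplex \<Rightarrow> 'a simplex" where
  "front_face p \<sigma> = restrict \<sigma> (standard_simplex p)"

definition back_face :: "nat \<Rightarrow> nat \<Rightarrow> 'a simplex \<Rightarrow> 'a simplex" where
  "back_face p q \<sigma> =
     restrict (\<lambda>x. \<sigma> (\<lambda>i. if i < p then 0 else x (i - p))) (standard_simplex q)"

definition cup2 :: "nat \<Rightarrow> nat \<Rightarrow> 'a cochain2 \<Rightarrow> 'a cochain2 \<Rightarrow> 'a cochain2" where
  "cup2 p q \<phi> \<psi> = (\<lambda>\<sigma>. \<phi> (front_face p \<sigma>) * \<psi> (back_face p q \<sigma>))"

definition cap2 :: "nat \<Rightarrow> nat \<Rightarrow> 'a chain2 \<Rightarrow> 'a cochain2 \<Rightarrow> 'a chain2" where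
  "cap2 p q c \<phi> =
     (\<Sum>\<sigma>\<in>Poly_Mapping.keys c.
        Poly_Mapping.single (back_face p q \<sigma>) (Poly_Mapping.lookup c \<sigma> * \<phi> (front_face p \<sigma>)))"

definition eval_cochain2 :: "'a cochain2 \<Rightarrow> 'a chain2 \<Rightarrow> bit" where
  "eval_cochain2 \<phi> c = (\<Sum>\<sigma>\<in>Poly_Mapping.keys c. Poly_Mapping.lookup c \<sigma> * \<phi> \<sigma>)"

text \<open>
  The intersection form on the middle homology of a closed \<open>2k\<close>-manifold: the pairing
  \<open>\<langle>\<phi> \<union> \<psi>, [X]\<rangle>\<close> of the Poincare duals \<open>\<phi>, \<psi>\<close> of \<open>x, y\<close>.  The value does not depend on the choice
  of the fundamental cycle and of the cocycles, and such choices exist by Poincare duality.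
\<close>

definition intersection_form2 ::
  "nat \<Rightarrow> 'a topology \<Rightarrow> 'a chain2 set \<Rightarrow> 'a chain2 set \<Rightarrow> bit" where
  "intersection_form2 k X x y =
     (THE r. \<exists>\<mu> \<phi> \<psi>. fundamental_cycle2 (2 * k) X \<mu> \<and>
        singular_cocycle2 k X \<phi> \<and> singular_cocycle2 k X \<psi> \<and>
        x = homology_class2 k X (cap2 k k \<mu> \<phi>) \<and>
        y = homology_class2 k X (cap2 k k \<mu> \<psi>) \<and>
        r = eval_cochain2 (cup2 k k \<phi> \<psi>) \<mu>)"

definition Omega :: "nat \<Rightarrow> 'a topology \<Rightarrow> bit mat" where
  "Omega k M =
     (if \<exists>x\<in>carrier (homology2 k M). intersection_form2 k M x x = 1
      then 1\<^sub>m (betti2 k M)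
      else diag_block_mat
             (replicate (betti2 k M div 2) (mat_of_rows_list 2 [[0, 1], [1, 0]])))"


section \<open>Complexes and almost embeddings\<close>

text \<open>
  A complex is the set of its nonempty faces, a face being its set of vertices.  Points of the
  geometric realization are given by barycentric coordinates; the product topology is the usual
  one for finite complexes.
\<close>

definition geometric_realization :: "'v set set \<Rightarrow> ('v \<Rightarrow> real) topology" where
  "geometric_realization K =
     subtopology (powertop_real UNIV)
       {x. (\<forall>v. 0 \<le> x v) \<and> {v. x v \<noteq> 0} \<in> K \<and> (\<Sum>v | x v \<noteq> 0. x v) = 1}"

definition geometric_face :: "'v set set \<Rightarrow> 'v set \<Rightarrow> ('v \<Rightarrow> real) set" where
  "geometric_face K \<sigma> = {x \<in> topspace (geometric_realization K). {v. x v \<noteq> 0} \<subseteq> \<sigma>}"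

definition almost_embedding :: "'v set set \<Rightarrow> 'a topology \<Rightarrow> (('v \<Rightarrow> real) \<Rightarrow> 'a) \<Rightarrow> bool" where
  "almost_embedding K M f \<longleftrightarrow>
     continuous_map (geometric_realization K) M f \<and>
     (\<forall>\<sigma>\<in>K. \<forall>\<tau>\<in>K. \<sigma> \<inter> \<tau> = {} \<longrightarrow> f ` geometric_face K \<sigma> \<inter> f ` geometric_face K \<tau> = {})"

definition span_face :: "nat \<Rightarrow> (nat \<Rightarrow> nat) \<Rightarrow> (nat \<times> nat) set" where
  "span_face k a = (\<lambda>i. (i, a i)) ` {1..k+1}"

definition join_complex :: "nat \<Rightarrow> nat \<Rightarrow> (nat \<times> nat) set set" where
  "join_complex n k =
     {\<tau>. \<tau> \<noteq> {} \<and> (\<exists>a. (\<forall>i\<in>{1..k+1}. a i \<in> {1..n}) \<and> \<tau> \<subseteq> span_face k a)}"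


section \<open>Octahedra and $(n,k)$-matrices\<close>

type_synonym octahedron = "(nat \<times> nat) set set"

definition octahedron_of :: "nat \<Rightarrow> (nat \<Rightarrow> nat set) \<Rightarrow> octahedron" where
  "octahedron_of k p = {span_face k a | a. \<forall>i\<in>{1..k+1}. a i \<in> p i}"

definition octahedra :: "nat \<Rightarrow> nat \<Rightarrow> octahedron set" where
  "octahedra n k =
     {octahedron_of k p | p. \<forall>i\<in>{1..k+1}. p i \<subseteq> {1..n} \<and> card (p i) = 2}"

text \<open>The join factor \<open>P\<^sub>i\<close> of an octahedron \<open>P\<close>, recovered from its set of faces.\<close>

definition factor :: "octahedron \<Rightarrow> nat \<Rightarrow> nat set" where
  "factor P i = {a. (i, a) \<in> \<Union>P}"

definition vertex_disjoint :: "nat \<Rightarrow> octahedron \<Rightarrow> octahedron \<Rightarrow> bool" where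
  "vertex_disjoint k P Q \<longleftrightarrow> (\<forall>i\<in>{1..k+1}. factor P i \<inter> factor Q i = {})"

text \<open>The entry of a symmetric matrix at an unordered pair of indices.\<close>

definition entry_at :: "('i \<Rightarrow> 'i \<Rightarrow> bit) \<Rightarrow> 'i set \<Rightarrow> bit" where
  "entry_at A E = (THE r. \<exists>P Q. E = {P, Q} \<and> r = A P Q)"

text \<open>The last condition refers to octahedra with vertices in \<open>[3]\<close>, so the notion needs \<open>n \<ge> 3\<close>.\<close>

definition nk_matrix :: "nat \<Rightarrow> nat \<Rightarrow> (octahedron \<Rightarrow> octahedron \<Rightarrow> bit) \<Rightarrow> bool" where
  "nk_matrix n k A \<longleftrightarrow>
     (\<forall>P\<in>octahedra n k. \<forall>Q\<in>octahedra n k. A P Q = A Q P) \<and>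
     (\<forall>P\<in>octahedra n k. \<forall>Q\<in>octahedra n k. vertex_disjoint k P Q \<longrightarrow> A P Q = 0) \<and>
     (\<forall>P\<in>octahedra n k. \<forall>X\<in>octahedra n k. \<forall>Y\<in>octahedra n k. \<forall>Q\<in>octahedra n k.
        P = sym_diff X Y \<longrightarrow> A P Q = A X Q + A Y Q) \<and>
     (\<Sum>E\<in>{{P, Q} | P Q. P \<in> octahedra n k \<and> Q \<in> octahedra n k \<and>
              (\<forall>i\<in>{1..k+1}. factor P i \<subseteq> {1..3} \<and> factor Q i \<subseteq> {1..3} \<and>
                 factor P i \<inter> factor Q i = {1})}.
        entry_at A E) = 1"


section \<open>Well-definedness\<close>

lemma entry_at_pair:
  assumes "A P Q = A Q P"
  shows "entry_at A {P, Q} = A P Q"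
  unfolding entry_at_def using assms by (intro the_equality) (auto simp: doubleton_eq_iff)

lemma factor_octahedron_of:
  assumes "\<forall>i\<in>{1..k+1}. p i \<noteq> {}" and "i \<in> {1..k+1}"
  shows "factor (octahedron_of k p) i = p i"
proof
  show "factor (octahedron_of k p) i \<subseteq> p i"
    by (auto simp: factor_def octahedron_of_def span_face_def)
  show "p i \<subseteq> factor (octahedron_of k p) i"
  proof
    fix b assume b: "b \<in> p i"
    define a where "a = (\<lambda>j. if j = i then b else (SOME c. c \<in> p j))"
    have "\<forall>j\<in>{1..k+1}. a j \<in> p j"
      using assms b by (auto simp: a_def some_in_eq)
    moreover have "(i, b) \<in> span_face k a"
      using assms(2) by (auto simp: span_face_def a_def image_iff)
    ultimately show "b \<in> factor (octahedron_of k p) i"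
      by (auto simp: factor_def octahedron_of_def)
  qed
qed

lemma octahedra_bij:
  "bij_betw (octahedron_of k) (PiE {1..k+1} (\<lambda>_. {S. S \<subseteq> {1..n} \<and> card S = 2})) (octahedra n k)"
proof (rule bij_betwI[where g = "\<lambda>P. restrict (factor P) {1..k+1}"])
  show "octahedron_of k \<in> (PiE {1..k+1} (\<lambda>_. {S. S \<subseteq> {1..n} \<and> card S = 2})) \<rightarrow> octahedra n k"
    by (fastforce simp: octahedra_def PiE_iff)
  have ne: "\<forall>i\<in>{1..k+1}. p i \<noteq> {}" if "\<forall>i\<in>{1..k+1}. p i \<subseteq> {1..n} \<and> card (p i) = 2" for p
    using that by fastforce
  have cong: "octahedron_of k p = octahedron_of k q" if "\<And>i. i \<in> {1..k+1} \<Longrightarrow> p i = q i" for p q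
    using that by (simp add: octahedron_of_def)
  show "(\<lambda>P. restrict (factor P) {1..k+1})
      \<in> octahedra n k \<rightarrow> (PiE {1..k+1} (\<lambda>_. {S. S \<subseteq> {1..n} \<and> card S = 2}))"
  proof
    fix P assume P: "P \<in> octahedra n k"
    obtain p where p: "P = octahedron_of k p" "\<forall>i\<in>{1..k+1}. p i \<subseteq> {1..n} \<and> card (p i) = 2"
      using P unfolding octahedra_def by blast
    show "restrict (factor P) {1..k+1} \<in> (PiE {1..k+1} (\<lambda>_. {S. S \<subseteq> {1..n} \<and> card S = 2}))"
      using factor_octahedron_of[OF ne[OF p(2)]] p by (auto simp: PiE_iff)
  qed
  show "restrict (factor (octahedron_of k p)) {1..k+1} = p"
    if "p \<in> (PiE {1..k+1} (\<lambda>_. {S. S \<subseteq> {1..n} \<and> card S = 2}))" for p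
  proof
    fix i
    have *: "\<forall>i\<in>{1..k+1}. p i \<subseteq> {1..n} \<and> card (p i) = 2" using that by (auto simp: PiE_iff)
    show "restrict (factor (octahedron_of k p)) {1..k+1} i = p i"
      using factor_octahedron_of[OF ne[OF *], of i] that
      by (cases "i \<in> {1..k+1}") (auto simp: PiE_iff extensional_def)
  qed
  show "octahedron_of k (restrict (factor P) {1..k+1}) = P" if P: "P \<in> octahedra n k" for P
  proof -
    obtain p where p: "P = octahedron_of k p" "\<forall>i\<in>{1..k+1}. p i \<subseteq> {1..n} \<and> card (p i) = 2"
      using P unfolding octahedra_def by blast
    show ?thesis
      unfolding p(1) using factor_octahedron_of[OF ne[OF p(2)]] by (intro cong) auto
  qed
qed

lemma finite_octahedra: "finite (octahedra n k)"
proof -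
  have "finite {S. S \<subseteq> {1..n} \<and> card S = 2}" by simp
  then show ?thesis
    using bij_betw_finite[OF octahedra_bij[of k n]] by (simp add: finite_PiE)
qed

lemma card_octahedra: "card (octahedra n k) = (n choose 2) ^ (k + 1)"
  using bij_betw_same_card[OF octahedra_bij[of k n]] n_subsets[of "{1..n}" 2]
  by (simp add: card_PiE)

lemma ex_octahedra_enumeration: "\<exists>e. bij_betw e (octahedra n k) {..<(n choose 2) ^ (k + 1)}"
  using ex_bij_betw_finite_nat[OF finite_octahedra, of n k]
  by (simp add: card_octahedra atLeast0LessThan)

lemma singular_chain2_add:
  "singular_chain2 p X c \<Longrightarrow> singular_chain2 p X d \<Longrightarrow> singular_chain2 p X (c + d)"
  unfolding singular_chain2_def using Poly_Mapping.keys_add[of c d] by blast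

lemma chain_boundary2_add: "chain_boundary2 p (c + d) = chain_boundary2 p c + chain_boundary2 p d"
proof -
  define h where "h = (\<lambda>(c::'a chain2) \<sigma>. \<Sum>i\<le>p.
    Poly_Mapping.single (singular_face p i \<sigma>) (Poly_Mapping.lookup c \<sigma>))"
  define S where "S = Poly_Mapping.keys c \<union> Poly_Mapping.keys d"
  have S: "finite S" "Poly_Mapping.keys c \<subseteq> S" "Poly_Mapping.keys d \<subseteq> S"
    "Poly_Mapping.keys (c + d) \<subseteq> S"
    using Poly_Mapping.keys_add[of c d] by (auto simp: S_def)
  have sum_S: "(\<Sum>\<sigma>\<in>Poly_Mapping.keys x. h x \<sigma>) = (\<Sum>\<sigma>\<in>S. h x \<sigma>)"
    if "Poly_Mapping.keys x \<subseteq> S" for x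
    using that S(1) by (intro sum.mono_neutral_left) (auto simp: h_def in_keys_iff)
  have h_add: "h (c + d) \<sigma> = h c \<sigma> + h d \<sigma>" for \<sigma>
    by (simp only: h_def lookup_add single_add sum.distrib)
  have "(\<Sum>\<sigma>\<in>Poly_Mapping.keys (c + d). h (c + d) \<sigma>) =
      (\<Sum>\<sigma>\<in>Poly_Mapping.keys c. h c \<sigma>) + (\<Sum>\<sigma>\<in>Poly_Mapping.keys d. h d \<sigma>)"
    unfolding sum_S[OF S(2)] sum_S[OF S(3)] sum_S[OF S(4)] unfolding h_add by (rule sum.distrib)
  then show ?thesis
    by (simp add: chain_boundary2_def h_def)
qed

lemma chain2_diff: "c - d = c + (d :: 'a chain2)"
  by (rule poly_mapping_eqI) (simp add: lookup_minus lookup_add)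

lemma chain2_add_self: "c + c = (0 :: 'a chain2)"
  using chain2_diff[of c c] by simp

lemma chain2_add_left_self: "c + (c + d) = (d :: 'a chain2)"
  by (simp add: chain2_add_self flip: add.assoc)

lemma singular_boundary2_iff:
  "singular_boundary2 p X c \<longleftrightarrow> (\<exists>d. singular_chain2 (Suc p) X d \<and> chain_boundary2 (Suc p) d = c)"
proof -
  have "topspace (subtopology X {}) = {}" by simp
  from singular_simplex_empty[OF this] have "singular_simplex_set p (subtopology X {}) = {}"
    by blast
  then have "singular_chain2 p (subtopology X {}) e \<longleftrightarrow> e = 0" for e :: "'a chain2"
    by (simp only: singular_chain2_def subset_empty keys_eq_empty)
  then show ?thesis
    by (simp only: singular_relboundary2_def right_minus_eq)
qed

lemma singular_boundary2_add:
  "singular_boundary2 p X c \<Longrightarrow> singular_boundary2 p X d \<Longrightarrow> singular_boundary2 p X (c + d)"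
  unfolding singular_boundary2_iff by (metis singular_chain2_add chain_boundary2_add)

lemma singular_boundary2_0: "singular_boundary2 p X 0"
  unfolding singular_boundary2_iff
  by (rule exI[of _ 0]) (simp add: singular_chain2_def chain_boundary2_def)

lemma homology_class2_eq_iff:
  "homology_class2 p X c = homology_class2 p X d \<longleftrightarrow> singular_boundary2 p X (c + d)"
proof
  assume "homology_class2 p X c = homology_class2 p X d"
  moreover have "d \<in> homology_class2 p X d"
    by (simp add: homology_class2_def chain2_add_self chain2_diff singular_boundary2_0)
  ultimately show "singular_boundary2 p X (c + d)"
    by (auto simp: homology_class2_def chain2_diff)
next
  assume cd: "singular_boundary2 p X (c + d)"
  have "(c + d) + (d + e) = c + e" "(c + d) + (c + e) = d + e" for e
    by (simp_all add: ac_simps chain2_add_left_self)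
  then have "singular_boundary2 p X (c + e) \<longleftrightarrow> singular_boundary2 p X (d + e)" for e
    using singular_boundary2_add[OF cd, of "d + e"] singular_boundary2_add[OF cd, of "c + e"]
    by metis
  then show "homology_class2 p X c = homology_class2 p X d"
    by (simp add: homology_class2_def chain2_diff)
qed

lemma homology2_add:
  "homology_class2 p X c \<oplus>\<^bsub>homology2 p X\<^esub> homology_class2 p X d = homology_class2 p X (c + d)"
proof -
  have "\<exists>a b. e = a + b \<and> singular_boundary2 p X (c + a) \<and> singular_boundary2 p X (d + b)"
    if "singular_boundary2 p X (c + d + e)" for e
    by (rule exI[of _ c], rule exI[of _ "c + e"])
      (use that in \<open>auto simp: singular_boundary2_0 ac_simps chain2_add_self chain2_add_left_self\<close>)
  moreover have "singular_boundary2 p X (c + d + (a + b))"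
    if "singular_boundary2 p X (c + a)" "singular_boundary2 p X (d + b)" for a b
    using singular_boundary2_add[OF that] by (simp add: ac_simps)
  ultimately show ?thesis
    by (auto simp: homology2_def homology_class2_def chain2_diff)
qed

lemma map_times_bit:
  "Poly_Mapping.map ((*) r) c = (if r = 0 then 0 else (c :: 'a chain2))"
  by (rule poly_mapping_eqI) (cases r; simp add: Poly_Mapping.map.rep_eq when_def)

lemma homology2_smult:
  "r \<odot>\<^bsub>homology2 p X\<^esub> homology_class2 p X c = homology_class2 p X (if r = 0 then 0 else c)"
proof -
  have eq: "homology_class2 p X a = homology_class2 p X c" if "a \<in> homology_class2 p X c" for a
    using that unfolding homology_class2_eq_iff
    by (simp add: homology_class2_def chain2_diff add.commute)
  have mem: "c \<in> homology_class2 p X c"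
    by (simp add: homology_class2_def chain2_add_self chain2_diff singular_boundary2_0)
  have "r \<odot>\<^bsub>homology2 p X\<^esub> homology_class2 p X c =
      (\<Union>a\<in>homology_class2 p X c. homology_class2 p X (if r = 0 then 0 else a))"
    by (simp only: homology2_def map_times_bit module.simps)
  also have "\<dots> = homology_class2 p X (if r = 0 then 0 else c)"
  proof (cases "r = 0")
    case True
    show ?thesis unfolding if_P[OF True] using mem by blast
  next
    case False
    show ?thesis unfolding if_not_P[OF False] using mem eq by blast
  qed
  finally show ?thesis .
qed

lemma vectorspace_homology2: "vectorspace (class_ring :: bit ring) (homology2 p X)"
proof -
  let ?H = "homology2 p X"
  let ?c = "homology_class2 p X"
  have car: "carrier ?H = ?c ` {c. singular_cycle2 p X c}" and zero: "\<zero>\<^bsub>?H\<^esub> = ?c 0"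
    by (simp_all add: homology2_def)
  have cyc_add: "singular_cycle2 p X (c + d)" if "singular_cycle2 p X c" "singular_cycle2 p X d"
    for c d :: "'a chain2"
    using that by (simp add: singular_cycle2_def singular_chain2_add chain_boundary2_add)
  have cyc_0: "singular_cycle2 p X 0"
    by (simp add: singular_cycle2_def singular_chain2_def chain_boundary2_def)
  have "abelian_group ?H"
  proof (rule abelian_groupI)
    fix x assume "x \<in> carrier ?H"
    then show "\<exists>y\<in>carrier ?H. y \<oplus>\<^bsub>?H\<^esub> x = \<zero>\<^bsub>?H\<^esub>"
      by (auto simp: car zero homology2_add chain2_add_self intro!: bexI[of _ x])
  qed (auto simp: car zero homology2_add cyc_add cyc_0 ac_simps)
  moreover have "cring (class_ring :: bit ring)" "field (class_ring :: bit ring)"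
    using class_field[where 'a = bit] by (simp_all add: field_def domain_def)
  ultimately show ?thesis
    unfolding vectorspace_def
    by (auto intro!: module.intro module_axioms.intro
        simp: car homology2_smult homology2_add cyc_add cyc_0 class_ring_simps chain2_add_self)
qed

end

theory Submission
  imports Defs
begin

text \<open>
  Let \<open>f\<close> be the almost embedding.  The entry at octahedra \<open>P\<close>, \<open>Q\<close> is the intersection number of
  the cycles \<open>f P\<close> and \<open>f Q\<close>; coordinates in an orthonormal or hyperbolic basis of the middle
  homology turn the intersection form into \<open>\<Omega>\<^sub>M\<close>, and the columns of \<open>Y\<close> are the coordinates of the
  classes of octahedra.  Poincare duality with control of supports represents every face \<open>a\<close> of the
  complex by a cochain \<open>D a\<close> of the manifold supported near \<open>f a\<close>, where \<open>D\<close> takes boundaries to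
  coboundaries.  Hence intersection numbers of vertex-disjoint faces vanish.

  The last condition says that the van Kampen number is 1.  Put
  \<open>u\<^sub>i(a, b) = \<langle>D a \<union>\<^sub>i D b, [M]\<rangle>\<close> with Steenrod's cup-i products.  These numbers vanish on
  vertex-disjoint faces, satisfy
  \<open>u\<^sub>i(\<partial>a, b) + u\<^sub>i(a, \<partial>b) = u\<^bsub>i-1\<^esub>(a, b) + u\<^bsub>i-1\<^esub>(b, a)\<close>, and \<open>u\<^bsub>2k\<^esub>(v, v) = 1\<close> for a vertex
  \<open>v\<close>.  The sum over pairs of octahedra reduces to the sum of \<open>u\<^sub>0(a, b)\<close> over pairs of
  top-dimensional faces with vertices in \<open>[3]\<close> which meet exactly in the vertex 1 of the first factor.
  Deleting the other \<open>k\<close> factors one after the other, each time raising \<open>i\<close> by 2, turns this sum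
  into \<open>u\<^bsub>2k\<^esub>(v, v)\<close>.
\<close>

text \<open>Since \<open>f\<close> is only continuous, its image may be wild and general position is
  out of reach; distance takes its place. Images of disjoint faces are disjoint compact sets, hence
  some positive distance apart, and duals, homotopies and simplices of the fundamental cycle are all
  made small against it. That a cochain vanishes away from a set is a statement about cochains and
  not about classes, so duality has to be built simplex by simplex from the local homology of cells;
  mod 2 this involves no orientation.

  Two faces with a common vertex have no intersection number of their own. The coherent choice
  \<open>D\<close> gives them one that depends on the choice, and the higher products record how:
  each one accounts for the failure of symmetry of the one before. A factor of the join uses up two
  orders, one to trade pairs of unequal letters for a deletion in one word and one for the deletion
  in the other. After k factors the order is 2k, the dimension, where the product of the dual of a
  vertex with itself is that dual and can be evaluated.\<close>

declare add_bit_eq_xor [simp del] mult_bit_eq_and [simp del]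

section \<open>Linear extension over the two-element field\<close>

text \<open>Scalars and chain groups share this class, so one set of cancellation rules serves both:
  together with \<open>ac_simps\<close>, the rules \<open>add_self\<close> and
  \<open>add_left_self\<close> settle identities between sums whose terms cancel in pairs.\<close>

class char2 = ab_group_add +
  assumes add_self: "x + x = 0"
begin

lemma add_left_self: "x + (x + y) = y"
  using add_self[of x] by (simp flip: add.assoc)

lemma add_eq_iff: "x + y = z \<longleftrightarrow> x = z + y"
  using add_left_self[of y x] add_left_self[of y z] by (auto simp: ac_simps)

lemma add_eq_add_swap: "x + y = z + w \<Longrightarrow> x + z = y + w"
  by (metis add.left_commute add_eq_iff add.commute add.assoc)

lemma diff_eq_add: "x - y = x + y"
  using add_self[of y] by (metis add_uminus_conv_diff minus_unique)

lemma add_eq_0_iff_eq: "x + y = 0 \<longleftrightarrow> x = y"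
  using diff_eq_add[of x y] right_minus_eq[of x y] by simp

end

instance bit :: char2
  by standard simp

instance poly_mapping :: (type, char2) char2
  by standard (rule poly_mapping_eqI, simp add: lookup_add add_self)

text \<open>Over the two-element field a chain is its support, so linear extension needs no
  coefficients. Boundary, evaluation, augmentation, cap product and induced map are all instances,
  which makes their linearity and interchange laws one and the same.\<close>

definition lin :: "('b \<Rightarrow> 'm::char2) \<Rightarrow> ('b \<Rightarrow>\<^sub>0 bit) \<Rightarrow> 'm" where
  "lin h c = (\<Sum>\<sigma>\<in>Poly_Mapping.keys c. h \<sigma>)"

abbreviation gen2 :: "'b \<Rightarrow> ('b \<Rightarrow>\<^sub>0 bit)" where
  "gen2 \<sigma> \<equiv> Poly_Mapping.single \<sigma> 1"

lemma lin_0 [simp]: "lin h 0 = 0"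
  by (simp add: lin_def)

lemma lin_gen2 [simp]: "lin h (gen2 \<sigma>) = h \<sigma>"
  by (simp add: lin_def)

lemma lin_single: "lin h (Poly_Mapping.single \<sigma> b) = (if b = 0 then 0 else h \<sigma>)"
  by (cases b) simp_all

lemma sum_closed_aux:
  assumes "\<And>i. i \<in> I \<Longrightarrow> P (f i)" "P 0" "\<And>x y. P x \<Longrightarrow> P y \<Longrightarrow> P (x + y)"
  shows "P (\<Sum>i\<in>I. f i)"
  using assms(1) by (induction I rule: infinite_finite_induct) (auto intro: assms(2,3))

lemma lookup_keys_bit: "\<sigma> \<in> Poly_Mapping.keys c \<Longrightarrow> Poly_Mapping.lookup c \<sigma> = (1 :: bit)"
  by (simp add: in_keys_iff)

lemma keys_add_bit:
  "Poly_Mapping.keys (c + d) = sym_diff (Poly_Mapping.keys c) (Poly_Mapping.keys (d :: 'b \<Rightarrow>\<^sub>0 bit))"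
proof (rule Set.set_eqI)
  fix x
  show "x \<in> Poly_Mapping.keys (c + d) \<longleftrightarrow> x \<in> sym_diff (Poly_Mapping.keys c) (Poly_Mapping.keys d)"
    by (cases "Poly_Mapping.lookup c x"; cases "Poly_Mapping.lookup d x")
      (simp_all add: in_keys_iff lookup_add)
qed

text \<open>The common part is counted twice. Adding chains is symmetric difference of supports
  (\<open>keys_add_bit\<close>), and the same identity later turns the symmetric difference of
  octahedra into a sum of cycles.\<close>

lemma sum_sym_diff:
  fixes h :: "'b \<Rightarrow> 'm::char2"
  assumes "finite A" "finite B"
  shows "sum h (sym_diff A B) = sum h A + sum h B"
proof -
  have "sum h A = sum h (A - B) + sum h (A \<inter> B)" "sum h B = sum h (B - A) + sum h (A \<inter> B)"
    using sum.Int_Diff[OF assms(1), of h B] sum.Int_Diff[OF assms(2), of h A]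
    by (simp_all add: ac_simps Int_commute)
  moreover have "sum h (sym_diff A B) = sum h (A - B) + sum h (B - A)"
    using assms by (intro sum.union_disjoint) auto
  ultimately show ?thesis by (simp add: ac_simps add_left_self add_self)
qed

lemma lin_add: "lin h (c + d) = lin h c + lin h d"
  unfolding lin_def keys_add_bit by (simp add: sum_sym_diff)

lemma lin_sum: "lin h (\<Sum>i\<in>I. c i) = (\<Sum>i\<in>I. lin h (c i))"
  by (induction I rule: infinite_finite_induct) (simp_all add: lin_add)

lemma lin_distrib: "lin (\<lambda>\<sigma>. f \<sigma> + g \<sigma>) c = lin f c + lin g c"
  by (simp add: lin_def sum.distrib)

lemma lin_zero [simp]: "lin (\<lambda>_. 0) c = 0"
  by (simp add: lin_def)

lemma lin_sum_fun: "lin (\<lambda>\<sigma>. \<Sum>i\<in>I. f i \<sigma>) c = (\<Sum>i\<in>I. lin (f i) c)"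
  unfolding lin_def by (rule sum.swap)

lemma lin_cong: "(\<And>\<sigma>. \<sigma> \<in> Poly_Mapping.keys c \<Longrightarrow> f \<sigma> = g \<sigma>) \<Longrightarrow> lin f c = lin g c"
  unfolding lin_def by (rule sum.cong) auto

lemma lin_id: "lin gen2 c = c"
proof (rule poly_mapping_eqI)
  fix \<sigma>
  show "Poly_Mapping.lookup (lin gen2 c) \<sigma> = Poly_Mapping.lookup c \<sigma>"
    by (cases "Poly_Mapping.lookup c \<sigma>")
      (simp_all add: lin_def lookup_sum lookup_single when_def in_keys_iff)
qed

text \<open>An additive map is determined on generators because \<open>lin gen2\<close> is the
  identity. This converts abstract functionals into cochains.\<close>

lemma additive_lin:
  fixes T :: "('b \<Rightarrow>\<^sub>0 bit) \<Rightarrow> 'm::char2"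
  assumes "\<And>c d. T (c + d) = T c + T d"
  shows "T c = lin (\<lambda>\<sigma>. T (gen2 \<sigma>)) c"
proof -
  have "T 0 = 0" using assms[of 0 0] by (simp add: add_self)
  then have "T (\<Sum>i\<in>I. f i) = (\<Sum>i\<in>I. T (f i))" for I :: "'b set" and f
    by (induction I rule: infinite_finite_induct) (simp_all add: assms)
  then have "T (lin gen2 c) = lin (\<lambda>\<sigma>. T (gen2 \<sigma>)) c" by (simp add: lin_def)
  then show ?thesis by (simp add: lin_id)
qed

lemma lin_lin: "lin g (lin h c) = lin (\<lambda>\<sigma>. lin g (h \<sigma>)) c"
  by (simp add: lin_def[of h] lin_sum) (simp add: lin_def[of "\<lambda>\<sigma>. lin g (h \<sigma>)"])

lemma keys_lin:
  "Poly_Mapping.keys (lin h c) \<subseteq> (\<Union>\<sigma>\<in>Poly_Mapping.keys c. Poly_Mapping.keys (h \<sigma>))"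
  unfolding lin_def by (rule keys_sum)

lemma lin_swap:
  "lin (\<lambda>\<sigma>. lin (\<lambda>\<tau>. f \<sigma> \<tau>) d) c = lin (\<lambda>\<tau>. lin (\<lambda>\<sigma>. f \<sigma> \<tau>) c) d"
  unfolding lin_def by (rule sum.swap)

section \<open>Mod 2 chains\<close>

definition bdry :: "nat \<Rightarrow> 'a simplex \<Rightarrow> 'a chain2" where
  "bdry p \<sigma> = (if p = 0 then 0 else \<Sum>i\<le>p. gen2 (singular_face p i \<sigma>))"

lemma chain_boundary2_lin: "chain_boundary2 p c = lin (bdry p) c"
  unfolding chain_boundary2_def lin_def bdry_def
  by (auto intro!: sum.cong simp: lookup_keys_bit)

lemma eval_cochain2_lin: "eval_cochain2 \<phi> c = lin \<phi> c"
  unfolding eval_cochain2_def lin_def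
  by (intro sum.cong refl) (simp add: lookup_keys_bit)

lemma cap2_lin:
  "cap2 p q c \<phi> = lin (\<lambda>\<sigma>. Poly_Mapping.single (back_face p q \<sigma>) (\<phi> (front_face p \<sigma>))) c"
  unfolding cap2_def lin_def
  by (intro sum.cong refl) (simp add: lookup_keys_bit)

lemma chain_boundary2_zero [simp]: "chain_boundary2 p 0 = 0" "chain_boundary2 0 c = 0"
  by (simp_all add: chain_boundary2_lin lin_def bdry_def)

lemma chain_boundary2_gen2 [simp]: "chain_boundary2 p (gen2 \<sigma>) = bdry p \<sigma>"
  by (simp add: chain_boundary2_lin)

lemma singular_chain2_zero [simp]: "singular_chain2 p X 0"
  by (simp add: singular_chain2_def)

lemma singular_chain2_gen2 [simp]: "singular_chain2 p X (gen2 \<sigma>) \<longleftrightarrow> singular_simplex p X \<sigma>"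
  by (simp add: singular_chain2_def)

lemma singular_chain2_sum:
  "(\<And>i. i \<in> I \<Longrightarrow> singular_chain2 p X (f i)) \<Longrightarrow> singular_chain2 p X (\<Sum>i\<in>I. f i)"
  by (induction I rule: infinite_finite_induct) (simp_all add: singular_chain2_add)

lemma singular_chain2_lin:
  "(\<And>\<sigma>. \<sigma> \<in> Poly_Mapping.keys c \<Longrightarrow> singular_chain2 p X (h \<sigma>)) \<Longrightarrow> singular_chain2 p X (lin h c)"
  unfolding lin_def by (rule singular_chain2_sum)

lemma singular_chain2_bdry:
  assumes "singular_simplex p X \<sigma>"
  shows "singular_chain2 (p - 1) X (bdry p \<sigma>)"
  using assms singular_simplex_singular_face[of p X \<sigma>] unfolding bdry_def
  by (auto intro!: singular_chain2_sum)

lemma singular_chain2_boundary: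
  "singular_chain2 p X c \<Longrightarrow> singular_chain2 (p - 1) X (chain_boundary2 p c)"
  unfolding chain_boundary2_lin
  by (intro singular_chain2_lin singular_chain2_bdry) (auto simp: singular_chain2_def)

lemma singular_chain2_boundary_Suc:
  "singular_chain2 (Suc p) X c \<Longrightarrow> singular_chain2 p X (chain_boundary2 (Suc p) c)"
  using singular_chain2_boundary[of "Suc p"] by simp

lemma singular_chain2_subtopology:
  "singular_chain2 p (subtopology X S) c \<longleftrightarrow>
     singular_chain2 p X c \<and> (\<forall>\<sigma>\<in>Poly_Mapping.keys c. \<sigma> ` standard_simplex p \<subseteq> S)"
  unfolding singular_chain2_def by (fastforce simp: singular_simplex_subtopology)

lemma singular_chain2_mono:
  "singular_chain2 p (subtopology X S) c \<Longrightarrow> S \<subseteq> T \<Longrightarrow> singular_chain2 p (subtopology X T) c"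
  unfolding singular_chain2_subtopology by blast

lemma singular_chain2_sub: "singular_chain2 p (subtopology X S) c \<Longrightarrow> singular_chain2 p X c"
  unfolding singular_chain2_subtopology by blast

lemma singular_chain2_Int:
  "singular_chain2 p (subtopology X S) c \<Longrightarrow> singular_chain2 p (subtopology X T) c \<Longrightarrow>
   singular_chain2 p (subtopology X (S \<inter> T)) c"
  unfolding singular_chain2_subtopology by blast

lemma singular_chain2_empty:
  "singular_chain2 p (subtopology X {}) c \<longleftrightarrow> c = 0"
  unfolding singular_chain2_subtopology
  using nonempty_standard_simplex[of p] by (auto simp: singular_chain2_def simp flip: keys_eq_empty)

lemma keys_split2:
  assumes "Poly_Mapping.keys (c :: 'b \<Rightarrow>\<^sub>0 bit) \<subseteq> A \<union> B"
  obtains a b where "Poly_Mapping.keys a \<subseteq> A" "Poly_Mapping.keys b \<subseteq> B" "c = a + b"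
proof -
  have keys: "Poly_Mapping.keys (\<Sum>\<sigma>\<in>K. gen2 \<sigma>) \<subseteq> K" if "finite K" for K :: "'b set"
    using keys_sum[of gen2 K] by auto
  have "c = (\<Sum>\<sigma>\<in>Poly_Mapping.keys c. gen2 \<sigma>)" using lin_id[of c] by (simp add: lin_def)
  also have "\<dots> = (\<Sum>\<sigma>\<in>Poly_Mapping.keys c \<inter> A. gen2 \<sigma>) + (\<Sum>\<sigma>\<in>Poly_Mapping.keys c - A. gen2 \<sigma>)"
    by (rule sum.Int_Diff) simp
  finally show thesis
    using that keys[of "Poly_Mapping.keys c \<inter> A"] keys[of "Poly_Mapping.keys c - A"] assms
    by (meson Diff_subset_conv Int_lower2 finite_Diff finite_Int finite_keys subset_trans)
qed

section \<open>Reduction of integral chains\<close>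

definition red :: "'a chain \<Rightarrow> 'a chain2" where
  "red c = Poly_Mapping.map of_int c"

text \<open>A section of \<open>red\<close> with coefficients 0 and 1. It is not additive; operators
  transported along it become so only after reduction, by \<open>transfer_additive\<close>.\<close>

definition lft :: "'a chain2 \<Rightarrow> 'a chain" where
  "lft c = (\<Sum>\<sigma>\<in>Poly_Mapping.keys c. frag_of \<sigma>)"

lemma lookup_red: "Poly_Mapping.lookup (red c) \<sigma> = of_int (Poly_Mapping.lookup c \<sigma>)"
  by (simp add: red_def Poly_Mapping.map.rep_eq when_def)

lemma red_0 [simp]: "red 0 = 0"
  by (rule poly_mapping_eqI) (simp add: lookup_red)

lemma red_add: "red (c + d) = red c + red d"
  by (rule poly_mapping_eqI) (simp add: lookup_red lookup_add)

lemma red_minus: "red (- c) = red c"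
  by (rule poly_mapping_eqI) (simp add: lookup_red)

lemma red_diff: "red (c - d) = red c + red d"
  using red_add[of c "- d"] by (simp add: red_minus)

lemma red_sum: "red (\<Sum>i\<in>I. f i) = (\<Sum>i\<in>I. red (f i))"
  by (induction I rule: infinite_finite_induct) (simp_all add: red_add)

lemma red_cmul: "red (frag_cmul k c) = (if even k then 0 else red c)"
  by (rule poly_mapping_eqI) (auto simp: lookup_red elim!: evenE oddE)

lemma red_frag_of [simp]: "red (frag_of \<sigma>) = gen2 \<sigma>"
  by (rule poly_mapping_eqI) (auto simp: lookup_red lookup_single when_def)

lemma red_lft: "red (lft c) = c"
  using lin_id[of c] by (simp add: lft_def red_sum lin_def)

lemma keys_red: "Poly_Mapping.keys (red c) \<subseteq> Poly_Mapping.keys c"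
  by (auto simp: in_keys_iff lookup_red)

lemma keys_lft: "Poly_Mapping.keys (lft c) \<subseteq> Poly_Mapping.keys c"
  unfolding lft_def using keys_sum[of frag_of "Poly_Mapping.keys c"] by auto

lemma singular_chain_lft: "singular_chain2 p X c \<Longrightarrow> singular_chain p X (lft c)"
  unfolding singular_chain2_def singular_chain_def using keys_lft by blast

lemma singular_chain2_red: "singular_chain p X c \<Longrightarrow> singular_chain2 p X (red c)"
  unfolding singular_chain2_def singular_chain_def using keys_red by blast

text \<open>The coefficients are even and can be halved. The half has no larger support, so it stays
  in whatever subspace carried the chain.\<close>

lemma red_eq_0_imp:
  assumes "red c = 0"
  obtains e where "c = e + e" "Poly_Mapping.keys e \<subseteq> Poly_Mapping.keys c"
proof
  define e where "e = Poly_Mapping.map (\<lambda>x. x div 2) c"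
  have ev: "even (Poly_Mapping.lookup c \<sigma>)" for \<sigma>
  proof -
    have "(of_int (Poly_Mapping.lookup c \<sigma>) :: bit) = 0"
      using assms lookup_red[of c \<sigma>] by simp
    then show ?thesis using odd_two_times_div_two_succ[of "Poly_Mapping.lookup c \<sigma>"]
      by (metis add_0 bit_2_eq_0 mult_zero_left of_int_1 of_int_add of_int_mult of_int_numeral one_neq_zero)
  qed
  have l: "Poly_Mapping.lookup e \<sigma> = Poly_Mapping.lookup c \<sigma> div 2" for \<sigma>
    by (simp add: e_def Poly_Mapping.map.rep_eq when_def)
  show "c = e + e"
    by (rule poly_mapping_eqI) (use ev l in \<open>auto simp: lookup_add elim!: evenE\<close>)
  show "Poly_Mapping.keys e \<subseteq> Poly_Mapping.keys c"
    by (auto simp: in_keys_iff l)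
qed

lemma red_eq_imp:
  assumes "red c = red d" "singular_chain p X c" "singular_chain p X d"
  obtains e where "c = d + e + e" "singular_chain p X e"
proof -
  have "red (c - d) = 0" using assms by (simp add: red_diff add_self)
  then obtain e where e: "c - d = e + e" "Poly_Mapping.keys e \<subseteq> Poly_Mapping.keys (c - d)"
    by (rule red_eq_0_imp)
  have "singular_chain p X (c - d)" using assms by (simp add: singular_chain_diff)
  then have "singular_chain p X e" using e(2) by (auto simp: singular_chain_def)
  with e(1) that[of e] show thesis by (simp add: algebra_simps)
qed

lemma red_boundary: "red (chain_boundary p c) = chain_boundary2 p (red c)"
proof (induction c rule: frag_induction[OF subset_UNIV])
  case 2
  fix \<sigma> :: "'a simplex"
  have "red (frag_cmul ((-1) ^ i) (frag_of \<tau>)) = gen2 \<tau>" for i and \<tau> :: "'a simplex"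
    by (simp add: red_cmul)
  then show "red (chain_boundary p (frag_of \<sigma>)) = chain_boundary2 p (red (frag_of \<sigma>))"
    by (simp add: chain_boundary_of bdry_def red_sum)
qed (simp_all add: chain_boundary_diff red_diff chain_boundary2_add)

lemma boundary2_boundary2:
  assumes "singular_chain2 p X c"
  shows "chain_boundary2 (p - 1) (chain_boundary2 p c) = 0"
  using chain_boundary_boundary[OF singular_chain_lft[OF assms]]
  by (metis One_nat_def red_0 red_boundary red_lft)

lemma boundary2_boundary2_Suc:
  "singular_chain2 (Suc p) X c \<Longrightarrow> chain_boundary2 p (chain_boundary2 (Suc p) c) = 0"
  using boundary2_boundary2[of "Suc p"] by simp

text \<open>Two integral chains with equal reduction differ by \<open>e + e\<close>, which
  \<open>T\<close> sends to \<open>T e + T e\<close>, and this reduces to 0. So every additive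
  operator on integral chains induces one on mod 2 chains, whatever lift is taken.\<close>

lemma transfer_additive:
  fixes T :: "'a chain \<Rightarrow> 'b chain"
  assumes "\<And>c d. T (c - d) = T c - T d"
  shows "red (T (lft (c + d))) = red (T (lft c)) + red (T (lft d))"
    and "red (T (lft (red z))) = red (T z)"
proof -
  have T0: "T 0 = 0" using assms[of 0 0] by simp
  have Tadd: "T (x + y) = T x + T y" for x y
    using assms[of x "0 - y"] assms[of 0 y] by (simp add: T0)
  have eq: "red (T x) = red (T y)" if xy: "red x = red y" for x y
  proof -
    have "red (x - y) = 0" using that by (simp add: red_diff add_self)
    then obtain e where "x - y = e + e" by (rule red_eq_0_imp)
    then have "x = y + (e + e)" by (simp add: algebra_simps)
    then have "T x = T y + (T e + T e)" by (simp only: Tadd)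
    then show ?thesis by (simp add: red_add add_self)
  qed
  show "red (T (lft (red z))) = red (T z)" by (rule eq) (simp add: red_lft)
  have "red (T (lft (c + d))) = red (T (lft c + lft d))" by (rule eq) (simp add: red_lft red_add)
  then show "red (T (lft (c + d))) = red (T (lft c)) + red (T (lft d))"
    by (simp add: Tadd red_add)
qed

section \<open>Relative cycles and subdivision\<close>

text \<open>In degree 0 the truncated \<open>p - 1\<close> does no harm: the boundary of a 0-chain
  is 0, so every 0-chain is a relative cycle.\<close>

definition relcycle2 :: "nat \<Rightarrow> 'a topology \<Rightarrow> 'a set \<Rightarrow> 'a chain2 \<Rightarrow> bool" where
  "relcycle2 p X S c \<longleftrightarrow>
     singular_chain2 p X c \<and> singular_chain2 (p - 1) (subtopology X S) (chain_boundary2 p c)"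

lemma relboundary2_iff:
  "singular_relboundary2 p X S c \<longleftrightarrow>
     (\<exists>d e. singular_chain2 (Suc p) X d \<and> singular_chain2 p (subtopology X S) e \<and>
            c = chain_boundary2 (Suc p) d + e)"
proof
  assume "singular_relboundary2 p X S c"
  then obtain d where "singular_chain2 (Suc p) X d"
    "singular_chain2 p (subtopology X S) (chain_boundary2 (Suc p) d + c)"
    by (auto simp: singular_relboundary2_def chain2_diff)
  then show "\<exists>d e. singular_chain2 (Suc p) X d \<and> singular_chain2 p (subtopology X S) e \<and>
            c = chain_boundary2 (Suc p) d + e"
    by (metis chain2_add_left_self)
qed (auto simp: singular_relboundary2_def chain2_diff chain2_add_left_self)

lemma relboundary2_add:
  "singular_relboundary2 p X S c \<Longrightarrow> singular_relboundary2 p X S d \<Longrightarrow>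
   singular_relboundary2 p X S (c + d)"
proof -
  assume "singular_relboundary2 p X S c" "singular_relboundary2 p X S d"
  then obtain a e b f where
    "singular_chain2 (Suc p) X a" "singular_chain2 p (subtopology X S) e" "c = chain_boundary2 (Suc p) a + e"
    "singular_chain2 (Suc p) X b" "singular_chain2 p (subtopology X S) f" "d = chain_boundary2 (Suc p) b + f"
    unfolding relboundary2_iff by blast
  then show ?thesis unfolding relboundary2_iff
    by (intro exI[of _ "a + b"] exI[of _ "e + f"])
      (simp add: singular_chain2_add chain_boundary2_add ac_simps)
qed

lemma relboundary2_add_cancel:
  "singular_relboundary2 p X S c \<Longrightarrow> singular_relboundary2 p X S (c + d) \<longleftrightarrow> singular_relboundary2 p X S d"
  by (metis add_left_self relboundary2_add)

lemma relboundary2_chain: "singular_chain2 p (subtopology X S) c \<Longrightarrow> singular_relboundary2 p X S c"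
  unfolding relboundary2_iff by (rule exI[of _ 0]) simp

lemma relboundary2_boundary:
  "singular_chain2 (Suc p) X d \<Longrightarrow> singular_relboundary2 p X S (chain_boundary2 (Suc p) d)"
  unfolding relboundary2_iff by (rule exI[of _ d], rule exI[of _ 0]) simp

lemma relboundary2_zero [simp]: "singular_relboundary2 p X S 0"
  by (simp add: relboundary2_chain)

lemma relboundary2_mono:
  "singular_relboundary2 p X S c \<Longrightarrow> S \<subseteq> T \<Longrightarrow> singular_relboundary2 p X T c"
  unfolding relboundary2_iff using singular_chain2_mono by metis

lemma relboundary2_imp_relcycle2: "singular_relboundary2 p X S c \<Longrightarrow> relcycle2 p X S c"
  unfolding relboundary2_iff relcycle2_def
  by (auto simp: chain_boundary2_add boundary2_boundary2_Suc
      intro!: singular_chain2_add singular_chain2_boundary_Suc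
      dest: singular_chain2_sub singular_chain2_boundary)

lemma relcycle2_add: "relcycle2 p X S c \<Longrightarrow> relcycle2 p X S d \<Longrightarrow> relcycle2 p X S (c + d)"
  unfolding relcycle2_def by (simp add: chain_boundary2_add singular_chain2_add)

lemma relcycle2_mono: "relcycle2 p X S c \<Longrightarrow> S \<subseteq> T \<Longrightarrow> relcycle2 p X T c"
  unfolding relcycle2_def by (meson singular_chain2_mono)

lemma relcycle2_empty: "relcycle2 p X {} c \<longleftrightarrow> singular_cycle2 p X c"
  unfolding relcycle2_def singular_cycle2_def singular_chain2_empty ..

lemma relcycle2_chain: "singular_chain2 p (subtopology X S) c \<Longrightarrow> relcycle2 p X S c"
  unfolding relcycle2_def using singular_chain2_boundary singular_chain2_sub by blast

definition sdiv :: "nat \<Rightarrow> nat \<Rightarrow> 'a chain2 \<Rightarrow> 'a chain2" where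
  "sdiv m p c = red ((singular_subdivision p ^^ m) (lft c))"

lemma sdiv_add: "sdiv m p (c + d) = sdiv m p c + sdiv m p d"
  unfolding sdiv_def by (rule transfer_additive) (rule singular_subdivision_power_diff)

lemma sdiv_red: "sdiv m p (red z) = red ((singular_subdivision p ^^ m) z)"
  unfolding sdiv_def by (rule transfer_additive) (rule singular_subdivision_power_diff)

lemma singular_chain_subdivision_power:
  "singular_chain p X c \<Longrightarrow> singular_chain p X ((singular_subdivision p ^^ m) c)"
  by (induction m) (simp_all add: singular_chain_singular_subdivision)

lemma sdiv_chain: "singular_chain2 p X c \<Longrightarrow> singular_chain2 p X (sdiv m p c)"
  unfolding sdiv_def
  by (intro singular_chain2_red singular_chain_subdivision_power singular_chain_lft)

lemma boundary_subdivision_power: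
  "singular_chain p X c \<Longrightarrow> chain_boundary p ((singular_subdivision p ^^ m) c) =
     (singular_subdivision (p - Suc 0) ^^ m) (chain_boundary p c)"
  by (induction m)
    (simp_all add: chain_boundary_singular_subdivision[OF singular_chain_subdivision_power])

lemma sdiv_boundary:
  assumes "singular_chain2 p X c"
  shows "chain_boundary2 p (sdiv m p c) = sdiv m (p - 1) (chain_boundary2 p c)"
proof -
  have "chain_boundary2 p (sdiv m p c)
      = red ((singular_subdivision (p - Suc 0) ^^ m) (chain_boundary p (lft c)))"
    unfolding sdiv_def red_boundary[symmetric]
    using boundary_subdivision_power[OF singular_chain_lft[OF assms]] by simp
  also have "\<dots> = sdiv m (p - 1) (chain_boundary2 p c)"
    by (simp add: sdiv_red[symmetric] red_boundary red_lft)
  finally show ?thesis .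
qed

text \<open>One operator \<open>h\<close> serves all spaces at once. Applied in \<open>X\<close> and
  in a subspace, the same homotopy is seen to preserve chains of the subspace, which is what
  relative statements ask for.\<close>

lemma sdiv_homotopy:
  obtains h :: "nat \<Rightarrow> 'a chain2 \<Rightarrow> 'a chain2" where
    "\<And>p X c. singular_chain2 p X c \<Longrightarrow> singular_chain2 (Suc p) X (h p c)"
    "\<And>p X c. singular_chain2 p X c \<Longrightarrow>
       chain_boundary2 (Suc p) (h p c) + h (p - 1) (chain_boundary2 p c) = sdiv m p c + c"
    "\<And>p. h p 0 = 0"
proof -
  obtain k where k: "\<And>p. k p 0 = (0 :: 'a chain)"
        "\<And>p c1 c2. k p (c1-c2) = k p c1 - k p c2"
        "\<And>p X c. singular_chain p X c \<Longrightarrow> singular_chain (Suc p) X (k p c)"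
        "\<And>p X c. singular_chain p X c
                 \<Longrightarrow> chain_boundary (Suc p) (k p c) + k (p - Suc 0) (chain_boundary p c)
                   = (singular_subdivision p ^^ m) c - c"
    using chain_homotopic_iterated_singular_subdivision[where n = m] by blast
  show thesis
  proof
    fix p X and c :: "'a chain2"
    assume c: "singular_chain2 p X c"
    show "singular_chain2 (Suc p) X (red (k p (lft c)))"
      by (intro singular_chain2_red k singular_chain_lft c)
    have "red (k (p - Suc 0) (lft (red (chain_boundary p (lft c)))))
        = red (k (p - Suc 0) (chain_boundary p (lft c)))"
      by (rule transfer_additive) (rule k)
    moreover have "red (chain_boundary (Suc p) (k p (lft c))) + red (k (p - Suc 0) (chain_boundary p (lft c)))
      = sdiv m p c + c"
      using k(4)[OF singular_chain_lft[OF c]] by (simp add: sdiv_def red_add[symmetric] red_diff red_lft)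
    ultimately show "chain_boundary2 (Suc p) (red (k p (lft c))) + red (k (p - 1) (lft (chain_boundary2 p c)))
       = sdiv m p c + c"
      by (simp add: red_boundary red_lft)
  qed (simp add: lft_def k)
qed

lemma sdiv_small:
  assumes "\<And>U. U \<in> \<C> \<Longrightarrow> openin X U" "topspace X \<subseteq> \<Union>\<C>" "singular_chain2 p X c"
  obtains n where "\<And>m \<sigma>. n \<le> m \<Longrightarrow> \<sigma> \<in> Poly_Mapping.keys (sdiv m p c) \<Longrightarrow>
    \<exists>V\<in>\<C>. \<sigma> ` standard_simplex p \<subseteq> V"
proof -
  obtain n where n: "\<And>m f. \<lbrakk>n \<le> m; f \<in> Poly_Mapping.keys ((singular_subdivision p ^^ m) (lft c))\<rbrakk>
                      \<Longrightarrow> \<exists>V \<in> \<C>. f \<in> (standard_simplex p) \<rightarrow> V"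
    using sufficient_iterated_singular_subdivision_exists[OF assms(1,2) singular_chain_lft[OF assms(3)]]
    by blast
  show thesis
  proof
    fix m \<sigma> assume m: "n \<le> m" "\<sigma> \<in> Poly_Mapping.keys (sdiv m p c)"
    then have "\<sigma> \<in> Poly_Mapping.keys ((singular_subdivision p ^^ m) (lft c))"
      using keys_red unfolding sdiv_def by blast
    from n[OF m(1) this] show "\<exists>V\<in>\<C>. \<sigma> ` standard_simplex p \<subseteq> V" by (auto simp: Pi_iff)
  qed
qed

lemma relcycle2_sdiv:
  assumes "relcycle2 p X S c"
  shows "relcycle2 p X S (sdiv m p c)" "singular_relboundary2 p X S (sdiv m p c + c)"
proof -
  obtain h :: "nat \<Rightarrow> 'a chain2 \<Rightarrow> 'a chain2" where h:
    "\<And>p X c. singular_chain2 p X c \<Longrightarrow> singular_chain2 (Suc p) X (h p c)"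
    "\<And>p X c. singular_chain2 p X c \<Longrightarrow>
       chain_boundary2 (Suc p) (h p c) + h (p - 1) (chain_boundary2 p c) = sdiv m p c + c"
    "\<And>p. h p 0 = 0"
    using sdiv_homotopy[where m = m and 'a = 'a] by blast
  have c: "singular_chain2 p X c" "singular_chain2 (p - 1) (subtopology X S) (chain_boundary2 p c)"
    using assms by (auto simp: relcycle2_def)
  have "singular_chain2 p (subtopology X S) (h (p - 1) (chain_boundary2 p c))"
  \<comment> \<open>In degree 0 the homotopy term would have degree 1 instead of 0, but the boundary
    is 0 there and \<open>h\<close> sends 0 to 0.\<close>
  proof (cases p)
    case 0
    then show ?thesis by (simp add: h)
  next
    case (Suc q)
    then show ?thesis using h(1)[OF c(2)] by simp
  qed
  then show "singular_relboundary2 p X S (sdiv m p c + c)"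
    unfolding relboundary2_iff using h(1)[OF c(1)] h(2)[OF c(1)] by metis
  from relcycle2_add[OF assms relboundary2_imp_relcycle2[OF this]]
  show "relcycle2 p X S (sdiv m p c)" by (simp add: add.left_commute add_left_self add.commute)
qed

text \<open>After enough subdivisions each simplex lies in \<open>S\<close> or in \<open>T\<close>;
  the simplices of the first kind make up \<open>a\<close>.\<close>

lemma split_sdiv:
  assumes "openin X S" "openin X T" "singular_chain2 p (subtopology X (S \<union> T)) c"
  obtains m a b where "singular_chain2 p (subtopology X S) a" "singular_chain2 p (subtopology X T) b"
    "sdiv m p c = a + b"
proof -
  let ?Y = "subtopology X (S \<union> T)"
  have op: "openin ?Y U" if "U \<in> {S, T}" for U
    using that assms by (auto simp: openin_open_subtopology openin_Un)
  have cov: "topspace ?Y \<subseteq> \<Union>{S, T}" by auto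
  obtain m where m: "\<And>m' \<sigma>. m \<le> m' \<Longrightarrow> \<sigma> \<in> Poly_Mapping.keys (sdiv m' p c) \<Longrightarrow>
    \<exists>V\<in>{S, T}. \<sigma> ` standard_simplex p \<subseteq> V"
    using sdiv_small[OF op cov assms(3)] by metis
  have "Poly_Mapping.keys (sdiv m p c) \<subseteq>
    singular_simplex_set p (subtopology X S) \<union> singular_simplex_set p (subtopology X T)"
  proof
    fix \<sigma> assume \<sigma>: "\<sigma> \<in> Poly_Mapping.keys (sdiv m p c)"
    have "singular_simplex p X \<sigma>"
      using sdiv_chain[OF assms(3), of m] \<sigma> by (auto simp: singular_chain2_def singular_simplex_subtopology)
    then show "\<sigma> \<in> singular_simplex_set p (subtopology X S) \<union> singular_simplex_set p (subtopology X T)"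
      using m[OF order_refl \<sigma>] by (auto simp: singular_simplex_subtopology)
  qed
  then show thesis
    by (rule keys_split2) (rule that; simp add: singular_chain2_def)
qed

section \<open>Excision and the Mayer--Vietoris argument\<close>

text \<open>Two null-homologies of \<open>z\<close>, one modulo \<open>S\<close> and one modulo
  \<open>T\<close>, differ by a relative cycle of (X, S \<union> T) one degree higher. Since that
  cycle bounds, subdivision lets the difference be shared out between \<open>S\<close> and
  \<open>T\<close>, and one corrected null-homology works for both.\<close>

lemma mayer_vietoris_inj:
  assumes op: "openin X S" "openin X T"
    and acyc: "\<And>w. relcycle2 (Suc p) X (S \<union> T) w \<Longrightarrow> singular_relboundary2 (Suc p) X (S \<union> T) w"
    and z: "relcycle2 p X (S \<inter> T) z"
    and zS: "singular_relboundary2 p X S z" and zT: "singular_relboundary2 p X T z"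
  shows "singular_relboundary2 p X (S \<inter> T) z"
proof -
  obtain a a' where a: "singular_chain2 (Suc p) X a" "singular_chain2 p (subtopology X S) a'"
    "z = chain_boundary2 (Suc p) a + a'" using zS relboundary2_iff by metis
  obtain b b' where b: "singular_chain2 (Suc p) X b" "singular_chain2 p (subtopology X T) b'"
    "z = chain_boundary2 (Suc p) b + b'" using zT relboundary2_iff by metis
  have "chain_boundary2 (Suc p) (a + b) = a' + b'"
    unfolding chain_boundary2_add by (rule add_eq_add_swap) (use a(3) b(3) in argo)
  moreover have "singular_chain2 p (subtopology X (S \<union> T)) (a' + b')"
    using a(2) b(2) by (intro singular_chain2_add) (auto elim: singular_chain2_mono)
  ultimately have "relcycle2 (Suc p) X (S \<union> T) (a + b)"
    using a b by (simp add: relcycle2_def singular_chain2_add)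
  then obtain v q where v: "singular_chain2 (Suc (Suc p)) X v"
    "singular_chain2 (Suc p) (subtopology X (S \<union> T)) q" "a + b = chain_boundary2 (Suc (Suc p)) v + q"
    using acyc unfolding relboundary2_iff by blast
  obtain m qS qT where q: "singular_chain2 (Suc p) (subtopology X S) qS"
    "singular_chain2 (Suc p) (subtopology X T) qT" "sdiv m (Suc p) q = qS + qT"
    using split_sdiv[OF op v(2)] by metis
  \<comment> \<open>The corrected null-homology. As the subdivided \<open>a\<close> plus a chain in
    \<open>S\<close> its boundary is right modulo \<open>S\<close>; as the subdivided
    \<open>b\<close> plus a boundary plus a chain in \<open>T\<close> it is right modulo
    \<open>T\<close>.\<close>
  define y where "y = sdiv m (Suc p) a + qS"
  have sdb: "chain_boundary2 (Suc p) (sdiv m (Suc p) c) = sdiv m p (chain_boundary2 (Suc p) c)"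
    if "singular_chain2 (Suc p) X c" for c
    using sdiv_boundary[OF that] by simp
  have y: "singular_chain2 (Suc p) X y"
    unfolding y_def using a q by (intro singular_chain2_add sdiv_chain) (auto dest: singular_chain2_sub)
  have "chain_boundary2 (Suc p) y + sdiv m p z = sdiv m p a' + chain_boundary2 (Suc p) qS"
    by (simp add: y_def chain_boundary2_add sdb[OF a(1)] a(3) sdiv_add ac_simps add_left_self add_self)
  then have yS: "singular_chain2 p (subtopology X S) (chain_boundary2 (Suc p) y + sdiv m p z)"
    using a q by (simp add: singular_chain2_add sdiv_chain singular_chain2_boundary_Suc)
  have "sdiv m (Suc p) a + sdiv m (Suc p) b = sdiv m (Suc p) (chain_boundary2 (Suc (Suc p)) v) + (qS + qT)"
    using v(3) q(3) by (metis sdiv_add)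
  then have "y = sdiv m (Suc p) b + sdiv m (Suc p) (chain_boundary2 (Suc (Suc p)) v) + qT"
    unfolding y_def by (simp add: add_eq_iff ac_simps)
  moreover have "chain_boundary2 (Suc p) (sdiv m (Suc p) (chain_boundary2 (Suc (Suc p)) v)) = 0"
    using sdb[OF singular_chain2_boundary_Suc[OF v(1)]] boundary2_boundary2_Suc[OF v(1)]
    by (simp add: sdiv_def lft_def)
  ultimately have "chain_boundary2 (Suc p) y + sdiv m p z = sdiv m p b' + chain_boundary2 (Suc p) qT"
    by (simp add: chain_boundary2_add sdb[OF b(1)] b(3) sdiv_add ac_simps add_left_self add_self)
  then have yT: "singular_chain2 p (subtopology X T) (chain_boundary2 (Suc p) y + sdiv m p z)"
    using b q by (simp add: singular_chain2_add sdiv_chain singular_chain2_boundary_Suc)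
  have "singular_relboundary2 p X (S \<inter> T) (chain_boundary2 (Suc p) y + (chain_boundary2 (Suc p) y
      + sdiv m p z))"
    by (intro relboundary2_add relboundary2_chain singular_chain2_Int yS yT relboundary2_boundary y)
  then have "singular_relboundary2 p X (S \<inter> T) (sdiv m p z)" by (simp add: add_left_self)
  then show ?thesis
    using relboundary2_add_cancel relcycle2_sdiv(2)[OF z, of m] by blast
qed

text \<open>Exactness at the middle term of the same sequence: \<open>z1 + z2\<close> bounds up to
  an error in S \<union> T; giving the \<open>S\<close> part of the error to \<open>z1\<close> and
  the \<open>T\<close> part to \<open>z2\<close> makes the two cycles agree up to a
  boundary.\<close>

lemma mayer_vietoris_glue:
  assumes op: "openin X S" "openin X T"
    and z1: "relcycle2 p X S z1" and z2: "relcycle2 p X T z2"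
    and z12: "singular_relboundary2 p X (S \<union> T) (z1 + z2)"
  obtains z where "relcycle2 p X (S \<inter> T) z" "singular_relboundary2 p X S (z + z1)"
    "singular_relboundary2 p X T (z + z2)"
proof -
  obtain w q where w: "singular_chain2 (Suc p) X w" "singular_chain2 p (subtopology X (S \<union> T)) q"
    "z1 + z2 = chain_boundary2 (Suc p) w + q" using z12 relboundary2_iff by metis
  obtain m qS qT where q: "singular_chain2 p (subtopology X S) qS"
    "singular_chain2 p (subtopology X T) qT" "sdiv m p q = qS + qT"
    using split_sdiv[OF op w(2)] by metis
  define z where "z = sdiv m p z1 + qS"
  have bw: "sdiv m p (chain_boundary2 (Suc p) w) = chain_boundary2 (Suc p) (sdiv m (Suc p) w)"
    using sdiv_boundary[OF w(1), of m] by simp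
  have "sdiv m p z1 + sdiv m p z2 = chain_boundary2 (Suc p) (sdiv m (Suc p) w) + (qS + qT)"
    using w(3) q(3) bw by (metis sdiv_add)
  then have z_eq: "z = sdiv m p z2 + (chain_boundary2 (Suc p) (sdiv m (Suc p) w) + qT)"
    unfolding z_def by (simp add: add_eq_iff ac_simps)
  have rw: "singular_relboundary2 p X T (chain_boundary2 (Suc p) (sdiv m (Suc p) w))"
    by (rule relboundary2_boundary) (rule sdiv_chain[OF w(1)])
  have S: "relcycle2 p X S z" unfolding z_def
    by (intro relcycle2_add relcycle2_sdiv z1 relcycle2_chain q)
  have T: "relcycle2 p X T z" unfolding z_eq
    by (intro relcycle2_add relcycle2_sdiv z2 relcycle2_chain q relboundary2_imp_relcycle2 rw)
  show thesis
  proof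
    show "relcycle2 p X (S \<inter> T) z" using S T by (auto simp: relcycle2_def intro: singular_chain2_Int)
    have "z + z1 = (sdiv m p z1 + z1) + qS" by (simp add: z_def ac_simps)
    also have "singular_relboundary2 p X S \<dots>"
      by (intro relboundary2_add relcycle2_sdiv(2) z1 relboundary2_chain q)
    finally show "singular_relboundary2 p X S (z + z1)" .
    have "z + z2 = (sdiv m p z2 + z2) + (chain_boundary2 (Suc p) (sdiv m (Suc p) w) + qT)"
      by (simp add: z_eq ac_simps)
    also have "singular_relboundary2 p X T \<dots>"
      by (intro relboundary2_add relcycle2_sdiv(2) z2 rw relboundary2_chain q)
    finally show "singular_relboundary2 p X T (z + z2)" .
  qed
qed

text \<open>A subdivided cycle is a part in \<open>U\<close> plus a part in \<open>S\<close>; the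
  second part is zero relative to \<open>S\<close> and is dropped.\<close>

lemma excision_surj:
  assumes op: "openin X U" "openin X S" and cov: "topspace X \<subseteq> U \<union> S"
    and z: "relcycle2 p X S z"
  obtains z' where "relcycle2 p (subtopology X U) (U \<inter> S) z'" "singular_relboundary2 p X S (z + z')"
proof -
  have "subtopology X (U \<union> S) = X" using cov by (simp add: subtopology_superset)
  with z have "singular_chain2 p (subtopology X (U \<union> S)) z" by (simp add: relcycle2_def)
  then obtain m a b where ab: "singular_chain2 p (subtopology X U) a" "singular_chain2 p (subtopology X S) b"
    "sdiv m p z = a + b" using split_sdiv[OF op] by metis
  have a_eq: "a = sdiv m p z + b" using ab(3) by (simp add: add_eq_iff)
  have "relcycle2 p X S a" unfolding a_eq
    by (intro relcycle2_add relcycle2_sdiv z relcycle2_chain ab)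
  then have "singular_chain2 (p - 1) (subtopology X S) (chain_boundary2 p a)" by (simp add: relcycle2_def)
  then have "relcycle2 p (subtopology X U) (U \<inter> S) a"
    using ab(1) singular_chain2_boundary[OF ab(1)]
    by (simp add: relcycle2_def subtopology_subtopology Int_absorb1 singular_chain2_Int flip: Int_assoc)
  moreover have "singular_relboundary2 p X S (z + a)"
    using relboundary2_add[OF relcycle2_sdiv(2)[OF z, of m] relboundary2_chain[OF ab(2)]]
    by (simp add: a_eq ac_simps)
  ultimately show thesis by (rule that)
qed

lemma excision_inj:
  assumes op: "openin X U" "openin X S" and cov: "topspace X \<subseteq> U \<union> S"
    and z: "relcycle2 p (subtopology X U) (U \<inter> S) z" and zS: "singular_relboundary2 p X S z"
  shows "singular_relboundary2 p (subtopology X U) (U \<inter> S) z"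
proof -
  obtain d e where d: "singular_chain2 (Suc p) X d" "singular_chain2 p (subtopology X S) e"
    "z = chain_boundary2 (Suc p) d + e" using zS relboundary2_iff by metis
  have "subtopology X (U \<union> S) = X" using cov by (simp add: subtopology_superset)
  with d(1) have "singular_chain2 (Suc p) (subtopology X (U \<union> S)) d" by simp
  then obtain m a b where ab: "singular_chain2 (Suc p) (subtopology X U) a"
    "singular_chain2 (Suc p) (subtopology X S) b" "sdiv m (Suc p) d = a + b"
    using split_sdiv[OF op] by metis
  have zU: "singular_chain2 p (subtopology X U) z" using z by (simp add: relcycle2_def)
  have "sdiv m p z = chain_boundary2 (Suc p) (sdiv m (Suc p) d) + sdiv m p e"
    using sdiv_boundary[OF d(1), of m] by (simp add: d(3) sdiv_add)
  then have eq: "sdiv m p z + chain_boundary2 (Suc p) a = chain_boundary2 (Suc p) b + sdiv m p e"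
    by (simp add: ab(3) chain_boundary2_add ac_simps add_left_self)
  have 1: "singular_chain2 p (subtopology X U) (sdiv m p z + chain_boundary2 (Suc p) a)"
    by (intro singular_chain2_add sdiv_chain zU singular_chain2_boundary_Suc ab)
  have 2: "singular_chain2 p (subtopology X S) (sdiv m p z + chain_boundary2 (Suc p) a)"
    unfolding eq by (intro singular_chain2_add sdiv_chain d singular_chain2_boundary_Suc ab)
  have "singular_chain2 p (subtopology (subtopology X U) (U \<inter> S)) (sdiv m p z + chain_boundary2 (Suc p) a)"
    using singular_chain2_Int[OF 1 2] by (simp add: subtopology_subtopology flip: Int_assoc)
  from relboundary2_add[OF relboundary2_chain[OF this] relboundary2_boundary[OF ab(1)]]
  have "singular_relboundary2 p (subtopology X U) (U \<inter> S) (sdiv m p z)"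
    by (simp add: add.assoc add_self)
  then show ?thesis
    using relcycle2_sdiv(2)[OF z, of m] by (metis relboundary2_add_cancel)
qed

section \<open>From integral to mod 2 homology\<close>

lemma singular_chain_half: "singular_chain p X (e + e) \<Longrightarrow> singular_chain p X e"
proof -
  have "Poly_Mapping.keys (e + e) = Poly_Mapping.keys e"
    by (auto simp: in_keys_iff lookup_add)
  then show "singular_chain p X (e + e) \<Longrightarrow> singular_chain p X e" by (simp add: singular_chain_def)
qed

lemma relboundary2_red:
  "singular_relboundary p X S c \<Longrightarrow> singular_relboundary2 p X S (red c)"
  unfolding singular_relboundary relboundary2_iff
  by (metis red_add red_boundary singular_chain2_red)

lemma lift_relcycle2_aux:
  assumes "relcycle2 p X S c" "singular_chain p X c'" "red c' = c"
  obtains e s where "singular_relcycle (p - 1) X S e" "singular_chain (p - 1) (subtopology X S) s"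
    "chain_boundary p c' = s + e + e"
proof -
  let ?s = "lft (chain_boundary2 p c)"
  have s: "singular_chain (p - 1) (subtopology X S) ?s"
    using assms(1) by (simp add: relcycle2_def singular_chain_lft)
  have b: "singular_chain (p - 1) X (chain_boundary p c')"
    using assms(2) singular_chain_boundary by fastforce
  obtain e where e: "chain_boundary p c' = ?s + e + e" "singular_chain (p - 1) X e"
    by (rule red_eq_imp[OF _ b singular_chain_subtopology[THEN iffD1, OF s, THEN conjunct1]])
      (simp add: red_boundary assms red_lft)
  have "chain_boundary (p - 1) (chain_boundary p c') = 0"
    using chain_boundary_boundary[OF assms(2)] by simp
  then have "chain_boundary (p - 1) e + chain_boundary (p - 1) e = - chain_boundary (p - 1) ?s"
    unfolding e(1) by (simp add: chain_boundary_add eq_neg_iff_add_eq_0 ac_simps)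
  moreover have "singular_chain (p - 1 - Suc 0) (subtopology X S) (- chain_boundary (p - 1) ?s)"
    by (simp only: singular_chain_minus) (rule singular_chain_boundary[OF s])
  ultimately have "singular_chain (p - 1 - Suc 0) (subtopology X S) (chain_boundary (p - 1) e)"
    by (metis singular_chain_half)
  then have "singular_relcycle (p - 1) X S e"
    using e(2) by (simp add: singular_relcycle)
  then show thesis using that s e(1) by blast
qed

text \<open>In place of the universal coefficient theorem: a mod 2 cycle lifts to an integral one unless its
  Bockstein is a nonzero 2-torsion class.\<close>

lemma lift_relcycle2:
  assumes c: "relcycle2 p X S c"
    and acyc: "\<And>e. p > 0 \<Longrightarrow> singular_relcycle (p - 1) X S e \<Longrightarrow>
      singular_relboundary (p - 1) X S (e + e) \<Longrightarrow> singular_relboundary (p - 1) X S e"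
  obtains c' where "singular_relcycle p X S c'" "red c' = c"
proof (cases "p = 0")
  case True
  then have "singular_relcycle p X S (lft c)"
    using c by (simp add: singular_relcycle relcycle2_def singular_chain_lft chain_boundary_def)
  then show thesis using that red_lft by blast
next
  case False
  have l: "singular_chain p X (lft c)" using c by (simp add: relcycle2_def singular_chain_lft)
  obtain e s where e: "singular_relcycle (p - 1) X S e" "singular_chain (p - 1) (subtopology X S) s"
    "chain_boundary p (lft c) = s + e + e"
    using lift_relcycle2_aux[OF c l red_lft] by metis
  have p: "Suc (p - 1) = p" using False by simp
  have "singular_relboundary (p - 1) X S (e + e)"
    unfolding singular_relboundary p using e(2,3) l
    by (intro exI[of _ "lft c"] exI[of _ "- s"]) (simp add: singular_chain_minus algebra_simps)
  then obtain g t where g: "singular_chain (Suc (p - 1)) X g" "singular_chain (p - 1) (subtopology X S) t"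
    "chain_boundary (Suc (p - 1)) g + t = e"
    using acyc[OF _ e(1)] False unfolding singular_relboundary by blast
  \<comment> \<open>Here \<open>g\<close> bounds the Bockstein cycle modulo \<open>S\<close>.
    Subtracting it twice removes the even part of the boundary up to chains in \<open>S\<close> and
    does not change the reduction.\<close>
  let ?c = "lft c - g - g"
  have bg: "chain_boundary p g = e - t" using g(3)[unfolded p] by (simp add: algebra_simps)
  have "chain_boundary p ?c = s + t + t"
    by (simp add: chain_boundary_diff e(3) bg)
  then have "singular_relcycle p X S ?c"
    using g l e(2) p by (simp add: singular_relcycle singular_chain_diff singular_chain_add)
  moreover have "red ?c = c" by (simp add: red_diff red_lft ac_simps add_self)
  ultimately show thesis by (rule that)
qed

text \<open>Lift the cycle, bound the lift, reduce the bounding chain. The second hypothesis,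
  absence of 2-torsion one degree below, is what lifting requires.\<close>

lemma acyclic_transfer:
  assumes "\<And>c. singular_relcycle p X S c \<Longrightarrow> singular_relboundary p X S c"
    and "\<And>e. p > 0 \<Longrightarrow> singular_relcycle (p - 1) X S e \<Longrightarrow>
      singular_relboundary (p - 1) X S (e + e) \<Longrightarrow> singular_relboundary (p - 1) X S e"
    and "relcycle2 p X S c"
  shows "singular_relboundary2 p X S c"
  using lift_relcycle2[OF assms(3,2)] assms(1) relboundary2_red by metis

section \<open>Local homology of Euclidean space\<close>

lemma trivial_homology_imp_relboundary:
  assumes "trivial_group (relative_homology_group (int p) X S)" "singular_relcycle p X S c"
  shows "singular_relboundary p X S c"
proof -
  have "homologous_rel_set p X S c \<in> carrier (relative_homology_group (int p) X S)"
    using assms(2) by (simp add: carrier_relative_homology_group)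
  then have "homologous_rel_set p X S c = singular_relboundary_set p X S"
    using assms(1) by (simp add: trivial_group_def)
  then show ?thesis by (simp add: homologous_rel_set_eq_relboundary)
qed

lemma homologous_rel_set_add:
  assumes "singular_relcycle p X S c" "singular_relcycle p X S d"
  shows "homologous_rel_set p X S c \<otimes>\<^bsub>relative_homology_group (int p) X S\<^esub> homologous_rel_set p X S d =
    homologous_rel_set p X S (c + d)"
proof -
  have "homologous_rel p X S (c + d) x \<Longrightarrow> \<exists>a b. homologous_rel p X S c a \<and> homologous_rel p X S d b
      \<and> x = a + b" for x
    by (rule exI[of _ c], rule exI[of _ "x - c"]) (simp add: homologous_rel_def algebra_simps)
  then show ?thesis
    unfolding mult_relative_homology_group by (auto intro: homologous_rel_add)
qed

text \<open>Trades cosets for chains: \<open>h\<close> is the isomorphism read on cycles as a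
  degree, \<open>g\<close> a cycle of degree 1.\<close>

lemma homology_integer_degree:
  assumes "relative_homology_group (int p) X S \<cong> integer_group"
  obtains h :: "'a chain \<Rightarrow> int" and g where
    "\<And>c d. singular_relcycle p X S c \<Longrightarrow> singular_relcycle p X S d \<Longrightarrow> h (c + d) = h c + h d"
    "\<And>c. singular_relcycle p X S c \<Longrightarrow> h c = 0 \<longleftrightarrow> singular_relboundary p X S c"
    "singular_relcycle p X S g" "h g = 1"
proof -
  let ?G = "relative_homology_group (int p) X S"
  obtain f where f: "f \<in> iso ?G integer_group" using assms by (auto simp: is_iso_def)
  then have fh: "f \<in> hom ?G integer_group" and fb: "bij_betw f (carrier ?G) UNIV"
    by (auto simp: iso_def integer_group_def)
  have car: "homologous_rel_set p X S c \<in> carrier ?G" if "singular_relcycle p X S c" for c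
    using that by (simp add: carrier_relative_homology_group)
  have f1: "f (\<one>\<^bsub>?G\<^esub>) = 0"
    using hom_one[OF fh] by (simp add: group_relative_homology_group)
  obtain \<gamma> where \<gamma>: "\<gamma> \<in> carrier ?G" "f \<gamma> = 1" using fb unfolding bij_betw_def by (metis UNIV_I imageE)
  then obtain g where g: "singular_relcycle p X S g" "\<gamma> = homologous_rel_set p X S g"
    by (auto simp: carrier_relative_homology_group)
  show thesis
  proof (rule that[of "\<lambda>c. f (homologous_rel_set p X S c)" g])
    fix c d assume "singular_relcycle p X S c" "singular_relcycle p X S d"
    then show "f (homologous_rel_set p X S (c + d)) = f (homologous_rel_set p X S c)
        + f (homologous_rel_set p X S d)"
      using hom_mult[OF fh car car] by (simp add: homologous_rel_set_add)
  next
    fix c assume c: "singular_relcycle p X S c"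
    have "f (homologous_rel_set p X S c) = 0 \<longleftrightarrow> homologous_rel_set p X S c = \<one>\<^bsub>?G\<^esub>"
      using inj_on_eq_iff[OF bij_betw_imp_inj_on[OF fb] car[OF c]
          monoid.one_closed[OF group.is_monoid[OF group_relative_homology_group]]] f1 by simp
    then show "f (homologous_rel_set p X S c) = 0 \<longleftrightarrow> singular_relboundary p X S c"
      unfolding one_relative_homology_group homologous_rel_set_eq_relboundary .
  qed (use g \<gamma> in auto)
qed

lemma homology_integer_torsion_free:
  assumes "relative_homology_group (int p) X S \<cong> integer_group"
    and e: "singular_relcycle p X S e" "singular_relboundary p X S (e + e)"
  shows "singular_relboundary p X S e"
proof -
  obtain h :: "'a chain \<Rightarrow> int" and g where h:
    "\<And>c d. singular_relcycle p X S c \<Longrightarrow> singular_relcycle p X S d \<Longrightarrow> h (c + d) = h c + h d"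
    "\<And>c. singular_relcycle p X S c \<Longrightarrow> h c = 0 \<longleftrightarrow> singular_relboundary p X S c"
    and "singular_relcycle p X S g" "h g = 1"
    using homology_integer_degree[OF assms(1)] by blast
  have "h (e + e) = 0" using h(2)[OF singular_relcycle_add[OF e(1) e(1)]] e(2) by blast
  then have "h e = 0" using h(1)[OF e(1) e(1)] by simp
  then show ?thesis using h(2)[OF e(1)] by simp
qed

text \<open>Universal coefficients by hand: with no homology one degree below, every mod 2 cycle
  lifts to an integral one, and the parity of its degree decides between 0 and the class of
  \<open>g\<close>.\<close>

lemma mod2_homology_of_integers:
  assumes top: "relative_homology_group (int p) X S \<cong> integer_group"
    and below: "p > 0 \<Longrightarrow> trivial_group (relative_homology_group (int (p - 1)) X S)"
  obtains g where "relcycle2 p X S g" "\<not> singular_relboundary2 p X S g"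
    "\<And>z. relcycle2 p X S z \<Longrightarrow> singular_relboundary2 p X S z \<or> singular_relboundary2 p X S (z + g)"
proof -
  obtain h :: "'a chain \<Rightarrow> int" and g where h:
    "\<And>c d. singular_relcycle p X S c \<Longrightarrow> singular_relcycle p X S d \<Longrightarrow> h (c + d) = h c + h d"
    "\<And>c. singular_relcycle p X S c \<Longrightarrow> h c = 0 \<longleftrightarrow> singular_relboundary p X S c"
    and g: "singular_relcycle p X S g" "h g = 1"
    using homology_integer_degree[OF top] by blast
  have h0: "h 0 = 0" using h(2)[of 0] by simp
  have hm: "h (- c) = - h c" if "singular_relcycle p X S c" for c
    using h(1)[of c "- c"] that h0 by (simp add: singular_relcycle_minus)
  have mult: "\<exists>w. singular_relcycle p X S w \<and> h w = int q" for q :: nat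
  proof (induction q)
    case 0
    then show ?case using h0 by (intro exI[of _ 0]) simp
  next
    case (Suc q)
    then show ?case using h(1) g by (metis of_nat_Suc singular_relcycle_add add.commute)
  qed
  have surj: "\<exists>w. singular_relcycle p X S w \<and> h w = q" for q :: int
  proof (cases "q \<ge> 0")
    case True
    then show ?thesis using mult[of "nat q"] by simp
  next
    case False
    then obtain w where w: "singular_relcycle p X S w" "h w = - q" using mult[of "nat (- q)"] by auto
    then show ?thesis using hm[OF w(1)] by (intro exI[of _ "- w"]) (simp add: singular_relcycle_minus)
  qed
  \<comment> \<open>Adding twice a cycle of minus half the degree leaves degree 0, hence a boundary,
    and has no effect mod 2.\<close>
  have even: "singular_relboundary2 p X S (red c)" if c: "singular_relcycle p X S c" "even (h c)" for c
  proof -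
    obtain q where q: "h c = 2 * q" using c(2) by blast
    obtain w where w: "singular_relcycle p X S w" "h w = - q" using surj by blast
    have "singular_relcycle p X S (w + w)" "h (w + w) = - (2 * q)"
      using w h(1) by (simp_all add: singular_relcycle_add)
    then have "h (c + (w + w)) = 0" "singular_relcycle p X S (c + (w + w))"
      using q h(1) c w by (simp_all add: singular_relcycle_add)
    then have "singular_relboundary p X S (c + (w + w))" using h(2) by blast
    from relboundary2_red[OF this] show ?thesis by (simp add: red_add add_self)
  qed
  have red_cycle: "relcycle2 p X S (red c)" if "singular_relcycle p X S c" for c
    using that singular_chain2_red unfolding singular_relcycle relcycle2_def red_boundary[symmetric]
    by fastforce
  show thesis
  proof (rule that[of "red g"])
    show "relcycle2 p X S (red g)" by (rule red_cycle) (rule g)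
    show "\<not> singular_relboundary2 p X S (red g)"
    proof
      \<comment> \<open>Lifting the bounding chain writes \<open>g\<close> as an integral relative
        boundary plus \<open>e + e\<close> with \<open>e\<close> a cycle, so the degree 1 of
        \<open>g\<close> would be even.\<close>
      assume "singular_relboundary2 p X S (red g)"
      then obtain d s where d: "singular_chain2 (Suc p) X d" "singular_chain2 p (subtopology X S) s"
        "red g = chain_boundary2 (Suc p) d + s" unfolding relboundary2_iff by blast
      let ?b = "chain_boundary (Suc p) (lft d) + lft s"
      have b: "singular_relboundary p X S ?b" unfolding singular_relboundary
        using d singular_chain_lft by metis
      have gb: "singular_chain p X g" "singular_chain p X ?b"
        using g(1) b by (auto simp: singular_relcycle singular_relboundary_imp_chain)
      have "red g = red ?b" by (simp add: d red_add red_boundary red_lft)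
      then obtain e where e: "g = ?b + e + e" "singular_chain p X e"
        using red_eq_imp[OF _ gb] by metis
      have ee: "singular_relcycle p X S (e + e)"
      proof -
        have "e + e = g - ?b" by (subst e(1)) (simp add: algebra_simps)
        then show ?thesis using g(1) singular_relboundary_imp_relcycle[OF b]
          by (simp only: singular_relcycle_diff)
      qed
      have e1: "singular_relcycle p X S e"
        using ee e(2) singular_chain_half unfolding singular_relcycle chain_boundary_add by blast
      have "h g = h (?b + (e + e))" by (subst e(1)) (simp only: add.assoc)
      also have "\<dots> = h ?b + (h e + h e)"
        by (simp only: h(1)[OF singular_relboundary_imp_relcycle[OF b] ee] h(1)[OF e1 e1])
      finally have "h g = h ?b + (h e + h e)" .
      moreover have "h ?b = 0" using h(2) b singular_relboundary_imp_relcycle[OF b] by blast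
      ultimately show False using g(2) by presburger
    qed
    fix z assume z: "relcycle2 p X S z"
    obtain c where c: "singular_relcycle p X S c" "red c = z"
      using lift_relcycle2[OF z] below trivial_homology_imp_relboundary by metis
    show "singular_relboundary2 p X S z \<or> singular_relboundary2 p X S (z + red g)"
    proof (cases "even (h c)")
      case True
      then show ?thesis using even c by blast
    next
      case False
      then have "even (h (c + g))" using h(1) c g by simp
      then show ?thesis using even[of "c + g"] c g by (simp add: red_add singular_relcycle_add)
    qed
  qed
qed

abbreviation eucl_minus :: "nat \<Rightarrow> (nat \<Rightarrow> real) set \<Rightarrow> (nat \<Rightarrow> real) set" where
  "eucl_minus n A \<equiv> topspace (Euclidean_space n) - A"

text \<open>Complements of homeomorphic closed sets have isomorphic relative homology, so the point
  may be moved to the origin; the suspension step then leads to the homology of a point in degree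
  \<open>p - int n\<close>.\<close>

lemma euclidean_local_homology:
  assumes x: "x \<in> topspace (Euclidean_space n)"
  shows "relative_homology_group (int n) (Euclidean_space n) (eucl_minus n {x}) \<cong> integer_group"
    and "p \<noteq> int n \<Longrightarrow> trivial_group (relative_homology_group p (Euclidean_space n) (eucl_minus n {x}))"
proof -
  let ?o = "(\<lambda>i. 0) :: nat \<Rightarrow> real"
  have o: "?o \<in> topspace (Euclidean_space m)" for m by (simp add: topspace_Euclidean_space)
  have Haus: "Hausdorff_space (Euclidean_space m)" for m
    unfolding Euclidean_space_def euclidean_product_topology by (intro Hausdorff_space_subtopology) simp
  have cl: "closedin (Euclidean_space m) {y}" if "y \<in> topspace (Euclidean_space m)" for m y
    using that Haus by (simp add: closedin_Hausdorff_singleton)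
  have top: "relative_homology_group p (Euclidean_space n) (eucl_minus n {x}) \<cong>
      homology_group (p - int n) (Euclidean_space 0)" for p
  proof -
    have "subtopology (Euclidean_space n) {x} homeomorphic_space subtopology (Euclidean_space n) {?o}"
      unfolding homeomorphic_space_def homeomorphic_maps_def
      using x o[of n] by (intro exI[of _ "\<lambda>_. ?o"] exI[of _ "\<lambda>_. x"]) simp
    from isomorphic_relative_homology_groups_Euclidean_complements[OF cl[OF x] cl[OF o] this]
    have 1: "relative_homology_group p (Euclidean_space n) (eucl_minus n {x}) \<cong>
      relative_homology_group p (Euclidean_space n) (eucl_minus n {?o})" .
    have "eucl_minus 0 {?o} = {}" by (auto simp: topspace_Euclidean_space)
    with relative_homology_group_Euclidean_complement_step[OF cl[OF o[of 0]], of "p - int n" n]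
    have 2: "homology_group (p - int n) (Euclidean_space 0) \<cong>
      relative_homology_group p (Euclidean_space n) (eucl_minus n {?o})" by simp
    show ?thesis by (rule iso_trans[OF 1 group.iso_sym[OF group_relative_homology_group 2]])
  qed
  have E0: "topspace (Euclidean_space 0) = {?o}" by (auto simp: topspace_Euclidean_space)
  show "relative_homology_group (int n) (Euclidean_space n) (eucl_minus n {x}) \<cong> integer_group"
    using top[of "int n"] by (intro iso_trans[OF _ homology_coefficients[OF E0]]) simp
  show "trivial_group (relative_homology_group p (Euclidean_space n) (eucl_minus n {x}))" if "p \<noteq> int n"
    using isomorphic_group_triviality[OF top] homology_dimension_axiom[OF E0, of "p - int n"] that by simp
qed

section \<open>Compact convex sets in Euclidean space\<close>

lemma compactin_singular_simplex:
  assumes "singular_simplex p X \<sigma>"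
  shows "compactin X (\<sigma> ` standard_simplex p)"
proof (rule image_compactin)
  show "continuous_map (subtopology (powertop_real UNIV) (standard_simplex p)) X \<sigma>"
    using assms by (simp add: singular_simplex_def)
  show "compactin (subtopology (powertop_real UNIV) (standard_simplex p)) (standard_simplex p)"
    by (simp add: compactin_subtopology compactin_standard_simplex)
qed

lemma compactin_chain_support:
  assumes "singular_chain p X c"
  shows "compactin X (\<Union>\<sigma>\<in>Poly_Mapping.keys c. \<sigma> ` standard_simplex p)"
  using assms by (intro compactin_Union) (auto simp: singular_chain_def intro: compactin_singular_simplex)

text \<open>The gauge that measures radial stretching. As a finite sum over coordinates it is
  plainly continuous, and it scales linearly along rays from \<open>x\<close>.\<close>

definition l1dist :: "nat \<Rightarrow> (nat \<Rightarrow> real) \<Rightarrow> (nat \<Rightarrow> real) \<Rightarrow> real" where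
  "l1dist n x y = (\<Sum>i<n. \<bar>y i - x i\<bar>)"

lemma continuous_map_Euclidean_component: "continuous_map (Euclidean_space n) euclideanreal (\<lambda>x. x i)"
  unfolding Euclidean_space_def
  by (intro continuous_map_from_subtopology continuous_map_product_projection) simp

lemma continuous_map_l1dist: "continuous_map (Euclidean_space n) euclideanreal (l1dist n x)"
  unfolding l1dist_def
  by (intro continuous_map_sum continuous_map_real_abs continuous_map_diff
      continuous_map_Euclidean_component continuous_map_const[THEN iffD2]) auto

lemma l1dist_pos:
  assumes "x \<in> topspace (Euclidean_space n)" "y \<in> topspace (Euclidean_space n)" "x \<noteq> y"
  shows "l1dist n x y > 0"
proof -
  have "\<exists>i. i < n \<and> x i \<noteq> y i"
  proof (rule ccontr)
    assume "\<not> ?thesis"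
    then have "x i = y i" for i
      using assms(1,2) by (cases "i < n") (auto simp: topspace_Euclidean_space)
    with assms(3) show False by blast
  qed
  then obtain i where i: "i < n" "x i \<noteq> y i" by blast
  have "0 < \<bar>y i - x i\<bar>" using i by simp
  also have "\<dots> \<le> l1dist n x y" unfolding l1dist_def using i
    by (intro member_le_sum[where f = "\<lambda>i. \<bar>y i - x i\<bar>"]) auto
  finally show ?thesis .
qed

lemma l1dist_scale:
  "s \<ge> 0 \<Longrightarrow> l1dist n x (\<lambda>i. x i + s * (y i - x i)) = s * l1dist n x y"
  by (simp add: l1dist_def abs_mult sum_distrib_left)

text \<open>Any compact set missing the centre of a star-shaped set can be pushed off that set by
  stretching radially away from the centre; this homotopy preserves the complement of the set.\<close>

lemma star_shaped_acyclic:
  fixes n :: nat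
  defines "E \<equiv> Euclidean_space n"
  assumes A: "compactin E A" and x: "x \<in> A"
    and star: "\<And>y t. \<lbrakk>y \<in> A; 0 \<le> t; t \<le> 1\<rbrakk> \<Longrightarrow> (\<lambda>i. x i + t * (y i - x i)) \<in> A"
    and c: "singular_relcycle p (subtopology E (eucl_minus n {x})) (eucl_minus n A) c"
  shows "singular_relboundary p (subtopology E (eucl_minus n {x})) (eucl_minus n A) c"
proof -
  define X where "X = subtopology E (eucl_minus n {x})"
  define K where "K = (\<Union>\<sigma>\<in>Poly_Mapping.keys c. \<sigma> ` standard_simplex p)"
  have AT: "A \<subseteq> topspace E" using A by (rule compactin_subset_topspace)
  have xT: "x \<in> topspace E" using x AT by blast
  have cX: "singular_chain p X c" using c by (simp add: X_def singular_relcycle)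
  have K: "compactin X K" unfolding K_def by (rule compactin_chain_support[OF cX])
  have topX: "topspace X = topspace E - {x}" by (auto simp: X_def E_def)
  have KE: "compactin E K" using K by (simp add: X_def compactin_subtopology)
  have Kx: "K \<subseteq> topspace E - {x}" using compactin_subset_topspace[OF K] topX by simp
  \<comment> \<open>The simplices of \<open>c\<close> cover a compact set missing \<open>x\<close>,
    which therefore keeps a positive distance from \<open>x\<close>.\<close>
  obtain r where r: "r > 0" "\<And>y. y \<in> K \<Longrightarrow> l1dist n x y \<ge> r"
  proof (cases "K = {}")
    case True
    then show thesis using that[of 1] by simp
  next
    case False
    have "compact (l1dist n x ` K)"
      using image_compactin[OF KE[unfolded E_def] continuous_map_l1dist] by simp
    then obtain s where s: "s \<in> l1dist n x ` K" "\<And>t. t \<in> l1dist n x ` K \<Longrightarrow> s \<le> t"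
      using compact_attains_inf[of "l1dist n x ` K"] False by blast
    have "s > 0" using s(1) Kx l1dist_pos xT unfolding E_def by fastforce
    then show thesis using that s(2) by blast
  qed
  obtain R where R: "R > 0" "\<And>y. y \<in> A \<Longrightarrow> l1dist n x y \<le> R"
  proof -
    have "compact (l1dist n x ` A)"
      using image_compactin[OF A[unfolded E_def] continuous_map_l1dist] by simp
    then have "bounded (l1dist n x ` A)" by (rule compact_imp_bounded)
    then obtain R where R: "\<And>y. y \<in> A \<Longrightarrow> \<bar>l1dist n x y\<bar> \<le> R"
      unfolding bounded_iff by auto
    show thesis by (rule that[of "max R 1"]) (use R in force)+
  qed
  \<comment> \<open>Stretching by \<open>l\<close> moves every point of \<open>K\<close> from
    distance at least \<open>r\<close> to distance at least \<open>l * r > R\<close>, beyond all of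
    \<open>A\<close>.\<close>
  define l where "l = 1 + R / r"
  have l: "l \<ge> 1" "l * r > R" using r(1) R(1) by (auto simp: l_def field_simps)
  define h where "h = (\<lambda>(t::real, y). \<lambda>i::nat. x i + (1 + t * (l - 1)) * (y i - x i))"
  let ?P = "prod_topology (top_of_set {0..1::real}) X"
  have s1: "1 + t * (l - 1) \<ge> 1" if "t \<ge> 0" for t using that l(1) by simp
  \<comment> \<open>A stretched point in \<open>A\<close> could be contracted back by the inverse
    factor, at most 1, without leaving the star-shaped \<open>A\<close>.\<close>
  have hA: "h (t, y) \<notin> A" if "t \<ge> 0" "y \<notin> A" for t y
  proof
    assume "h (t, y) \<in> A"
    from star[OF this, of "1 / (1 + t * (l - 1))"] s1[OF that(1)]
    have "(\<lambda>i. x i + 1 / (1 + t * (l - 1)) * (h (t, y) i - x i)) \<in> A" by simp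
    moreover have "(\<lambda>i. x i + 1 / (1 + t * (l - 1)) * (h (t, y) i - x i)) = y"
      using s1[OF that(1)] by (auto simp: h_def fun_eq_iff)
    ultimately show False using that(2) by simp
  qed
  have hx: "h (t, y) \<noteq> x" if "t \<ge> 0" "y \<noteq> x" for t y
  proof
    assume "h (t, y) = x"
    then have "(1 + t * (l - 1)) * (y i - x i) = 0" for i by (auto simp: h_def fun_eq_iff)
    then have "y i = x i" for i using s1[OF that(1)] by (metis eq_iff_diff_eq_0 mult_eq_0_iff not_one_le_zero)
    then show False using that(2) by blast
  qed
  have hT: "h (t, y) \<in> topspace E" if "y \<in> topspace E" for t y
    using that xT by (simp add: h_def E_def topspace_Euclidean_space)
  have cont: "continuous_map ?P X h"
  proof -
    have 1: "continuous_map ?P euclideanreal (\<lambda>z. fst z)"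
      using continuous_map_fst continuous_map_in_subtopology by blast
    have 2: "continuous_map ?P euclideanreal (\<lambda>z. snd z i)" for i
    proof -
      have "continuous_map X euclideanreal (\<lambda>y. y i)"
        unfolding X_def E_def
        by (intro continuous_map_from_subtopology continuous_map_Euclidean_component)
      from continuous_map_compose[OF continuous_map_snd this] show ?thesis by (simp add: o_def)
    qed
    have 3: "continuous_map ?P euclideanreal (\<lambda>z. h z i)" for i
      unfolding h_def case_prod_beta
      by (intro continuous_map_add continuous_map_real_mult continuous_map_diff 1 2
          continuous_map_const[THEN iffD2]) auto
    have 4: "h \<in> topspace ?P \<rightarrow> topspace E - {x}"
    proof (rule Pi_I)
      fix z assume zP: "z \<in> topspace ?P"
      obtain t y where z: "z = (t, y)" by (cases z)
      have "t \<ge> 0" "y \<in> topspace E" "y \<noteq> x" using zP topX by (simp_all add: z)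
      with z show "h z \<in> topspace E - {x}" using hT[of y t] hx[of t y] by simp
    qed
    then have cE: "continuous_map ?P E h"
      unfolding E_def Euclidean_space_def continuous_map_in_subtopology
      using 3 by (auto simp: continuous_map_componentwise_UNIV E_def Euclidean_space_def)
    have "continuous_map ?P (subtopology E (eucl_minus n {x})) h"
      unfolding continuous_map_in_subtopology using cE 4 by (simp add: E_def)
    then show ?thesis by (simp only: X_def[symmetric])
  qed
  have hom: "homotopic_with (\<lambda>f. f \<in> (eucl_minus n A) \<rightarrow> (eucl_minus n A)) X X id (\<lambda>y. h (1, y))"
    unfolding homotopic_with_def
    using cont hA hT by (intro exI[of _ h]) (auto simp: h_def[abs_def] E_def)
  have c': "singular_relcycle p X (eucl_minus n A) c" using c by (simp add: X_def)
  have hr: "homologous_rel p X (eucl_minus n A) c (chain_map p (\<lambda>y. h (1, y)) c)"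
    using homotopic_imp_homologous_rel_chain_maps[OF hom c'] chain_map_ident[OF cX] by simp
  have off: "h (1, y) \<in> eucl_minus n A" if "y \<in> K" for y
  proof -
    have "l1dist n x (h (1, y)) = l * l1dist n x y" using l1dist_scale[of l n x y] l(1) by (simp add: h_def)
    also have "\<dots> \<ge> l * r" using r(2)[OF that] l(1) by (intro mult_left_mono) auto
    finally have "h (1, y) \<notin> A" using R(2) l(2) by force
    then show ?thesis using hT Kx that by (auto simp: E_def)
  qed
  have "singular_chain p (subtopology X K) c"
    using cX by (auto simp: singular_chain_subtopology K_def)
  moreover have "continuous_map (subtopology X K) (subtopology X (eucl_minus n A)) (\<lambda>y. h (1, y))"
    using homotopic_with_imp_continuous_maps[OF hom] off
    by (auto simp: continuous_map_in_subtopology intro: continuous_map_from_subtopology)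
  ultimately have "singular_chain p (subtopology X (eucl_minus n A)) (chain_map p (\<lambda>y. h (1, y)) c)"
    by (rule singular_chain_chain_map)
  then have "singular_relboundary p X (eucl_minus n A) (chain_map p (\<lambda>y. h (1, y)) c)"
    by (rule singular_chain_imp_relboundary)
  with hr show ?thesis
    unfolding homologous_rel_def X_def by (metis diff_add_cancel singular_relboundary_add)
qed

text \<open>The half of the exact sequence of the triple X, X - {x}, X - A that gives injectivity: a
  null-homology of \<open>z\<close> modulo X - {x} leaves an error in X - {x} that is a cycle modulo
  X - A, and there it bounds.\<close>

lemma acyclic_complement_null:
  assumes A: "A \<subseteq> topspace X" "x \<in> A"
    and acyc: "\<And>p c. relcycle2 p (subtopology X (topspace X - {x})) (topspace X - A) c \<Longrightarrow>
      singular_relboundary2 p (subtopology X (topspace X - {x})) (topspace X - A) c"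
    and z: "relcycle2 p X (topspace X - A) z" "singular_relboundary2 p X (topspace X - {x}) z"
  shows "singular_relboundary2 p X (topspace X - A) z"
proof -
  let ?U = "topspace X - {x}" and ?V = "topspace X - A"
  have UV: "subtopology (subtopology X ?U) ?V = subtopology X ?V"
    using A by (simp add: subtopology_subtopology Int_absorb1 Diff_mono)
  obtain d e where d: "singular_chain2 (Suc p) X d" "singular_chain2 p (subtopology X ?U) e"
    "z = chain_boundary2 (Suc p) d + e" using z(2) relboundary2_iff by metis
  have "chain_boundary2 p z = chain_boundary2 p e"
    using boundary2_boundary2_Suc[OF d(1)] by (simp add: d(3) chain_boundary2_add)
  with z(1) d(2) have "relcycle2 p (subtopology X ?U) ?V e"
    by (simp add: relcycle2_def UV)
  then obtain f a where f: "singular_chain2 (Suc p) (subtopology X ?U) f" "singular_chain2 p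
      (subtopology X ?V) a"
    "e = chain_boundary2 (Suc p) f + a" using acyc[of p e] unfolding relboundary2_iff UV by blast
  have "z = chain_boundary2 (Suc p) (d + f) + a" by (simp add: d(3) f(3) chain_boundary2_add ac_simps)
  then show ?thesis unfolding relboundary2_iff
    using d(1) f singular_chain2_add singular_chain2_sub by blast
qed

text \<open>The other half of that sequence: the boundary of \<open>z\<close> is a cycle in X - {x}
  modulo X - A; adding a chain of X - {x} that bounds it pushes the boundary of \<open>z\<close>
  into X - A.\<close>

lemma acyclic_complement_lift:
  assumes A: "A \<subseteq> topspace X" "x \<in> A"
    and acyc: "\<And>p c. relcycle2 p (subtopology X (topspace X - {x})) (topspace X - A) c \<Longrightarrow>
      singular_relboundary2 p (subtopology X (topspace X - {x})) (topspace X - A) c"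
    and z: "relcycle2 p X (topspace X - {x}) z"
  obtains z' where "relcycle2 p X (topspace X - A) z'" "singular_relboundary2 p X (topspace X - {x}) (z + z')"
proof (cases "p = 0")
  case True
  then have "relcycle2 p X (topspace X - A) z" using z by (simp add: relcycle2_def)
  then show thesis using that[of z] by (simp add: add_self)
next
  case False
  let ?U = "topspace X - {x}" and ?V = "topspace X - A"
  have UV: "subtopology (subtopology X ?U) ?V = subtopology X ?V"
    using A by (simp add: subtopology_subtopology Int_absorb1 Diff_mono)
  have p: "Suc (p - 1) = p" using False by simp
  have zc: "singular_chain2 p X z" using z by (simp add: relcycle2_def)
  have "chain_boundary2 (p - 1) (chain_boundary2 p z) = 0"
    by (rule boundary2_boundary2[OF zc])
  then have "relcycle2 (p - 1) (subtopology X ?U) ?V (chain_boundary2 p z)"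
    using z by (simp add: relcycle2_def)
  then obtain f a where f: "singular_chain2 p (subtopology X ?U) f" "singular_chain2 (p - 1)
      (subtopology X ?V) a"
    "chain_boundary2 p z = chain_boundary2 p f + a"
    using acyc[of "p - 1" "chain_boundary2 p z"] unfolding relboundary2_iff UV p by blast
  have "chain_boundary2 p (z + f) = a"
    by (simp add: chain_boundary2_add f(3) ac_simps add_self)
  then have 1: "relcycle2 p X ?V (z + f)"
    using f zc singular_chain2_sub[OF f(1)] by (simp add: relcycle2_def singular_chain2_add)
  have 2: "singular_relboundary2 p X ?U (z + (z + f))"
    using relboundary2_chain[OF f(1)] by (simp add: add_left_self)
  show thesis by (rule that[OF 1 2])
qed

text \<open>For nonempty \<open>A\<close>: the mod 2 homology of (X, X - A) is Z_2 concentrated in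
  degree \<open>n\<close> and restricts injectively to every point of \<open>A\<close>, as for a
  closed ball in an n-manifold.\<close>

definition local_cell :: "nat \<Rightarrow> 'a topology \<Rightarrow> 'a set \<Rightarrow> bool" where
  "local_cell n X A \<longleftrightarrow>
     (\<forall>p z. p \<noteq> n \<longrightarrow> relcycle2 p X (topspace X - A) z \<longrightarrow> singular_relboundary2 p X (topspace X - A) z) \<and>
     (\<forall>x\<in>A. \<forall>z. relcycle2 n X (topspace X - A) z \<longrightarrow> singular_relboundary2 n X (topspace X - {x}) z \<longrightarrow>
        singular_relboundary2 n X (topspace X - A) z) \<and>
     (\<exists>g. relcycle2 n X (topspace X - A) g \<and> (\<forall>x\<in>A. \<not> singular_relboundary2 n X (topspace X - {x}) g) \<and>
        (\<forall>z. relcycle2 n X (topspace X - A) z \<longrightarrow>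
           singular_relboundary2 n X (topspace X - A) z \<or> singular_relboundary2 n X (topspace X - A) (z + g)))"

lemma local_cell_Euclidean:
  assumes A: "compactin (Euclidean_space n) A" "A \<noteq> {}"
    and conv: "\<And>x y t. \<lbrakk>x \<in> A; y \<in> A; 0 \<le> t; t \<le> 1\<rbrakk> \<Longrightarrow> (\<lambda>i. x i + t * (y i - x i)) \<in> A"
  shows "local_cell n (Euclidean_space n) A"
proof -
  let ?E = "Euclidean_space n"
  have AT: "A \<subseteq> topspace ?E" using A(1) by (rule compactin_subset_topspace)
  have acyc: "singular_relboundary2 p (subtopology ?E (eucl_minus n {x})) (eucl_minus n A) c"
    if "x \<in> A" "relcycle2 p (subtopology ?E (eucl_minus n {x})) (eucl_minus n A) c" for x p c
  proof (rule acyclic_transfer[OF _ _ that(2)])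
    show "singular_relboundary p (subtopology ?E (eucl_minus n {x})) (eucl_minus n A) e"
      if "singular_relcycle p (subtopology ?E (eucl_minus n {x})) (eucl_minus n A) e" for p e
      by (rule star_shaped_acyclic[OF A(1) \<open>x \<in> A\<close> conv[OF \<open>x \<in> A\<close>] that])
    then show "singular_relboundary (p - 1) (subtopology ?E (eucl_minus n {x})) (eucl_minus n A) e"
      if "singular_relcycle (p - 1) (subtopology ?E (eucl_minus n {x})) (eucl_minus n A) e" for e
      using that by blast
  qed
  have null: "singular_relboundary2 p ?E (eucl_minus n A) z"
    if "x \<in> A" "relcycle2 p ?E (eucl_minus n A) z" "singular_relboundary2 p ?E (eucl_minus n {x}) z" for p x z
    using acyclic_complement_null[OF AT that(1) acyc[OF that(1)]] that(2,3) by blast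
  have up: "relcycle2 p ?E (eucl_minus n {x}) z" if "relcycle2 p ?E (eucl_minus n A) z" "x \<in> A" for p x z
    using that by (auto elim!: relcycle2_mono)
  have pt: "singular_relboundary2 p ?E (eucl_minus n {x}) z"
    if "p \<noteq> n" "x \<in> A" "relcycle2 p ?E (eucl_minus n {x}) z" for p x z
  proof (rule acyclic_transfer[OF _ _ that(3)])
    have xT: "x \<in> topspace ?E" using that AT by blast
    have triv: "singular_relboundary q ?E (eucl_minus n {x}) c"
      if "q \<noteq> n" "singular_relcycle q ?E (eucl_minus n {x}) c" for q c
      using trivial_homology_imp_relboundary[OF euclidean_local_homology(2)[OF xT] that(2)] that(1) by simp
    show "singular_relboundary p ?E (eucl_minus n {x}) c" if "singular_relcycle p ?E (eucl_minus n {x}) c" for c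
      using triv[OF \<open>p \<noteq> n\<close> that] .
    show "singular_relboundary (p - 1) ?E (eucl_minus n {x}) e"
      if "p > 0" "singular_relcycle (p - 1) ?E (eucl_minus n {x}) e"
        "singular_relboundary (p - 1) ?E (eucl_minus n {x}) (e + e)" for e
    proof (cases "p - 1 = n")
      case False
      then show ?thesis using triv that by blast
    next
      case True
      show ?thesis
        using homology_integer_torsion_free[OF euclidean_local_homology(1)[OF xT], of e] that True by simp
    qed
  qed
  obtain x where x: "x \<in> A" using A(2) by blast
  then have xT: "x \<in> topspace ?E" using AT by blast
  obtain g0 where g0: "relcycle2 n ?E (eucl_minus n {x}) g0" "\<not> singular_relboundary2 n ?E
      (eucl_minus n {x}) g0"
    "\<And>z. relcycle2 n ?E (eucl_minus n {x}) z \<Longrightarrow>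
       singular_relboundary2 n ?E (eucl_minus n {x}) z \<or> singular_relboundary2 n ?E (eucl_minus n {x}) (z + g0)"
  proof (rule mod2_homology_of_integers[OF euclidean_local_homology(1)[OF xT]])
    show "trivial_group (relative_homology_group (int (n - 1)) ?E (eucl_minus n {x}))" if "n > 0"
      using euclidean_local_homology(2)[OF xT, of "int (n - 1)"] that by simp
  qed blast
  obtain g where g: "relcycle2 n ?E (eucl_minus n A) g" "singular_relboundary2 n ?E (eucl_minus n {x}) (g0 + g)"
    using acyclic_complement_lift[OF AT x acyc[OF x] g0(1)] by blast
  have gx: "\<not> singular_relboundary2 n ?E (eucl_minus n {x}) g"
  proof
    assume "singular_relboundary2 n ?E (eucl_minus n {x}) g"
    from relboundary2_add[OF g(2) this] g0(2) show False by (simp add: add.assoc add_self)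
  qed
  \<comment> \<open>Vanishing at \<open>y\<close> forces vanishing over all of \<open>A\<close> by
    \<open>null\<close>, hence at \<open>x\<close>, where \<open>g\<close> represents the
    generator.\<close>
  have gy: "\<not> singular_relboundary2 n ?E (eucl_minus n {y}) g" if "y \<in> A" for y
  proof
    assume "singular_relboundary2 n ?E (eucl_minus n {y}) g"
    from null[OF that g(1) this] have "singular_relboundary2 n ?E (eucl_minus n {x}) g"
      by (rule relboundary2_mono) (use x in auto)
    with gx show False by blast
  qed
  have gen: "singular_relboundary2 n ?E (eucl_minus n A) z
      \<or> singular_relboundary2 n ?E (eucl_minus n A) (z + g)"
    if z: "relcycle2 n ?E (eucl_minus n A) z" for z
  proof -
    consider "singular_relboundary2 n ?E (eucl_minus n {x}) z" | "singular_relboundary2 n ?E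
        (eucl_minus n {x}) (z + g0)"
      using g0(3)[OF up[OF z x]] by blast
    then show ?thesis
    proof cases
      case 1
      then show ?thesis using null[OF x z] by blast
    next
      case 2
      have eq: "z + g0 + (g0 + g) = z + g" by (simp add: ac_simps add_left_self)
      have "singular_relboundary2 n ?E (eucl_minus n {x}) (z + g)"
        using relboundary2_add[OF 2 g(2)] unfolding eq .
      then show ?thesis using null[OF x relcycle2_add[OF z g(1)]] by blast
    qed
  qed
  have ne: "singular_relboundary2 p ?E (eucl_minus n A) z"
    if "p \<noteq> n" "relcycle2 p ?E (eucl_minus n A) z" for p z
    using null[OF x that(2) pt[OF that(1) x up[OF that(2) x]]] .
  show ?thesis unfolding local_cell_def
    using ne null g(1) gy gen by blast
qed

section \<open>Induced maps on chains and transport to a chart\<close>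

definition chain_map2 :: "nat \<Rightarrow> ('a \<Rightarrow> 'b) \<Rightarrow> 'a chain2 \<Rightarrow> 'b chain2" where
  "chain_map2 p f c = lin (\<lambda>\<sigma>. gen2 (simplex_map p f \<sigma>)) c"

lemma chain_map2_add: "chain_map2 p f (c + d) = chain_map2 p f c + chain_map2 p f d"
  by (simp add: chain_map2_def lin_add)

lemma red_chain_map: "red (chain_map p f c) = chain_map2 p f (red c)"
  by (induction c rule: frag_induction[OF subset_UNIV])
    (simp_all add: chain_map_diff red_diff chain_map2_add, simp_all add: chain_map2_def)

lemma chain_map2_chain:
  assumes "singular_chain2 p X c" "continuous_map X Y f"
  shows "singular_chain2 p Y (chain_map2 p f c)"
  unfolding chain_map2_def using assms
  by (intro singular_chain2_lin) (auto simp: singular_chain2_def intro: singular_simplex_simplex_map)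

lemma chain_map2_boundary:
  assumes "singular_chain2 p X c"
  shows "chain_boundary2 p (chain_map2 p f c) = chain_map2 (p - 1) f (chain_boundary2 p c)"
proof -
  have "red (chain_boundary p (chain_map p f (lft c)))
      = red (chain_map (p - Suc 0) f (chain_boundary p (lft c)))"
    by (simp only: chain_boundary_chain_map[OF singular_chain_lft[OF assms]])
  then show ?thesis by (simp add: red_boundary red_chain_map red_lft)
qed

lemma chain_map2_inverse:
  assumes "singular_chain2 p X c" "\<And>x. x \<in> topspace X \<Longrightarrow> g (f x) = x"
  shows "chain_map2 p g (chain_map2 p f c) = c"
proof -
  have "simplex_map p g (simplex_map p f \<sigma>) = \<sigma>" if "\<sigma> \<in> Poly_Mapping.keys c" for \<sigma>
  proof -
    have "singular_simplex p X \<sigma>" using that assms(1) by (auto simp: singular_chain2_def)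
    from simplex_map_id_gen[OF this, of "g \<circ> f"] show ?thesis
      using assms(2) by (simp add: simplex_map_compose)
  qed
  then have "chain_map2 p g (chain_map2 p f c) = lin gen2 c"
    unfolding chain_map2_def lin_lin by (intro lin_cong) simp
  then show ?thesis by (simp add: lin_id)
qed

lemma chain_map2_relcycle:
  assumes "relcycle2 p X S c" "continuous_map X Y f" "\<And>x. x \<in> S \<Longrightarrow> x \<in> topspace X \<Longrightarrow> f x \<in> T"
  shows "relcycle2 p Y T (chain_map2 p f c)"
proof -
  have "continuous_map (subtopology X S) (subtopology Y T) f"
    using assms(2,3) by (auto simp: continuous_map_in_subtopology continuous_map_from_subtopology)
  then show ?thesis
    using assms(1,2) chain_map2_boundary[of p X c f]
    by (auto simp: relcycle2_def intro: chain_map2_chain)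
qed

lemma chain_map2_relboundary:
  assumes "singular_relboundary2 p X S c" "continuous_map X Y f" "\<And>x. x \<in> S \<Longrightarrow> x \<in> topspace X \<Longrightarrow> f x \<in> T"
  shows "singular_relboundary2 p Y T (chain_map2 p f c)"
proof -
  have cont: "continuous_map (subtopology X S) (subtopology Y T) f"
    using assms(2,3) by (auto simp: continuous_map_in_subtopology continuous_map_from_subtopology)
  obtain d e where d: "singular_chain2 (Suc p) X d" "singular_chain2 p (subtopology X S) e"
    "c = chain_boundary2 (Suc p) d + e" using assms(1) relboundary2_iff by metis
  show ?thesis unfolding relboundary2_iff
    by (rule exI[of _ "chain_map2 (Suc p) f d"], rule exI[of _ "chain_map2 p f e"])
      (use d cont assms(2) chain_map2_boundary[OF d(1), of f] in
        \<open>auto simp: chain_map2_add intro: chain_map2_chain\<close>)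
qed

lemma local_cell_transport:
  assumes fg: "homeomorphic_maps X Y f g" and A: "A \<subseteq> topspace X" and cell: "local_cell n X A"
  shows "local_cell n Y (f ` A)"
proof -
  have f: "continuous_map X Y f" and g: "continuous_map Y X g"
    and gf: "\<And>x. x \<in> topspace X \<Longrightarrow> g (f x) = x" and fg': "\<And>y. y \<in> topspace Y \<Longrightarrow> f (g y) = y"
    using fg by (auto simp: homeomorphic_maps_def)
  have fT: "f x \<in> topspace Y" if "x \<in> topspace X" for x using f that by (auto simp: continuous_map_def)
  have gT: "g x \<in> topspace X" if "x \<in> topspace Y" for x using g that by (auto simp: continuous_map_def)
  have gB: "g y \<in> topspace X - B" if "y \<in> topspace Y - f ` B" "B \<subseteq> topspace X" for y B
    using that fg' gT by (metis Diff_iff imageI)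
  have fB: "f x \<in> topspace Y - f ` B" if "x \<in> topspace X - B" "B \<subseteq> topspace X" for x B
  proof -
    have "f x \<noteq> f y" if y: "y \<in> B" for y
    proof
      assume "f x = f y"
      moreover have "x \<in> topspace X" "y \<in> topspace X" "x \<noteq> y" using y \<open>x \<in> _\<close> \<open>B \<subseteq> _\<close> by auto
      ultimately show False using gf by metis
    qed
    then show ?thesis using fT that(1) by auto
  qed
  have to: "relcycle2 p X (topspace X - B) (chain_map2 p g z)"
    if "relcycle2 p Y (topspace Y - f ` B) z" "B \<subseteq> topspace X" for B p z
    using gB[OF _ that(2)] by (intro chain_map2_relcycle[OF that(1) g]) blast
  have tob: "singular_relboundary2 p X (topspace X - B) (chain_map2 p g z)"
    if "singular_relboundary2 p Y (topspace Y - f ` B) z" "B \<subseteq> topspace X" for B p z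
    using gB[OF _ that(2)] by (intro chain_map2_relboundary[OF that(1) g]) blast
  have fro: "relcycle2 p Y (topspace Y - f ` B) (chain_map2 p f z)"
    if "relcycle2 p X (topspace X - B) z" "B \<subseteq> topspace X" for B p z
    using fB[OF _ that(2)] by (intro chain_map2_relcycle[OF that(1) f]) blast
  have frob: "singular_relboundary2 p Y (topspace Y - f ` B) (chain_map2 p f z)"
    if "singular_relboundary2 p X (topspace X - B) z" "B \<subseteq> topspace X" for B p z
    using fB[OF _ that(2)] by (intro chain_map2_relboundary[OF that(1) f]) blast
  have inv: "chain_map2 p f (chain_map2 p g z) = z" if "relcycle2 p Y S z" for p S z
    using that fg' by (intro chain_map2_inverse[of p Y]) (auto simp: relcycle2_def)
  have inv': "chain_map2 p g (chain_map2 p f z) = z" if "relcycle2 p X S z" for p S z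
    using that gf by (intro chain_map2_inverse[of p X]) (auto simp: relcycle2_def)
  have bk: "singular_relboundary2 p Y (topspace Y - f ` A) z"
    if "relcycle2 p Y S z" "singular_relboundary2 p X (topspace X - A) (chain_map2 p g z)" for p S z
    using frob[OF that(2) A] inv[OF that(1)] by simp
  obtain \<gamma> where \<gamma>: "relcycle2 n X (topspace X - A) \<gamma>" "\<And>x. x \<in> A
      \<Longrightarrow> \<not> singular_relboundary2 n X (topspace X - {x}) \<gamma>"
    "\<And>z. relcycle2 n X (topspace X - A) z \<Longrightarrow>
       singular_relboundary2 n X (topspace X - A) z \<or> singular_relboundary2 n X (topspace X - A) (z + \<gamma>)"
    using cell unfolding local_cell_def by blast
  have C1: "singular_relboundary2 p Y (topspace Y - f ` A) z"
    if "p \<noteq> n" "relcycle2 p Y (topspace Y - f ` A) z" for p z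
    using bk[OF that(2)] to[OF that(2) A] cell that(1) unfolding local_cell_def by blast
  have C2: "singular_relboundary2 n Y (topspace Y - f ` A) z"
    if y: "y \<in> f ` A"
      and "relcycle2 n Y (topspace Y - f ` A) z" "singular_relboundary2 n Y (topspace Y - {y}) z" for y z
  proof -
    obtain x where x: "x \<in> A" "y = f x" using y by blast
    then have "singular_relboundary2 n X (topspace X - {x}) (chain_map2 n g z)"
      using tob[of n "{x}" z] that(3) A by auto
    then show ?thesis using bk[OF that(2)] to[OF that(2) A] cell x(1) unfolding local_cell_def by blast
  qed
  have C3: "\<not> singular_relboundary2 n Y (topspace Y - {f x}) (chain_map2 n f \<gamma>)" if "x \<in> A" for x
    using tob[of n "{x}" "chain_map2 n f \<gamma>"] inv'[OF \<gamma>(1)] \<gamma>(2)[OF that] that A by auto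
  have C4: "singular_relboundary2 n Y (topspace Y - f ` A) z \<or>
      singular_relboundary2 n Y (topspace Y - f ` A) (z + chain_map2 n f \<gamma>)"
    if z: "relcycle2 n Y (topspace Y - f ` A) z" for z
    using \<gamma>(3)[OF to[OF z A]] bk[OF z] bk[OF relcycle2_add[OF z fro[OF \<gamma>(1) A]]] inv'[OF \<gamma>(1)]
    by (auto simp: chain_map2_add)
  show ?thesis unfolding local_cell_def
    using C1 C2 C3 C4 fro[OF \<gamma>(1) A] by blast
qed

text \<open>Excision compares (X, X - B) with (U, U - B) both for B = A and for B = {x}; the second
  comparison is why points have to be closed.\<close>

lemma local_cell_excision:
  assumes U: "openin X U" and A: "A \<subseteq> U" "closedin X A" and cell: "local_cell n (subtopology X U) A"
    and T1: "\<And>x. x \<in> topspace X \<Longrightarrow> closedin X {x}"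
  shows "local_cell n X A"
proof -
  have UT: "U \<subseteq> topspace X" using U by (rule openin_subset)
  have tU: "topspace (subtopology X U) = U" using UT by auto
  have surj: "\<exists>z'. relcycle2 p (subtopology X U) (U - B) z'
      \<and> singular_relboundary2 p X (topspace X - B) (z + z')"
    if "closedin X B" "B \<subseteq> U" "relcycle2 p X (topspace X - B) z" for p B z
  proof -
    have "openin X (topspace X - B)" "topspace X \<subseteq> U \<union> (topspace X - B)" "U \<inter> (topspace X - B) = U - B"
      using that UT by auto
    then show ?thesis using excision_surj[OF U _ _ that(3)] by metis
  qed
  have inj: "singular_relboundary2 p (subtopology X U) (U - B) z"
    if "closedin X B" "B \<subseteq> U" "relcycle2 p (subtopology X U) (U - B) z"
      "singular_relboundary2 p X (topspace X - B) z" for p B z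
  proof -
    have "openin X (topspace X - B)" "topspace X \<subseteq> U \<union> (topspace X - B)" "U \<inter> (topspace X - B) = U - B"
      using that UT by auto
    then show ?thesis using excision_inj[OF U _ _ _ that(4)] that(3) by metis
  qed
  have idT: "continuous_map (subtopology X U) X id" by (simp add: continuous_map_from_subtopology)
  have cm: "chain_map2 p id z = z" if "singular_chain2 p Y z" for p Y and z :: "'a chain2"
  proof -
    have "chain_map2 p id z = lin gen2 z" unfolding chain_map2_def
    proof (rule lin_cong)
      fix \<sigma> assume "\<sigma> \<in> Poly_Mapping.keys z"
      then have "singular_simplex p Y \<sigma>" using that by (auto simp: singular_chain2_def)
      then show "gen2 (simplex_map p id \<sigma>) = gen2 \<sigma>" by (simp only: simplex_map_id_gen[of p Y \<sigma> id] id_apply)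
    qed
    then show ?thesis by (simp add: lin_id)
  qed
  have incl: "singular_relboundary2 p X (topspace X - B) z"
    if "singular_relboundary2 p (subtopology X U) (U - B) z" for p B z
  proof -
    have "singular_relboundary2 p X (topspace X - B) (chain_map2 p id z)"
      by (rule chain_map2_relboundary[OF that idT]) (use UT in auto)
    moreover have "singular_chain2 p (subtopology X U) z"
      using relboundary2_imp_relcycle2[OF that] by (simp add: relcycle2_def)
    ultimately show ?thesis using cm by metis
  qed
  have inclc: "relcycle2 p X (topspace X - B) z" if "relcycle2 p (subtopology X U) (U - B) z" for p B z
  proof -
    have "relcycle2 p X (topspace X - B) (chain_map2 p id z)"
      by (rule chain_map2_relcycle[OF that idT]) (use UT in auto)
    moreover have "singular_chain2 p (subtopology X U) z" using that by (simp add: relcycle2_def)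
    ultimately show ?thesis using cm by metis
  qed
  have C1: "\<And>p z. p \<noteq> n \<Longrightarrow> relcycle2 p (subtopology X U) (U - A) z \<Longrightarrow>
      singular_relboundary2 p (subtopology X U) (U - A) z"
    and C2: "\<And>x z. x \<in> A \<Longrightarrow> relcycle2 n (subtopology X U) (U - A) z \<Longrightarrow>
      singular_relboundary2 n (subtopology X U) (U - {x}) z \<Longrightarrow> singular_relboundary2 n (subtopology X
          U) (U - A) z"
    using cell unfolding local_cell_def tU by blast+
  obtain g where g: "relcycle2 n (subtopology X U) (U - A) g"
    "\<And>x. x \<in> A \<Longrightarrow> \<not> singular_relboundary2 n (subtopology X U) (U - {x}) g"
    "\<And>z. relcycle2 n (subtopology X U) (U - A) z \<Longrightarrow> singular_relboundary2 n (subtopology X U) (U - A) z \<or>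
       singular_relboundary2 n (subtopology X U) (U - A) (z + g)"
    using cell unfolding local_cell_def tU by blast
  have cancel: "singular_relboundary2 p X S (z + z') \<Longrightarrow> singular_relboundary2 p X S z' \<Longrightarrow>
      singular_relboundary2 p X S z" for p S z z'
    using relboundary2_add_cancel by (metis add.commute)
  have up: "relcycle2 n (subtopology X U) (U - {x}) z"
    if "x \<in> A" "relcycle2 n (subtopology X U) (U - A) z" for x z
    using that by (auto elim!: relcycle2_mono)
  have cx: "closedin X {x}" "{x} \<subseteq> U" if "x \<in> A" for x using T1 that A UT by auto
  have D1: "singular_relboundary2 p X (topspace X - A) z" if "p \<noteq> n" "relcycle2 p X (topspace X - A) z" for p z
    using surj[OF A(2,1) that(2)] C1[OF that(1)] incl cancel by blast
  have D2: "singular_relboundary2 n X (topspace X - A) z"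
    if x: "x \<in> A" and z: "relcycle2 n X (topspace X - A) z"
      and zx: "singular_relboundary2 n X (topspace X - {x}) z" for x z
  proof -
    obtain z' where z': "relcycle2 n (subtopology X U) (U - A) z'" "singular_relboundary2 n X
        (topspace X - A) (z + z')"
      using surj[OF A(2,1) z] by blast
    have "singular_relboundary2 n X (topspace X - {x}) (z + z')"
      by (rule relboundary2_mono[OF z'(2)]) (use x in auto)
    then have "singular_relboundary2 n X (topspace X - {x}) z'" using relboundary2_add_cancel[OF zx] by blast
    from inj[OF cx[OF x] up[OF x z'(1)] this]
    show ?thesis using C2[OF x z'(1)] incl cancel[OF z'(2)] by blast
  qed
  have D3: "\<not> singular_relboundary2 n X (topspace X - {x}) g" if "x \<in> A" for x
    using inj[OF cx[OF that] up[OF that g(1)]] g(2)[OF that] by blast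
  have D4: "singular_relboundary2 n X (topspace X - A) z \<or> singular_relboundary2 n X (topspace X - A) (z + g)"
    if z: "relcycle2 n X (topspace X - A) z" for z
  proof -
    obtain z' where z': "relcycle2 n (subtopology X U) (U - A) z'" "singular_relboundary2 n X
        (topspace X - A) (z + z')"
      using surj[OF A(2,1) z] by blast
    consider "singular_relboundary2 n X (topspace X - A) z'" | "singular_relboundary2 n X (topspace
        X - A) (z' + g)"
      using g(3)[OF z'(1)] incl by blast
    then show ?thesis
    proof cases
      case 1
      then show ?thesis using cancel[OF z'(2)] by blast
    next
      case 2
      have eq: "z + z' + (z' + g) = z + g" by (simp add: ac_simps add_left_self)
      show ?thesis using relboundary2_add[OF z'(2) 2] unfolding eq ..
    qed
  qed
  show ?thesis unfolding local_cell_def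
    using D1 D2 D3 D4 inclc[OF g(1)] by blast
qed

section \<open>Cells of a closed manifold\<close>

text \<open>A ball of the maximum norm: compact as a product of intervals, convex, and of the shape
  that basic neighbourhoods have in the product topology.\<close>

definition eucl_box :: "nat \<Rightarrow> (nat \<Rightarrow> real) \<Rightarrow> real \<Rightarrow> (nat \<Rightarrow> real) set" where
  "eucl_box n y r = {v \<in> topspace (Euclidean_space n). \<forall>i<n. \<bar>v i - y i\<bar> \<le> r}"

lemma compactin_box: "compactin (Euclidean_space n) (eucl_box n y r)"
proof -
  have eq: "eucl_box n y r = (PiE UNIV (\<lambda>i. if i < n then {y i - r..y i + r} else {0}))"
    unfolding eucl_box_def topspace_Euclidean_space
    by (auto simp: PiE_iff abs_le_iff split: if_splits) (smt (verit))+
  have "compactin (powertop_real UNIV) (eucl_box n y r)"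
    unfolding eq by (simp add: compactin_PiE)
  moreover have "eucl_box n y r \<subseteq> {x. \<forall>i\<ge>n. x i = 0}"
    by (auto simp: eucl_box_def topspace_Euclidean_space)
  ultimately show ?thesis unfolding Euclidean_space_def by (simp add: compactin_subtopology)
qed

lemma convex_box:
  assumes "x \<in> eucl_box n c r" "y \<in> eucl_box n c r" "0 \<le> t" "t \<le> 1"
  shows "(\<lambda>i. x i + t * (y i - x i)) \<in> eucl_box n c r"
proof -
  have "\<bar>x i + t * (y i - x i) - c i\<bar> \<le> r" if "i < n" for i
  proof -
    have 1: "\<bar>x i - c i\<bar> \<le> r" "\<bar>y i - c i\<bar> \<le> r" using assms that by (auto simp: eucl_box_def)
    have "x i + t * (y i - x i) - c i = (1 - t) * (x i - c i) + t * (y i - c i)" by (simp add: algebra_simps)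
    also have "\<bar>\<dots>\<bar> \<le> (1 - t) * \<bar>x i - c i\<bar> + t * \<bar>y i - c i\<bar>"
      using assms by (intro order_trans[OF abs_triangle_ineq]) (simp add: abs_mult)
    also have "\<dots> \<le> (1 - t) * r + t * r" using 1 assms by (intro add_mono mult_left_mono) auto
    finally show ?thesis by (simp add: algebra_simps)
  qed
  then show ?thesis using assms by (auto simp: eucl_box_def topspace_Euclidean_space)
qed

lemma box_in_open:
  assumes W: "openin (Euclidean_space n) W" "y \<in> W"
  obtains r V where "r > 0" "eucl_box n y r \<subseteq> W" "y \<in> V" "V \<subseteq> eucl_box n y r" "openin (Euclidean_space n) V"
proof -
  have yT: "y \<in> topspace (Euclidean_space n)" using W openin_subset by blast
  obtain W' where W': "openin (powertop_real UNIV) W'" "W = W' \<inter> {x. \<forall>i\<ge>n. x i = 0}"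
    using W(1) unfolding Euclidean_space_def openin_subtopology by blast
  obtain X where X: "y \<in> PiE UNIV X" "\<And>i. openin euclideanreal (X i)" "PiE UNIV X \<subseteq> W'"
    using W'(1) W(2) W'(2) unfolding openin_product_topology_alt by fastforce
  have "\<exists>e>0. cball (y i) e \<subseteq> X i" for i
    using X(1) X(2)[of i] by (simp add: open_contains_cball PiE_iff)
  then obtain e where e: "\<And>i. e i > 0" "\<And>i. cball (y i) (e i) \<subseteq> X i" by metis
  \<comment> \<open>The extra 1 keeps the minimum defined when n = 0.\<close>
  define r where "r = Min (insert 1 (e ` {..<n}))"
  have r: "r > 0" unfolding r_def using e(1) by (subst Min_gr_iff) auto
  have rle: "r \<le> e i" if "i < n" for i unfolding r_def using that by (intro Min_le) auto
  have sub: "eucl_box n y r \<subseteq> W"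
  proof
    fix v assume v: "v \<in> eucl_box n y r"
    have "v i \<in> X i" for i
    proof (cases "i < n")
      case True
      then have "v i \<in> cball (y i) (e i)"
        using v rle[OF True] by (auto simp: eucl_box_def dist_real_def abs_minus_commute intro: order_trans)
      then show ?thesis using e(2) by blast
    next
      case False
      then have "v i = y i" using v yT by (simp add: eucl_box_def topspace_Euclidean_space)
      then show ?thesis using X(1) by (simp add: PiE_iff)
    qed
    then have "v \<in> W'" using X(3) by (auto simp: PiE_iff)
    then show "v \<in> W" using v W'(2) by (simp add: eucl_box_def topspace_Euclidean_space)
  qed
  define V where "V = {v \<in> topspace (Euclidean_space n). \<forall>i<n. v i - y i \<in> {-r<..<r}}"
  have "V = topspace (Euclidean_space n) \<inter> (\<Inter>i\<in>{..<n}. {v \<in> topspace (Euclidean_space n). v i - y i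
      \<in> {-r<..<r}})"
    by (auto simp: V_def)
  moreover have "openin (Euclidean_space n) {v \<in> topspace (Euclidean_space n). v i - y i \<in> {-r<..<r}}" for i
    by (rule openin_continuous_map_preimage[of _ euclideanreal])
      (auto intro!: continuous_map_diff continuous_map_Euclidean_component)
  ultimately have "openin (Euclidean_space n) V"
    by (cases "n = 0") (auto intro!: openin_Int openin_INT)
  moreover have "V \<subseteq> eucl_box n y r" by (force simp: V_def eucl_box_def)
  moreover have "y \<in> V" using yT r by (simp add: V_def)
  ultimately show thesis using that r sub by blast
qed

text \<open>Vanishing of reduced mod 2 homology; hence in degree 0 only cycles of augmentation 0
  have to bound.\<close>

definition acyclic2 :: "'a topology \<Rightarrow> bool" where
  "acyclic2 X \<longleftrightarrow> (\<forall>p z. singular_cycle2 p X z \<longrightarrow> (p = 0 \<longrightarrow> lin (\<lambda>_. 1 :: bit) z = 0) \<longrightarrow>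
     singular_boundary2 p X z)"

lemma lin_const: "lin (\<lambda>_. v) c = (if lin (\<lambda>_. 1 :: bit) c = 0 then 0 else (v :: 'm::char2))"
proof -
  let ?f = "\<lambda>b::bit. if b = 0 then 0 else v"
  have f_add: "?f (a + b) = ?f a + ?f b" for a b by (cases a; cases b) (simp_all add: add_self)
  have "?f (\<Sum>i\<in>K. 1) = (\<Sum>i\<in>K. ?f 1)" for K :: "'b set"
  proof (induction K rule: infinite_finite_induct)
    case (insert x F)
    have "(\<Sum>i\<in>insert x F. 1 :: bit) = 1 + (\<Sum>i\<in>F. 1)" using insert by simp
    then have "?f (\<Sum>i\<in>insert x F. 1) = ?f 1 + ?f (\<Sum>i\<in>F. 1)" by (simp only: f_add)
    also have "\<dots> = ?f 1 + (\<Sum>i\<in>F. ?f 1)" by (simp only: insert.IH)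
    also have "\<dots> = (\<Sum>i\<in>insert x F. ?f 1)" by (rule sum.insert[OF insert.hyps, symmetric])
    finally show ?case .
  qed simp_all
  from this[of "Poly_Mapping.keys c"] show ?thesis by (simp add: lin_def)
qed

lemma contractible_imp_acyclic2:
  assumes "contractible_space X" "topspace X \<noteq> {}"
  shows "acyclic2 X"
  unfolding acyclic2_def
proof (intro allI impI)
  fix p z assume z: "singular_cycle2 p X z" and z0: "p = 0 \<longrightarrow> lin (\<lambda>_. 1 :: bit) z = 0"
  have pc: "path_connected_space X" by (rule contractible_imp_path_connected_space[OF assms(1)])
  show "singular_boundary2 p X z"
  proof (cases "p = 0")
    case True
    obtain a where a: "a \<in> topspace X" using assms(2) by blast
    define \<sigma>0 where "\<sigma>0 = restrict (\<lambda>_. a) (standard_simplex 0)"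
    have \<sigma>0: "singular_simplex 0 X \<sigma>0" using a by (simp add: singular_simplex_def \<sigma>0_def)
    have sb: "singular_boundary2 0 X (gen2 \<sigma> + gen2 \<sigma>0)" if "singular_simplex 0 X \<sigma>" for \<sigma>
      using relboundary2_red[OF iso_integer_zeroth_homology_group_aux[OF pc that \<sigma>0, unfolded
          homologous_rel_def]]
      by (simp add: red_diff)
    have "singular_boundary2 0 X (lin (\<lambda>\<sigma>. gen2 \<sigma> + gen2 \<sigma>0) z)"
      unfolding lin_def
    proof (rule sum_closed_aux)
      show "singular_boundary2 0 X (gen2 \<sigma> + gen2 \<sigma>0)" if "\<sigma> \<in> Poly_Mapping.keys z" for \<sigma>
        using that z True sb by (auto simp: singular_cycle2_def singular_chain2_def)
    qed (simp_all add: relboundary2_add)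
    moreover have "lin (\<lambda>\<sigma>. gen2 \<sigma> + gen2 \<sigma>0) z = z"
      using z0 True by (simp add: lin_distrib lin_id lin_const[of "gen2 \<sigma>0"])
    ultimately show ?thesis using True by simp
  next
    case False
    have triv: "singular_relboundary q X {} c" if "q > 0" "singular_relcycle q X {} c" for q c
      using trivial_reduced_homology_group_contractible_space[OF assms(1), of "int q"]
        trivial_homology_imp_relboundary[OF _ that(2)] that(1) un_reduced_homology_group[of "int q" X] by simp
    have z': "relcycle2 p X {} z" using z by (simp add: relcycle2_empty)
    show ?thesis
    proof (rule acyclic_transfer[OF triv _ z'])
      show "singular_relboundary (p - 1) X {} e"
        if "singular_relcycle (p - 1) X {} e" "singular_relboundary (p - 1) X {} (e + e)" for e
      \<comment> \<open>The Bockstein of a 1-cycle lies in degree 0, where the homology is the group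
        of integers rather than zero; torsion-freeness is enough.\<close>
      proof (cases "p = 1")
        case True
        then show ?thesis
          using homology_integer_torsion_free[of 0 X "{}" e]
            isomorphic_integer_zeroth_homology_group[OF pc assms(2)] that by simp
      next
        case F: False
        then show ?thesis using triv[of "p - 1"] that False by simp
      qed
    qed (use False in auto)
  qed
qed

lemma contractible_box:
  assumes "r \<ge> 0" "y \<in> topspace (Euclidean_space n)"
  shows "contractible_space (subtopology (Euclidean_space n) (eucl_box n y r))"
proof -
  let ?E = "Euclidean_space n" and ?B = "eucl_box n y r"
  let ?X = "subtopology ?E ?B"
  let ?P = "prod_topology (top_of_set {0..1::real}) ?X"
  have yB: "y \<in> ?B" using assms by (simp add: eucl_box_def)
  have topX: "topspace ?X = ?B" by (auto simp: eucl_box_def)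
  define h where "h = (\<lambda>(t::real, v::nat \<Rightarrow> real). \<lambda>i. v i + t * (y i - v i))"
  have 1: "continuous_map ?P euclideanreal (\<lambda>z. fst z)"
    using continuous_map_fst continuous_map_in_subtopology by blast
  have 2: "continuous_map ?P euclideanreal (\<lambda>z. snd z i)" for i
  proof -
    have "continuous_map ?X euclideanreal (\<lambda>y. y i)"
      by (intro continuous_map_from_subtopology continuous_map_Euclidean_component)
    from continuous_map_compose[OF continuous_map_snd this] show ?thesis by (simp add: o_def)
  qed
  have 3: "continuous_map ?P euclideanreal (\<lambda>z. h z i)" for i
    unfolding h_def case_prod_beta
    by (intro continuous_map_add continuous_map_real_mult continuous_map_diff 1 2
        continuous_map_const[THEN iffD2]) auto
  have 4: "h \<in> topspace ?P \<rightarrow> ?B"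
  proof (rule Pi_I)
    fix z assume zP: "z \<in> topspace ?P"
    obtain t v where z: "z = (t, v)" by (cases z)
    have "0 \<le> t" "t \<le> 1" "v \<in> ?B" using zP topX by (simp_all add: z)
    then show "h z \<in> ?B" using convex_box[OF _ yB] by (simp add: z h_def)
  qed
  have "?B \<subseteq> topspace ?E" by (auto simp: eucl_box_def)
  then have "h \<in> topspace ?P \<rightarrow> topspace ?E" using 4 by blast
  then have "continuous_map ?P ?E h"
    unfolding Euclidean_space_def continuous_map_in_subtopology
    using 3 by (auto simp: continuous_map_componentwise_UNIV Euclidean_space_def)
  then have "continuous_map ?P ?X h" unfolding continuous_map_in_subtopology using 4 by blast
  then have "homotopic_with (\<lambda>_. True) ?X ?X id (\<lambda>_. y)"
    unfolding homotopic_with_def by (intro exI[of _ h]) (auto simp: h_def)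
  then show ?thesis unfolding contractible_space_def by blast
qed

lemma closed_manifold_T1:
  assumes "closed_manifold n M" "x \<in> topspace M"
  shows "closedin M {x}"
  using assms by (simp add: closed_manifold_def closedin_Hausdorff_singleton)

lemma chart_image:
  assumes M: "closed_manifold n M" and U: "openin M U"
    and fg: "homeomorphic_maps (Euclidean_space n) (subtopology M U) f g"
    and A: "compactin (Euclidean_space n) A"
    and conv: "\<And>x y t. \<lbrakk>x \<in> A; y \<in> A; 0 \<le> t; t \<le> 1\<rbrakk> \<Longrightarrow> (\<lambda>i. x i + t * (y i - x i)) \<in> A"
  shows "closedin M (f ` A)" "f ` A \<subseteq> U" "A \<noteq> {} \<Longrightarrow> local_cell n M (f ` A)"
proof -
  have AT: "A \<subseteq> topspace (Euclidean_space n)" using A by (rule compactin_subset_topspace)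
  have f: "continuous_map (Euclidean_space n) (subtopology M U) f"
    using fg by (simp add: homeomorphic_maps_def)
  show sub: "f ` A \<subseteq> U" using f AT by (auto simp: continuous_map_in_subtopology)
  have "compactin M (f ` A)"
    using image_compactin[OF A f] by (simp add: compactin_subtopology)
  then show cl: "closedin M (f ` A)"
    using M by (simp add: closed_manifold_def compactin_imp_closedin)
  show "local_cell n M (f ` A)" if "A \<noteq> {}"
    by (rule local_cell_excision[OF U sub cl
          local_cell_transport[OF fg AT local_cell_Euclidean[OF A that conv]] closed_manifold_T1[OF M]])
qed

lemma manifold_chart:
  assumes "closed_manifold n M" "x \<in> topspace M"
  obtains U f g where "openin M U" "x \<in> U"
    "homeomorphic_maps (Euclidean_space n) (subtopology M U) f g"
proof -
  obtain U where U: "openin M U" "x \<in> U" "subtopology M U homeomorphic_space Euclidean_space n"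
    using assms by (auto simp: closed_manifold_def)
  then obtain f g where "homeomorphic_maps (Euclidean_space n) (subtopology M U) f g"
    using homeomorphic_space_sym unfolding homeomorphic_space_def by blast
  with U that show thesis by blast
qed

text \<open>The image of a small box in a chart serves in both roles: as a local cell it carries
  dual cochains, as an acyclic space it carries homotopies.\<close>

lemma cell_basis:
  assumes M: "closed_manifold n M" and W: "openin M W" "x \<in> W"
  obtains C V where "openin M V" "x \<in> V" "V \<subseteq> C" "C \<subseteq> W" "closedin M C" "local_cell n M C"
    "acyclic2 (subtopology M C)"
proof -
  have xM: "x \<in> topspace M" using W openin_subset by blast
  obtain U f g where U: "openin M U" "x \<in> U"
    and fg: "homeomorphic_maps (Euclidean_space n) (subtopology M U) f g"
    by (rule manifold_chart[OF M xM])
  have f: "continuous_map (Euclidean_space n) (subtopology M U) f"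
    and fM: "continuous_map (Euclidean_space n) M f"
    using fg by (auto simp: homeomorphic_maps_def continuous_map_in_subtopology)
  have UT: "topspace (subtopology M U) = U" using U(1) openin_subset by auto
  have g: "g x \<in> topspace (Euclidean_space n)" "f (g x) = x"
    using fg U(2) UT by (auto simp: homeomorphic_maps_def continuous_map_def)
  let ?W = "{v \<in> topspace (Euclidean_space n). f v \<in> W}"
  have "openin (Euclidean_space n) ?W" by (rule openin_continuous_map_preimage[OF fM W(1)])
  moreover have "g x \<in> ?W" using g W(2) by simp
  ultimately obtain r V where r: "r > 0" "eucl_box n (g x) r \<subseteq> ?W" "g x \<in> V" "V \<subseteq> eucl_box n (g x) r"
    "openin (Euclidean_space n) V" by (rule box_in_open)
  let ?B = "eucl_box n (g x) r"
  have BT: "?B \<subseteq> topspace (Euclidean_space n)" by (auto simp: eucl_box_def)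
  have "openin (subtopology M U) (f ` V)"
    using fg r(5) by (metis homeomorphic_imp_open_map homeomorphic_maps_map open_map_def)
  then have V: "openin M (f ` V)" using U(1) by (simp add: openin_open_subtopology)
  have xV: "x \<in> f ` V" using r(3) g(2) by (metis imageI)
  have VB: "f ` V \<subseteq> f ` ?B" using r(4) by blast
  have BW: "f ` ?B \<subseteq> W" using r(2) by blast
  have Bne: "?B \<noteq> {}" using r(3,4) by blast
  have cl: "closedin M (f ` ?B)"
    by (rule chart_image(1)[OF M U(1) fg compactin_box]) (rule convex_box; assumption)
  have cell: "local_cell n M (f ` ?B)"
    by (rule chart_image(3)[OF M U(1) fg compactin_box _ Bne]) (rule convex_box; assumption)
  have acyc: "acyclic2 (subtopology M (f ` ?B))"
  proof (rule contractible_imp_acyclic2)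
    have sub: "f ` ?B \<subseteq> U" using f BT by (auto simp: continuous_map_in_subtopology)
    have "homeomorphic_maps (subtopology (Euclidean_space n) ?B) (subtopology (subtopology M U) (f ` ?B)) f g"
      by (rule homeomorphic_maps_subtopologies_alt[OF fg]) (use fg BT in \<open>auto simp: homeomorphic_maps_def\<close>)
    moreover have "subtopology (subtopology M U) (f ` ?B) = subtopology M (f ` ?B)"
      using sub by (simp add: subtopology_subtopology Int_absorb1)
    ultimately have "subtopology (Euclidean_space n) ?B homeomorphic_space subtopology M (f ` ?B)"
      unfolding homeomorphic_space_def by metis
    then show "contractible_space (subtopology M (f ` ?B))"
      using homeomorphic_space_contractibility contractible_box[OF less_imp_le[OF r(1)] g(1)] by blast
    show "topspace (subtopology M (f ` ?B)) \<noteq> {}"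
      using xV VB xM by auto
  qed
  show thesis by (rule that[OF V xV VB BW cl cell acyc])
qed

section \<open>The mod 2 fundamental cycle\<close>

text \<open>The induction hypothesis of the Mayer--Vietoris argument that glues cells.\<close>

definition detected :: "nat \<Rightarrow> 'a topology \<Rightarrow> 'a set \<Rightarrow> bool" where
  "detected n X A \<longleftrightarrow>
     (\<forall>p z. p > n \<longrightarrow> relcycle2 p X (topspace X - A) z \<longrightarrow> singular_relboundary2 p X (topspace X - A) z) \<and>
     (\<forall>z. relcycle2 n X (topspace X - A) z \<longrightarrow>
        (\<forall>x\<in>A. singular_relboundary2 n X (topspace X - {x}) z) \<longrightarrow> singular_relboundary2 n X (topspace X - A) z)"

lemma detected_empty: "detected n X {}"
  unfolding detected_def by (auto intro!: relboundary2_chain simp: relcycle2_def)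

lemma local_cell_detected: "local_cell n X A \<Longrightarrow> A \<noteq> {} \<Longrightarrow> detected n X A"
  unfolding local_cell_def detected_def by (metis ex_in_conv less_irrefl)

text \<open>The Mayer--Vietoris hypothesis concerns degree p + 1 > n, where detection for the
  intersection says that all relative cycles bound.\<close>

lemma detected_Un:
  assumes A: "closedin X A" "detected n X A" and B: "closedin X B" "detected n X B"
    and AB: "detected n X (A \<inter> B)"
  shows "detected n X (A \<union> B)"
proof -
  let ?T = "topspace X"
  have op: "openin X (?T - A)" "openin X (?T - B)" using A B by auto
  have eq: "(?T - A) \<inter> (?T - B) = ?T - (A \<union> B)" "(?T - A) \<union> (?T - B) = ?T - (A \<inter> B)" by auto
  have null: "singular_relboundary2 p X (?T - (A \<union> B)) z"
    if "p \<ge> n" "relcycle2 p X (?T - (A \<union> B)) z" "singular_relboundary2 p X (?T - A) z"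
      "singular_relboundary2 p X (?T - B) z" for p z
    using mayer_vietoris_inj[OF op, of p z] that AB unfolding eq detected_def by simp
  have up: "relcycle2 p X (?T - A) z" "relcycle2 p X (?T - B) z" if "relcycle2 p X (?T - (A \<union> B)) z" for p z
    using that by (auto elim!: relcycle2_mono)
  show ?thesis
    unfolding detected_def
  proof (intro conjI allI impI)
    fix p z assume "p > n" "relcycle2 p X (?T - (A \<union> B)) z"
    then show "singular_relboundary2 p X (?T - (A \<union> B)) z"
      using null up A(2) B(2) unfolding detected_def by simp
  next
    fix z assume z: "relcycle2 n X (?T - (A \<union> B)) z" "\<forall>x\<in>A \<union> B. singular_relboundary2 n X (?T - {x}) z"
    then have "singular_relboundary2 n X (?T - A) z" "singular_relboundary2 n X (?T - B) z"
      using up[OF z(1)] A(2) B(2) unfolding detected_def by blast+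
    then show "singular_relboundary2 n X (?T - (A \<union> B)) z" using null z(1) by blast
  qed
qed

text \<open>The induction is on the length of the list: the intersection of the head with the union
  of the tail is a union of as many sets as the tail has, again taken from the family because it is
  closed under intersection.\<close>

lemma detected_Union:
  assumes cl: "\<And>A. A \<in> \<C> \<Longrightarrow> closedin X A" and det: "\<And>A. A \<in> \<C> \<Longrightarrow> detected n X A"
    and Int: "\<And>A B. A \<in> \<C> \<Longrightarrow> B \<in> \<C> \<Longrightarrow> A \<inter> B \<in> \<C>"
  shows "set As \<subseteq> \<C> \<Longrightarrow> detected n X (\<Union>(set As))"
proof (induction As rule: length_induct)
  case (1 As)
  show ?case
  proof (cases As)
    case Nil
    then show ?thesis by (simp add: detected_empty)
  next
    case (Cons B Bs)
    have "set (map (\<lambda>A. A \<inter> B) Bs) \<subseteq> \<C>" using 1(2) Int by (auto simp: Cons)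
    moreover have "length (map (\<lambda>A. A \<inter> B) Bs) < length As" by (simp add: Cons)
    ultimately have "detected n X (\<Union>(set (map (\<lambda>A. A \<inter> B) Bs)))" using 1(1) by blast
    moreover have "\<Union>(set (map (\<lambda>A. A \<inter> B) Bs)) = B \<inter> \<Union>(set Bs)" by auto
    moreover have "detected n X (\<Union>(set Bs))" using 1 by (simp add: Cons)
    moreover have "closedin X (\<Union>(set Bs))" using 1(2) cl by (intro closedin_Union) (auto simp: Cons)
    moreover have "closedin X B" "detected n X B" using 1(2) cl det by (auto simp: Cons)
    ultimately have "detected n X (B \<union> \<Union>(set Bs))" using detected_Un[of X B n "\<Union>(set Bs)"] by simp
    then show ?thesis by (simp add: Cons)
  qed
qed

text \<open>A compact set need not be a finite union of convex sets. But the boundary of a given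
  relative cycle is carried by a compact set off \<open>K\<close>, so the cycle remains one for a
  finite union of boxes containing \<open>K\<close>, and there detection is known.\<close>

lemma detected_compact_in_chart:
  assumes M: "closed_manifold n M" and U: "openin M U"
    and fg: "homeomorphic_maps (Euclidean_space n) (subtopology M U) f g"
    and K: "compactin M K" "K \<subseteq> U"
  shows "detected n M K"
proof -
  let ?E = "Euclidean_space n" and ?T = "topspace M"
  define conv where "conv = (\<lambda>A. \<forall>x\<in>A. \<forall>y\<in>A. \<forall>t. 0 \<le> t \<and> t \<le> 1 \<longrightarrow> (\<lambda>i. x i
      + t * (y i - x i)) \<in> (A :: (nat \<Rightarrow> real) set))"
  define \<C> where "\<C> = {f ` A | A. compactin ?E A \<and> conv A}"
  have f: "continuous_map ?E (subtopology M U) f" and fM: "continuous_map ?E M f"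
    using fg by (auto simp: homeomorphic_maps_def continuous_map_in_subtopology)
  have gf: "g (f v) = v" if "v \<in> topspace ?E" for v using fg that by (auto simp: homeomorphic_maps_def)
  have UT: "topspace (subtopology M U) = U" using U(1) openin_subset by auto
  have g: "g x \<in> topspace ?E" "f (g x) = x" if "x \<in> U" for x
    using fg that UT by (auto simp: homeomorphic_maps_def continuous_map_def)
  have HausE: "Hausdorff_space ?E"
    unfolding Euclidean_space_def euclidean_product_topology by (intro Hausdorff_space_subtopology) simp
  have C: "closedin M A" "detected n M A" if A: "A \<in> \<C>" for A
  proof -
    obtain B where B: "A = f ` B" "compactin ?E B" "conv B" using A by (auto simp: \<C>_def)
    note ci = chart_image[OF M U fg B(2)]
    show "closedin M A" using ci(1) B unfolding conv_def by blast
    show "detected n M A"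
    proof (cases "B = {}")
      case True
      then show ?thesis by (simp add: B detected_empty)
    next
      case False
      have "local_cell n M A" using ci(3) B False unfolding conv_def by blast
      then show ?thesis using local_cell_detected B False by blast
    qed
  qed
  have Int: "A \<inter> B \<in> \<C>" if AB: "A \<in> \<C>" "B \<in> \<C>" for A B
  proof -
    obtain A0 B0 where 0: "A = f ` A0" "compactin ?E A0" "conv A0" "B = f ` B0" "compactin ?E B0" "conv B0"
      using AB by (auto simp: \<C>_def)
    have s: "A0 \<subseteq> topspace ?E" "B0 \<subseteq> topspace ?E" using 0 by (auto dest: compactin_subset_topspace)
    have "inj_on f (topspace ?E)" using gf by (rule inj_on_inverseI)
    then have "A \<inter> B = f ` (A0 \<inter> B0)" using 0 s by (simp add: inj_on_image_Int)
    moreover have "compactin ?E (A0 \<inter> B0)"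
      by (rule closed_Int_compactin[OF compactin_imp_closedin[OF HausE 0(2)] 0(5)])
    moreover have "conv (A0 \<inter> B0)" using 0 by (auto simp: conv_def)
    ultimately show ?thesis by (auto simp: \<C>_def)
  qed
  have main: "singular_relboundary2 p M (?T - K) z"
    if p: "p \<ge> n" and z: "relcycle2 p M (?T - K) z"
      and pt: "p = n \<Longrightarrow> \<forall>x\<in>K. singular_relboundary2 n M (?T - {x}) z" for p z
  proof -
    \<comment> \<open>The carrier of the boundary of \<open>z\<close>: for every set disjoint from
      it, \<open>z\<close> is a cycle relative to the complement of that set.\<close>
    define L where "L = (\<Union>\<sigma>\<in>Poly_Mapping.keys (chain_boundary2 p z). \<sigma> ` standard_simplex (p - 1))"
    have bz: "singular_chain2 (p - 1) (subtopology M (?T - K)) (chain_boundary2 p z)"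
      using z by (simp add: relcycle2_def)
    have "compactin (subtopology M (?T - K)) L" unfolding L_def
      by (rule compactin_Union) (use bz in \<open>auto simp: singular_chain2_def intro: compactin_singular_simplex\<close>)
    then have L: "compactin M L" "L \<inter> K = {}" by (auto simp: compactin_subtopology)
    have Lcl: "closedin M L" using L(1) M by (simp add: closed_manifold_def compactin_imp_closedin)
    have zL: "relcycle2 p M (?T - A) z" if "A \<inter> L = {}" for A
      using z that compactin_subset_topspace[OF L(1)]
      unfolding relcycle2_def singular_chain2_subtopology L_def by fastforce
    have "\<exists>C V. openin M V \<and> x \<in> V \<and> V \<subseteq> C \<and> C \<inter> L = {} \<and> C \<in> \<C> \<and> x \<in> C" if x: "x \<in> K" for x
    proof -
      have xU: "x \<in> U" using x K by blast
      let ?W = "{v \<in> topspace ?E. f v \<in> ?T - L}"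
      have "openin ?E ?W" by (rule openin_continuous_map_preimage[OF fM]) (use Lcl in auto)
      moreover have "g x \<in> ?W" using g[OF xU] x L(2) K(1) compactin_subset_topspace by fastforce
      ultimately obtain r V where r: "r > 0" "eucl_box n (g x) r \<subseteq> ?W" "g x \<in> V" "V \<subseteq> eucl_box n (g x) r"
        "openin ?E V" by (rule box_in_open)
      have "openin (subtopology M U) (f ` V)"
        using fg r(5) by (metis homeomorphic_imp_open_map homeomorphic_maps_map open_map_def)
      then have 1: "openin M (f ` V)" using U(1) by (simp add: openin_open_subtopology)
      have 2: "x \<in> f ` V" using r(3) g(2)[OF xU] by (metis imageI)
      have 3: "f ` eucl_box n (g x) r \<in> \<C>"
        unfolding \<C>_def conv_def
        by (intro CollectI exI[of _ "eucl_box n (g x) r"] conjI refl compactin_box) (use convex_box in blast)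
      have 4: "f ` V \<subseteq> f ` eucl_box n (g x) r" "f ` eucl_box n (g x) r \<inter> L = {}" using r(2,4) by auto
      have 5: "x \<in> f ` eucl_box n (g x) r" using 2 4(1) by blast
      show ?thesis
        by (rule exI[of _ "f ` eucl_box n (g x) r"], rule exI[of _ "f ` V"]) (intro conjI 1 2 3 4 5)
    qed
    then have ex: "\<forall>x\<in>K. \<exists>C V. openin M V \<and> x \<in> V \<and> V \<subseteq> C \<and> C \<inter> L = {} \<and> C \<in> \<C> \<and> x \<in> C" by blast
    obtain C where exC: "\<forall>x\<in>K. \<exists>V. openin M V \<and> x \<in> V \<and> V \<subseteq> C x \<and> C x \<inter> L = {} \<and> C x \<in> \<C> \<and> x \<in> C x"
      using bchoice[OF ex] by blast
    obtain V where CV: "\<And>x. x \<in> K \<Longrightarrow> openin M (V x)" "\<And>x. x \<in> K \<Longrightarrow> x \<in> V x"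
      "\<And>x. x \<in> K \<Longrightarrow> V x \<subseteq> C x" "\<And>x. x \<in> K \<Longrightarrow> C x \<inter> L = {}" "\<And>x. x \<in> K \<Longrightarrow> C x \<in> \<C>" "\<And>x. x \<in> K \<Longrightarrow> x \<in> C x"
      using bchoice[OF exC] by blast
    have "\<exists>F. finite F \<and> F \<subseteq> V ` K \<and> K \<subseteq> \<Union>F"
      using K(1) CV(1,2) unfolding compactin_def by (smt (verit) UN_iff image_iff subsetI)
    then obtain F where F: "finite F" "F \<subseteq> V ` K" "K \<subseteq> \<Union>F" by blast
    obtain S where S: "finite S" "S \<subseteq> K" "F = V ` S" using finite_subset_image[OF F(1,2)] by blast
    obtain xs where xs: "set xs = S" using finite_list[OF S(1)] by blast
    let ?A = "\<Union>(set (map C xs))"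
    have "set (map C xs) \<subseteq> \<C>" using CV(5) S xs by auto
    from this C Int have "detected n M ?A" by (intro detected_Union[where \<C> = \<C>])
    moreover have KA: "K \<subseteq> ?A"
    proof
      fix x assume "x \<in> K"
      then obtain y where "y \<in> S" "x \<in> V y" using F(3) S(3) by blast
      then show "x \<in> ?A" using CV(3)[of y] S(2) xs by auto
    qed
    moreover have AL: "?A \<inter> L = {}" using CV(4) S(2) xs by auto
    \<comment> \<open>Vanishing is given at points of \<open>K\<close> only. Each box contains such
      a point \<open>x\<close>, and in a local cell vanishing at \<open>x\<close> spreads to the
      whole box.\<close>
    moreover have "\<forall>y\<in>?A. singular_relboundary2 n M (?T - {y}) z" if pn: "p = n"
    proof
      fix y assume "y \<in> ?A"
      then obtain x where x: "x \<in> S" "y \<in> C x" using xs by auto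
      then have xK: "x \<in> K" using S(2) by blast
      obtain B where B: "C x = f ` B" "compactin ?E B" "conv B" using CV(5)[OF xK] by (auto simp: \<C>_def)
      have "B \<noteq> {}" using B(1) x by auto
      have "local_cell n M (C x)"
        unfolding B(1) by (rule chart_image(3)[OF M U fg B(2)]) (use \<open>B \<noteq> {}\<close> B(3) in \<open>auto simp: conv_def\<close>)
      moreover have "relcycle2 n M (?T - C x) z" using zL[OF CV(4)[OF xK]] pn by simp
      moreover have "singular_relboundary2 n M (?T - {x}) z" using pt[OF pn] xK by blast
      ultimately have "singular_relboundary2 n M (?T - C x) z"
        using CV(6)[OF xK] unfolding local_cell_def by blast
      then show "singular_relboundary2 n M (?T - {y}) z"
        by (rule relboundary2_mono) (use x in auto)
    qed
    ultimately have "singular_relboundary2 p M (?T - ?A) z"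
      using p zL[OF AL] unfolding detected_def by (metis le_neq_implies_less)
    then show ?thesis by (rule relboundary2_mono) (use KA in auto)
  qed
  then show ?thesis unfolding detected_def by auto
qed

lemma local_cell_singleton:
  assumes M: "closed_manifold n M" and x: "x \<in> topspace M"
  shows "local_cell n M {x}"
proof -
  obtain U f g where U: "openin M U" "x \<in> U"
    and fg: "homeomorphic_maps (Euclidean_space n) (subtopology M U) f g"
    by (rule manifold_chart[OF M x])
  have UT: "topspace (subtopology M U) = U" using U(1) openin_subset by auto
  have g: "g x \<in> topspace (Euclidean_space n)" "f (g x) = x"
    using fg U(2) UT by (auto simp: homeomorphic_maps_def continuous_map_def)
  have "local_cell n M (f ` {g x})"
    by (rule chart_image(3)[OF M U(1) fg]) (use g in \<open>auto simp: compactin_sing\<close>)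
  then show ?thesis by (simp add: g)
qed

text \<open>The local group has a single nonzero class, so two nonzero classes cancel. With other
  coefficients this is the place where an orientation would enter.\<close>

lemma local_homology_sum:
  assumes M: "closed_manifold n M" and x: "x \<in> topspace M"
    and z: "relcycle2 n M (topspace M - {x}) z" "\<not> singular_relboundary2 n M (topspace M - {x}) z"
    and w: "relcycle2 n M (topspace M - {x}) w" "\<not> singular_relboundary2 n M (topspace M - {x}) w"
  shows "singular_relboundary2 n M (topspace M - {x}) (z + w)"
proof -
  obtain g where g: "\<And>z. relcycle2 n M (topspace M - {x}) z \<Longrightarrow>
      singular_relboundary2 n M (topspace M - {x}) z \<or> singular_relboundary2 n M (topspace M - {x}) (z + g)"
    using local_cell_singleton[OF M x] unfolding local_cell_def by blast
  have "singular_relboundary2 n M (topspace M - {x}) (z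
      + g)" "singular_relboundary2 n M (topspace M - {x}) (w + g)"
    using g z w by blast+
  from relboundary2_add[OF this] show ?thesis by (simp add: ac_simps add_left_self)
qed

text \<open>Local generators are unique mod 2, so the cycle on the union so far and the generator on
  the next cell agree at each point of the overlap. The overlap is a compact subset of a chart,
  where pointwise agreement is agreement, and the two can be glued.\<close>

lemma fundamental_cycle_on_cells:
  assumes M: "closed_manifold n M"
  shows "(\<And>C. C \<in> set Cs \<Longrightarrow> closedin M C \<and> local_cell n M C \<and>
      (\<exists>U f g. openin M U \<and> homeomorphic_maps (Euclidean_space n) (subtopology M U) f g \<and> C \<subseteq> U)) \<Longrightarrow>
    \<exists>z. relcycle2 n M (topspace M - \<Union>(set Cs)) z \<and>
      (\<forall>x\<in>\<Union>(set Cs). \<not> singular_relboundary2 n M (topspace M - {x}) z)"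
proof (induction Cs)
  case Nil
  show ?case by (rule exI[of _ 0]) (simp add: relcycle2_def)
next
  case (Cons B Bs)
  let ?T = "topspace M" and ?A = "\<Union>(set Bs)"
  obtain zA where zA: "relcycle2 n M (?T - ?A) zA" "\<And>x. x \<in> ?A \<Longrightarrow> \<not> singular_relboundary2 n M (?T - {x}) zA"
  proof -
    have "\<exists>z. relcycle2 n M (?T - ?A) z \<and> (\<forall>x\<in>?A. \<not> singular_relboundary2 n M (?T - {x}) z)"
      by (rule Cons.IH) (use Cons.prems in simp)
    then show thesis using that by blast
  qed
  have B: "closedin M B" "local_cell n M B" using Cons.prems by auto
  obtain U f g where U: "openin M U" "homeomorphic_maps (Euclidean_space n) (subtopology M U) f g" "B \<subseteq> U"
    using Cons.prems[of B] by auto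
  have Acl: "closedin M ?A" using Cons.prems by (intro closedin_Union) auto
  obtain zB where zB: "relcycle2 n M (?T - B) zB" "\<And>x. x \<in> B \<Longrightarrow> \<not> singular_relboundary2 n M (?T - {x}) zB"
    using B(2) unfolding local_cell_def by blast
  have AB: "closedin M (?A \<inter> B)" using Acl B(1) by blast
  have "compactin M (?A \<inter> B)"
    using M AB by (simp add: closed_manifold_def closedin_compact_space)
  then have det: "detected n M (?A \<inter> B)"
    by (rule detected_compact_in_chart[OF M U(1,2)]) (use U(3) in blast)
  have op: "openin M (?T - ?A)" "openin M (?T - B)" using Acl B(1) by auto
  have eq: "(?T - ?A) \<union> (?T - B) = ?T - (?A \<inter> B)" "(?T - ?A) \<inter> (?T - B) = ?T - (?A \<union> B)" by auto
  have "relcycle2 n M (?T - (?A \<inter> B)) (zA + zB)"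
    by (intro relcycle2_add relcycle2_mono[OF zA(1)] relcycle2_mono[OF zB(1)]) auto
  moreover have "singular_relboundary2 n M (?T - {x}) (zA + zB)" if x: "x \<in> ?A \<inter> B" for x
  proof (rule local_homology_sum[OF M])
    show "x \<in> ?T" using x B(1) closedin_subset by blast
    show "relcycle2 n M (?T - {x}) zA" by (rule relcycle2_mono[OF zA(1)]) (use x in auto)
    show "relcycle2 n M (?T - {x}) zB" by (rule relcycle2_mono[OF zB(1)]) (use x in auto)
  qed (use x zA zB in auto)
  ultimately have "singular_relboundary2 n M ((?T - ?A) \<union> (?T - B)) (zA + zB)"
    using det unfolding eq detected_def by blast
  from mayer_vietoris_glue[OF op zA(1) zB(1) this]
  obtain z where z: "relcycle2 n M ((?T - ?A) \<inter> (?T - B)) z" "singular_relboundary2 n M (?T - ?A) (z + zA)"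
    "singular_relboundary2 n M (?T - B) (z + zB)" by blast
  have "\<not> singular_relboundary2 n M (?T - {x}) z" if x: "x \<in> ?A \<union> B" for x
  proof
    assume zx: "singular_relboundary2 n M (?T - {x}) z"
    show False
    proof (cases "x \<in> ?A")
      case True
      have "singular_relboundary2 n M (?T - {x}) (z + zA)"
        by (rule relboundary2_mono[OF z(2)]) (use True in auto)
      then show False using zA(2)[OF True] relboundary2_add_cancel[OF zx] by blast
    next
      case False
      then have xB: "x \<in> B" using x by blast
      have "singular_relboundary2 n M (?T - {x}) (z + zB)" by (rule relboundary2_mono[OF z(3)]) (use xB in auto)
      then show False using zB(2)[OF xB] relboundary2_add_cancel[OF zx] by blast
    qed
  qed
  moreover have "\<Union>(set (B # Bs)) = ?A \<union> B" by auto
  ultimately show ?case using z(1) unfolding eq by metis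
qed

lemma compact_space_finite_subcover:
  assumes "compact_space X" "\<And>x. x \<in> topspace X \<Longrightarrow> openin X (V x) \<and> x \<in> V x"
  obtains S where "finite S" "S \<subseteq> topspace X" "topspace X \<subseteq> \<Union>(V ` S)"
proof -
  have "compactin X (topspace X)" using assms(1) by (simp add: compact_space_def)
  then have "(\<forall>U\<in>V ` topspace X. openin X U) \<and> topspace X \<subseteq> \<Union>(V ` topspace X) \<Longrightarrow>
     \<exists>\<F>. finite \<F> \<and> \<F> \<subseteq> V ` topspace X \<and> topspace X \<subseteq> \<Union>\<F>"
    unfolding compactin_def by blast
  then obtain \<F> where F: "finite \<F>" "\<F> \<subseteq> V ` topspace X" "topspace X \<subseteq> \<Union>\<F>"
    using assms(2) by blast
  obtain S where "S \<subseteq> topspace X" "finite S" "\<F> = V ` S" using finite_subset_image[OF F(1,2)] by blast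
  then show thesis using that F(3) by blast
qed

lemma fundamental_cycle_exists:
  assumes M: "closed_manifold n M"
  obtains \<mu> where "fundamental_cycle2 n M \<mu>"
proof -
  have "\<forall>x\<in>topspace M. \<exists>C V. openin M V \<and> x \<in> V \<and> V \<subseteq> C \<and> closedin M C \<and> local_cell n M C \<and>
      (\<exists>U f g. openin M U \<and> homeomorphic_maps (Euclidean_space n) (subtopology M U) f g \<and> C \<subseteq> U)"
  proof
    fix x assume x: "x \<in> topspace M"
    obtain U f g where U: "openin M U" "x \<in> U"
      and fg: "homeomorphic_maps (Euclidean_space n) (subtopology M U) f g"
      by (rule manifold_chart[OF M x])
    obtain C V where CV: "openin M V" "x \<in> V" "V \<subseteq> C" "C \<subseteq> U" "closedin M C" "local_cell n M C"
      "acyclic2 (subtopology M C)" by (rule cell_basis[OF M U])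
    then show "\<exists>C V. openin M V \<and> x \<in> V \<and> V \<subseteq> C \<and> closedin M C \<and> local_cell n M C \<and>
      (\<exists>U f g. openin M U \<and> homeomorphic_maps (Euclidean_space n) (subtopology M U) f g \<and> C \<subseteq> U)"
      using U(1) fg by blast
  qed
  from bchoice[OF this] obtain C
    where "\<forall>x\<in>topspace M. \<exists>V. openin M V \<and> x \<in> V \<and> V \<subseteq> C x \<and> closedin M (C x) \<and> local_cell n M (C x) \<and>
      (\<exists>U f g. openin M U \<and> homeomorphic_maps (Euclidean_space n) (subtopology M U) f g \<and> C x \<subseteq> U)" by blast
  from bchoice[OF this] obtain V
    where V: "\<forall>x\<in>topspace M. openin M (V x) \<and> x \<in> V x \<and> V x \<subseteq> C x \<and> closedin M (C x) \<and> local_cell n M (C x) \<and>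
      (\<exists>U f g. openin M U \<and> homeomorphic_maps (Euclidean_space n) (subtopology M U) f g \<and> C x \<subseteq> U)" by blast
  have cM: "compact_space M" using M by (simp add: closed_manifold_def)
  obtain S where S: "finite S" "S \<subseteq> topspace M" "topspace M \<subseteq> \<Union>(V ` S)"
    using compact_space_finite_subcover[OF cM, of V] V by blast
  obtain xs where xs: "set xs = S" using finite_list[OF S(1)] by blast
  have prem: "closedin M D \<and> local_cell n M D \<and>
      (\<exists>U f g. openin M U \<and> homeomorphic_maps (Euclidean_space n) (subtopology M U) f g \<and> D \<subseteq> U)"
    if D: "D \<in> set (map C xs)" for D
  proof -
    obtain x where "x \<in> S" "D = C x" using D xs by auto
    then show ?thesis using V S(2) by blast
  qed
  from fundamental_cycle_on_cells[OF M, of "map C xs", OF prem]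
  obtain z where z: "relcycle2 n M (topspace M - \<Union>(set (map C xs))) z"
      "\<forall>x\<in>\<Union>(set (map C xs)). \<not> singular_relboundary2 n M (topspace M - {x}) z" by blast
  have cov: "topspace M \<subseteq> \<Union>(set (map C xs))"
  proof
    fix y assume "y \<in> topspace M"
    then obtain x where x: "x \<in> S" "y \<in> V x" using S(3) by blast
    then have "y \<in> C x" using V S(2) by blast
    then show "y \<in> \<Union>(set (map C xs))" using x(1) xs by auto
  qed
  then have "topspace M - \<Union>(set (map C xs)) = {}" by blast
  then have "singular_cycle2 n M z" using z(1) by (metis relcycle2_empty)
  then have "fundamental_cycle2 n M z" unfolding fundamental_cycle2_def using z(2) cov by blast
  then show thesis by (rule that)
qed

text \<open>The class of \<mu> over \<open>C\<close> is nonzero because it is so at a point of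
  \<open>C\<close>, and there is only one nonzero class.\<close>

lemma fundamental_cycle_generates:
  assumes \<mu>: "fundamental_cycle2 n M \<mu>" and C: "local_cell n M C" "C \<noteq> {}" "C \<subseteq> topspace M"
    and z: "relcycle2 n M (topspace M - C) z"
  shows "singular_relboundary2 n M (topspace M - C) z \<or> singular_relboundary2 n M (topspace M - C) (z + \<mu>)"
proof -
  let ?T = "topspace M"
  obtain g where g: "\<And>z. relcycle2 n M (?T - C) z \<Longrightarrow>
      singular_relboundary2 n M (?T - C) z \<or> singular_relboundary2 n M (?T - C) (z + g)"
    using C(1) unfolding local_cell_def by blast
  obtain x where x: "x \<in> C" using C(2) by blast
  have "relcycle2 n M (?T - C) \<mu>"
    using \<mu> by (simp add: fundamental_cycle2_def singular_cycle2_def relcycle2_def)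
  moreover have "\<not> singular_relboundary2 n M (?T - C) \<mu>"
    using \<mu> x C(3) relboundary2_mono[of n M "?T - C" \<mu> "?T - {x}"] unfolding fundamental_cycle2_def by blast
  ultimately have \<mu>g: "singular_relboundary2 n M (?T - C) (\<mu> + g)" using g by blast
  have "z + g + (\<mu> + g) = z + \<mu>" by (simp add: ac_simps add_left_self)
  then show ?thesis using g[OF z] relboundary2_add[OF _ \<mu>g] by metis
qed

section \<open>A metric on a closed manifold\<close>

text \<open>Supports of cochains and homotopies are controlled by distances rather than by covers,
  so that errors can be added by the triangle inequality; this is what the metric is for.\<close>

definition compatible_metric :: "'a topology \<Rightarrow> ('a \<Rightarrow> 'a \<Rightarrow> real) \<Rightarrow> bool" where
  "compatible_metric X d \<longleftrightarrow>
     (\<forall>x. d x x = 0) \<and> (\<forall>x y. d x y = d y x) \<and> (\<forall>x y z. d x z \<le> d x y + d y z) \<and>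
     (\<forall>x e. openin X {y \<in> topspace X. d x y < e}) \<and>
     (\<forall>W x. openin X W \<longrightarrow> x \<in> W \<longrightarrow> (\<exists>e>0. \<forall>y\<in>topspace X. d x y < e \<longrightarrow> y \<in> W))"

lemma continuous_map_extend_by_zero:
  assumes M: "closed_manifold n M" and U: "openin M U"
    and fg: "homeomorphic_maps (Euclidean_space n) (subtopology M U) f g"
    and \<phi>: "continuous_map (Euclidean_space n) euclideanreal \<phi>"
    and K: "compactin (Euclidean_space n) K" "\<And>v. v \<in> topspace (Euclidean_space n) \<Longrightarrow> v \<notin> K \<Longrightarrow> \<phi> v = 0"
  shows "continuous_map M euclideanreal (\<lambda>y. if y \<in> U then \<phi> (g y) else 0)" (is "continuous_map M _ ?F")
proof -
  have f: "continuous_map (Euclidean_space n) (subtopology M U) f"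
    and g: "continuous_map (subtopology M U) (Euclidean_space n) g"
    and fg': "\<And>y. y \<in> topspace (subtopology M U) \<Longrightarrow> f (g y) = y"
    using fg by (auto simp: homeomorphic_maps_def)
  have UT: "topspace (subtopology M U) = U" using U(1) openin_subset by auto
  have "compactin M (f ` K)" using image_compactin[OF K(1) f] by (simp add: compactin_subtopology)
  then have fK: "closedin M (f ` K)" using M by (simp add: closed_manifold_def compactin_imp_closedin)
  have "openin M {y \<in> topspace M. ?F y \<in> T}" if T: "open T" for T
  proof -
    have "continuous_map (subtopology M U) euclideanreal (\<phi> \<circ> g)"
      by (rule continuous_map_compose[OF g \<phi>])
    from openin_continuous_map_preimage[OF this, of T]
    have "openin (subtopology M U) {y \<in> U. \<phi> (g y) \<in> T}" using T by (simp add: UT[simplified])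
    then have 1: "openin M {y \<in> U. \<phi> (g y) \<in> T}" using U by (simp add: openin_open_subtopology)
    show ?thesis
    proof (cases "0 \<in> T")
      case False
      then have "{y \<in> topspace M. ?F y \<in> T} = {y \<in> U. \<phi> (g y) \<in> T}"
        using openin_subset[OF U] False by auto
      then show ?thesis using 1 by simp
    next
      case True
      have "y \<in> {y \<in> topspace M. ?F y \<in> T} \<longleftrightarrow> y \<in> {y \<in> U. \<phi> (g y) \<in> T} \<union> (topspace M - f ` K)" for y
      proof (cases "y \<in> U")
        case yU: True
        then have yT: "y \<in> topspace M" using U openin_subset by blast
        have gE: "g y \<in> topspace (Euclidean_space n)" using g yU UT by (auto simp: continuous_map_def)
        have "y \<in> f ` K" if "g y \<in> K" using fg'[of y] that yU UT by (metis imageI)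
        then have "\<phi> (g y) = 0" if "y \<notin> f ` K" using K(2)[OF gE] that by blast
        then show ?thesis using yU yT True by auto
      next
        case False
        have "f ` K \<subseteq> U" using f compactin_subset_topspace[OF K(1)]
          by (auto simp: continuous_map_in_subtopology)
        then show ?thesis using False True by auto
      qed
      then have "{y \<in> topspace M. ?F y \<in> T} = {y \<in> U. \<phi> (g y) \<in> T} \<union> (topspace M - f ` K)" by blast
      then show ?thesis using 1 fK by (metis closedin_def openin_Un)
    qed
  qed
  then show ?thesis by (simp add: continuous_map_def)
qed

text \<open>\<open>F n\<close> is a bump function on a chart and the other \<open>F j\<close> are
  the coordinates multiplied by it. Equality of the bumps puts both points into the chart, and where
  the bump is positive the coordinates are recovered by division.\<close>

lemma bump_coordinates:
  assumes M: "closed_manifold n M" and x: "x \<in> topspace M"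
  obtains F :: "nat \<Rightarrow> 'a \<Rightarrow> real" where "\<And>j. continuous_map M euclideanreal (F j)" "F n x > 0"
    "\<And>y z. y \<in> topspace M \<Longrightarrow> z \<in> topspace M \<Longrightarrow> F n y > 0 \<Longrightarrow> (\<And>j. j \<le> n \<Longrightarrow> F j y = F j z) \<Longrightarrow> y = z"
proof -
  let ?E = "Euclidean_space n"
  obtain U f g where U: "openin M U" "x \<in> U"
    and fg: "homeomorphic_maps ?E (subtopology M U) f g"
    by (rule manifold_chart[OF M x])
  have UT: "topspace (subtopology M U) = U" using U(1) openin_subset by auto
  have g: "g y \<in> topspace ?E" "f (g y) = y" if "y \<in> U" for y
    using fg that UT by (auto simp: homeomorphic_maps_def continuous_map_def)
  define h where "h = (\<lambda>v. max 0 (1 - l1dist n (g x) v))"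
  define \<phi> where "\<phi> = (\<lambda>j v. if j < n then h v * v j else h v)"
  define F where "F = (\<lambda>j y. if y \<in> U then \<phi> j (g y) else 0)"
  have ch: "continuous_map ?E euclideanreal h" unfolding h_def
    by (intro continuous_map_real_max continuous_map_diff continuous_map_l1dist
        continuous_map_const[THEN iffD2]) auto
  have c\<phi>: "continuous_map ?E euclideanreal (\<phi> j)" for j
    by (cases "j < n") (simp_all add: \<phi>_def ch continuous_map_real_mult continuous_map_Euclidean_component)
  have supp: "\<phi> j v = 0" if "v \<in> topspace ?E" "v \<notin> eucl_box n (g x) 1" for v j
  proof -
    have "\<exists>i<n. \<bar>v i - g x i\<bar> > 1" using that by (auto simp: eucl_box_def not_le)
    then obtain i where i: "i < n" "\<bar>v i - g x i\<bar> > 1" by blast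
    have "\<bar>v i - g x i\<bar> \<le> l1dist n (g x) v" unfolding l1dist_def
      by (rule member_le_sum[where f = "\<lambda>i. \<bar>v i - g x i\<bar>"]) (use i in auto)
    then have "h v = 0" using i by (simp add: h_def)
    then show ?thesis by (simp add: \<phi>_def)
  qed
  show thesis
  proof (rule that[of F])
    show "continuous_map M euclideanreal (F j)" for j
      unfolding F_def by (rule continuous_map_extend_by_zero[OF M U(1) fg c\<phi> compactin_box supp])
    show "F n x > 0" using U by (simp add: F_def \<phi>_def h_def l1dist_def)
    fix y z assume yz: "y \<in> topspace M" "z \<in> topspace M" "F n y > 0" "\<And>j. j \<le> n \<Longrightarrow> F j y = F j z"
    have yU: "y \<in> U" using yz(3) by (auto simp: F_def split: if_splits)
    have "F n z > 0" using yz(3) yz(4)[of n] by simp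
    then have zU: "z \<in> U" by (auto simp: F_def split: if_splits)
    have hh: "h (g y) = h (g z)" "h (g y) > 0" using yz(3) yz(4)[of n] yU zU by (auto simp: F_def \<phi>_def)
    have "g y j = g z j" for j
    proof (cases "j < n")
      case True
      then show ?thesis using yz(4)[of j] yU zU hh by (simp add: F_def \<phi>_def)
    next
      case False
      then show ?thesis using g(1)[OF yU] g(1)[OF zU] by (simp add: topspace_Euclidean_space)
    qed
    then have "g y = g z" by blast
    then show "y = z" using g(2) yU zU by metis
  qed
qed

text \<open>Finitely many systems of bump coordinates embed the compact manifold in a Euclidean
  space; \<open>d\<close> is the l1 distance of the images. Compactness makes small distances force
  nearness in the topology.\<close>

lemma closed_manifold_metric:
  assumes M: "closed_manifold n M"
  obtains d where "compatible_metric M d"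
proof -
  let ?P = "\<lambda>x F. (\<forall>j. continuous_map M euclideanreal (F j)) \<and> F n x > (0::real) \<and>
    (\<forall>y z. y \<in> topspace M \<longrightarrow> z \<in> topspace M \<longrightarrow> F n y > 0 \<longrightarrow> (\<forall>j\<le>n. F j y = F j z) \<longrightarrow> y = z)"
  have "\<forall>x\<in>topspace M. \<exists>F. ?P x F"
  proof
    fix x assume x: "x \<in> topspace M"
    show "\<exists>F. ?P x F"
    proof (rule bump_coordinates[OF M x])
      fix F :: "nat \<Rightarrow> 'a \<Rightarrow> real"
      assume c: "\<And>j. continuous_map M euclideanreal (F j)" and p: "F n x > 0"
        and s: "\<And>y z. y \<in> topspace M \<Longrightarrow> z \<in> topspace M \<Longrightarrow> F n y > 0 \<Longrightarrow> (\<And>j. j \<le> n \<Longrightarrow> F j y = F j z) \<Longrightarrow> y = z"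
      show "\<exists>F. ?P x F" by (rule exI[of _ F]) (use c p in \<open>auto intro: s\<close>)
    qed
  qed
  from bchoice[OF this] obtain F where F: "\<And>x. x \<in> topspace M \<Longrightarrow> ?P x (F x)" by blast
  have cM: "compact_space M" using M by (simp add: closed_manifold_def)
  define V where "V = (\<lambda>x. {y \<in> topspace M. F x n y \<in> {0<..}})"
  have "openin M (V x) \<and> x \<in> V x" if "x \<in> topspace M" for x
  proof
    show "openin M (V x)" unfolding V_def
      by (rule openin_continuous_map_preimage[where Y = euclideanreal]) (use F[OF that] in auto)
    show "x \<in> V x" using F[OF that] that by (simp add: V_def)
  qed
  then obtain S where S: "finite S" "S \<subseteq> topspace M" "topspace M \<subseteq> \<Union>(V ` S)"
    using compact_space_finite_subcover[OF cM, of V] by blast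
  define d where "d = (\<lambda>y z. \<Sum>x\<in>S. \<Sum>j\<le>n. \<bar>F x j y - F x j z\<bar>)"
  have d0: "d x y \<ge> 0" for x y by (simp add: d_def sum_nonneg)
  have dsep: "d y z > 0" if yz: "y \<in> topspace M" "z \<in> topspace M" "y \<noteq> z" for y z
  proof (rule ccontr)
    assume "\<not> d y z > 0"
    then have "d y z = 0" using d0[of y z] by simp
    then have eq: "F x j y = F x j z" if "x \<in> S" "j \<le> n" for x j
      using that S(1) by (simp add: d_def sum_nonneg_eq_0_iff sum_nonneg)
    obtain x where x: "x \<in> S" "y \<in> V x" using S(3) yz(1) by blast
    then show False using F[of x] S(2) yz eq[OF x(1)] by (auto simp: V_def)
  qed
  have dc: "continuous_map M euclideanreal (d y)" for y
    unfolding d_def using F S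
    by (intro continuous_map_sum continuous_map_real_abs continuous_map_diff
        continuous_map_const[THEN iffD2]) auto
  have "compatible_metric M d"
    unfolding compatible_metric_def
  proof (intro conjI allI impI)
    show "d x x = 0" for x by (simp add: d_def)
    show "d x y = d y x" for x y by (simp add: d_def abs_minus_commute)
    show "d x z \<le> d x y + d y z" for x y z
      unfolding d_def sum.distrib[symmetric] by (intro sum_mono) simp
    show "openin M {y \<in> topspace M. d x y < e}" for x e
      using openin_continuous_map_preimage[OF dc[of x], of "{..<e}"] by simp
    fix W x assume W: "openin M W" "x \<in> W"
    have xT: "x \<in> topspace M" using W openin_subset by blast
    have "closedin M (topspace M - W)" using W(1) by blast
    then have c: "compactin M (topspace M - W)" using cM by (simp add: closedin_compact_space)
    show "\<exists>e>0. \<forall>y\<in>topspace M. d x y < e \<longrightarrow> y \<in> W"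
    proof (cases "topspace M - W = {}")
      case True
      then show ?thesis by (intro exI[of _ 1]) auto
    next
      case False
      have "compact (d x ` (topspace M - W))" using image_compactin[OF c dc[of x]] by simp
      then obtain s where s: "s \<in> d x ` (topspace M - W)" "\<And>t. t \<in> d x ` (topspace M - W) \<Longrightarrow> s \<le> t"
        using compact_attains_inf[of "d x ` (topspace M - W)"] False by blast
      obtain w where w: "w \<in> topspace M" "w \<notin> W" "s = d x w" using s(1) by blast
      have "s > 0" using dsep[OF xT w(1)] w W(2) by metis
      moreover have "\<forall>y\<in>topspace M. d x y < s \<longrightarrow> y \<in> W" using s(2) by force
      ultimately show ?thesis by blast
    qed
  qed
  then show thesis by (rule that)
qed

section \<open>Cup-i products\<close>

text \<open>
  The faces of a simplex are indexed by lists of vertices.  A term of Steenrod's cup-i coproduct on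
  \<open>[v\<^sub>0,\<dots>,v\<^sub>p]\<close> arises from reading the vertices from left to right and sending each one to the first
  or to the second factor, where \<open>i + 1\<close> of the vertices go to both factors and switch the active
  factor.  \<open>steenrod s L m g\<close> sums \<open>g\<close> over all terms with \<open>m\<close> switches and active factor \<open>s\<close>; thus
  \<open>m = i + 1\<close>.
\<close>

fun steenrod :: "bool \<Rightarrow> nat list \<Rightarrow> nat \<Rightarrow> (nat list \<Rightarrow> nat list \<Rightarrow> 'm::char2) \<Rightarrow> 'm" where
  "steenrod s [] m g = (if m = 0 then g [] [] else 0)"
| "steenrod s (v # L) m g =
     steenrod s L m (\<lambda>A B. if s then g (v # A) B else g A (v # B)) +
     (if m = 0 then 0 else steenrod (\<not> s) L (m - 1) (\<lambda>A B. g (v # A) (v # B)))"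

text \<open>Recursion on the first vertex, as in \<open>steenrod\<close>, so that the Leibniz rule
  goes by one common induction; \<open>list_bdry_sum\<close> is the closed form.\<close>

fun list_bdry :: "(nat list \<Rightarrow> 'm::char2) \<Rightarrow> nat list \<Rightarrow> 'm" where
  "list_bdry h [] = 0"
| "list_bdry h (v # L) = h L + list_bdry (\<lambda>L'. h (v # L')) L"

lemma steenrod_add:
  "steenrod s L m (\<lambda>A B. f A B + g A B) = steenrod s L m f + steenrod s L m g"
proof (induction L arbitrary: s m f g)
  case (Cons v L)
  have "(\<lambda>A B. if s then f (v # A) B + g (v # A) B else f A (v # B) + g A (v # B)) =
    (\<lambda>A B. (if s then f (v # A) B else f A (v # B)) + (if s then g (v # A) B else g A (v # B)))"
    by (auto simp: fun_eq_iff)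
  then show ?case by (simp add: Cons.IH ac_simps)
qed simp

lemma list_bdry_add: "list_bdry (\<lambda>L. f L + g L) L = list_bdry f L + list_bdry g L"
  by (induction L arbitrary: f g) (simp_all add: ac_simps)

lemma list_bdry_zero: "list_bdry (\<lambda>L. 0) L = 0"
  by (induction L) simp_all

text \<open>Steenrod's coboundary formula before any degree is fixed, by induction on the first
  vertex. Deleting that vertex from a factor or from the whole list gives terms without it, most of
  which cancel; what survives are the terms with one switch less, with either factor active at the
  start.\<close>

lemma steenrod_leibniz:
  "steenrod s L m (\<lambda>A B. list_bdry (\<lambda>A'. g A' B) A + list_bdry (\<lambda>B'. g A B') B) +
     list_bdry (\<lambda>L'. steenrod s L' m g) L =
   (if m = 0 then 0 else steenrod True L (m - 1) g + steenrod False L (m - 1) g)"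
proof (induction L arbitrary: s m g)
  case Nil
  show ?case by (simp add: add_self)
next
  case (Cons v L)
  define D where "D = (\<lambda>(g :: nat list \<Rightarrow> nat list \<Rightarrow> 'a) A B.
    list_bdry (\<lambda>A'. g A' B) A + list_bdry (\<lambda>B'. g A B') B)"
  define g1 where "g1 = (\<lambda>A B. g (v # A) B)"
  define g2 where "g2 = (\<lambda>A B. g A (v # B))"
  define g3 where "g3 = (\<lambda>A B. g (v # A) (v # B))"
  define gs where "gs = (if s then g1 else g2)"
  have IH: "steenrod s L m (D g) + list_bdry (\<lambda>L'. steenrod s L' m g) L =
    (if m = 0 then 0 else steenrod True L (m - 1) g + steenrod False L (m - 1) g)" for s m g
    unfolding D_def by (rule Cons.IH)
  have IH': "list_bdry (\<lambda>L'. steenrod s L' m g) L = steenrod s L m (D g) +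
    (if m = 0 then 0 else steenrod True L (m - 1) g + steenrod False L (m - 1) g)" for s m g
    by (subst IH[of s m g, symmetric]) (simp only: add_left_self)
  \<comment> \<open>Deleting the new head vertex from a factor leaves a term without it; all other
    deletions act on the tail. When both factors contain the head there are two such terms.\<close>
  have Dg1: "(\<lambda>A B. D g (v # A) B) = (\<lambda>A B. g A B + D g1 A B)"
    and Dg2: "(\<lambda>A B. D g A (v # B)) = (\<lambda>A B. g A B + D g2 A B)"
    and Dg3: "(\<lambda>A B. D g (v # A) (v # B)) = (\<lambda>A B. (g2 A B + g1 A B) + D g3 A B)"
    by (simp_all add: D_def g1_def g2_def g3_def fun_eq_iff ac_simps)
  have Ds: "(\<lambda>A B. if s then D g (v # A) B else D g A (v # B)) = (\<lambda>A B. g A B + D gs A B)"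
    using Dg1 Dg2 by (cases s) (simp_all add: gs_def)
  have gs': "(\<lambda>A B. if s then g (v # A) B else g A (v # B)) = gs"
    by (auto simp: gs_def g1_def g2_def fun_eq_iff)
  have unf: "steenrod t (v # L') k g = steenrod t L' k (if t then g1 else g2) +
      (if k = 0 then 0 else steenrod (\<not> t) L' (k - 1) g3)" for t L' k
    by (cases t) (simp_all add: g1_def[symmetric] g2_def[symmetric] g3_def[symmetric])
  have lb: "list_bdry (\<lambda>L'. steenrod s L' m g) (v # L) = steenrod s L m g +
      (list_bdry (\<lambda>L'. steenrod s L' m gs) L +
       (if m = 0 then 0 else list_bdry (\<lambda>L'. steenrod (\<not> s) L' (m - 1) g3) L))"
    unfolding list_bdry.simps unf gs_def[symmetric] by (cases "m = 0") (simp_all add: list_bdry_add)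
  have st: "steenrod s (v # L) m (D g) = steenrod s L m g + steenrod s L m (D gs) +
      (if m = 0 then 0 else steenrod (\<not> s) L (m - 1) g2 + steenrod (\<not> s) L (m - 1) g1 +
        steenrod (\<not> s) L (m - 1) (D g3))"
    unfolding steenrod.simps Ds Dg3 steenrod_add by (rule refl)
  have alg: "(a + b + (x + y + z)) + (a + ((b + (p + q)) + (z + w))) = x + y + p + q + w"
    for a b x y z p q w :: 'a
    by (simp add: ac_simps add_left_self add_self)
  have "steenrod s (v # L) m (D g) + list_bdry (\<lambda>L'. steenrod s L' m g) (v # L) =
    (if m = 0 then 0 else steenrod True (v # L) (m - 1) g + steenrod False (v # L) (m - 1) g)"
  proof (cases m)
    case 0
    have "list_bdry (\<lambda>L'. steenrod s L' 0 gs) L = steenrod s L 0 (D gs)" using IH'[of s 0 gs] by simp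
    then show ?thesis
      using st lb by (simp add: 0 ac_simps add_left_self add_self del: steenrod.simps list_bdry.simps)
  next
    case (Suc k)
    define w where "w = (if k = 0 then 0 else steenrod True L (k - 1) g3 + steenrod False L (k - 1) g3)"
    have gs: "list_bdry (\<lambda>L'. steenrod s L' m gs) L =
        steenrod s L m (D gs) + (steenrod True L k gs + steenrod False L k gs)"
      using IH'[of s m gs] Suc by simp
    have g3: "list_bdry (\<lambda>L'. steenrod (\<not> s) L' k g3) L = steenrod (\<not> s) L k (D g3) + w"
      using IH'[of "\<not> s" k g3] by (simp add: w_def)
    have "steenrod s (v # L) m (D g) + list_bdry (\<lambda>L'. steenrod s L' m g) (v # L) =
      (steenrod s L m g + steenrod s L m (D gs) + (steenrod (\<not> s) L k g2 + steenrod (\<not> s) L k g1 +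
        steenrod (\<not> s) L k (D g3))) + (steenrod s L m g + ((steenrod s L m (D gs) +
        (steenrod True L k gs + steenrod False L k gs)) + (steenrod (\<not> s) L k (D g3) + w)))"
      unfolding gs[symmetric] g3[symmetric] using st lb by (simp add: Suc del: steenrod.simps list_bdry.simps)
    also have "\<dots> = steenrod (\<not> s) L k g2 + steenrod (\<not> s) L k g1 + steenrod True L k gs
        + steenrod False L k gs + w"
      by (rule alg)
    also have "\<dots> = steenrod True L k g1 + steenrod False L k g2 + w"
      by (cases s) (simp_all add: gs_def ac_simps add_left_self add_self)
    also have "\<dots> = steenrod True (v # L) k g + steenrod False (v # L) k g"
      unfolding unf w_def by (simp add: ac_simps)
    finally show ?thesis by (simp add: Suc del: steenrod.simps)
  qed
  then show ?case unfolding D_def .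
qed

text \<open>Exchanging the factors exchanges the starting states; this is how the right-hand side of
  the Leibniz rule becomes a symmetrization.\<close>

lemma steenrod_swap: "steenrod (\<not> s) L m g = steenrod s L m (\<lambda>A B. g B A)"
proof (induction L arbitrary: s m g)
  case (Cons v L)
  show ?case
  proof (cases s)
    case True
    then show ?thesis
      using Cons.IH[of True m "\<lambda>A B. g A (v # B)"] Cons.IH[of False "m - 1" "\<lambda>A B. g (v # A) (v # B)"]
      by simp
  next
    case False
    then show ?thesis
      using Cons.IH[of False m "\<lambda>A B. g (v # A) B"] Cons.IH[of True "m - 1" "\<lambda>A B. g (v # A) (v # B)"]
      by simp
  qed
qed simp

lemma steenrod_cong:
  "(\<And>A B. set A \<subseteq> set L \<Longrightarrow> set B \<subseteq> set L \<Longrightarrow> f A B = g A B) \<Longrightarrow> steenrod s L m f = steenrod s L m g"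
proof (induction L arbitrary: s m f g)
  case (Cons v L)
  have "steenrod s L m (\<lambda>A B. if s then f (v # A) B else f A (v # B)) =
        steenrod s L m (\<lambda>A B. if s then g (v # A) B else g A (v # B))"
    by (rule Cons.IH) (use Cons.prems in \<open>auto simp: subset_insertI2\<close>)
  moreover have "steenrod (\<not> s) L (m - 1) (\<lambda>A B. f (v # A) (v # B))
      = steenrod (\<not> s) L (m - 1) (\<lambda>A B. g (v # A) (v # B))"
    by (rule Cons.IH) (use Cons.prems in \<open>auto simp: subset_insertI2\<close>)
  ultimately show ?case by simp
qed simp

lemma steenrod_map:
  "steenrod s (map f L) m g = steenrod s L m (\<lambda>A B. g (map f A) (map f B))"
proof (induction L arbitrary: s m g)
  case (Cons v L)
  show ?case by (cases s) (simp_all add: Cons.IH)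
qed simp

lemma steenrod_zero: "steenrod s L m (\<lambda>A B. 0) = 0"
  by (induction L arbitrary: s m) simp_all

lemma steenrod_0: "steenrod s L 0 g = (if s then g L [] else g [] L)"
  by (induction L arbitrary: s g) auto

lemma steenrod_1: "steenrod True L 1 g = (\<Sum>i<length L. g (take (Suc i) L) (drop i L))"
  by (induction L arbitrary: g)
    (simp_all add: steenrod_0 sum.lessThan_Suc_shift add.commute del: sum.lessThan_Suc)

lemma steenrod_exceed: "length L < m \<Longrightarrow> steenrod s L m g = 0"
  by (induction L arbitrary: s m g) auto

text \<open>Every vertex must be a switch, so both factors receive the whole list.\<close>

lemma steenrod_length: "steenrod s L (length L) g = g L L"
  by (induction L arbitrary: s g) (simp_all add: steenrod_exceed)

lemma list_bdry_sum: "list_bdry h L = (\<Sum>i<length L. h (take i L @ drop (Suc i) L))"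
  by (induction L arbitrary: h) (simp_all add: sum.lessThan_Suc_shift del: sum.lessThan_Suc)

section \<open>Faces indexed by lists of vertices\<close>

text \<open>The affine map that sends the j-th vertex to the vertex \<open>A ! j\<close>. The vertex
  type is arbitrary: the same map parametrizes faces of a standard simplex and faces of a realized
  complex.\<close>

definition vertex_map :: "'v list \<Rightarrow> (nat \<Rightarrow> real) \<Rightarrow> 'v \<Rightarrow> real" where
  "vertex_map A x = (\<lambda>i. \<Sum>j<length A. if A ! j = i then x j else 0)"

definition list_face :: "(('v \<Rightarrow> real) \<Rightarrow> 'a) \<Rightarrow> 'v list \<Rightarrow> 'a simplex" where
  "list_face \<sigma> A = restrict (\<lambda>x. \<sigma> (vertex_map A x)) (standard_simplex (length A - 1))"

lemma vertex_map_in_simplex: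
  assumes "A \<noteq> []" "set A \<subseteq> {..p}" "x \<in> standard_simplex (length A - 1)"
  shows "vertex_map A x \<in> standard_simplex p"
proof -
  have A: "{..<length A} = {..length A - 1}" using assms(1) by (cases A) auto
  have x: "\<And>i. 0 \<le> x i" "sum x {..<length A} = 1"
    using assms(3) by (auto simp: standard_simplex_def A)
  have nn: "0 \<le> vertex_map A x i" for i unfolding vertex_map_def using x by (intro sum_nonneg) auto
  have z: "vertex_map A x i = 0" if "i > p" for i
    unfolding vertex_map_def using assms(2) that by (intro sum.neutral) (fastforce dest: nth_mem)
  have "(\<Sum>i\<le>p. vertex_map A x i) = (\<Sum>j<length A. \<Sum>i\<le>p. if A ! j = i then x j else 0)"
    unfolding vertex_map_def by (rule sum.swap)
  also have "\<dots> = (\<Sum>j<length A. x j)"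
    using assms(2) by (intro sum.cong refl) (auto dest: nth_mem)
  finally have s: "(\<Sum>i\<le>p. vertex_map A x i) = 1" using x by simp
  have "vertex_map A x i \<le> 1" for i
  proof (cases "i \<le> p")
    case True
    then have "vertex_map A x i \<le> (\<Sum>i\<le>p. vertex_map A x i)" using nn by (intro member_le_sum) auto
    then show ?thesis using s by simp
  qed (use z in auto)
  then show ?thesis using nn z s by (simp add: standard_simplex_def)
qed

lemma singular_simplex_list_face:
  assumes \<sigma>: "singular_simplex p X \<sigma>" and A: "A \<noteq> []" "set A \<subseteq> {..p}"
  shows "singular_simplex (length A - 1) X (list_face \<sigma> A)"
    and "list_face \<sigma> A ` standard_simplex (length A - 1) \<subseteq> \<sigma> ` standard_simplex p"
proof -
  let ?PT = "powertop_real UNIV"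
  have cont: "continuous_map ?PT euclideanreal (\<lambda>x. vertex_map A x i)" for i
    unfolding vertex_map_def
    by (intro continuous_map_sum) (auto intro: continuous_map_product_projection)
  have "continuous_map (subtopology ?PT (standard_simplex (length A - 1))) (subtopology ?PT
      (standard_simplex p)) (vertex_map A)"
    unfolding continuous_map_in_subtopology continuous_map_componentwise_UNIV
    using vertex_map_in_simplex[OF A] cont by (auto intro: continuous_map_from_subtopology)
  moreover have "continuous_map (subtopology ?PT (standard_simplex p)) X \<sigma>"
    using \<sigma> by (simp add: singular_simplex_def)
  ultimately have "continuous_map (subtopology ?PT (standard_simplex (length A - 1))) X (\<sigma> \<circ> vertex_map A)"
    by (rule continuous_map_compose)
  then show "singular_simplex (length A - 1) X (list_face \<sigma> A)"
    by (simp add: singular_simplex_def list_face_def o_def)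
  show "list_face \<sigma> A ` standard_simplex (length A - 1) \<subseteq> \<sigma> ` standard_simplex p"
    using vertex_map_in_simplex[OF A] by (auto simp: list_face_def)
qed

lemma vertex_map_simplical_face:
  assumes "i < length A"
  shows "vertex_map A (simplical_face i x) = vertex_map (take i A @ drop (Suc i) A) x"
proof
  fix v
  let ?B = "take i A @ drop (Suc i) A"
  have len: "length ?B = length A - 1" using assms by simp
  have B: "?B ! j = (if j < i then A ! j else A ! Suc j)" if "j < length A - 1" for j
    using assms that by (auto simp: nth_append)
  have "vertex_map A (simplical_face i x) v =
    (\<Sum>j<length A. if j < i then (if A ! j = v then x j else 0) else
      if j = i then 0 else (if A ! j = v then x (j - 1) else 0))"
    unfolding vertex_map_def simplical_face_def by (intro sum.cong) auto
  also have "\<dots> = (\<Sum>j<length A - 1. if (if j < i then A ! j else A ! Suc j) = v then x j else 0)"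
  proof (cases "length A = 1")
    case True
    then show ?thesis using assms by simp
  next
    case False
    then have e: "{..<length A} = {..length A - 1}" "{..<length A - 1} = {..length A - 1 - Suc 0}"
      "1 \<le> length A - 1" "i \<le> length A - 1" using assms by auto
    have *: "(if A ! j = v then x (j - 1) else 0) = (\<lambda>k. if A ! Suc k = v then x k else 0) (j - Suc 0)"
      if "j > i" for j using that by simp
    have "(\<Sum>j\<le>length A - 1. if j < i then (if A ! j = v then x j else 0) else if j
        = i then 0 else (if A ! j = v then x (j - 1) else 0)) =
      (\<Sum>j\<le>length A - 1. if j < i then (if A ! j = v then x j else 0) else if j = i then 0 else (\<lambda>k.
        if A ! Suc k = v then x k else 0) (j - Suc 0))"
      by (intro sum.cong refl) (use * in auto)
    also have "\<dots> = (\<Sum>j\<le>length A - 1 - Suc 0. if j < i then (if A ! j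
        = v then x j else 0) else (if A ! Suc j = v then x j else 0))"
      using sum.zero_middle[OF e(3,4), of "\<lambda>j. if A ! j = v then x j else 0" "\<lambda>k. if A ! Suc k
          = v then x k else 0"]
      .
    finally show ?thesis unfolding e by (auto intro!: sum.cong)
  qed
  also have "\<dots> = vertex_map ?B x v"
    unfolding vertex_map_def len by (intro sum.cong refl) (use B in auto)
  finally show "vertex_map A (simplical_face i x) v = vertex_map ?B x v" .
qed

lemma singular_face_list_face:
  assumes "length A \<ge> 2" "i < length A"
  shows "singular_face (length A - 1) i (list_face \<sigma> A) = list_face \<sigma> (take i A @ drop (Suc i) A)"
proof -
  have "simplical_face i x \<in> standard_simplex (length A - 1)" if "x \<in> standard_simplex (length A - 1 - 1)" for x
    using simplical_face_in_standard_simplex[of "length A - 1" i x] assms that by simp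
  moreover have "length (take i A @ drop (Suc i) A) - 1 = length A - 1 - Suc 0" using assms by simp
  ultimately show ?thesis
    unfolding singular_face_def list_face_def
    by (auto simp: vertex_map_simplical_face[OF assms(2)] fun_eq_iff restrict_def)
qed

text \<open>The i-th coface map: the increasing map of vertices that omits \<open>i\<close>.\<close>

definition skip :: "nat \<Rightarrow> nat \<Rightarrow> nat" where
  "skip i a = (if a < i then a else Suc a)"

lemma list_face_singular_face:
  assumes "A \<noteq> []" "set A \<subseteq> {..p}"
  shows "list_face (singular_face (Suc p) i \<sigma>) A = list_face \<sigma> (map (skip i) A)"
proof -
  have "simplical_face i (vertex_map A x) = vertex_map (map (skip i) A) x" for x
  proof
    fix v
    have "simplical_face i (vertex_map A x) v = (\<Sum>j<length A. if skip i (A ! j) = v then x j else 0)"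
      unfolding simplical_face_def vertex_map_def skip_def by (auto intro!: sum.cong sum.neutral)
    then show "simplical_face i (vertex_map A x) v = vertex_map (map (skip i) A) x v"
      by (simp add: vertex_map_def)
  qed
  then show ?thesis
    unfolding list_face_def singular_face_def
    by (simp, intro restrict_ext) (use vertex_map_in_simplex[OF assms] in simp)
qed

lemma vertex_map_upt: "vertex_map [a..<b] x i = (if a \<le> i \<and> i < b then x (i - a) else 0)"
proof (cases "a \<le> i \<and> i < b")
  case True
  have "vertex_map [a..<b] x i = (\<Sum>j<b - a. if j = i - a then x j else 0)"
    unfolding vertex_map_def using True by (intro sum.cong) auto
  also have "\<dots> = x (i - a)" using True by (subst sum.delta) auto
  finally show ?thesis using True by simp
next
  case False
  then show ?thesis unfolding vertex_map_def by (auto intro!: sum.neutral)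
qed

lemma front_face_list_face: "front_face p \<sigma> = list_face \<sigma> [0..<Suc p]"
proof -
  have "vertex_map [0..<Suc p] x = x" if "x \<in> standard_simplex p" for x
    using that by (auto simp: vertex_map_upt standard_simplex_def fun_eq_iff simp del: upt_Suc)
  then show ?thesis unfolding front_face_def list_face_def
    by (simp del: upt_Suc cong: restrict_cong)
qed

lemma back_face_list_face: "back_face p q \<sigma> = list_face \<sigma> [p..<Suc (p + q)]"
proof -
  have "vertex_map [p..<Suc (p + q)] x = (\<lambda>i. if i < p then 0 else x (i - p))" if "x \<in> standard_simplex q" for x
    using that by (auto simp: vertex_map_upt standard_simplex_def fun_eq_iff simp del: upt_Suc)
  then show ?thesis unfolding back_face_def list_face_def
    by (simp del: upt_Suc cong: restrict_cong)
qed

lemma list_face_all: "singular_simplex p X \<sigma> \<Longrightarrow> list_face \<sigma> [0..<Suc p] = \<sigma>"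
  unfolding front_face_list_face[symmetric] front_face_def
  by (simp add: singular_simplex_def extensional_restrict)

definition cobd :: "nat \<Rightarrow> 'a cochain2 \<Rightarrow> 'a cochain2" where
  "cobd q \<phi> = (\<lambda>\<sigma>. lin \<phi> (bdry (Suc q) \<sigma>))"

lemma cobd_sum: "cobd q \<phi> \<sigma> = (\<Sum>i\<le>Suc q. \<phi> (singular_face (Suc q) i \<sigma>))"
  by (simp add: cobd_def bdry_def lin_sum lin_add del: sum.atMost_Suc)

lemma lin_cobd: "lin (cobd q \<phi>) c = lin \<phi> (chain_boundary2 (Suc q) c)"
  by (simp add: cobd_def chain_boundary2_lin lin_lin)

lemma singular_cocycle2_iff:
  "singular_cocycle2 p X \<phi> \<longleftrightarrow> (\<forall>\<sigma>. singular_simplex (Suc p) X \<sigma> \<longrightarrow> cobd p \<phi> \<sigma> = 0)"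
  by (simp add: singular_cocycle2_def cobd_sum)

lemma lin_eq_0:
  assumes "singular_chain2 p X c" "\<And>\<sigma>. singular_simplex p X \<sigma> \<Longrightarrow> f \<sigma> = 0"
  shows "lin f c = 0"
  unfolding lin_def using assms by (intro sum.neutral) (auto simp: singular_chain2_def)

lemma lin_eq:
  assumes "singular_chain2 p X c" "\<And>\<sigma>. singular_simplex p X \<sigma> \<Longrightarrow> f \<sigma> = g \<sigma>"
  shows "lin f c = lin g c"
  using assms by (intro lin_cong) (auto simp: singular_chain2_def)

lemma cocycle_boundary:
  assumes "singular_cocycle2 p X \<phi>" "singular_chain2 (Suc p) X c"
  shows "lin \<phi> (chain_boundary2 (Suc p) c) = 0"
  using lin_eq_0[OF assms(2), of "cobd p \<phi>"] assms(1) by (simp add: lin_cobd singular_cocycle2_iff)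

text \<open>Extending by 0 to lists of the wrong length lets \<open>steenrod\<close> sum over all
  bidegrees; only the intended one contributes.\<close>

definition list_cochain :: "nat \<Rightarrow> 'a cochain2 \<Rightarrow> 'a simplex \<Rightarrow> nat list \<Rightarrow> bit" where
  "list_cochain q \<phi> \<sigma> A = (if length A = Suc q then \<phi> (list_face \<sigma> A) else 0)"

lemma list_bdry_vanish:
  assumes "length A \<noteq> Suc k" "\<And>A'. length A' \<noteq> k \<Longrightarrow> h A' = 0"
  shows "list_bdry h A = 0"
  unfolding list_bdry_sum using assms by (intro sum.neutral ballI) auto

lemma cobd_list_face:
  assumes "length A = Suc (Suc q)"
  shows "cobd q \<phi> (list_face \<sigma> A) = (\<Sum>i<length A. \<phi> (list_face \<sigma> (take i A @ drop (Suc i) A)))"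
proof -
  have "{..Suc q} = {..<length A}" using assms by auto
  then have "cobd q \<phi> (list_face \<sigma> A) = (\<Sum>i<length A. \<phi> (singular_face (length A - 1) i (list_face \<sigma> A)))"
    using assms by (simp add: cobd_sum del: sum.atMost_Suc)
  also have "\<dots> = (\<Sum>i<length A. \<phi> (list_face \<sigma> (take i A @ drop (Suc i) A)))"
  proof (rule sum.cong[OF refl])
    fix i assume "i \<in> {..<length A}"
    then show "\<phi> (singular_face (length A - 1) i (list_face \<sigma> A)) = \<phi> (list_face \<sigma> (take i A @ drop (Suc i) A))"
      by (subst singular_face_list_face) (use assms in auto)
  qed
  finally show ?thesis .
qed

lemma list_bdry_list_cochain: "list_bdry (list_cochain q \<phi> \<sigma>) A = list_cochain (Suc q) (cobd q \<phi>) \<sigma> A"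
proof (cases "length A = Suc (Suc q)")
  case True
  then show ?thesis
    unfolding list_bdry_sum list_cochain_def cobd_list_face[OF True] by (auto intro!: sum.cong)
next
  case False
  then have "list_bdry (list_cochain q \<phi> \<sigma>) A = 0"
    by (intro list_bdry_vanish[of A "Suc q"]) (auto simp: list_cochain_def)
  then show ?thesis using False by (simp add: list_cochain_def)
qed

lemma list_cochain_face:
  assumes "set A \<subseteq> {..p}"
  shows "list_cochain q \<phi> (singular_face (Suc p) i \<sigma>) A = list_cochain q \<phi> \<sigma> (map (skip i) A)"
  using assms list_face_singular_face[of A p i \<sigma>] by (cases "A = []") (simp_all add: list_cochain_def)

lemma remove_nth_upt:
  assumes "i \<le> Suc p"
  shows "take i [0..<Suc (Suc p)] @ drop (Suc i) [0..<Suc (Suc p)] = map (skip i) [0..<Suc p]"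
  using assms by (intro nth_equalityI) (auto simp: nth_append skip_def simp del: upt_Suc)

lemma list_bdry_upt:
  "list_bdry h [0..<Suc (Suc p)] = (\<Sum>i\<le>Suc p. h (map (skip i) [0..<Suc p]))"
proof -
  have "list_bdry h [0..<Suc (Suc p)]
      = (\<Sum>i<Suc (Suc p). h (take i [0..<Suc (Suc p)] @ drop (Suc i) [0..<Suc (Suc p)]))"
    unfolding list_bdry_sum by (simp del: upt_Suc sum.lessThan_Suc)
  also have "\<dots> = (\<Sum>i\<le>Suc p. h (take i [0..<Suc (Suc p)] @ drop (Suc i) [0..<Suc (Suc p)]))"
    unfolding lessThan_Suc_atMost ..
  also have "\<dots> = (\<Sum>i\<le>Suc p. h (map (skip i) [0..<Suc p]))"
    by (intro sum.cong refl) (simp only: remove_nth_upt atMost_iff)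
  finally show ?thesis .
qed

text \<open>\<open>m\<close> is i + 1; the cochains have degrees \<open>q\<close> and
  \<open>r\<close>, the simplex has degree \<open>p\<close>. In a term with \<open>m\<close>
  switches the list lengths add up to p + 1 + m, so the product can be nonzero only if p + m = q + r
  + 1.\<close>

definition cup_i :: "nat \<Rightarrow> nat \<Rightarrow> nat \<Rightarrow> nat \<Rightarrow> 'a cochain2 \<Rightarrow> 'a cochain2 \<Rightarrow> 'a cochain2" where
  "cup_i m p q r \<phi> \<psi> = (\<lambda>\<sigma>. steenrod True [0..<Suc p] m (\<lambda>A B. list_cochain q \<phi> \<sigma> A * list_cochain r \<psi> \<sigma> B))"

lemma list_bdry_mult: "list_bdry (\<lambda>A. h A * c) A = list_bdry h A * (c :: bit)"
  "list_bdry (\<lambda>A. c * h A) A = c * list_bdry h A"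
  by (simp_all add: list_bdry_sum sum_distrib_left sum_distrib_right)

text \<open>The third summand is the coboundary of the product, evaluated on \<sigma>: deletions in
  the vertex list of the simplex correspond to its faces through \<open>skip\<close>.\<close>

lemma cup_i_leibniz_simplex:
  "cup_i m (Suc p) (Suc q) r (cobd q \<phi>) \<psi> \<sigma> + cup_i m (Suc p) q (Suc r) \<phi> (cobd r \<psi>) \<sigma> +
     lin (cup_i m p q r \<phi> \<psi>) (bdry (Suc p) \<sigma>) =
   (if m = 0 then 0 else cup_i (m - 1) (Suc p) q r \<phi> \<psi> \<sigma> + cup_i (m - 1) (Suc p) r q \<psi> \<phi> \<sigma>)"
proof -
  define g where "g = (\<lambda>A B. list_cochain q \<phi> \<sigma> A * list_cochain r \<psi> \<sigma> B)"
  let ?L = "[0..<Suc (Suc p)]"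
  have 1: "steenrod True ?L m (\<lambda>A B. list_bdry (\<lambda>A'. g A' B) A + list_bdry (\<lambda>B'. g A B') B) =
    cup_i m (Suc p) (Suc q) r (cobd q \<phi>) \<psi> \<sigma> + cup_i m (Suc p) q (Suc r) \<phi> (cobd r \<psi>) \<sigma>"
    unfolding g_def list_bdry_mult list_bdry_list_cochain steenrod_add cup_i_def ..
  have "list_bdry (\<lambda>L'. steenrod True L' m g) ?L = (\<Sum>i\<le>Suc p. cup_i m p q r \<phi> \<psi> (singular_face (Suc p) i \<sigma>))"
    unfolding list_bdry_upt cup_i_def steenrod_map
    by (intro sum.cong refl steenrod_cong)
      (simp add: g_def list_cochain_face atLeast0LessThan lessThan_Suc_atMost del: upt_Suc)
  also have "\<dots> = lin (cup_i m p q r \<phi> \<psi>) (bdry (Suc p) \<sigma>)"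
    by (simp add: bdry_def lin_sum lin_add del: sum.atMost_Suc)
  finally have 2: "list_bdry (\<lambda>L'. steenrod True L' m g) ?L = lin (cup_i m p q r \<phi> \<psi>) (bdry (Suc p) \<sigma>)" .
  have 3: "steenrod True ?L k g = cup_i k (Suc p) q r \<phi> \<psi> \<sigma>" for k
    by (simp add: g_def cup_i_def)
  have 4: "steenrod False ?L k g = cup_i k (Suc p) r q \<psi> \<phi> \<sigma>" for k
    using steenrod_swap[of True ?L k g] by (simp add: g_def cup_i_def mult.commute)
  show ?thesis using steenrod_leibniz[of True ?L m g] unfolding 1 2 3 4 .
qed

text \<open>On a cycle the coboundary of the product evaluates to 0, which leaves the rule in the
  form in which it governs intersection numbers.\<close>

lemma cup_i_leibniz:
  assumes "chain_boundary2 (Suc p) c = 0"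
  shows "lin (cup_i m (Suc p) (Suc q) r (cobd q \<phi>) \<psi>) c + lin (cup_i m (Suc p) q (Suc r) \<phi> (cobd r \<psi>)) c =
   (if m = 0 then 0 else lin (cup_i (m - 1) (Suc p) q r \<phi> \<psi>) c + lin (cup_i (m - 1) (Suc p) r q \<psi> \<phi>) c)"
proof -
  have "lin (\<lambda>\<sigma>. cup_i m (Suc p) (Suc q) r (cobd q \<phi>) \<psi> \<sigma> + cup_i m (Suc p) q (Suc r) \<phi> (cobd r \<psi>) \<sigma> +
     lin (cup_i m p q r \<phi> \<psi>) (bdry (Suc p) \<sigma>)) c =
   lin (\<lambda>\<sigma>. if m = 0 then 0 else cup_i (m - 1) (Suc p) q r \<phi> \<psi> \<sigma> + cup_i (m - 1) (Suc p) r q \<psi> \<phi> \<sigma>) c"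
    by (intro lin_cong) (rule cup_i_leibniz_simplex)
  moreover have "lin (\<lambda>\<sigma>. lin (cup_i m p q r \<phi> \<psi>) (bdry (Suc p) \<sigma>)) c = 0"
    unfolding lin_lin[symmetric] chain_boundary2_lin[symmetric] assms by simp
  ultimately show ?thesis by (cases "m = 0") (simp_all add: lin_distrib)
qed

lemma steenrod_split_upt:
  assumes "\<And>A B. length A \<noteq> Suc q \<or> length B \<noteq> Suc r \<Longrightarrow> g A B = 0"
  shows "steenrod True [0..<Suc (q + r)] 1 g = g [0..<Suc q] [q..<Suc (q + r)]"
proof -
  let ?L = "[0..<Suc (q + r)]"
  have "steenrod True ?L 1 g = (\<Sum>i<Suc (q + r). g (take (Suc i) ?L) (drop i ?L))"
    unfolding steenrod_1 by (simp del: upt_Suc sum.lessThan_Suc)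
  also have "\<dots> = (\<Sum>i\<in>{q}. g (take (Suc i) ?L) (drop i ?L))"
    by (rule sum.mono_neutral_right) (auto intro!: assms simp del: upt_Suc)
  also have "\<dots> = g [0..<Suc q] [q..<Suc (q + r)]" by (simp add: take_upt drop_upt del: upt_Suc)
  finally show ?thesis .
qed

lemma cup2_cup_i: "cup2 q r \<phi> \<psi> = cup_i 1 (q + r) q r \<phi> \<psi>"
proof
  fix \<sigma>
  have "steenrod True [0..<Suc (q + r)] 1 (\<lambda>A B. list_cochain q \<phi> \<sigma> A * list_cochain r \<psi> \<sigma> B) =
    list_cochain q \<phi> \<sigma> [0..<Suc q] * list_cochain r \<psi> \<sigma> [q..<Suc (q + r)]"
    by (rule steenrod_split_upt) (auto simp: list_cochain_def)
  then show "cup2 q r \<phi> \<psi> \<sigma> = cup_i 1 (q + r) q r \<phi> \<psi> \<sigma>"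
    unfolding cup_i_def cup2_def front_face_list_face back_face_list_face
    by (simp add: list_cochain_def del: upt_Suc)
qed

text \<open>A simplex of dimension \<open>n\<close> has \<open>Suc n\<close> vertices, all of them
  switches here. For equal factors this is Sq^0 = id at cochain level.\<close>

lemma cup_i_top:
  assumes "singular_simplex n X \<sigma>"
  shows "cup_i (Suc n) n n n \<phi> \<psi> \<sigma> = \<phi> \<sigma> * \<psi> \<sigma>"
  using steenrod_length[of True "[0..<Suc n]" "\<lambda>A B. list_cochain n \<phi> \<sigma> A * list_cochain n \<psi> \<sigma> B"]
  by (simp add: cup_i_def del: upt_Suc) (simp add: list_cochain_def list_face_all[OF assms] del: upt_Suc)

text \<open>Every term multiplies values on two faces of the same simplex. Thus separated supports
  kill the products of all orders at once.\<close>

lemma cup_i_eq_0: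
  assumes "\<And>A B. \<lbrakk>set A \<subseteq> {..p}; set B \<subseteq> {..p}; length A = Suc q; length B = Suc r\<rbrakk> \<Longrightarrow>
    \<phi> (list_face \<sigma> A) = 0 \<or> \<psi> (list_face \<sigma> B) = 0"
  shows "cup_i m p q r \<phi> \<psi> \<sigma> = 0"
proof -
  have "cup_i m p q r \<phi> \<psi> \<sigma> = steenrod True [0..<Suc p] m (\<lambda>A B. 0)"
    unfolding cup_i_def
  proof (rule steenrod_cong)
    fix A B assume "set A \<subseteq> set [0..<Suc p]" "set B \<subseteq> set [0..<Suc p]"
    then have "set A \<subseteq> {..p}" "set B \<subseteq> {..p}" by (auto simp: less_Suc_eq_le simp del: upt_Suc)
    then show "list_cochain q \<phi> \<sigma> A * list_cochain r \<psi> \<sigma> B = 0"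
      using assms[of A B] by (auto simp: list_cochain_def)
  qed
  then show ?thesis by (simp add: steenrod_zero del: upt_Suc)
qed

lemma steenrod_lin:
  "steenrod s L m (\<lambda>A B. lin (\<lambda>\<tau>. f \<tau> A B) c) = lin (\<lambda>\<tau>. steenrod s L m (f \<tau>)) c"
proof (induction L arbitrary: s m f)
  case Nil
  then show ?case by (simp add: lin_def)
next
  case (Cons v L)
  have 1: "(\<lambda>A B. if s then lin (\<lambda>\<tau>. f \<tau> (v # A) B) c else lin (\<lambda>\<tau>. f \<tau> A (v # B)) c) =
    (\<lambda>A B. lin (\<lambda>\<tau>. if s then f \<tau> (v # A) B else f \<tau> A (v # B)) c)" by (cases s) simp_all
  show ?case unfolding steenrod.simps 1 Cons.IH
    by (cases "m = 0") (simp_all add: lin_distrib)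
qed

lemma lin_mult: "lin (\<lambda>\<tau>. f \<tau> * b) c = lin f c * (b :: bit)" "lin (\<lambda>\<tau>. b * f \<tau>) c = b * lin f c"
  by (simp_all add: lin_def sum_distrib_left sum_distrib_right)

lemma cup_i_lin:
  "cup_i m p q r (\<lambda>\<rho>. lin (\<lambda>\<tau>. f \<tau> \<rho>) c) \<psi> \<sigma> = lin (\<lambda>\<tau>. cup_i m p q r (f \<tau>) \<psi> \<sigma>) c"
  "cup_i m p q r \<psi> (\<lambda>\<rho>. lin (\<lambda>\<tau>. f \<tau> \<rho>) c) \<sigma> = lin (\<lambda>\<tau>. cup_i m p q r \<psi> (f \<tau>) \<sigma>) c"
proof -
  have 1: "list_cochain q (\<lambda>\<rho>. lin (\<lambda>\<tau>. f \<tau> \<rho>) c) \<sigma> A = lin (\<lambda>\<tau>. list_cochain q (f \<tau>) \<sigma> A) c" for q A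
    by (simp add: list_cochain_def)
  show "cup_i m p q r (\<lambda>\<rho>. lin (\<lambda>\<tau>. f \<tau> \<rho>) c) \<psi> \<sigma> = lin (\<lambda>\<tau>. cup_i m p q r (f \<tau>) \<psi> \<sigma>) c"
    "cup_i m p q r \<psi> (\<lambda>\<rho>. lin (\<lambda>\<tau>. f \<tau> \<rho>) c) \<sigma> = lin (\<lambda>\<tau>. cup_i m p q r \<psi> (f \<tau>) \<sigma>) c"
    unfolding cup_i_def 1 lin_mult[symmetric] steenrod_lin by (rule refl)+
qed

lemma cup_i_cong:
  assumes \<sigma>: "singular_simplex p X \<sigma>"
    and "\<And>\<rho>. singular_simplex q X \<rho> \<Longrightarrow> \<phi> \<rho> = \<phi>' \<rho>" "\<And>\<rho>. singular_simplex r X \<rho> \<Longrightarrow> \<psi> \<rho> = \<psi>' \<rho>"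
  shows "cup_i m p q r \<phi> \<psi> \<sigma> = cup_i m p q r \<phi>' \<psi>' \<sigma>"
  unfolding cup_i_def
proof (rule steenrod_cong)
  fix A B assume "set A \<subseteq> set [0..<Suc p]" "set B \<subseteq> set [0..<Suc p]"
  then have AB: "set A \<subseteq> {..p}" "set B \<subseteq> {..p}" by (auto simp: less_Suc_eq_le simp del: upt_Suc)
  have "list_cochain q \<phi> \<sigma> A = list_cochain q \<phi>' \<sigma> A"
    using singular_simplex_list_face(1)[OF \<sigma> _ AB(1)] assms(2) by (cases "A = []") (auto simp: list_cochain_def)
  moreover have "list_cochain r \<psi> \<sigma> B = list_cochain r \<psi>' \<sigma> B"
    using singular_simplex_list_face(1)[OF \<sigma> _ AB(2)] assms(3) by (cases "B = []") (auto simp: list_cochain_def)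
  ultimately show "list_cochain q \<phi> \<sigma> A * list_cochain r \<psi> \<sigma> B = list_cochain q \<phi>' \<sigma> A * list_cochain r \<psi>' \<sigma> B"
    by simp
qed

section \<open>Cap products\<close>

text \<open>The chain-valued counterpart of the integrand in \<open>cup_i\<close>. For its sake
  \<open>steenrod\<close> takes values in any \<open>char2\<close> group, and the boundary of a cap
  product becomes another case of the Leibniz rule.\<close>

definition list_cap :: "nat \<Rightarrow> nat \<Rightarrow> 'a cochain2 \<Rightarrow> 'a simplex \<Rightarrow> nat list \<Rightarrow> nat list \<Rightarrow> 'a chain2" where
  "list_cap q r \<phi> \<sigma> A B =
     (if length A = Suc q \<and> length B = Suc r then Poly_Mapping.single (list_face \<sigma> B) (\<phi> (list_face
         \<sigma> A)) else 0)"

lemma cap2_list_cap: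
  "cap2 q r c \<phi> = lin (\<lambda>\<sigma>. steenrod True [0..<Suc (q + r)] 1 (list_cap q r \<phi> \<sigma>)) c"
  unfolding cap2_lin
proof (rule lin_cong)
  fix \<sigma>
  have "steenrod True [0..<Suc (q + r)] 1 (list_cap q r \<phi> \<sigma>) = list_cap q r \<phi> \<sigma> [0..<Suc q] [q..<Suc (q + r)]"
    by (rule steenrod_split_upt) (auto simp: list_cap_def)
  then show "Poly_Mapping.single (back_face q r \<sigma>) (\<phi> (front_face q \<sigma>)) =
    steenrod True [0..<Suc (q + r)] 1 (list_cap q r \<phi> \<sigma>)"
    unfolding front_face_list_face back_face_list_face by (simp add: list_cap_def del: upt_Suc)
qed

lemma list_bdry_list_cap_left:
  "list_bdry (\<lambda>A'. list_cap q r \<phi> \<sigma> A' B) A = list_cap (Suc q) r (cobd q \<phi>) \<sigma> A B"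
proof (cases "length A = Suc (Suc q) \<and> length B = Suc r")
  case True
  have s: "(\<Sum>i\<in>I. Poly_Mapping.single b (f i)) = Poly_Mapping.single b (\<Sum>i\<in>I. f i)"
    for b :: "'a simplex" and f :: "nat \<Rightarrow> bit" and I
    by (induction I rule: infinite_finite_induct) (simp_all add: single_add)
  have "list_bdry (\<lambda>A'. list_cap q r \<phi> \<sigma> A' B) A =
    (\<Sum>i<length A. Poly_Mapping.single (list_face \<sigma> B) (\<phi> (list_face \<sigma> (take i A @ drop (Suc i) A))))"
    unfolding list_bdry_sum using True by (intro sum.cong refl) (auto simp: list_cap_def)
  also have "\<dots> = Poly_Mapping.single (list_face \<sigma> B) (cobd q \<phi> (list_face \<sigma> A))"
    unfolding s cobd_list_face[OF conjunct1[OF True]] ..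
  finally show ?thesis using True by (simp add: list_cap_def)
next
  case False
  have "list_bdry (\<lambda>A'. list_cap q r \<phi> \<sigma> A' B) A = 0"
  proof (cases "length B = Suc r")
    case True
    then show ?thesis
      using False by (intro list_bdry_vanish[of A "Suc q"]) (auto simp: list_cap_def)
  next
    case F: False
    then show ?thesis by (simp add: list_cap_def list_bdry_zero)
  qed
  then show ?thesis using False by (auto simp: list_cap_def)
qed

lemma bdry_list_face:
  assumes "length B = Suc (Suc r)"
  shows "bdry (Suc r) (list_face \<sigma> B) = (\<Sum>i<length B. gen2 (list_face \<sigma> (take i B @ drop (Suc i) B)))"
proof -
  have "{..Suc r} = {..<length B}" using assms by auto
  then have "bdry (Suc r) (list_face \<sigma> B)
      = (\<Sum>i<length B. gen2 (singular_face (length B - 1) i (list_face \<sigma> B)))"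
    using assms by (simp add: bdry_def del: sum.atMost_Suc)
  also have "\<dots> = (\<Sum>i<length B. gen2 (list_face \<sigma> (take i B @ drop (Suc i) B)))"
  proof (rule sum.cong[OF refl])
    fix i assume "i \<in> {..<length B}"
    then show "gen2 (singular_face (length B - 1) i (list_face \<sigma> B))
        = gen2 (list_face \<sigma> (take i B @ drop (Suc i) B))"
      by (subst singular_face_list_face) (use assms in auto)
  qed
  finally show ?thesis .
qed

lemma list_bdry_list_cap_right:
  "list_bdry (\<lambda>B'. list_cap q r \<phi> \<sigma> A B') B = chain_boundary2 (Suc r) (list_cap q (Suc r) \<phi> \<sigma> A B)"
proof (cases "length B = Suc (Suc r) \<and> length A = Suc q")
  case True
  show ?thesis
  proof (cases "\<phi> (list_face \<sigma> A)")
    case zero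
    then have "(\<lambda>B'. list_cap q r \<phi> \<sigma> A B') = (\<lambda>_. 0)" by (auto simp: list_cap_def fun_eq_iff)
    then show ?thesis using zero by (simp add: list_bdry_zero list_cap_def)
  next
    case one
    have "list_bdry (\<lambda>B'. list_cap q r \<phi> \<sigma> A B') B
        = (\<Sum>i<length B. gen2 (list_face \<sigma> (take i B @ drop (Suc i) B)))"
      unfolding list_bdry_sum using True one by (intro sum.cong refl) (auto simp: list_cap_def)
    then show ?thesis using True one by (simp add: list_cap_def bdry_list_face del: sum.lessThan_Suc)
  qed
next
  case False
  have "list_bdry (\<lambda>B'. list_cap q r \<phi> \<sigma> A B') B = 0"
  proof (cases "length A = Suc q")
    case True
    then show ?thesis
      using False by (intro list_bdry_vanish[of B "Suc r"]) (auto simp: list_cap_def)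
  next
    case F: False
    then show ?thesis by (simp add: list_cap_def list_bdry_zero)
  qed
  then show ?thesis using False by (auto simp: list_cap_def)
qed

lemma steenrod_boundary:
  "steenrod s L m (\<lambda>A B. chain_boundary2 p (f A B)) = chain_boundary2 p (steenrod s L m f)"
proof (induction L arbitrary: s m f)
  case (Cons v L)
  have 1: "(\<lambda>A B. if s then chain_boundary2 p (f (v # A) B) else chain_boundary2 p (f A (v # B))) =
    (\<lambda>A B. chain_boundary2 p (if s then f (v # A) B else f A (v # B)))" by (cases s) simp_all
  show ?case unfolding steenrod.simps 1 Cons.IH by (simp add: chain_boundary2_add)
qed simp

lemma list_cap_face:
  assumes "set A \<subseteq> {..p}" "set B \<subseteq> {..p}"
  shows "list_cap q r \<phi> (singular_face (Suc p) i \<sigma>) A B = list_cap q r \<phi> \<sigma> (map (skip i) A) (map (skip i) B)"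
  using assms list_face_singular_face[of A p i \<sigma>] list_face_singular_face[of B p i \<sigma>]
  by (cases "A = [] \<or> B = []") (auto simp: list_cap_def)

text \<open>The case m = 1 of \<open>steenrod_leibniz\<close> with values in chains. Its right-hand
  side has no switch, so one of the two lists is empty there and \<open>list_cap\<close>
  vanishes.\<close>

lemma cap2_boundary:
  "cap2 q r (chain_boundary2 (Suc (q + r)) c) \<phi> =
     cap2 (Suc q) r c (cobd q \<phi>) + chain_boundary2 (Suc r) (cap2 q (Suc r) c \<phi>)"
proof -
  let ?L = "[0..<Suc (Suc (q + r))]"
  have lei: "lin (\<lambda>\<sigma>. steenrod True [0..<Suc (q + r)] 1 (list_cap q r \<phi> \<sigma>)) (bdry (Suc (q + r)) \<sigma>) =
    steenrod True ?L 1 (list_cap (Suc q) r (cobd q \<phi>) \<sigma>) +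
    chain_boundary2 (Suc r) (steenrod True ?L 1 (list_cap q (Suc r) \<phi> \<sigma>))" for \<sigma> :: "'a simplex"
  proof -
    have "list_bdry (\<lambda>L'. steenrod True L' 1 (list_cap q r \<phi> \<sigma>)) ?L =
      (\<Sum>i\<le>Suc (q + r). steenrod True [0..<Suc (q + r)] 1 (list_cap q r \<phi> (singular_face (Suc (q + r)) i \<sigma>)))"
      unfolding list_bdry_upt steenrod_map
      by (intro sum.cong refl steenrod_cong)
        (simp add: list_cap_face atLeast0LessThan lessThan_Suc_atMost del: upt_Suc)
    also have "\<dots> = lin (\<lambda>\<sigma>. steenrod True [0..<Suc (q + r)] 1 (list_cap q r \<phi> \<sigma>)) (bdry (Suc (q + r)) \<sigma>)"
      by (simp add: bdry_def lin_sum lin_add del: sum.atMost_Suc upt_Suc)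
    finally have 1: "lin (\<lambda>\<sigma>. steenrod True [0..<Suc (q + r)] 1 (list_cap q r \<phi> \<sigma>)) (bdry (Suc (q + r)) \<sigma>) =
      list_bdry (\<lambda>L'. steenrod True L' 1 (list_cap q r \<phi> \<sigma>)) ?L" by simp
    have nil: "list_cap q r \<phi> \<sigma> A [] = 0" "list_cap q r \<phi> \<sigma> [] A = 0" for A
      by (simp_all add: list_cap_def)
    have "steenrod True ?L 1 (list_cap (Suc q) r (cobd q \<phi>) \<sigma>) +
      chain_boundary2 (Suc r) (steenrod True ?L 1 (list_cap q (Suc r) \<phi> \<sigma>)) +
      list_bdry (\<lambda>L'. steenrod True L' 1 (list_cap q r \<phi> \<sigma>)) ?L = 0"
      using steenrod_leibniz[of True ?L 1 "list_cap q r \<phi> \<sigma>"]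
      unfolding list_bdry_list_cap_left list_bdry_list_cap_right steenrod_add steenrod_boundary
      by (simp add: steenrod_0 nil del: upt_Suc)
    then show ?thesis unfolding 1 by (simp only: add_eq_0_iff_eq)
  qed
  have "cap2 q r (chain_boundary2 (Suc (q + r)) c) \<phi> =
    lin (\<lambda>\<sigma>. lin (\<lambda>\<sigma>. steenrod True [0..<Suc (q + r)] 1 (list_cap q r \<phi> \<sigma>)) (bdry (Suc (q + r)) \<sigma>)) c"
    unfolding cap2_list_cap chain_boundary2_lin lin_lin ..
  also have "\<dots> = cap2 (Suc q) r c (cobd q \<phi>) + chain_boundary2 (Suc r) (cap2 q (Suc r) c \<phi>)"
    unfolding lei lin_distrib cap2_list_cap
    by (simp add: chain_boundary2_lin lin_lin del: upt_Suc)
  finally show ?thesis .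
qed

lemma cap2_eval: "lin \<psi> (cap2 q r c \<phi>) = lin (cup2 q r \<phi> \<psi>) c"
  unfolding cap2_lin lin_lin cup2_def
  by (intro lin_cong) (auto simp: lin_single split: bit.split)

lemma cap2_chain:
  assumes "singular_chain2 (q + r) X c"
  shows "singular_chain2 r X (cap2 q r c \<phi>)"
  unfolding cap2_lin
proof (rule singular_chain2_lin)
  fix \<sigma> assume "\<sigma> \<in> Poly_Mapping.keys c"
  then have "singular_simplex (q + r) X \<sigma>" using assms by (auto simp: singular_chain2_def)
  from singular_simplex_list_face(1)[OF this, of "[q..<Suc (q + r)]"]
  have "singular_simplex r X (back_face q r \<sigma>)"
    unfolding back_face_list_face by (simp add: subset_iff del: upt_Suc)
  then show "singular_chain2 r X (Poly_Mapping.single (back_face q r \<sigma>) (\<phi> (front_face q \<sigma>)))"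
    by (cases "\<phi> (front_face q \<sigma>)") simp_all
qed

lemma cap2_lin_cochain:
  "cap2 q r c (\<lambda>\<rho>. lin (\<lambda>\<tau>. f \<tau> \<rho>) b) = lin (\<lambda>\<tau>. cap2 q r c (f \<tau>)) b"
proof -
  have s: "Poly_Mapping.single v (lin h b) = lin (\<lambda>\<tau>. Poly_Mapping.single v (h \<tau>)) b"
    for v :: "'a simplex" and h :: "'b \<Rightarrow> bit"
  proof -
    have "(\<Sum>i\<in>I. Poly_Mapping.single v (h i)) = Poly_Mapping.single v (\<Sum>i\<in>I. h i)" for I
      by (induction I rule: infinite_finite_induct) (simp_all add: single_add)
    then show ?thesis by (simp add: lin_def)
  qed
  show ?thesis unfolding cap2_lin s by (rule lin_swap)
qed

lemma cap2_add: "cap2 q r (c + d) \<phi> = cap2 q r c \<phi> + cap2 q r d \<phi>"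
  by (simp add: cap2_lin lin_add)

lemma cap2_cong:
  assumes c: "singular_chain2 (q + r) X c" and "\<And>\<rho>. singular_simplex q X \<rho> \<Longrightarrow> \<phi> \<rho> = \<phi>' \<rho>"
  shows "cap2 q r c \<phi> = cap2 q r c \<phi>'"
  unfolding cap2_lin
proof (rule lin_eq[OF c])
  fix \<sigma> assume "singular_simplex (q + r) X \<sigma>"
  from singular_simplex_list_face(1)[OF this, of "[0..<Suc q]"]
  have "singular_simplex q X (front_face q \<sigma>)"
    unfolding front_face_list_face by (simp add: subset_iff del: upt_Suc)
  then show "Poly_Mapping.single (back_face q r \<sigma>) (\<phi> (front_face q \<sigma>)) =
    Poly_Mapping.single (back_face q r \<sigma>) (\<phi>' (front_face q \<sigma>))" using assms(2) by simp
qed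

section \<open>Extension of functionals and relative coboundaries\<close>

definition bit_scale :: "bit \<Rightarrow> ('b \<Rightarrow>\<^sub>0 bit) \<Rightarrow> ('b \<Rightarrow>\<^sub>0 bit)" where
  "bit_scale r c = (if r = 0 then 0 else c)"

text \<open>A nonempty set closed under addition is a subspace over the two-element field, and a
  functional on a subspace extends by choice of a basis. The cochains below that are not written
  down explicitly come from here.\<close>

lemma extend_functional:
  fixes S :: "('b \<Rightarrow>\<^sub>0 bit) set" and f :: "('b \<Rightarrow>\<^sub>0 bit) \<Rightarrow> bit"
  assumes S: "\<And>x y. x \<in> S \<Longrightarrow> y \<in> S \<Longrightarrow> x + y \<in> S"
    and f: "\<And>x y. x \<in> S \<Longrightarrow> y \<in> S \<Longrightarrow> f (x + y) = f x + f y"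
  obtains \<psi> where "\<And>x. x \<in> S \<Longrightarrow> lin \<psi> x = f x"
proof (cases "S = {}")
  case True
  then show thesis using that by blast
next
  case False
  have S0: "0 \<in> S" using False S add_self by (metis ex_in_conv)
  have f0: "f 0 = 0" using f[OF S0 S0] by simp
  interpret V: vector_space "bit_scale :: bit \<Rightarrow> ('b \<Rightarrow>\<^sub>0 bit) \<Rightarrow> _"
    by unfold_locales (auto simp: bit_scale_def add_self)
  interpret W: vector_space "(*) :: bit \<Rightarrow> bit \<Rightarrow> bit"
    by unfold_locales (auto simp: algebra_simps)
  interpret VW: vector_space_pair "bit_scale :: bit \<Rightarrow> ('b \<Rightarrow>\<^sub>0 bit) \<Rightarrow> _" "(*) :: bit \<Rightarrow> bit \<Rightarrow> bit" ..
  obtain B where B: "B \<subseteq> S" "V.independent B" "S \<subseteq> V.span B"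
    using V.maximal_independent_subset[of S] by blast
  obtain g where g: "Vector_Spaces.linear bit_scale (*) g" "\<And>x. x \<in> B \<Longrightarrow> g x = f x"
    using VW.linear_independent_extend[OF B(2), of f] by blast
  have gadd: "g (x + y) = g x + g y" for x y
    using g(1) by (simp add: Vector_Spaces.linear_iff)
  have g0: "g 0 = 0" using gadd[of 0 0] by simp
  have "x \<in> S \<and> g x = f x" if "x \<in> V.span B" for x
    using that
  proof (induction rule: V.span_induct_alt)
    case base
    show ?case using S0 f0 g0 by simp
  next
    case (step c x y)
    then show ?case
    proof (cases c)
      case zero
      then show ?thesis using step by (simp add: bit_scale_def)
    next
      case one
      then show ?thesis using step S f gadd g(2) B(1) by (auto simp: bit_scale_def)
    qed
  qed
  then have "g x = f x" if "x \<in> S" for x using that B(3) by blast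
  moreover have "lin (\<lambda>\<sigma>. g (gen2 \<sigma>)) x = g x" for x
    using additive_lin[of g x, OF gadd] by simp
  ultimately show thesis using that[of "\<lambda>\<sigma>. g (gen2 \<sigma>)"] by simp
qed

text \<open>\<open>R\<close> is membership in a subspace, closure being expressed by translation
  invariance. The functional extends the indicator of the coset of \<open>x\<close> from the span of
  \<open>R\<close> and \<open>x\<close>.\<close>

lemma separating_functional:
  assumes zero: "R 0" and add: "\<forall>v w. R v \<longrightarrow> R (v + w) = R w" and x: "\<not> R x"
  shows "\<exists>\<psi> :: 'b \<Rightarrow> bit. (\<forall>w. R w \<longrightarrow> lin \<psi> w = 0) \<and> (\<forall>w. R (w + x) \<longrightarrow> lin \<psi> w = 1)"
proof -
  define f where "f = (\<lambda>w. if R w then 0 else (1 :: bit))"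
  define W where "W = {w. R w \<or> R (w + x)}"
  have excl: "R (w + x) \<Longrightarrow> R w \<Longrightarrow> False" for w using add x by blast
  have "(v + w \<in> W) \<and> f (v + w) = f v + f w" if vw: "v \<in> W" "w \<in> W" for v w
  proof -
    consider "R v" "R w" | "R v" "R (w + x)" | "R (v + x)" "R w" | "R (v + x)" "R (w + x)"
      using vw by (auto simp: W_def)
    then show ?thesis
    proof cases
      case 1
      then have "R (v + w)" using add by blast
      then show ?thesis using 1 by (simp add: W_def f_def)
    next
      case 2
      then have "R (v + (w + x))" using add by blast
      then have "R (v + w + x)" by (simp add: add.assoc)
      then show ?thesis using 2 excl by (auto simp: W_def f_def)
    next
      case 3
      then have "R (w + (v + x))" using add by blast
      then have "R (v + w + x)" by (simp add: ac_simps)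
      then show ?thesis using 3 excl by (auto simp: W_def f_def)
    next
      case 4
      have "R ((v + x) + (w + x))" using 4 add by blast
      moreover have "(v + x) + (w + x) = v + w" by (simp add: ac_simps add_left_self add_self)
      ultimately have "R (v + w)" by simp
      then show ?thesis using 4 excl by (auto simp: W_def f_def)
    qed
  qed
  then obtain \<psi> where \<psi>: "\<And>w. w \<in> W \<Longrightarrow> lin \<psi> w = f w"
    using extend_functional[of W f] by blast
  have "lin \<psi> w = 0" if "R w" for w using \<psi>[of w] that by (simp add: W_def f_def)
  moreover have "lin \<psi> w = 1" if "R (w + x)" for w using \<psi>[of w] that excl by (auto simp: W_def f_def)
  ultimately show ?thesis by blast
qed

text \<open>\<open>\<psi>\<close> is prescribed on sums of a boundary and a chain in
  \<open>S\<close>, as the value of \<phi> on the bounding chain. Two choices of that chain differ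
  by a relative cycle, on which \<phi> vanishes.\<close>

lemma relative_coboundary:
  fixes \<phi> :: "'a cochain2"
  assumes \<phi>: "\<And>z. relcycle2 (Suc p) X S z \<Longrightarrow> lin \<phi> z = 0"
  obtains \<psi> where "\<And>c. singular_chain2 (Suc p) X c \<Longrightarrow> lin \<psi> (chain_boundary2 (Suc p) c) = lin \<phi> c"
    "\<And>a. singular_chain2 p (subtopology X S) a \<Longrightarrow> lin \<psi> a = 0"
proof -
  define P where "P = (\<lambda>w c. singular_chain2 (Suc p) X c \<and>
    singular_chain2 p (subtopology X S) (w + chain_boundary2 (Suc p) c))"
  define W where "W = {w. \<exists>c. P w c}"
  define f where "f = (\<lambda>w. lin \<phi> (SOME c. P w c))"
  have uniq: "lin \<phi> c = lin \<phi> d" if "P w c" "P w d" for w c d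
  proof -
    have "singular_chain2 p (subtopology X S) ((w + chain_boundary2 (Suc p) c) + (w
        + chain_boundary2 (Suc p) d))"
      by (rule singular_chain2_add) (use that in \<open>auto simp: P_def\<close>)
    moreover have "(w + chain_boundary2 (Suc p) c) + (w + chain_boundary2 (Suc p) d)
        = chain_boundary2 (Suc p) (c + d)"
      by (simp add: chain_boundary2_add ac_simps add_left_self)
    ultimately have "relcycle2 (Suc p) X S (c + d)"
      using that by (simp add: relcycle2_def P_def singular_chain2_add)
    from \<phi>[OF this] show ?thesis by (simp add: lin_add add_eq_0_iff_eq)
  qed
  have fP: "f w = lin \<phi> c" if "P w c" for w c
    unfolding f_def by (rule uniq[OF someI[of "P w" c] that]) (rule that)
  have Padd: "P (w + v) (c + d)" if "P w c" "P v d" for w v c d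
  proof -
    have "singular_chain2 p (subtopology X S) ((w + chain_boundary2 (Suc p) c) + (v
        + chain_boundary2 (Suc p) d))"
      by (rule singular_chain2_add) (use that in \<open>auto simp: P_def\<close>)
    then show ?thesis using that by (simp add: P_def singular_chain2_add chain_boundary2_add ac_simps)
  qed
  obtain \<psi> where \<psi>: "\<And>w. w \<in> W \<Longrightarrow> lin \<psi> w = f w"
  proof (rule extend_functional[of W f])
    show "x + y \<in> W" if "x \<in> W" "y \<in> W" for x y using that Padd unfolding W_def by blast
    show "f (x + y) = f x + f y" if xy: "x \<in> W" "y \<in> W" for x y
    proof -
      obtain c d where cd: "P x c" "P y d" using xy by (auto simp: W_def)
      then show ?thesis using fP[OF Padd[OF cd]] fP[OF cd(1)] fP[OF cd(2)] by (simp add: lin_add)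
    qed
  qed blast
  show thesis
  proof (rule that[of \<psi>])
    fix c assume "singular_chain2 (Suc p) X c"
    then have "P (chain_boundary2 (Suc p) c) c" by (simp add: P_def add_self)
    then show "lin \<psi> (chain_boundary2 (Suc p) c) = lin \<phi> c"
      using \<psi>[of "chain_boundary2 (Suc p) c"] fP[of "chain_boundary2 (Suc p) c" c] by (auto simp: W_def)
  next
    fix a assume "singular_chain2 p (subtopology X S) a"
    then have "P a 0" by (simp add: P_def)
    then show "lin \<psi> a = 0" using \<psi>[of a] fP[of a 0] by (auto simp: W_def)
  qed
qed

section \<open>Small cells and small chains\<close>

lemma compatible_metricD:
  assumes "compatible_metric M d"
  shows "d x x = 0" "d x y = d y x" "d x z \<le> d x y + d y z" "openin M {y \<in> topspace M. d x y < r}"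
proof -
  have "\<forall>x. d x x = 0" "\<forall>x y. d x y = d y x" "\<forall>x y z. d x z \<le> d x y + d y z"
    "\<forall>x e. openin M {y \<in> topspace M. d x y < e}"
    using assms unfolding compatible_metric_def by simp_all
  then show "d x x = 0" "d x y = d y x" "d x z \<le> d x y + d y z" "openin M {y \<in> topspace M. d x y < r}"
    by iprover+
qed

definition dsmall :: "('a \<Rightarrow> 'a \<Rightarrow> real) \<Rightarrow> real \<Rightarrow> 'a set \<Rightarrow> bool" where
  "dsmall d e S \<longleftrightarrow> (\<forall>x\<in>S. \<forall>y\<in>S. d x y < e)"

text \<open>A Lebesgue number for a cover by small cells.\<close>

lemma small_cell:
  assumes M: "closed_manifold n M" and d: "compatible_metric M d" and e: "e > 0"
  obtains \<delta> where "\<delta> > 0" "\<And>S. S \<subseteq> topspace M \<Longrightarrow> S \<noteq> {} \<Longrightarrow> dsmall d \<delta> S \<Longrightarrow>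
    \<exists>C. S \<subseteq> C \<and> C \<subseteq> topspace M \<and> local_cell n M C \<and> acyclic2 (subtopology M C) \<and> dsmall d e C"
proof -
  have dx: "d x x = 0" and sym: "d x y = d y x" and tri: "d x z \<le> d x y + d y z"
    and op: "openin M {y \<in> topspace M. d x y < r}" for x y z r
    using compatible_metricD[OF d] by blast+
  have nb: "\<exists>r>0. \<forall>y\<in>topspace M. d x y < r \<longrightarrow> y \<in> W" if "openin M W" "x \<in> W" for W x
    using d that unfolding compatible_metric_def by blast
  have "\<forall>x\<in>topspace M. \<exists>r>0. \<exists>C. {y \<in> topspace M. d x y < r} \<subseteq> C \<and> C \<subseteq> topspace M \<and> local_cell n M C \<and>
      acyclic2 (subtopology M C) \<and> dsmall d e C"
  proof
    fix x assume x: "x \<in> topspace M"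
    have W: "x \<in> {y \<in> topspace M. d x y < e / 2}" using x e dx by simp
    obtain C V where C: "openin M V" "x \<in> V" "V \<subseteq> C" "C \<subseteq> {y \<in> topspace M. d x y < e / 2}" "closedin M C"
      "local_cell n M C" "acyclic2 (subtopology M C)"
      by (rule cell_basis[OF M op W])
    obtain r where r: "r > 0" "\<forall>y\<in>topspace M. d x y < r \<longrightarrow> y \<in> V" using nb[OF C(1,2)] by blast
    have "dsmall d e C"
      unfolding dsmall_def
    proof (intro ballI)
      fix y z assume "y \<in> C" "z \<in> C"
      then have "d x y < e / 2" "d x z < e / 2" using C(4) by auto
      then show "d y z < e" using tri[of y z x] sym[of y x] by simp
    qed
    then show "\<exists>r>0. \<exists>C. {y \<in> topspace M. d x y < r} \<subseteq> C \<and> C \<subseteq> topspace M \<and> local_cell n M C \<and>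
      acyclic2 (subtopology M C) \<and> dsmall d e C"
      using r C by (intro exI[of _ r] conjI exI[of _ C]) auto
  qed
  from bchoice[OF this] obtain r where r: "\<forall>x\<in>topspace M. r x > 0 \<and> (\<exists>C. {y \<in> topspace M. d x y < r x} \<subseteq> C \<and>
      C \<subseteq> topspace M \<and> local_cell n M C \<and> acyclic2 (subtopology M C) \<and> dsmall d e C)" by blast
  have cM: "compact_space M" using M by (simp add: closed_manifold_def)
  obtain F where F: "finite F" "F \<subseteq> topspace M" "topspace M \<subseteq> \<Union>((\<lambda>x. {y \<in> topspace M. d x y < r x / 2}) ` F)"
  proof (rule compact_space_finite_subcover[OF cM, of "\<lambda>x. {y \<in> topspace M. d x y < r x / 2}"])
    show "openin M {y \<in> topspace M. d x y < r x / 2} \<and> x \<in> {y \<in> topspace M. d x y < r x / 2}"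
      if "x \<in> topspace M" for x
      using op[of x "r x / 2"] r that dx by simp
  qed
  \<comment> \<open>The cover uses half radii, so a set of diameter below \<delta> that meets a half
    ball stays in the full ball. The 1 takes care of an empty \<open>F\<close>.\<close>
  define \<delta> where "\<delta> = Min (insert 1 ((\<lambda>x. r x / 2) ` F))"
  have \<delta>: "\<delta> > 0" unfolding \<delta>_def using F r by (subst Min_gr_iff) auto
  have \<delta>le: "\<delta> \<le> r x / 2" if "x \<in> F" for x unfolding \<delta>_def using F that by (intro Min_le) auto
  show thesis
  proof (rule that[OF \<delta>])
    fix S assume S: "S \<subseteq> topspace M" "S \<noteq> {}" "dsmall d \<delta> S"
    obtain a where a: "a \<in> S" using S(2) by blast
    then obtain x where x: "x \<in> F" "d x a < r x / 2" using F(3) S(1) by auto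
    have "S \<subseteq> {y \<in> topspace M. d x y < r x}"
    proof
      fix y assume y: "y \<in> S"
      then have "d a y < \<delta>" using S(3) a by (auto simp: dsmall_def)
      then have "d x y < r x" using tri[of x y a] x(2) \<delta>le[OF x(1)] by simp
      then show "y \<in> {y \<in> topspace M. d x y < r x}" using y S(1) by blast
    qed
    then show "\<exists>C. S \<subseteq> C \<and> C \<subseteq> topspace M \<and> local_cell n M C \<and> acyclic2 (subtopology M C) \<and> dsmall d e C"
      using r F(2) x(1) by (meson subset_trans subsetD)
  qed
qed

definition small_chain :: "('a \<Rightarrow> 'a \<Rightarrow> real) \<Rightarrow> real \<Rightarrow> nat \<Rightarrow> 'a chain2 \<Rightarrow> bool" where
  "small_chain d e p c \<longleftrightarrow> (\<forall>\<sigma>\<in>Poly_Mapping.keys c. dsmall d e (\<sigma> ` standard_simplex p))"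

lemma sdiv_small_chain:
  assumes d: "compatible_metric M d" and e: "e > 0" and c: "singular_chain2 p M c"
  obtains m where "\<And>k. k \<ge> m \<Longrightarrow> small_chain d e p (sdiv k p c)"
proof -
  have dx: "d x x = 0" and sym: "d x y = d y x" and tri: "d x z \<le> d x y + d y z"
    and op: "openin M {y \<in> topspace M. d x y < r}" for x y z r
    using compatible_metricD[OF d] by blast+
  define \<C> where "\<C> = (\<lambda>x. {y \<in> topspace M. d x y < e / 2}) ` topspace M"
  have "topspace M \<subseteq> \<Union>\<C>" using e dx by (auto simp: \<C>_def)
  moreover have "openin M U" if "U \<in> \<C>" for U using that op[where r = "e / 2"] unfolding \<C>_def by blast
  ultimately obtain m where m: "\<And>k \<sigma>. m \<le> k \<Longrightarrow> \<sigma> \<in> Poly_Mapping.keys (sdiv k p c) \<Longrightarrow>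
    \<exists>V\<in>\<C>. \<sigma> ` standard_simplex p \<subseteq> V"
    using sdiv_small[OF _ _ c, of \<C>] by metis
  have "dsmall d e V" if "V \<in> \<C>" for V
    unfolding dsmall_def
  proof (intro ballI)
    fix y z assume "y \<in> V" "z \<in> V"
    then obtain x where "d x y < e / 2" "d x z < e / 2" using \<open>V \<in> \<C>\<close> by (auto simp: \<C>_def)
    then show "d y z < e" using tri[of y z x] sym[of y x] by simp
  qed
  then have "small_chain d e p (sdiv k p c)" if "m \<le> k" for k
    using m[OF that] unfolding small_chain_def dsmall_def by (meson subsetD)
  then show thesis by (rule that)
qed

section \<open>Local duality\<close>

text \<open>
  Poincare duality is obtained by acyclic carriers: a dual system is a chain map from small singular
  chains to cochains that preserves supports up to \<open>e\<close>.  Capping a fundamental cycle with it is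
  chain homotopic to the identity, by a homotopy with small supports.
\<close>

definition dual_system ::
  "nat \<Rightarrow> 'a topology \<Rightarrow> ('a \<Rightarrow> 'a \<Rightarrow> real) \<Rightarrow> nat \<Rightarrow> real \<Rightarrow> real \<Rightarrow> (nat \<Rightarrow> 'a simplex \<Rightarrow> 'a cochain2) \<Rightarrow> bool" where
  "dual_system n M d j e \<delta> D \<longleftrightarrow>
     (\<forall>i\<le>j. \<forall>\<sigma>. singular_simplex i M \<sigma> \<longrightarrow> dsmall d \<delta> (\<sigma> ` standard_simplex i) \<longrightarrow>
        (\<forall>c. singular_chain2 (Suc (n - i)) M c \<longrightarrow>
           lin (D i \<sigma>) (chain_boundary2 (Suc (n - i)) c) = lin (\<lambda>\<tau>. lin (D (i - 1) \<tau>) c) (bdry i \<sigma>)) \<and>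
        (\<forall>\<rho>. singular_simplex (n - i) M \<rho> \<longrightarrow> D i \<sigma> \<rho> \<noteq> 0 \<longrightarrow>
           (\<exists>x\<in>\<rho> ` standard_simplex (n - i). \<exists>y\<in>\<sigma> ` standard_simplex i. d x y < e)) \<and>
        (i = 0 \<longrightarrow> (\<forall>\<mu>. fundamental_cycle2 n M \<mu> \<longrightarrow> lin (D 0 \<sigma>) \<mu> = 1)))"

lemma singular_simplex_image: "singular_simplex p X \<sigma> \<Longrightarrow> \<sigma> ` standard_simplex p \<subseteq> topspace X"
  using compactin_subset_topspace[OF compactin_singular_simplex] .

lemma bdry_face:
  assumes \<sigma>: "singular_simplex p X \<sigma>" and \<tau>: "\<tau> \<in> Poly_Mapping.keys (bdry p \<sigma>)"
  shows "p > 0" "singular_simplex (p - 1) X \<tau>" "\<tau> ` standard_simplex (p - 1) \<subseteq> \<sigma> ` standard_simplex p"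
proof -
  show p: "p > 0" using \<tau> by (cases "p = 0") (auto simp: bdry_def)
  have "Poly_Mapping.keys (\<Sum>i\<le>p. gen2 (singular_face p i \<sigma>)) \<subseteq> (\<Union>i\<in>{..p}. Poly_Mapping.keys (gen2
      (singular_face p i \<sigma>)))"
    by (rule keys_sum)
  then obtain i where i: "i \<le> p" "\<tau> = singular_face p i \<sigma>" using \<tau> p by (auto simp: bdry_def)
  show "singular_simplex (p - 1) X \<tau>"
    using singular_simplex_singular_face[OF \<sigma>, of i] p i by simp
  show "\<tau> ` standard_simplex (p - 1) \<subseteq> \<sigma> ` standard_simplex p"
    using simplical_face_in_standard_simplex[of p i] p i by (auto simp: singular_face_def)
qed

lemma chain_boundary2_lin_fun: "chain_boundary2 p (lin h c) = lin (\<lambda>\<sigma>. chain_boundary2 p (h \<sigma>)) c"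
  by (simp add: chain_boundary2_lin lin_lin)

lemma lin_bdry_bdry:
  assumes "singular_simplex (Suc j) X \<sigma>"
  shows "lin (\<lambda>\<tau>. lin f (bdry j \<tau>)) (bdry (Suc j) \<sigma>) = 0"
proof -
  have "lin (\<lambda>\<tau>. lin f (bdry j \<tau>)) (bdry (Suc j) \<sigma>)
      = lin f (chain_boundary2 j (chain_boundary2 (Suc j) (gen2 \<sigma>)))"
    by (simp add: chain_boundary2_lin lin_lin)
  also have "\<dots> = 0" using boundary2_boundary2_Suc[of j X "gen2 \<sigma>"] assms by simp
  finally show ?thesis .
qed

lemma dsmall_mono: "dsmall d e S \<Longrightarrow> T \<subseteq> S \<Longrightarrow> e \<le> e' \<Longrightarrow> dsmall d e' T"
  unfolding dsmall_def by (meson less_le_trans subsetD)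

text \<open>Three steps, into the set, across it and out again, each shorter than r / 4.\<close>

lemma dsmall_neighbourhood:
  assumes d: "compatible_metric M d" and I: "dsmall d (r / 4) I" "I \<subseteq> topspace M" "r > 0"
  shows "I \<subseteq> {x \<in> topspace M. \<exists>y\<in>I. d x y < r / 4}" "dsmall d r {x \<in> topspace M. \<exists>y\<in>I. d x y < r / 4}"
proof -
  note dd = compatible_metricD[OF d]
  show "I \<subseteq> {x \<in> topspace M. \<exists>y\<in>I. d x y < r / 4}"
  proof
    fix x assume x: "x \<in> I"
    then have "x \<in> topspace M" using I(2) by blast
    moreover have "d x x < r / 4" using dd(1)[of x] I(3) by simp
    ultimately show "x \<in> {x \<in> topspace M. \<exists>y\<in>I. d x y < r / 4}" using x by blast
  qed
  show "dsmall d r {x \<in> topspace M. \<exists>y\<in>I. d x y < r / 4}"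
    unfolding dsmall_def
  proof (intro ballI)
    fix x z assume "x \<in> {x \<in> topspace M. \<exists>y\<in>I. d x y < r / 4}" "z \<in> {x \<in> topspace M. \<exists>y\<in>I. d x y < r / 4}"
    then obtain y w where "y \<in> I" "w \<in> I" "d x y < r / 4" "d z w < r / 4" by blast
    moreover have "d y w < r / 4" using I(1) \<open>y \<in> I\<close> \<open>w \<in> I\<close> by (simp add: dsmall_def)
    ultimately show "d x z < r"
      using dd(3)[of x z y] dd(3)[of y z w] dd(2)[of w z] I(3) by linarith
  qed
qed

lemma singular_chain2_avoid:
  assumes "singular_simplex p M \<rho>" "\<not> singular_chain2 p (subtopology M (topspace M - C)) (gen2 \<rho>)"
  shows "\<exists>x\<in>\<rho> ` standard_simplex p. x \<in> C"
  using assms singular_simplex_image[OF assms(1)] by (auto simp: singular_simplex_subtopology)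

text \<open>The dual of a small 0-simplex represents the generator of the n-th cohomology of (M, M -
  C) for a small cell \<open>C\<close> around it: the functional kills boundaries relative to M - C
  and is 1 on fundamental cycles. It vanishes on simplices that avoid \<open>C\<close>, hence its
  support is near.\<close>

lemma dual_system_0:
  assumes M: "closed_manifold n M" and d: "compatible_metric M d" and e: "e > 0"
  obtains \<delta> D where "\<delta> > 0" "dual_system n M d 0 e \<delta> D"
proof -
  let ?T = "topspace M"
  obtain \<mu>0 where \<mu>0: "fundamental_cycle2 n M \<mu>0" using fundamental_cycle_exists[OF M] .
  obtain \<delta> where \<delta>: "\<delta> > 0" "\<And>S. S \<subseteq> ?T \<Longrightarrow> S \<noteq> {} \<Longrightarrow> dsmall d \<delta> S \<Longrightarrow>
    \<exists>C. S \<subseteq> C \<and> C \<subseteq> ?T \<and> local_cell n M C \<and> acyclic2 (subtopology M C) \<and> dsmall d e C"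
    using small_cell[OF M d e] by blast
  have "\<exists>\<psi>. singular_simplex 0 M \<sigma> \<longrightarrow> dsmall d \<delta> (\<sigma> ` standard_simplex 0) \<longrightarrow>
      (\<forall>c. singular_chain2 (Suc n) M c \<longrightarrow> lin \<psi> (chain_boundary2 (Suc n) c) = 0) \<and>
      (\<forall>\<rho>. singular_simplex n M \<rho> \<longrightarrow> \<psi> \<rho> \<noteq> 0 \<longrightarrow>
           (\<exists>x\<in>\<rho> ` standard_simplex n. \<exists>y\<in>\<sigma> ` standard_simplex 0. d x y < e)) \<and>
      (\<forall>\<mu>. fundamental_cycle2 n M \<mu> \<longrightarrow> lin \<psi> \<mu> = (1 :: bit))" for \<sigma>
  proof (cases "singular_simplex 0 M \<sigma> \<and> dsmall d \<delta> (\<sigma> ` standard_simplex 0)")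
    case False
    then show ?thesis by blast
  next
    case True
    let ?I = "\<sigma> ` standard_simplex 0"
    have I: "?I \<subseteq> ?T" "?I \<noteq> {}" using singular_simplex_image True nonempty_standard_simplex by blast+
    obtain C where C: "?I \<subseteq> C" "C \<subseteq> ?T" "local_cell n M C" "dsmall d e C"
      using \<delta>(2)[OF I] True by blast
    have Cne: "C \<noteq> {}" using C(1) I(2) by blast
    obtain x0 where x0: "x0 \<in> C" using Cne by blast
    define R where "R = (\<lambda>w. singular_relboundary2 n M (?T - C) w)"
    have Radd: "R v \<Longrightarrow> R (v + w) \<longleftrightarrow> R w" for v w unfolding R_def by (rule relboundary2_add_cancel)
    have fund: "\<not> R \<mu>" "R (\<mu> + \<mu>0)" if "fundamental_cycle2 n M \<mu>" for \<mu>
    proof -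
      have "\<not> singular_relboundary2 n M (?T - {x0}) \<mu>"
        using that x0 C(2) unfolding fundamental_cycle2_def by blast
      then show nR: "\<not> R \<mu>" unfolding R_def using relboundary2_mono[of n M "?T - C" \<mu> "?T - {x0}"] x0 by blast
      have "relcycle2 n M (?T - C) \<mu>"
        using that by (simp add: fundamental_cycle2_def singular_cycle2_def relcycle2_def)
      then show "R (\<mu> + \<mu>0)"
        using fundamental_cycle_generates[OF \<mu>0 C(3) Cne C(2)] nR unfolding R_def by blast
    qed
    have R0: "R 0" by (simp add: R_def)
    have Rall: "\<forall>v w. R v \<longrightarrow> R (v + w) = R w" using Radd by blast
    obtain \<psi> :: "'a cochain2" where "(\<forall>w. R w \<longrightarrow> lin \<psi> w = 0) \<and> (\<forall>w. R (w + \<mu>0) \<longrightarrow> lin \<psi> w = 1)"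
      using separating_functional[of R \<mu>0, OF R0 Rall fund(1)[OF \<mu>0]] by blast
    then have \<psi>: "\<And>w. R w \<Longrightarrow> lin \<psi> w = 0" "\<And>w. R (w + \<mu>0) \<Longrightarrow> lin \<psi> w = 1" by blast+
    show ?thesis
    proof (intro exI[of _ \<psi>] impI conjI allI)
      fix c assume "singular_chain2 (Suc n) M c"
      then have "R (chain_boundary2 (Suc n) c)" unfolding R_def by (rule relboundary2_boundary)
      then show "lin \<psi> (chain_boundary2 (Suc n) c) = 0" by (rule \<psi>(1))
    next
      fix \<rho> assume \<rho>: "singular_simplex n M \<rho>" "\<psi> \<rho> \<noteq> 0"
      have "\<not> R (gen2 \<rho>)" using \<psi>(1)[of "gen2 \<rho>"] \<rho>(2) by auto
      then have "\<not> singular_chain2 n (subtopology M (?T - C)) (gen2 \<rho>)"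
        unfolding R_def using relboundary2_chain by blast
      then obtain x where x: "x \<in> \<rho> ` standard_simplex n" "x \<in> C" using singular_chain2_avoid[OF \<rho>(1)] by blast
      obtain y where y: "y \<in> ?I" using I(2) by blast
      have "d x y < e" using C(1,4) x(2) y unfolding dsmall_def by blast
      then show "\<exists>x\<in>\<rho> ` standard_simplex n. \<exists>y\<in>?I. d x y < e" using x(1) y by blast
    next
      fix \<mu> assume "fundamental_cycle2 n M \<mu>"
      then show "lin \<psi> \<mu> = 1" using fund(2) \<psi>(2) by blast
    qed
  qed
  then obtain \<Psi> where \<Psi>: "\<And>\<sigma>. singular_simplex 0 M \<sigma> \<longrightarrow> dsmall d \<delta> (\<sigma> ` standard_simplex 0) \<longrightarrow>
      (\<forall>c. singular_chain2 (Suc n) M c \<longrightarrow> lin (\<Psi> \<sigma>) (chain_boundary2 (Suc n) c) = 0) \<and>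
      (\<forall>\<rho>. singular_simplex n M \<rho> \<longrightarrow> \<Psi> \<sigma> \<rho> \<noteq> 0 \<longrightarrow>
           (\<exists>x\<in>\<rho> ` standard_simplex n. \<exists>y\<in>\<sigma> ` standard_simplex 0. d x y < e)) \<and>
      (\<forall>\<mu>. fundamental_cycle2 n M \<mu> \<longrightarrow> lin (\<Psi> \<sigma>) \<mu> = (1 :: bit))"
    by metis
  have "dual_system n M d 0 e \<delta> (\<lambda>_. \<Psi>)"
    unfolding dual_system_def using \<Psi> by (simp add: bdry_def)
  then show thesis using that \<delta>(1) by blast
qed

text \<open>The dual of the boundary of \<sigma> is a cocycle supported in a small cell around
  \<sigma>, and has to be the coboundary of a cochain supported there. The obstruction, its values
  on relative cycles of degree n - j, vanishes because there is no local homology when j > 0, and by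
  the normalization when j = 0.\<close>

lemma dual_system_Suc:
  assumes M: "closed_manifold n M" and d: "compatible_metric M d" and j: "Suc j \<le> n"
    and IH: "\<And>e. e > 0 \<Longrightarrow> \<exists>\<delta> D. \<delta> > 0 \<and> dual_system n M d j e \<delta> D" and e: "e > 0"
  shows "\<exists>\<delta> D. \<delta> > 0 \<and> dual_system n M d (Suc j) e \<delta> D"
proof -
  let ?T = "topspace M"
  obtain \<mu>0 where \<mu>0: "fundamental_cycle2 n M \<mu>0" using fundamental_cycle_exists[OF M] .
  obtain r where r: "r > 0" "\<And>S. S \<subseteq> ?T \<Longrightarrow> S \<noteq> {} \<Longrightarrow> dsmall d r S \<Longrightarrow>
    \<exists>C. S \<subseteq> C \<and> C \<subseteq> ?T \<and> local_cell n M C \<and> acyclic2 (subtopology M C) \<and> dsmall d e C"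
    using small_cell[OF M d e] by blast
  \<comment> \<open>Duals of faces must stay within r / 4 of \<sigma>, inside the neighbourhood that
    the cell \<open>C\<close> is chosen to contain.\<close>
  define e' where "e' = min e (r / 4)"
  have e': "e' > 0" "e' \<le> e" "e' \<le> r / 4" using e r(1) by (auto simp: e'_def)
  obtain \<delta>' D where \<delta>': "\<delta>' > 0" and D: "dual_system n M d j e' \<delta>' D" using IH[OF e'(1)] by blast
  define \<delta> where "\<delta> = min \<delta>' (r / 4)"
  have \<delta>: "\<delta> > 0" "\<delta> \<le> \<delta>'" "\<delta> \<le> r / 4" using \<delta>' r(1) by (auto simp: \<delta>_def)
  have Da: "lin (D i \<sigma>) (chain_boundary2 (Suc (n - i)) c) = lin (\<lambda>\<tau>. lin (D (i - 1) \<tau>) c) (bdry i \<sigma>)"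
    if "i \<le> j" "singular_simplex i M \<sigma>" "dsmall d \<delta>' (\<sigma> ` standard_simplex i)" "singular_chain2 (Suc
        (n - i)) M c"
    for i \<sigma> c using D that unfolding dual_system_def by blast
  have Db: "\<exists>x\<in>\<rho> ` standard_simplex (n - i). \<exists>y\<in>\<sigma> ` standard_simplex i. d x y < e'"
    if "i \<le> j" "singular_simplex i M \<sigma>" "dsmall d \<delta>' (\<sigma> ` standard_simplex i)"
      "singular_simplex (n - i) M \<rho>" "D i \<sigma> \<rho> \<noteq> 0" for i \<sigma> \<rho>
    using D that unfolding dual_system_def by blast
  have Dc: "lin (D 0 \<sigma>) \<mu> = 1"
    if "singular_simplex 0 M \<sigma>" "dsmall d \<delta>' (\<sigma> ` standard_simplex 0)" "fundamental_cycle2 n M \<mu>" for \<sigma> \<mu>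
    using D that unfolding dual_system_def by blast
  have nj: "Suc (n - Suc j) = n - j" using j by simp
  define good where "good = (\<lambda>\<sigma>. singular_simplex (Suc j) M \<sigma> \<and> dsmall d \<delta> (\<sigma> ` standard_simplex (Suc j)))"
  have "\<exists>\<psi>. good \<sigma> \<longrightarrow>
      (\<forall>c. singular_chain2 (n - j) M c \<longrightarrow>
         lin \<psi> (chain_boundary2 (n - j) c) = lin (\<lambda>\<tau>. lin (D j \<tau>) c) (bdry (Suc j) \<sigma>)) \<and>
      (\<forall>\<rho>. singular_simplex (n - Suc j) M \<rho> \<longrightarrow> \<psi> \<rho> \<noteq> 0 \<longrightarrow>
           (\<exists>x\<in>\<rho> ` standard_simplex (n - Suc j). \<exists>y\<in>\<sigma> ` standard_simplex (Suc j). d x y < e))" for \<sigma>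
  proof (cases "good \<sigma>")
    case False
    then show ?thesis by blast
  next
    case True
    let ?I = "\<sigma> ` standard_simplex (Suc j)"
    have \<sigma>: "singular_simplex (Suc j) M \<sigma>" "dsmall d \<delta> ?I" using True by (auto simp: good_def)
    have I: "?I \<subseteq> ?T" "?I \<noteq> {}" using singular_simplex_image \<sigma> nonempty_standard_simplex by blast+
    let ?S = "{x \<in> ?T. \<exists>y\<in>?I. d x y < r / 4}"
    have "dsmall d (r / 4) ?I" by (rule dsmall_mono[OF \<sigma>(2) order_refl \<delta>(3)])
    note S = dsmall_neighbourhood[OF d this I(1) r(1)]
    have Sne: "?S \<subseteq> ?T" "?S \<noteq> {}" using S(1) I(2) by blast+
    obtain C where C: "?S \<subseteq> C" "C \<subseteq> ?T" "local_cell n M C" "dsmall d e C"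
      using r(2)[OF Sne S(2)] by blast
    have Cne: "C \<noteq> {}" using C(1) Sne(2) by blast
    have face: "singular_simplex j M \<tau>" "\<tau> ` standard_simplex j \<subseteq> ?I" "dsmall d \<delta>' (\<tau> ` standard_simplex j)"
      if "\<tau> \<in> Poly_Mapping.keys (bdry (Suc j) \<sigma>)" for \<tau>
      using bdry_face[OF \<sigma>(1) that] dsmall_mono[OF \<sigma>(2) _ \<delta>(2)] by auto
    define \<phi> where "\<phi> = (\<lambda>\<rho>. lin (\<lambda>\<tau>. D j \<tau> \<rho>) (bdry (Suc j) \<sigma>))"
    have ev: "lin \<phi> z = lin (\<lambda>\<tau>. lin (D j \<tau>) z) (bdry (Suc j) \<sigma>)" for z
      unfolding \<phi>_def by (rule lin_swap)
    have \<phi>0: "lin \<phi> a = 0" if a: "singular_chain2 (n - j) (subtopology M (?T - C)) a" for a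
    proof (rule lin_eq_0[OF a])
      fix \<rho> assume "singular_simplex (n - j) (subtopology M (?T - C)) \<rho>"
      then have \<rho>: "singular_simplex (n - j) M \<rho>" "\<rho> ` standard_simplex (n - j) \<subseteq> ?T - C"
        by (auto simp: singular_simplex_subtopology)
      have "D j \<tau> \<rho> = 0" if \<tau>: "\<tau> \<in> Poly_Mapping.keys (bdry (Suc j) \<sigma>)" for \<tau>
      proof (rule ccontr)
        assume "D j \<tau> \<rho> \<noteq> 0"
        then obtain x y where xy: "x \<in> \<rho> ` standard_simplex (n - j)" "y \<in> \<tau> ` standard_simplex j" "d x y < e'"
          using Db[OF order_refl face(1)[OF \<tau>] face(3)[OF \<tau>] \<rho>(1)] by blast
        have "y \<in> ?I" using face(2)[OF \<tau>] xy(2) by blast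
        moreover have "d x y < r / 4" using xy(3) e'(3) by simp
        moreover have "x \<in> ?T" using xy(1) \<rho>(2) by blast
        ultimately have "x \<in> ?S" by blast
        then show False using C(1) xy(1) \<rho>(2) by blast
      qed
      then show "\<phi> \<rho> = 0" unfolding \<phi>_def lin_def by simp
    qed
    have \<phi>b: "lin \<phi> (chain_boundary2 (Suc (n - j)) c) = 0" if c: "singular_chain2 (Suc (n - j)) M c" for c
    proof -
      have "lin \<phi> (chain_boundary2 (Suc (n - j)) c) =
        lin (\<lambda>\<tau>. lin (\<lambda>\<upsilon>. lin (D (j - 1) \<upsilon>) c) (bdry j \<tau>)) (bdry (Suc j) \<sigma>)"
        unfolding ev by (rule lin_cong) (rule Da[OF order_refl face(1) face(3) c])
      also have "\<dots> = 0" by (rule lin_bdry_bdry[OF \<sigma>(1)])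
      finally show ?thesis .
    qed
    have \<phi>rb: "lin \<phi> z = 0" if zb: "singular_relboundary2 (n - j) M (?T - C) z" for z
    proof -
      obtain b a where b: "singular_chain2 (Suc (n - j)) M b" "singular_chain2 (n - j) (subtopology
          M (?T - C)) a"
        "z = chain_boundary2 (Suc (n - j)) b + a" using zb unfolding relboundary2_iff by blast
      show ?thesis unfolding b(3) lin_add using \<phi>b[OF b(1)] \<phi>0[OF b(2)] by simp
    qed
    have \<phi>rel: "lin \<phi> z = 0" if z: "relcycle2 (n - j) M (?T - C) z" for z
    proof (cases "j = 0")
      case False
      then have "n - j \<noteq> n" using j by simp
      then have "singular_relboundary2 (n - j) M (?T - C) z"
        using C(3) z unfolding local_cell_def by blast
      then show ?thesis by (rule \<phi>rb)
    next
      case j0: True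
      have "lin \<phi> \<mu>0 = lin (\<lambda>\<tau>. 1) (bdry (Suc j) \<sigma>)" unfolding ev
        by (rule lin_cong) (use Dc[OF _ _ \<mu>0] face j0 in auto)
      \<comment> \<open>The two end points of an edge contribute 1 + 1.\<close>
      also have "\<dots> = 0" by (simp add: bdry_def lin_sum lin_add j0)
      finally have \<mu>: "lin \<phi> \<mu>0 = 0" .
      have "singular_relboundary2 n M (?T - C) z \<or> singular_relboundary2 n M (?T - C) (z + \<mu>0)"
        by (rule fundamental_cycle_generates[OF \<mu>0 C(3) Cne C(2)]) (use z j0 in simp)
      then show ?thesis using \<phi>rb[of z] \<phi>rb[of "z + \<mu>0"] \<mu> j0 by (auto simp: lin_add)
    qed
    obtain \<psi> where \<psi>: "\<And>c. singular_chain2 (n - j) M c \<Longrightarrow> lin \<psi> (chain_boundary2 (n - j) c) = lin \<phi> c"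
      "\<And>a. singular_chain2 (n - Suc j) (subtopology M (?T - C)) a \<Longrightarrow> lin \<psi> a = 0"
      using relative_coboundary[of "n - Suc j" M "?T - C" \<phi>, unfolded nj] \<phi>rel by blast
    show ?thesis
    proof (intro exI[of _ \<psi>] impI conjI allI)
      fix c assume "singular_chain2 (n - j) M c"
      then show "lin \<psi> (chain_boundary2 (n - j) c) = lin (\<lambda>\<tau>. lin (D j \<tau>) c) (bdry (Suc j) \<sigma>)"
        using \<psi>(1) ev by simp
    next
      fix \<rho> assume \<rho>: "singular_simplex (n - Suc j) M \<rho>" "\<psi> \<rho> \<noteq> 0"
      then have "\<not> singular_chain2 (n - Suc j) (subtopology M (?T - C)) (gen2 \<rho>)"
        using \<psi>(2)[of "gen2 \<rho>"] by auto
      then obtain x where x: "x \<in> \<rho> ` standard_simplex (n - Suc j)" "x \<in> C"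
        using singular_chain2_avoid[OF \<rho>(1)] by blast
      obtain y where y: "y \<in> ?I" using I(2) by blast
      have "y \<in> C" using C(1) S(1) y by blast
      then have "d x y < e" using C(4) x(2) unfolding dsmall_def by blast
      then show "\<exists>x\<in>\<rho> ` standard_simplex (n - Suc j). \<exists>y\<in>?I. d x y < e" using x(1) y by blast
    qed
  qed
  then obtain \<Psi> where \<Psi>: "\<And>\<sigma>. good \<sigma> \<longrightarrow>
      (\<forall>c. singular_chain2 (n - j) M c \<longrightarrow>
         lin (\<Psi> \<sigma>) (chain_boundary2 (n - j) c) = lin (\<lambda>\<tau>. lin (D j \<tau>) c) (bdry (Suc j) \<sigma>)) \<and>
      (\<forall>\<rho>. singular_simplex (n - Suc j) M \<rho> \<longrightarrow> \<Psi> \<sigma> \<rho> \<noteq> 0 \<longrightarrow>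
           (\<exists>x\<in>\<rho> ` standard_simplex (n - Suc j). \<exists>y\<in>\<sigma> ` standard_simplex (Suc j). d x y < e))"
    by metis
  define E where "E = D(Suc j := \<Psi>)"
  have Ei: "E i = D i" if "i \<le> j" for i using that by (simp add: E_def)
  have ES: "E (Suc j) = \<Psi>" by (simp add: E_def)
  have "dual_system n M d (Suc j) e \<delta> E"
    unfolding dual_system_def
  proof (intro allI impI)
    fix i \<sigma> assume i: "i \<le> Suc j" and \<sigma>: "singular_simplex i M \<sigma>" "dsmall d \<delta> (\<sigma> ` standard_simplex i)"
    show "(\<forall>c. singular_chain2 (Suc (n - i)) M c \<longrightarrow>
           lin (E i \<sigma>) (chain_boundary2 (Suc (n - i)) c) = lin (\<lambda>\<tau>. lin (E (i - 1) \<tau>) c) (bdry i \<sigma>)) \<and>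
        (\<forall>\<rho>. singular_simplex (n - i) M \<rho> \<longrightarrow> E i \<sigma> \<rho> \<noteq> 0 \<longrightarrow>
           (\<exists>x\<in>\<rho> ` standard_simplex (n - i). \<exists>y\<in>\<sigma> ` standard_simplex i. d x y < e)) \<and>
        (i = 0 \<longrightarrow> (\<forall>\<mu>. fundamental_cycle2 n M \<mu> \<longrightarrow> lin (E 0 \<sigma>) \<mu> = 1))"
    proof (cases "i = Suc j")
      case True
      then have "good \<sigma>" using \<sigma> by (simp add: good_def)
      then show ?thesis using \<Psi>[of \<sigma>] True by (simp add: ES Ei nj)
    next
      case False
      then have ij: "i \<le> j" using i by simp
      have sm: "dsmall d \<delta>' (\<sigma> ` standard_simplex i)" by (rule dsmall_mono[OF \<sigma>(2) order_refl \<delta>(2)])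
      have Ep: "E (i - 1) = D (i - 1)" by (rule Ei) (use ij in simp)
      show ?thesis
      proof (intro conjI allI impI)
        fix c assume "singular_chain2 (Suc (n - i)) M c"
        then show "lin (E i \<sigma>) (chain_boundary2 (Suc (n - i)) c) = lin (\<lambda>\<tau>. lin (E (i - 1) \<tau>) c) (bdry i \<sigma>)"
          using Da[OF ij \<sigma>(1) sm] unfolding Ei[OF ij] Ep by blast
      next
        fix \<rho> assume "singular_simplex (n - i) M \<rho>" "E i \<sigma> \<rho> \<noteq> 0"
        then have "\<exists>x\<in>\<rho> ` standard_simplex (n - i). \<exists>y\<in>\<sigma> ` standard_simplex i. d x y < e'"
          using Db[OF ij \<sigma>(1) sm] by (simp add: Ei[OF ij])
        then show "\<exists>x\<in>\<rho> ` standard_simplex (n - i). \<exists>y\<in>\<sigma> ` standard_simplex i. d x y < e"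
          using e'(2) by (meson less_le_trans)
      next
        fix \<mu> assume "i = 0" "fundamental_cycle2 n M \<mu>"
        then show "lin (E 0 \<sigma>) \<mu> = 1" using Dc[of \<sigma> \<mu>] \<sigma>(1) sm Ei[of 0] by simp
      qed
    qed
  qed
  then show ?thesis using \<delta>(1) by blast
qed

lemma dual_system_exists:
  assumes M: "closed_manifold n M" and d: "compatible_metric M d"
  shows "j \<le> n \<Longrightarrow> e > 0 \<Longrightarrow> \<exists>\<delta> D. \<delta> > 0 \<and> dual_system n M d j e \<delta> D"
proof (induction j arbitrary: e)
  case 0
  then show ?case using dual_system_0[OF M d, of e] by metis
next
  case (Suc j)
  show ?case by (rule dual_system_Suc[OF M d Suc.prems(1) Suc.IH Suc.prems(2)]) (use Suc.prems in auto)
qed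

section \<open>Capping with a dual system is homotopic to the identity\<close>

lemma front_face_image:
  assumes "singular_simplex (q + r) X \<tau>"
  shows "singular_simplex q X (front_face q \<tau>)"
    "front_face q \<tau> ` standard_simplex q \<subseteq> \<tau> ` standard_simplex (q + r)"
proof -
  have A: "[0..<Suc q] \<noteq> []" "set [0..<Suc q] \<subseteq> {..q + r}" "length [0..<Suc q] - 1 = q" by auto
  show "singular_simplex q X (front_face q \<tau>)"
    "front_face q \<tau> ` standard_simplex q \<subseteq> \<tau> ` standard_simplex (q + r)"
    using singular_simplex_list_face[OF assms A(1,2)] unfolding A(3) front_face_list_face by blast+
qed

lemma back_face_image:
  assumes "singular_simplex (q + r) X \<tau>"
  shows "singular_simplex r X (back_face q r \<tau>)"
    "back_face q r \<tau> ` standard_simplex r \<subseteq> \<tau> ` standard_simplex (q + r)"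
proof -
  have A: "[q..<Suc (q + r)] \<noteq> []" "set [q..<Suc (q + r)] \<subseteq> {..q + r}" "length [q..<Suc (q + r)] - 1
      = r" by auto
  show "singular_simplex r X (back_face q r \<tau>)"
    "back_face q r \<tau> ` standard_simplex r \<subseteq> \<tau> ` standard_simplex (q + r)"
    using singular_simplex_list_face[OF assms A(1,2)] unfolding A(3) back_face_list_face by blast+
qed

lemma singular_chain2_cap2:
  assumes c: "singular_chain2 (q + r) X c"
    and C: "\<And>\<tau>. \<tau> \<in> Poly_Mapping.keys c \<Longrightarrow> \<phi> (front_face q \<tau>) \<noteq> 0 \<Longrightarrow>
      \<tau> ` standard_simplex (q + r) \<subseteq> C"
  shows "singular_chain2 r (subtopology X C) (cap2 q r c \<phi>)"
  unfolding cap2_lin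
proof (rule singular_chain2_lin)
  fix \<tau> assume \<tau>: "\<tau> \<in> Poly_Mapping.keys c"
  have s: "singular_simplex (q + r) X \<tau>" using c \<tau> unfolding singular_chain2_def by blast
  show "singular_chain2 r (subtopology X C) (Poly_Mapping.single (back_face q r \<tau>) (\<phi> (front_face q \<tau>)))"
  proof (cases "\<phi> (front_face q \<tau>) = 0")
    case False
    note bf = back_face_image[OF s]
    have "back_face q r \<tau> ` standard_simplex r \<subseteq> C" using bf(2) C[OF \<tau> False] by (rule order_trans)
    then have "singular_simplex r (subtopology X C) (back_face q r \<tau>)"
      using bf(1) by (simp add: singular_simplex_subtopology)
    then show ?thesis using False by (simp add: bit_not_zero_iff)
  qed simp
qed



lemma augmentation_cap2:
  assumes "singular_chain2 n X c"
  shows "lin (\<lambda>_. 1 :: bit) (cap2 n 0 c \<phi>) = lin \<phi> c"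
  unfolding cap2_eval
proof (rule lin_eq[OF assms])
  fix \<tau> assume "singular_simplex n X \<tau>"
  then have "front_face n \<tau> = \<tau>" unfolding front_face_list_face by (rule list_face_all)
  then show "cup2 n 0 \<phi> (\<lambda>_. 1) \<tau> = \<phi> \<tau>" by (simp add: cup2_def)
qed



lemma dual_systemD:
  assumes "dual_system n M d j e \<delta> D" "i \<le> j" "singular_simplex i M \<sigma>" "dsmall d \<delta> (\<sigma> ` standard_simplex i)"
  shows "singular_chain2 (Suc (n - i)) M c \<Longrightarrow>
      lin (D i \<sigma>) (chain_boundary2 (Suc (n - i)) c) = lin (\<lambda>\<tau>. lin (D (i - 1) \<tau>) c) (bdry i \<sigma>)"
    and "singular_simplex (n - i) M \<rho> \<Longrightarrow> D i \<sigma> \<rho> \<noteq> 0 \<Longrightarrow>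
      \<exists>x\<in>\<rho> ` standard_simplex (n - i). \<exists>y\<in>\<sigma> ` standard_simplex i. d x y < e"
    and "i = 0 \<Longrightarrow> fundamental_cycle2 n M \<mu> \<Longrightarrow> lin (D 0 \<sigma>) \<mu> = 1"
  using assms unfolding dual_system_def by blast+

lemma dual_system_mono:
  assumes D: "dual_system n M d j e \<delta> D" and e: "e \<le> e'"
  shows "dual_system n M d j e' \<delta> D"
  unfolding dual_system_def
proof (intro allI impI conjI)
  fix i \<sigma> \<rho>
  assume h: "i \<le> j" "singular_simplex i M \<sigma>" "dsmall d \<delta> (\<sigma> ` standard_simplex i)"
    and \<rho>: "singular_simplex (n - i) M \<rho>" "D i \<sigma> \<rho> \<noteq> 0"
  show "\<exists>x\<in>\<rho> ` standard_simplex (n - i). \<exists>y\<in>\<sigma> ` standard_simplex i. d x y < e'"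
    using dual_systemD(2)[OF D h, OF \<rho>] e by (meson less_le_trans)
qed (use dual_systemD[OF D] in blast)+

lemma boundary_cap_dual:
  assumes D: "dual_system n M d j e \<delta> D" and i: "Suc i \<le> j" "Suc i \<le> n"
    and \<sigma>: "singular_simplex (Suc i) M \<sigma>" "dsmall d \<delta> (\<sigma> ` standard_simplex (Suc i))"
    and \<mu>: "singular_cycle2 n M \<mu>"
  shows "chain_boundary2 (Suc i) (cap2 (n - Suc i) (Suc i) \<mu> (D (Suc i) \<sigma>)) =
    lin (\<lambda>\<tau>. cap2 (n - i) i \<mu> (D i \<tau>)) (bdry (Suc i) \<sigma>)"
proof -
  have n: "Suc (n - Suc i + i) = n" "Suc (n - Suc i) = n - i" "n - i + i = n" using i(2) by auto
  have \<mu>': "singular_chain2 n M \<mu>" "chain_boundary2 n \<mu> = 0" using \<mu> by (auto simp: singular_cycle2_def)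
  have "cap2 (n - Suc i) i (chain_boundary2 n \<mu>) (D (Suc i) \<sigma>) = 0"
    unfolding \<mu>'(2) by (simp add: cap2_lin)
  then have "chain_boundary2 (Suc i) (cap2 (n - Suc i) (Suc i) \<mu> (D (Suc i) \<sigma>)) =
      cap2 (n - i) i \<mu> (cobd (n - Suc i) (D (Suc i) \<sigma>))"
    using cap2_boundary[of "n - Suc i" i \<mu> "D (Suc i) \<sigma>"] unfolding n
    by (metis add_eq_0_iff_eq)
  also have "\<dots> = cap2 (n - i) i \<mu> (\<lambda>\<rho>. lin (\<lambda>\<tau>. D i \<tau> \<rho>) (bdry (Suc i) \<sigma>))"
  proof (rule cap2_cong)
    show "singular_chain2 (n - i + i) M \<mu>" using \<mu>'(1) n(3) by simp
    fix \<rho> assume "singular_simplex (n - i) M \<rho>"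
    then show "cobd (n - Suc i) (D (Suc i) \<sigma>) \<rho> = lin (\<lambda>\<tau>. D i \<tau> \<rho>) (bdry (Suc i) \<sigma>)"
      using dual_systemD(1)[OF D i(1) \<sigma>, of "gen2 \<rho>"] by (simp add: cobd_def n)
  qed
  also have "\<dots> = lin (\<lambda>\<tau>. cap2 (n - i) i \<mu> (D i \<tau>)) (bdry (Suc i) \<sigma>)" by (rule cap2_lin_cochain)
  finally show ?thesis .
qed

text \<open>The homotopy is built degree by degree; \<open>J\<close> is the first degree not yet
  reached. In degree 0 the last summand is 0 because the boundary of a 0-simplex is, so the
  truncated index i - 1 is harmless.\<close>

definition cap_homotopy ::
  "nat \<Rightarrow> 'a topology \<Rightarrow> ('a \<Rightarrow> 'a \<Rightarrow> real) \<Rightarrow> nat \<Rightarrow> real \<Rightarrow> real \<Rightarrow> (nat \<Rightarrow> 'a simplex \<Rightarrow> 'a cochain2) \<Rightarrow>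
     'a chain2 \<Rightarrow> (nat \<Rightarrow> 'a simplex \<Rightarrow> 'a chain2) \<Rightarrow> bool" where
  "cap_homotopy n M d J e \<delta> D \<mu> G \<longleftrightarrow>
     (\<forall>i<J. \<forall>\<sigma>. singular_simplex i M \<sigma> \<longrightarrow> dsmall d \<delta> (\<sigma> ` standard_simplex i) \<longrightarrow>
        singular_chain2 (Suc i) M (G i \<sigma>) \<and>
        chain_boundary2 (Suc i) (G i \<sigma>) =
          gen2 \<sigma> + cap2 (n - i) i \<mu> (D i \<sigma>) + lin (G (i - 1)) (bdry i \<sigma>) \<and>
        (\<forall>\<tau>\<in>Poly_Mapping.keys (G i \<sigma>). \<forall>x\<in>\<tau> ` standard_simplex (Suc i). \<exists>y\<in>\<sigma> ` standard_simplex i. d x y < e))"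

lemma cap_homotopyD:
  assumes "cap_homotopy n M d J e \<delta> D \<mu> G" "i < J" "singular_simplex i M \<sigma>" "dsmall d \<delta> (\<sigma> `
      standard_simplex i)"
  shows "singular_chain2 (Suc i) M (G i \<sigma>)"
    and "chain_boundary2 (Suc i) (G i \<sigma>) =
          gen2 \<sigma> + cap2 (n - i) i \<mu> (D i \<sigma>) + lin (G (i - 1)) (bdry i \<sigma>)"
    and "\<tau> \<in> Poly_Mapping.keys (G i \<sigma>) \<Longrightarrow> x \<in> \<tau> ` standard_simplex (Suc i) \<Longrightarrow>
      \<exists>y\<in>\<sigma> ` standard_simplex i. d x y < e"
  using assms unfolding cap_homotopy_def by blast+

text \<open>The method of acyclic carriers: the error chain \<open>z\<close> is a cycle inside one
  cell \<open>C\<close> around \<sigma>, with augmentation 0 when J = 0, so it bounds in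
  \<open>C\<close>; the diameter of \<open>C\<close> controls the support of the new
  homotopy.\<close>

lemma cap_homotopy_Suc:
  assumes M: "closed_manifold n M" and d: "compatible_metric M d" and J: "J \<le> j" "j \<le> n"
    and e: "e > 0"
    and r: "r > 0" "\<And>S. S \<subseteq> topspace M \<Longrightarrow> S \<noteq> {} \<Longrightarrow> dsmall d r S \<Longrightarrow>
      \<exists>C. S \<subseteq> C \<and> C \<subseteq> topspace M \<and> local_cell n M C \<and> acyclic2 (subtopology M C) \<and> dsmall d e C"
    and D: "dual_system n M d j (r / 8) \<delta> D" and \<delta>: "\<delta> \<le> r / 4"
    and \<mu>: "fundamental_cycle2 n M \<mu>" "small_chain d (r / 8) n \<mu>"
    and G: "cap_homotopy n M d J (r / 4) \<delta> D \<mu> G"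
    and \<sigma>: "singular_simplex J M \<sigma>" "dsmall d \<delta> (\<sigma> ` standard_simplex J)"
  shows "\<exists>w. singular_chain2 (Suc J) M w \<and>
        chain_boundary2 (Suc J) w = gen2 \<sigma> + cap2 (n - J) J \<mu> (D J \<sigma>) + lin (G (J - 1)) (bdry J \<sigma>) \<and>
        (\<forall>\<tau>\<in>Poly_Mapping.keys w. \<forall>x\<in>\<tau> ` standard_simplex (Suc J). \<exists>y\<in>\<sigma> ` standard_simplex J. d x y < e)"
proof -
  let ?T = "topspace M" and ?I = "\<sigma> ` standard_simplex J"
  note dd = compatible_metricD[OF d]
  have I: "?I \<subseteq> ?T" "?I \<noteq> {}" using singular_simplex_image \<sigma> nonempty_standard_simplex by blast+
  let ?S = "{x \<in> ?T. \<exists>y\<in>?I. d x y < r / 4}"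
  have "dsmall d (r / 4) ?I" by (rule dsmall_mono[OF \<sigma>(2) order_refl \<delta>])
  note S = dsmall_neighbourhood[OF d this I(1) r(1)]
  have Sne: "?S \<subseteq> ?T" "?S \<noteq> {}" using S(1) I(2) by blast+
  obtain C where C: "?S \<subseteq> C" "C \<subseteq> ?T" "acyclic2 (subtopology M C)" "dsmall d e C"
    using r(2)[OF Sne S(2)] by blast
  have IC: "?I \<subseteq> C" using S(1) C(1) by blast
  have \<mu>': "singular_chain2 n M \<mu>" "chain_boundary2 n \<mu> = 0" "singular_cycle2 n M \<mu>"
    using \<mu>(1) by (auto simp: fundamental_cycle2_def singular_cycle2_def)
  have nJ: "n - J + J = n" using J by simp
  have face: "singular_simplex (J - 1) M \<tau>" "\<tau> ` standard_simplex (J - 1) \<subseteq> ?I"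
      "dsmall d \<delta> (\<tau> ` standard_simplex (J - 1))" "J - 1 < J" "Suc (J - 1) = J"
    if "\<tau> \<in> Poly_Mapping.keys (bdry J \<sigma>)" for \<tau>
    using bdry_face[OF \<sigma>(1) that] dsmall_mono[OF \<sigma>(2) _ order_refl] by auto
  define z where "z = gen2 \<sigma> + cap2 (n - J) J \<mu> (D J \<sigma>) + lin (G (J - 1)) (bdry J \<sigma>)"
  \<comment> \<open>A simplex of \<mu> that contributes has its front face within r / 8 of \<sigma>
    and diameter below r / 8, so it lies in the r / 4 neighbourhood and thus in
    \<open>C\<close>.\<close>
  have zcap: "singular_chain2 J (subtopology M C) (cap2 (n - J) J \<mu> (D J \<sigma>))"
  proof (rule singular_chain2_cap2, unfold nJ)
    show "singular_chain2 n M \<mu>" by (rule \<mu>'(1))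
    fix \<tau> assume \<tau>: "\<tau> \<in> Poly_Mapping.keys \<mu>" "D J \<sigma> (front_face (n - J) \<tau>) \<noteq> 0"
    have s: "singular_simplex n M \<tau>" using \<mu>'(1) \<tau> unfolding singular_chain2_def by blast
    have s': "singular_simplex (n - J + J) M \<tau>" using s nJ by simp
    note ff = front_face_image[OF s', unfolded nJ]
    obtain x y where x: "x \<in> front_face (n - J) \<tau> ` standard_simplex (n - J)" and y: "y \<in> ?I" "d x y < r / 8"
      using dual_systemD(2)[OF D J(1) \<sigma>, OF ff(1) \<tau>(2)] by (elim bexE)
    have xy: "x \<in> \<tau> ` standard_simplex n" "y \<in> ?I" "d x y < r / 8"
      using subsetD[OF ff(2) x] y by simp_all
    show "\<tau> ` standard_simplex n \<subseteq> C"
    proof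
      fix w assume w: "w \<in> \<tau> ` standard_simplex n"
      have "d w x < r / 8" using \<mu>(2) \<tau>(1) w xy(1) unfolding small_chain_def dsmall_def by blast
      then have "d w y < r / 4" using dd(3)[of w y x] xy(3) by linarith
      moreover have "w \<in> ?T" using w singular_simplex_image[OF s] by blast
      ultimately show "w \<in> C" using C(1) xy(2) by blast
    qed
  qed
  have zG: "singular_chain2 J (subtopology M C) (lin (G (J - 1)) (bdry J \<sigma>))"
  proof (rule singular_chain2_lin)
    fix \<tau> assume \<tau>: "\<tau> \<in> Poly_Mapping.keys (bdry J \<sigma>)"
    note f = face[OF \<tau>]
    note g = cap_homotopyD[OF G f(4) f(1) f(3), unfolded f(5)]
    show "singular_chain2 J (subtopology M C) (G (J - 1) \<tau>)"
      unfolding singular_chain2_subtopology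
    proof (intro conjI ballI subsetI)
      show "singular_chain2 J M (G (J - 1) \<tau>)" by (rule g(1))
      fix \<upsilon> x assume \<upsilon>: "\<upsilon> \<in> Poly_Mapping.keys (G (J - 1) \<tau>)" and x: "x \<in> \<upsilon> ` standard_simplex J"
      obtain y where "y \<in> ?I" "d x y < r / 4" using g(3)[OF \<upsilon> x] f(2) by blast
      moreover have "singular_simplex J M \<upsilon>" using g(1) \<upsilon> unfolding singular_chain2_def by blast
      then have "x \<in> ?T" using singular_simplex_image x by blast
      ultimately show "x \<in> C" using C(1) by blast
    qed
  qed
  have z\<sigma>: "singular_chain2 J (subtopology M C) (gen2 \<sigma>)"
    using \<sigma>(1) IC by (simp add: singular_simplex_subtopology)
  have zC: "singular_chain2 J (subtopology M C) z"
    unfolding z_def using z\<sigma> zcap zG by (intro singular_chain2_add)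
  \<comment> \<open>Both \<sigma> and the cap product have augmentation 1, the latter because
    \<open>D 0 \<sigma>\<close> is 1 on fundamental cycles.\<close>
  have aug: "lin (\<lambda>_. 1 :: bit) z = 0" if J0: "J = 0"
  proof -
    have "lin (\<lambda>_. 1 :: bit) (cap2 n 0 \<mu> (D 0 \<sigma>)) = 1"
      using augmentation_cap2[OF \<mu>'(1)] dual_systemD(3)[OF D J(1) \<sigma> J0 \<mu>(1)] by simp
    then show ?thesis using J0 by (simp add: z_def lin_add bdry_def)
  qed
  have bz: "chain_boundary2 J z = 0"
  proof (cases J)
    case (Suc i)
    have i: "Suc i \<le> j" "Suc i \<le> n" using J Suc by auto
    have Gb: "chain_boundary2 (Suc i) (lin (G i) (bdry (Suc i) \<sigma>)) =
        lin (\<lambda>\<tau>. gen2 \<tau> + cap2 (n - i) i \<mu> (D i \<tau>) + lin (G (i - 1)) (bdry i \<tau>)) (bdry (Suc i) \<sigma>)"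
      unfolding chain_boundary2_lin_fun
    proof (rule lin_cong)
      fix \<tau> assume "\<tau> \<in> Poly_Mapping.keys (bdry (Suc i) \<sigma>)"
      note f = face[unfolded Suc, OF this, simplified]
      show "chain_boundary2 (Suc i) (G i \<tau>) = gen2 \<tau> + cap2 (n - i) i \<mu> (D i \<tau>) + lin (G (i - 1)) (bdry i \<tau>)"
        by (rule cap_homotopyD(2)[OF G _ f(1) f(3)]) (simp add: Suc)
    qed
    have "lin (\<lambda>\<tau>. lin (G (i - 1)) (bdry i \<tau>)) (bdry (Suc i) \<sigma>) = 0"
      using lin_bdry_bdry \<sigma>(1) Suc by blast
    then have Gb': "chain_boundary2 (Suc i) (lin (G i) (bdry (Suc i) \<sigma>)) =
        bdry (Suc i) \<sigma> + lin (\<lambda>\<tau>. cap2 (n - i) i \<mu> (D i \<tau>)) (bdry (Suc i) \<sigma>)"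
      unfolding Gb lin_distrib lin_id by simp
    have Cb: "chain_boundary2 (Suc i) (cap2 (n - Suc i) (Suc i) \<mu> (D (Suc i) \<sigma>)) =
        lin (\<lambda>\<tau>. cap2 (n - i) i \<mu> (D i \<tau>)) (bdry (Suc i) \<sigma>)"
      by (rule boundary_cap_dual[OF D i \<sigma>[unfolded Suc] \<mu>'(3)])
    have z': "z = gen2 \<sigma> + cap2 (n - Suc i) (Suc i) \<mu> (D (Suc i) \<sigma>) + lin (G i) (bdry (Suc i) \<sigma>)"
      unfolding z_def Suc by simp
    show ?thesis unfolding Suc z' chain_boundary2_add Gb' Cb
      by (simp add: ac_simps add_left_self add_self)
  qed simp
  have "singular_boundary2 J (subtopology M C) z"
    using C(3) zC bz aug unfolding acyclic2_def singular_cycle2_def by blast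
  then obtain w where w: "singular_chain2 (Suc J) (subtopology M C) w" "chain_boundary2 (Suc J) w = z"
    unfolding singular_boundary2_iff by blast
  obtain y where y: "y \<in> ?I" using I(2) by blast
  show ?thesis
  proof (intro exI[of _ w] conjI ballI)
    show "singular_chain2 (Suc J) M w" using w(1) by (rule singular_chain2_sub)
    show "chain_boundary2 (Suc J) w = gen2 \<sigma> + cap2 (n - J) J \<mu> (D J \<sigma>) + lin (G (J - 1)) (bdry J \<sigma>)"
      using w(2) by (simp only: z_def)
    fix \<tau> x assume "\<tau> \<in> Poly_Mapping.keys w" "x \<in> \<tau> ` standard_simplex (Suc J)"
    then have "x \<in> C" using w(1) unfolding singular_chain2_subtopology by blast
    then show "\<exists>y\<in>?I. d x y < e" using C(4) IC y unfolding dsmall_def by blast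
  qed
qed

text \<open>The threshold \<eta> precedes \<delta>, \<open>D\<close> and \<mu>. A homotopy at scale
  \<open>e\<close> in the last degree dictates the scale needed one degree below, so scales are
  fixed from the top degree downwards; this is why the induction is over all
  \<open>e\<close>.\<close>

lemma cap_homotopy_exists:
  assumes M: "closed_manifold n M" and d: "compatible_metric M d" and j: "j \<le> n"
  shows "J \<le> Suc j \<Longrightarrow> e > 0 \<Longrightarrow> \<exists>\<eta>>0. \<forall>\<delta> D \<mu>. \<delta> \<le> \<eta> \<longrightarrow> dual_system n M d j \<eta> \<delta> D \<longrightarrow>
    fundamental_cycle2 n M \<mu> \<longrightarrow> small_chain d \<eta> n \<mu> \<longrightarrow> (\<exists>G. cap_homotopy n M d J e \<delta> D \<mu> G)"
proof (induction J arbitrary: e)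
  case 0
  show ?case by (rule exI[of _ 1]) (simp add: cap_homotopy_def)
next
  case (Suc J)
  obtain r where r: "r > 0" "\<And>S. S \<subseteq> topspace M \<Longrightarrow> S \<noteq> {} \<Longrightarrow> dsmall d r S \<Longrightarrow>
      \<exists>C. S \<subseteq> C \<and> C \<subseteq> topspace M \<and> local_cell n M C \<and> acyclic2 (subtopology M C) \<and> dsmall d e C"
    using small_cell[OF M d Suc.prems(2)] by blast
  define e' where "e' = min e (r / 4)"
  have e': "e' > 0" "e' \<le> e" "e' \<le> r / 4" using Suc.prems(2) r(1) by (auto simp: e'_def)
  have J: "J \<le> Suc j" "J \<le> j" using Suc.prems(1) by auto
  obtain \<eta>' where \<eta>': "\<eta>' > 0" "\<And>\<delta> D \<mu>. \<delta> \<le> \<eta>' \<Longrightarrow> dual_system n M d j \<eta>' \<delta> D \<Longrightarrow>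
    fundamental_cycle2 n M \<mu> \<Longrightarrow> small_chain d \<eta>' n \<mu> \<Longrightarrow> \<exists>G. cap_homotopy n M d J e' \<delta> D \<mu> G"
    using Suc.IH[OF J(1) e'(1)] by blast
  define \<eta> where "\<eta> = min \<eta>' (r / 8)"
  have \<eta>: "\<eta> > 0" "\<eta> \<le> \<eta>'" "\<eta> \<le> r / 8" "\<eta> \<le> r / 4" using \<eta>'(1) r(1) by (auto simp: \<eta>_def)
  show ?case
  proof (intro exI[of _ \<eta>] conjI allI impI)
    show "\<eta> > 0" by (rule \<eta>(1))
    fix \<delta> D \<mu> assume \<delta>: "\<delta> \<le> \<eta>" and D: "dual_system n M d j \<eta> \<delta> D"
      and \<mu>: "fundamental_cycle2 n M \<mu>" and sm: "small_chain d \<eta> n \<mu>"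
    have sm': "small_chain d x n \<mu>" if x: "\<eta> \<le> x" for x
      using sm dsmall_mono[OF _ order_refl x] unfolding small_chain_def by blast
    obtain G where G: "cap_homotopy n M d J e' \<delta> D \<mu> G"
      using \<eta>'(2)[OF order_trans[OF \<delta> \<eta>(2)] dual_system_mono[OF D \<eta>(2)] \<mu> sm'[OF \<eta>(2)]] by blast
    have G4: "cap_homotopy n M d J (r / 4) \<delta> D \<mu> G" and Ge: "cap_homotopy n M d J e \<delta> D \<mu> G"
      using G e'(2,3) unfolding cap_homotopy_def by (meson less_le_trans)+
    have "\<exists>w. singular_simplex J M \<sigma> \<longrightarrow> dsmall d \<delta> (\<sigma> ` standard_simplex J) \<longrightarrow> singular_chain2 (Suc J) M w \<and>
        chain_boundary2 (Suc J) w = gen2 \<sigma> + cap2 (n - J) J \<mu> (D J \<sigma>) + lin (G (J - 1)) (bdry J \<sigma>) \<and>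
        (\<forall>\<tau>\<in>Poly_Mapping.keys w. \<forall>x\<in>\<tau> ` standard_simplex (Suc J). \<exists>y\<in>\<sigma> ` standard_simplex J. d x y < e)" for \<sigma>
      using cap_homotopy_Suc[OF M d J(2) j Suc.prems(2) r dual_system_mono[OF D \<eta>(3)] order_trans[OF
          \<delta> \<eta>(4)] \<mu> sm'[OF \<eta>(3)] G4]
      by blast
    then obtain g where g: "\<And>\<sigma>. singular_simplex J M \<sigma> \<longrightarrow> dsmall d \<delta> (\<sigma> ` standard_simplex J)
        \<longrightarrow> singular_chain2 (Suc J) M (g \<sigma>) \<and>
        chain_boundary2 (Suc J) (g \<sigma>) = gen2 \<sigma> + cap2 (n - J) J \<mu> (D J \<sigma>) + lin (G (J - 1)) (bdry J \<sigma>) \<and>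
        (\<forall>\<tau>\<in>Poly_Mapping.keys (g \<sigma>). \<forall>x\<in>\<tau> ` standard_simplex (Suc J). \<exists>y\<in>\<sigma> ` standard_simplex J. d x y < e)"
      by metis
    define G' where "G' = G(J := g)"
    have "cap_homotopy n M d (Suc J) e \<delta> D \<mu> G'"
      unfolding cap_homotopy_def
    proof (intro allI impI)
      fix i \<sigma> assume i: "i < Suc J" and \<sigma>: "singular_simplex i M \<sigma>" "dsmall d \<delta> (\<sigma> ` standard_simplex i)"
      have b: "lin (G' (i - 1)) (bdry i \<sigma>) = lin (G (i - 1)) (bdry i \<sigma>)"
        using i by (cases "i = 0") (auto simp: bdry_def G'_def)
      show "singular_chain2 (Suc i) M (G' i \<sigma>) \<and>
        chain_boundary2 (Suc i) (G' i \<sigma>) =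
          gen2 \<sigma> + cap2 (n - i) i \<mu> (D i \<sigma>) + lin (G' (i - 1)) (bdry i \<sigma>) \<and>
        (\<forall>\<tau>\<in>Poly_Mapping.keys (G' i \<sigma>). \<forall>x\<in>\<tau> ` standard_simplex (Suc i). \<exists>y\<in>\<sigma> ` standard_simplex i. d x y < e)"
      proof (cases "i = J")
        case True
        have "G' i = g" by (simp add: G'_def True)
        then show ?thesis unfolding b using g[of \<sigma>] \<sigma> unfolding True by simp
      next
        case False
        then have iJ: "i < J" "G' i = G i" using i by (auto simp: G'_def)
        show ?thesis unfolding b iJ(2) using cap_homotopyD[OF Ge iJ(1) \<sigma>] by blast
      qed
    qed
    then show "\<exists>G. cap_homotopy n M d (Suc J) e \<delta> D \<mu> G" by blast
  qed
qed

lemma local_duality: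
  assumes M: "closed_manifold n M" and d: "compatible_metric M d" and j: "j \<le> n"
  obtains \<eta> where "\<eta> > 0"
    "\<And>\<delta> D \<mu> i x. \<lbrakk>\<delta> \<le> \<eta>; dual_system n M d j \<eta> \<delta> D; fundamental_cycle2 n M \<mu>; small_chain d \<eta> n \<mu>; i \<le> j;
       singular_cycle2 i M x; small_chain d \<delta> i x\<rbrakk> \<Longrightarrow>
       singular_boundary2 i M (x + cap2 (n - i) i \<mu> (\<lambda>\<rho>. lin (\<lambda>\<sigma>. D i \<sigma> \<rho>) x))"
proof -
  obtain \<eta> where \<eta>: "\<eta> > 0" "\<forall>\<delta> D \<mu>. \<delta> \<le> \<eta> \<longrightarrow> dual_system n M d j \<eta> \<delta> D \<longrightarrow>
    fundamental_cycle2 n M \<mu> \<longrightarrow> small_chain d \<eta> n \<mu> \<longrightarrow> (\<exists>G. cap_homotopy n M d (Suc j) 1 \<delta> D \<mu> G)"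
    using cap_homotopy_exists[OF M d j, of "Suc j" 1] by auto
  show thesis
  proof (rule that[OF \<eta>(1)])
    fix \<delta> D \<mu> i x
    assume h: "\<delta> \<le> \<eta>" "dual_system n M d j \<eta> \<delta> D" "fundamental_cycle2 n M \<mu>" "small_chain d \<eta> n \<mu>"
      and i: "i \<le> j" and x: "singular_cycle2 i M x" "small_chain d \<delta> i x"
    obtain G where G: "cap_homotopy n M d (Suc j) 1 \<delta> D \<mu> G" using \<eta>(2) h by blast
    have ij: "i < Suc j" using i by simp
    have xs: "singular_simplex i M \<sigma>" "dsmall d \<delta> (\<sigma> ` standard_simplex i)" if "\<sigma> \<in> Poly_Mapping.keys x" for \<sigma>
      using x that unfolding singular_cycle2_def singular_chain2_def small_chain_def by blast+
    have c: "singular_chain2 (Suc i) M (lin (G i) x)"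
      by (rule singular_chain2_lin) (use cap_homotopyD(1)[OF G ij] xs in blast)
    have "chain_boundary2 (Suc i) (lin (G i) x) =
        lin (\<lambda>\<sigma>. gen2 \<sigma> + cap2 (n - i) i \<mu> (D i \<sigma>) + lin (G (i - 1)) (bdry i \<sigma>)) x"
      unfolding chain_boundary2_lin_fun by (rule lin_cong) (use cap_homotopyD(2)[OF G ij] xs in blast)
    also have "\<dots> = x + cap2 (n - i) i \<mu> (\<lambda>\<rho>. lin (\<lambda>\<sigma>. D i \<sigma> \<rho>) x) + lin (G (i - 1)) (chain_boundary2 i x)"
      by (simp only: lin_distrib lin_id cap2_lin_cochain chain_boundary2_lin lin_lin)
    also have "chain_boundary2 i x = 0" using x(1) by (simp add: singular_cycle2_def)
    finally show "singular_boundary2 i M (x + cap2 (n - i) i \<mu> (\<lambda>\<rho>. lin (\<lambda>\<sigma>. D i \<sigma> \<rho>) x))"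
      unfolding singular_boundary2_iff using c by (intro exI[of _ "lin (G i) x"]) simp
  qed
qed

section \<open>The intersection form\<close>

lemma dual_system_shrink:
  assumes D: "dual_system n M d j e \<delta> D" and \<delta>: "\<delta>' \<le> \<delta>"
  shows "dual_system n M d j e \<delta>' D"
proof -
  have "dsmall d \<delta> S" if "dsmall d \<delta>' S" for S
    by (rule dsmall_mono[OF that order_refl \<delta>])
  then show ?thesis using D unfolding dual_system_def by blast
qed

lemma small_chain_mono: "small_chain d e p c \<Longrightarrow> e \<le> e' \<Longrightarrow> small_chain d e' p c"
  unfolding small_chain_def using dsmall_mono[OF _ order_refl] by blast

definition dual_cochain :: "(nat \<Rightarrow> 'a simplex \<Rightarrow> 'a cochain2) \<Rightarrow> nat \<Rightarrow> 'a chain2 \<Rightarrow> 'a cochain2" where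
  "dual_cochain D i x = (\<lambda>\<rho>. lin (\<lambda>\<sigma>. D i \<sigma> \<rho>) x)"

lemma lin_dual_cochain: "lin (dual_cochain D i x) c = lin (\<lambda>\<sigma>. lin (D i \<sigma>) c) x"
  unfolding dual_cochain_def by (rule lin_swap)

lemma cobd_dual_cochain:
  assumes D: "dual_system n M d j e \<delta> D" and i: "i \<le> j"
    and x: "singular_chain2 i M x" "small_chain d \<delta> i x" and \<rho>: "singular_simplex (Suc (n - i)) M \<rho>"
  shows "cobd (n - i) (dual_cochain D i x) \<rho> = dual_cochain D (i - 1) (chain_boundary2 i x) \<rho>"
proof -
  have "cobd (n - i) (dual_cochain D i x) \<rho> = lin (\<lambda>\<sigma>. lin (D i \<sigma>) (bdry (Suc (n - i)) \<rho>)) x"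
    by (simp add: cobd_def lin_dual_cochain)
  also have "\<dots> = lin (\<lambda>\<sigma>. lin (\<lambda>\<tau>. D (i - 1) \<tau> \<rho>) (bdry i \<sigma>)) x"
  proof (rule lin_cong)
    fix \<sigma> assume \<sigma>: "\<sigma> \<in> Poly_Mapping.keys x"
    have s: "singular_simplex i M \<sigma>" "dsmall d \<delta> (\<sigma> ` standard_simplex i)"
      using x \<sigma> by (auto simp: singular_chain2_def small_chain_def)
    show "lin (D i \<sigma>) (bdry (Suc (n - i)) \<rho>) = lin (\<lambda>\<tau>. D (i - 1) \<tau> \<rho>) (bdry i \<sigma>)"
      using dual_systemD(1)[OF D i s, of "gen2 \<rho>"] \<rho> by simp
  qed
  also have "\<dots> = dual_cochain D (i - 1) (chain_boundary2 i x) \<rho>"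
    by (simp add: dual_cochain_def chain_boundary2_lin lin_lin)
  finally show ?thesis .
qed

section \<open>Cup and cap products of cocycles and cycles\<close>

lemma cap2_cocycle:
  assumes \<phi>: "singular_cocycle2 q X \<phi>" and c: "singular_chain2 (Suc (q + r)) X c"
  shows "cap2 q r (chain_boundary2 (Suc (q + r)) c) \<phi> = chain_boundary2 (Suc r) (cap2 q (Suc r) c \<phi>)"
proof -
  have "cap2 (Suc q) r c (cobd q \<phi>) = cap2 (Suc q) r c (\<lambda>_. 0)"
    by (rule cap2_cong[of "Suc q" r X]) (use \<phi> c in \<open>auto simp: singular_cocycle2_iff\<close>)
  also have "\<dots> = 0" by (simp add: cap2_lin)
  finally show ?thesis by (simp add: cap2_boundary)
qed

lemma cap2_cocycle_cycle:
  assumes \<phi>: "singular_cocycle2 q X \<phi>" and c: "singular_cycle2 (q + r) X c"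
  shows "singular_cycle2 r X (cap2 q r c \<phi>)"
  unfolding singular_cycle2_def
proof
  show "singular_chain2 r X (cap2 q r c \<phi>)"
    using c by (intro cap2_chain) (simp add: singular_cycle2_def)
  show "chain_boundary2 r (cap2 q r c \<phi>) = 0"
  proof (cases r)
    case (Suc r')
    have "chain_boundary2 (Suc r') (cap2 q (Suc r') c \<phi>) = cap2 q r' (chain_boundary2 (Suc (q + r')) c) \<phi>"
      using cap2_cocycle[OF \<phi>, of r' c] c Suc by (simp add: singular_cycle2_def)
    also have "\<dots> = 0" using c Suc by (simp add: singular_cycle2_def cap2_lin)
    finally show ?thesis using Suc by simp
  qed simp
qed

lemma cap2_cocycle_boundary:
  assumes \<phi>: "singular_cocycle2 q X \<phi>" and c: "singular_boundary2 (q + r) X c"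
  shows "singular_boundary2 r X (cap2 q r c \<phi>)"
proof -
  obtain b where b: "singular_chain2 (Suc (q + r)) X b" "chain_boundary2 (Suc (q + r)) b = c"
    using c unfolding singular_boundary2_iff by blast
  have "singular_chain2 (q + Suc r) X b" using b(1) by simp
  then have "singular_chain2 (Suc r) X (cap2 q (Suc r) b \<phi>)" by (rule cap2_chain)
  then show ?thesis
    unfolding singular_boundary2_iff using cap2_cocycle[OF \<phi> b(1)] b(2) by auto
qed

text \<open>The commutator is the coboundary of the cup-1 product, m = 2, and a coboundary evaluates
  to 0 on a cycle.\<close>

lemma cup2_commute:
  assumes \<phi>: "singular_cocycle2 k X \<phi>" and \<psi>: "singular_cocycle2 k X \<psi>"
    and c: "singular_cycle2 (k + k) X c" and k: "k \<ge> 1"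
  shows "lin (cup2 k k \<phi> \<psi>) c = lin (cup2 k k \<psi> \<phi>) c"
proof -
  obtain p where p: "k + k = Suc p" using k by (cases "k + k") auto
  have c': "singular_chain2 (Suc p) X c" "chain_boundary2 (Suc p) c = 0"
    using c by (auto simp: singular_cycle2_def p)
  have z: "cobd k \<theta> (list_face \<sigma> A) = 0"
    if "singular_cocycle2 k X \<theta>" "singular_simplex (Suc p) X \<sigma>" "set A \<subseteq> {..Suc p}" "length A
        = Suc (Suc k)" for \<theta> \<sigma> A
  proof -
    have "A \<noteq> []" using that(4) by auto
    then show ?thesis
      using that singular_simplex_list_face(1)[OF that(2) \<open>A \<noteq> []\<close> that(3)]
        by (auto simp: singular_cocycle2_iff)
  qed
  have "lin (cup_i 2 (Suc p) (Suc k) k (cobd k \<phi>) \<psi>) c = 0"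
    by (rule lin_eq_0[OF c'(1)], rule cup_i_eq_0) (use z[OF \<phi>] in blast)
  moreover have "lin (cup_i 2 (Suc p) k (Suc k) \<phi> (cobd k \<psi>)) c = 0"
    by (rule lin_eq_0[OF c'(1)], rule cup_i_eq_0) (use z[OF \<psi>] in blast)
  ultimately have "lin (cup_i 1 (Suc p) k k \<phi> \<psi>) c + lin (cup_i 1 (Suc p) k k \<psi> \<phi>) c = 0"
    using cup_i_leibniz[OF c'(2), of 2 k k \<phi> \<psi>] by simp
  then show ?thesis by (simp only: add_eq_0_iff_eq cup2_cup_i p)
qed

lemma fundamental_cycle_sdiv:
  assumes "fundamental_cycle2 n M \<mu>"
  shows "fundamental_cycle2 n M (sdiv m n \<mu>)"
proof -
  have \<mu>: "singular_cycle2 n M \<mu>" using assms by (simp add: fundamental_cycle2_def)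
  have "singular_cycle2 n M (sdiv m n \<mu>)"
    using relcycle2_sdiv(1)[of n M "{}" \<mu> m] \<mu> by (simp add: relcycle2_empty)
  moreover have "singular_relboundary2 n M (topspace M - {x}) (sdiv m n \<mu> + \<mu>)" for x
    using relcycle2_sdiv(2)[of n M "{}" \<mu> m] \<mu> by (auto simp: relcycle2_empty intro: relboundary2_mono)
  then have "singular_relboundary2 n M (topspace M - {x}) (sdiv m n \<mu>)
      \<longleftrightarrow> singular_relboundary2 n M (topspace M - {x}) \<mu>" for x
    using relboundary2_add_cancel[of n M "topspace M - {x}" "sdiv m n \<mu> + \<mu>" \<mu>]
    by (simp add: ac_simps add_self add_left_self)
  ultimately show ?thesis using assms by (simp add: fundamental_cycle2_def)
qed

text \<open>Two scales: \<delta> bounds the simplices on which \<open>D\<close> is meaningful,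
  \<eta> bounds the spread of the duals and the simplices of the fundamental cycle. The last
  assumption is Poincare duality in the middle degree.\<close>

locale local_dual =
  fixes M :: "'a topology" and k :: nat and d :: "'a \<Rightarrow> 'a \<Rightarrow> real" and \<eta> \<delta> :: real
    and D :: "nat \<Rightarrow> 'a simplex \<Rightarrow> 'a cochain2"
  assumes k: "k \<ge> 1" and manifold: "closed_manifold (2 * k) M" and metric: "compatible_metric M d"
    and pos: "\<delta> > 0" "\<eta> > 0" "\<delta> \<le> \<eta>" and dual: "dual_system (2 * k) M d k \<eta> \<delta> D"
    and cap_dual: "\<And>\<mu> x. \<lbrakk>fundamental_cycle2 (2 * k) M \<mu>; small_chain d \<eta> (2 * k) \<mu>;
       singular_cycle2 k M x; small_chain d \<delta> k x\<rbrakk> \<Longrightarrow>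
       singular_boundary2 k M (x + cap2 k k \<mu> (dual_cochain D k x))"

lemma local_dual_exists:
  assumes k: "k \<ge> 1" and M: "closed_manifold (2 * k) M" and d: "compatible_metric M d" and e: "e > 0"
  obtains \<eta> \<delta> D where "\<eta> \<le> e" "local_dual M k d \<eta> \<delta> D"
proof -
  have kn: "k \<le> 2 * k" by simp
  obtain \<eta>0 where \<eta>0: "\<eta>0 > 0"
    "\<And>\<delta> D \<mu> i x. \<lbrakk>\<delta> \<le> \<eta>0; dual_system (2 * k) M d k \<eta>0 \<delta> D; fundamental_cycle2 (2 * k) M \<mu>;
       small_chain d \<eta>0 (2 * k) \<mu>; i \<le> k; singular_cycle2 i M x; small_chain d \<delta> i x\<rbrakk> \<Longrightarrow>
       singular_boundary2 i M (x + cap2 (2 * k - i) i \<mu> (\<lambda>\<rho>. lin (\<lambda>\<sigma>. D i \<sigma> \<rho>) x))"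
    using local_duality[OF M d kn] by blast
  define \<eta> where "\<eta> = min \<eta>0 e"
  have \<eta>: "\<eta> > 0" "\<eta> \<le> e" "\<eta> \<le> \<eta>0" using \<eta>0(1) e by (auto simp: \<eta>_def)
  obtain \<delta>' D where D': "\<delta>' > 0" "dual_system (2 * k) M d k \<eta> \<delta>' D"
    using dual_system_exists[OF M d kn \<eta>(1)] by blast
  define \<delta> where "\<delta> = min \<delta>' \<eta>"
  have \<delta>: "\<delta> > 0" "\<delta> \<le> \<delta>'" "\<delta> \<le> \<eta>" using D'(1) \<eta>(1) by (auto simp: \<delta>_def)
  have D: "dual_system (2 * k) M d k \<eta> \<delta> D" by (rule dual_system_shrink[OF D'(2) \<delta>(2)])
  have "local_dual M k d \<eta> \<delta> D"
  proof (unfold_locales)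
    fix \<mu> x assume h: "fundamental_cycle2 (2 * k) M \<mu>" "small_chain d \<eta> (2 * k) \<mu>"
      "singular_cycle2 k M x" "small_chain d \<delta> k x"
    have "2 * k - k = k" by simp
    then show "singular_boundary2 k M (x + cap2 k k \<mu> (dual_cochain D k x))"
      using \<eta>0(2)[OF order_trans[OF \<delta>(3) \<eta>(3)] dual_system_mono[OF D \<eta>(3)] h(1) small_chain_mono[OF
          h(2) \<eta>(3)] order_refl h(3,4)]
      by (simp add: dual_cochain_def)
  qed (use k M d \<delta> \<eta> D in auto)
  then show thesis using that \<eta>(2) by blast
qed

context local_dual
begin

lemma dual_cocycle:
  assumes x: "singular_cycle2 k M x" "small_chain d \<delta> k x"
  shows "singular_cocycle2 k M (dual_cochain D k x)"
proof -
  have kk: "2 * k - k = k" by simp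
  show ?thesis
    unfolding singular_cocycle2_iff
  proof (intro allI impI)
    fix \<rho> assume "singular_simplex (Suc k) M \<rho>"
    then have "cobd k (dual_cochain D k x) \<rho> = dual_cochain D (k - 1) (chain_boundary2 k x) \<rho>"
      using cobd_dual_cochain[OF dual order_refl _ x(2), of \<rho>] x(1) by (simp add: singular_cycle2_def kk)
    also have "\<dots> = 0" using x(1) by (simp add: singular_cycle2_def dual_cochain_def)
    finally show "cobd k (dual_cochain D k x) \<rho> = 0" .
  qed
qed

text \<open>Subdivision makes \<mu> small and changes the cap product with a cocycle by a boundary
  only.\<close>

lemma cap_dual_any:
  assumes \<mu>: "fundamental_cycle2 (2 * k) M \<mu>" and x: "singular_cycle2 k M x" "small_chain d \<delta> k x"
  shows "singular_boundary2 k M (x + cap2 k k \<mu> (dual_cochain D k x))"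
proof -
  have c: "singular_cycle2 (k + k) M \<mu>" using \<mu> by (simp add: fundamental_cycle2_def mult_2)
  then obtain m where m: "small_chain d \<eta> (2 * k) (sdiv m (2 * k) \<mu>)"
    using sdiv_small_chain[OF metric pos(2), of "2 * k" \<mu>] by (auto simp: singular_cycle2_def mult_2)
  have "singular_boundary2 (k + k) M (sdiv m (k + k) \<mu> + \<mu>)"
    using relcycle2_sdiv(2)[of "k + k" M "{}" \<mu> m] c by (simp add: relcycle2_empty)
  then have "singular_boundary2 k M (cap2 k k (sdiv m (k + k) \<mu> + \<mu>) (dual_cochain D k x))"
    by (rule cap2_cocycle_boundary[OF dual_cocycle[OF x]])
  moreover have "singular_boundary2 k M (x + cap2 k k (sdiv m (k + k) \<mu>) (dual_cochain D k x))"
    using cap_dual[OF fundamental_cycle_sdiv[OF \<mu>] m x] by (simp add: mult_2)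
  ultimately have "singular_boundary2 k M (x + cap2 k k (sdiv m (k + k) \<mu>) (dual_cochain D k x) +
      cap2 k k (sdiv m (k + k) \<mu> + \<mu>) (dual_cochain D k x))"
    using singular_boundary2_add by blast
  then show ?thesis by (simp add: cap2_add ac_simps add_left_self add_self)
qed

lemma small_representative:
  assumes x: "singular_cycle2 k M x"
  obtains m where "\<And>i. i \<ge> m \<Longrightarrow> small_chain d \<delta> k (sdiv i k x)"
proof -
  have "singular_chain2 k M x" using x by (simp add: singular_cycle2_def)
  then show thesis using sdiv_small_chain[OF metric pos(1)] that by blast
qed

lemma sdiv_cycle:
  assumes x: "singular_cycle2 k M x"
  shows "singular_cycle2 k M (sdiv m k x)" "singular_boundary2 k M (sdiv m k x + x)"
    "homology_class2 k M (sdiv m k x) = homology_class2 k M x"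
  using relcycle2_sdiv[of k M "{}" x m] x by (simp_all add: relcycle2_empty homology_class2_eq_iff)

text \<open>Commutativity and the adjunction of cup and cap move \<psi> onto \<open>y\<close> and
  then replace \<open>y\<close> by the cap product with its own dual. The result mentions none of
  \<mu>, \<phi>, \<psi>, which is the source of all independence of choices.\<close>

lemma cup_eq_dual:
  assumes \<mu>: "fundamental_cycle2 (2 * k) M \<mu>"
    and \<phi>: "singular_cocycle2 k M \<phi>" and \<psi>: "singular_cocycle2 k M \<psi>"
    and y: "singular_cycle2 k M y" "small_chain d \<delta> k y" "singular_boundary2 k M (y + cap2 k k \<mu> \<psi>)"
    and x: "singular_boundary2 k M (x + cap2 k k \<mu> \<phi>)"
  shows "lin (cup2 k k \<phi> \<psi>) \<mu> = lin (dual_cochain D k y) x"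
proof -
  have c: "singular_cycle2 (k + k) M \<mu>" using \<mu> by (simp add: fundamental_cycle2_def mult_2)
  let ?\<theta> = "dual_cochain D k y"
  have \<theta>: "singular_cocycle2 k M ?\<theta>" by (rule dual_cocycle[OF y(1,2)])
  have hom: "lin \<omega> a = lin \<omega> b" if om: "singular_cocycle2 k M \<omega>" "singular_boundary2 k M (a + b)" for \<omega> a b
  proof -
    obtain v where v: "singular_chain2 (Suc k) M v" "chain_boundary2 (Suc k) v = a + b"
      using om(2) unfolding singular_boundary2_iff by blast
    have "lin \<omega> (a + b) = 0" using cocycle_boundary[OF om(1) v(1)] unfolding v(2) .
    then show ?thesis by (simp add: lin_add add_eq_0_iff_eq)
  qed
  have "lin (cup2 k k \<phi> \<psi>) \<mu> = lin (cup2 k k \<psi> \<phi>) \<mu>" by (rule cup2_commute[OF \<phi> \<psi> c k])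
  also have "\<dots> = lin \<phi> y" unfolding cap2_eval[symmetric] by (rule hom[OF \<phi> y(3), symmetric])
  also have "\<dots> = lin \<phi> (cap2 k k \<mu> ?\<theta>)" by (rule hom[OF \<phi> cap_dual_any[OF \<mu> y(1,2)]])
  also have "\<dots> = lin (cup2 k k \<phi> ?\<theta>) \<mu>" unfolding cap2_eval by (rule cup2_commute[OF \<theta> \<phi> c k])
  also have "\<dots> = lin ?\<theta> x" unfolding cap2_eval[symmetric] by (rule hom[OF \<theta> x, symmetric])
  finally show ?thesis .
qed

text \<open>Uniqueness behind the definite description: both sets of data give the value on
  \<open>x\<close> of the dual of one small representative \<open>z\<close> of the second
  class.\<close>

lemma intersection_form2_eqI:
  assumes \<mu>: "fundamental_cycle2 (2 * k) M \<mu>"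
    and \<phi>: "singular_cocycle2 k M \<phi>" and \<psi>: "singular_cocycle2 k M \<psi>"
    and x: "singular_boundary2 k M (x + cap2 k k \<mu> \<phi>)" and y: "singular_boundary2 k M (y + cap2 k k \<mu> \<psi>)"
  shows "intersection_form2 k M (homology_class2 k M x) (homology_class2 k M y) = lin (cup2 k k \<phi> \<psi>) \<mu>"
  unfolding intersection_form2_def
proof (rule the_equality)
  show "\<exists>\<mu>' \<phi>' \<psi>'. fundamental_cycle2 (2 * k) M \<mu>' \<and> singular_cocycle2 k M \<phi>' \<and> singular_cocycle2 k M \<psi>' \<and>
      homology_class2 k M x = homology_class2 k M (cap2 k k \<mu>' \<phi>') \<and>
      homology_class2 k M y = homology_class2 k M (cap2 k k \<mu>' \<psi>') \<and>
      lin (cup2 k k \<phi> \<psi>) \<mu> = eval_cochain2 (cup2 k k \<phi>' \<psi>') \<mu>'"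
    by (intro exI[of _ \<mu>] exI[of _ \<phi>] exI[of _ \<psi>])
      (use assms in \<open>simp add: homology_class2_eq_iff eval_cochain2_lin\<close>)
  fix r assume "\<exists>\<mu>' \<phi>' \<psi>'. fundamental_cycle2 (2 * k) M \<mu>' \<and> singular_cocycle2 k M \<phi>'
      \<and> singular_cocycle2 k M \<psi>' \<and>
      homology_class2 k M x = homology_class2 k M (cap2 k k \<mu>' \<phi>') \<and>
      homology_class2 k M y = homology_class2 k M (cap2 k k \<mu>' \<psi>') \<and>
      r = eval_cochain2 (cup2 k k \<phi>' \<psi>') \<mu>'"
  then obtain \<mu>' \<phi>' \<psi>'
    where h: "fundamental_cycle2 (2 * k) M \<mu>'" "singular_cocycle2 k M \<phi>'" "singular_cocycle2 k M \<psi>'"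
    and x': "singular_boundary2 k M (x + cap2 k k \<mu>' \<phi>')" and y': "singular_boundary2 k M (y + cap2 k k \<mu>' \<psi>')"
    and r: "r = lin (cup2 k k \<phi>' \<psi>') \<mu>'"
    unfolding homology_class2_eq_iff eval_cochain2_lin by blast
  have cy: "singular_cycle2 k M (cap2 k k \<mu> \<psi>)"
    using \<mu> by (intro cap2_cocycle_cycle[OF \<psi>]) (simp add: fundamental_cycle2_def mult_2)
  then obtain m where m: "small_chain d \<delta> k (sdiv m k (cap2 k k \<mu> \<psi>))"
    using small_representative by blast
  define z where "z = sdiv m k (cap2 k k \<mu> \<psi>)"
  have z: "singular_cycle2 k M z" "small_chain d \<delta> k z" "singular_boundary2 k M (z + cap2 k k \<mu> \<psi>)"
    using sdiv_cycle[OF cy] m by (simp_all add: z_def)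
  have e: "(z + cap2 k k \<mu> \<psi>) + (y + cap2 k k \<mu> \<psi>) + (y + cap2 k k \<mu>' \<psi>') = z + cap2 k k \<mu>' \<psi>'"
    by (simp add: ac_simps add_left_self)
  have z': "singular_boundary2 k M (z + cap2 k k \<mu>' \<psi>')"
    using singular_boundary2_add[OF singular_boundary2_add[OF z(3) y] y'] unfolding e .
  show "r = lin (cup2 k k \<phi> \<psi>) \<mu>"
    unfolding r cup_eq_dual[OF \<mu> \<phi> \<psi> z x] cup_eq_dual[OF h z(1,2) z' x'] by (rule refl)
qed

lemma fundamental_cycle: obtains \<mu> where "fundamental_cycle2 (2 * k) M \<mu>"
  using fundamental_cycle_exists[OF manifold] by blast

lemma intersection_form2_dual:
  assumes x: "singular_cycle2 k M x" "small_chain d \<delta> k x"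
    and y: "singular_cycle2 k M y" "small_chain d \<delta> k y"
  shows "intersection_form2 k M (homology_class2 k M x) (homology_class2 k M y) = lin (dual_cochain D k y) x"
proof -
  obtain \<mu> where \<mu>: "fundamental_cycle2 (2 * k) M \<mu>" by (rule fundamental_cycle)
  note cx = cap_dual_any[OF \<mu> x] and cy = cap_dual_any[OF \<mu> y]
  show ?thesis
    unfolding intersection_form2_eqI[OF \<mu> dual_cocycle[OF x] dual_cocycle[OF y] cx cy]
    by (rule cup_eq_dual[OF \<mu> dual_cocycle[OF x] dual_cocycle[OF y] y cy cx])
qed

text \<open>The bound works for all larger numbers of subdivisions, so several classes can be made
  small by the same number; additivity of \<open>sdiv\<close> then yields bilinearity.\<close>

lemma intersection_form2_sdiv:
  assumes x: "singular_cycle2 k M x" and y: "singular_cycle2 k M y"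
  shows "\<exists>m. \<forall>i\<ge>m. small_chain d \<delta> k (sdiv i k x) \<and> small_chain d \<delta> k (sdiv i k y) \<and>
    intersection_form2 k M (homology_class2 k M x) (homology_class2 k M y) =
       lin (dual_cochain D k (sdiv i k y)) (sdiv i k x)"
proof -
  obtain m1 where m1: "\<And>i. i \<ge> m1 \<Longrightarrow> small_chain d \<delta> k (sdiv i k x)" using small_representative[OF x] by blast
  obtain m2 where m2: "\<And>i. i \<ge> m2 \<Longrightarrow> small_chain d \<delta> k (sdiv i k y)" using small_representative[OF y] by blast
  show ?thesis
  proof (intro exI[of _ "max m1 m2"] allI impI conjI)
    fix i assume i: "i \<ge> max m1 m2"
    show s: "small_chain d \<delta> k (sdiv i k x)" "small_chain d \<delta> k (sdiv i k y)" using m1 m2 i by auto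
    show "intersection_form2 k M (homology_class2 k M x) (homology_class2 k M y) =
       lin (dual_cochain D k (sdiv i k y)) (sdiv i k x)"
      using intersection_form2_dual[OF sdiv_cycle(1)[OF x] s(1) sdiv_cycle(1)[OF y] s(2)]
      by (simp add: sdiv_cycle(3)[OF x] sdiv_cycle(3)[OF y])
  qed
qed

lemma intersection_form2_commute:
  assumes x: "singular_cycle2 k M x" and y: "singular_cycle2 k M y"
  shows "intersection_form2 k M (homology_class2 k M x) (homology_class2 k M y) =
    intersection_form2 k M (homology_class2 k M y) (homology_class2 k M x)"
proof -
  obtain m where m: "small_chain d \<delta> k (sdiv m k x)" "small_chain d \<delta> k (sdiv m k y)"
    using intersection_form2_sdiv[OF x y] by (meson order_refl)
  obtain \<mu> where \<mu>: "fundamental_cycle2 (2 * k) M \<mu>" by (rule fundamental_cycle)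
  have c: "singular_cycle2 (k + k) M \<mu>" using \<mu> by (simp add: fundamental_cycle2_def mult_2)
  note X = sdiv_cycle(1)[OF x, of m] m(1) and Y = sdiv_cycle(1)[OF y, of m] m(2)
  show ?thesis
    using intersection_form2_eqI[OF \<mu> dual_cocycle[OF X] dual_cocycle[OF Y] cap_dual_any[OF \<mu> X]
        cap_dual_any[OF \<mu> Y]]
      intersection_form2_eqI[OF \<mu> dual_cocycle[OF Y] dual_cocycle[OF X] cap_dual_any[OF \<mu> Y]
          cap_dual_any[OF \<mu> X]]
      cup2_commute[OF dual_cocycle[OF X] dual_cocycle[OF Y] c k]
    by (simp add: sdiv_cycle(3)[OF x] sdiv_cycle(3)[OF y])
qed

lemma intersection_form2_add:
  assumes x: "singular_cycle2 k M x" and x': "singular_cycle2 k M x'" and y: "singular_cycle2 k M y"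
  shows "intersection_form2 k M (homology_class2 k M (x + x')) (homology_class2 k M y) =
    intersection_form2 k M (homology_class2 k M x) (homology_class2 k M y) +
    intersection_form2 k M (homology_class2 k M x') (homology_class2 k M y)"
proof -
  have xx: "singular_cycle2 k M (x + x')"
    using x x' by (simp add: singular_cycle2_def singular_chain2_add chain_boundary2_add)
  obtain m1 where m1: "\<And>i. i \<ge> m1 \<Longrightarrow> intersection_form2 k M (homology_class2 k M x) (homology_class2 k M y) =
       lin (dual_cochain D k (sdiv i k y)) (sdiv i k x)"
    using intersection_form2_sdiv[OF x y] by meson
  obtain m2 where m2: "\<And>i. i \<ge> m2 \<Longrightarrow> intersection_form2 k M (homology_class2 k M x') (homology_class2 k M y) =
       lin (dual_cochain D k (sdiv i k y)) (sdiv i k x')"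
    using intersection_form2_sdiv[OF x' y] by meson
  obtain m3 where m3: "\<And>i. i \<ge> m3 \<Longrightarrow> intersection_form2 k M (homology_class2 k M (x
      + x')) (homology_class2 k M y) =
       lin (dual_cochain D k (sdiv i k y)) (sdiv i k (x + x'))"
    using intersection_form2_sdiv[OF xx y] by meson
  define i where "i = m1 + m2 + m3"
  have "i \<ge> m1" "i \<ge> m2" "i \<ge> m3" by (simp_all add: i_def)
  then show ?thesis using m1[of i] m2[of i] m3[of i] by (simp add: sdiv_add lin_add)
qed

text \<open>A cycle that does not bound is detected by a cocycle \<psi>; the partner sought is the
  cap product of \<mu> with \<psi>.\<close>

lemma intersection_form2_nondegenerate:
  assumes x: "singular_cycle2 k M x" and nb: "\<not> singular_boundary2 k M x"
  obtains y where "singular_cycle2 k M y" "intersection_form2 k M (homology_class2 k M x)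
      (homology_class2 k M y) = 1"
proof -
  let ?B = "singular_boundary2 k M"
  have Badd: "?B v \<Longrightarrow> ?B (v + w) \<longleftrightarrow> ?B w" for v w by (rule relboundary2_add_cancel)
  have Ball: "\<forall>v w. ?B v \<longrightarrow> ?B (v + w) = ?B w" using Badd by blast
  obtain \<psi> :: "'a cochain2" where "(\<forall>w. ?B w \<longrightarrow> lin \<psi> w = 0) \<and> (\<forall>w. ?B (w + x) \<longrightarrow> lin \<psi> w = 1)"
    using separating_functional[of ?B x, OF relboundary2_zero Ball nb] by blast
  then have \<psi>b: "\<And>w. ?B w \<Longrightarrow> lin \<psi> w = 0" and \<psi>1: "\<And>w. ?B (w + x) \<Longrightarrow> lin \<psi> w = 1" by blast+
  have \<psi>x: "lin \<psi> x = 1" by (rule \<psi>1) (simp add: add_self)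
  have \<psi>c: "singular_cocycle2 k M \<psi>"
    unfolding singular_cocycle2_iff
  proof (intro allI impI)
    fix \<sigma> assume "singular_simplex (Suc k) M \<sigma>"
    then have "?B (chain_boundary2 (Suc k) (gen2 \<sigma>))" by (intro relboundary2_boundary) simp
    then show "cobd k \<psi> \<sigma> = 0" using \<psi>b by (simp add: cobd_def)
  qed
  obtain \<mu> where \<mu>: "fundamental_cycle2 (2 * k) M \<mu>" by (rule fundamental_cycle)
  have c: "singular_cycle2 (k + k) M \<mu>" using \<mu> by (simp add: fundamental_cycle2_def mult_2)
  obtain m where m: "small_chain d \<delta> k (sdiv m k x)" using small_representative[OF x] by blast
  note X = sdiv_cycle(1)[OF x, of m] m
  have cap: "?B (x + cap2 k k \<mu> (dual_cochain D k (sdiv m k x)))"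
  proof -
    have "?B ((sdiv m k x + x) + (sdiv m k x + cap2 k k \<mu> (dual_cochain D k (sdiv m k x))))"
      by (rule singular_boundary2_add[OF sdiv_cycle(2)[OF x] cap_dual_any[OF \<mu> X]])
    then show ?thesis by (simp add: ac_simps add_left_self)
  qed
  have "intersection_form2 k M (homology_class2 k M x) (homology_class2 k M (cap2 k k \<mu> \<psi>)) =
      lin (cup2 k k (dual_cochain D k (sdiv m k x)) \<psi>) \<mu>"
    by (rule intersection_form2_eqI[OF \<mu> dual_cocycle[OF X] \<psi>c cap]) (simp add: add_self)
  also have "\<dots> = lin \<psi> x + lin \<psi> (x + cap2 k k \<mu> (dual_cochain D k (sdiv m k x)))"
    by (simp add: cap2_eval lin_add add_left_self)
  also have "\<dots> = 1" using \<psi>b[OF cap] \<psi>x by simp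
  finally show thesis using that cap2_cocycle_cycle[OF \<psi>c c] by blast
qed

text \<open>Duality represents every class by a cap product with one fixed \<mu>, which is a sum of
  some of the finitely many back faces of its simplices.\<close>

lemma finite_homology2: "finite (homology_class2 k M ` {c. singular_cycle2 k M c})"
proof -
  obtain \<mu> where \<mu>: "fundamental_cycle2 (2 * k) M \<mu>" by (rule fundamental_cycle)
  define F where "F = back_face k k ` Poly_Mapping.keys \<mu>"
  have F: "finite F" by (simp add: F_def)
  define T where "T = (\<lambda>S. \<Sum>\<sigma>\<in>S. gen2 \<sigma>) ` Pow F"
  have "homology_class2 k M x \<in> homology_class2 k M ` T" if x: "singular_cycle2 k M x" for x
  proof -
    obtain m where m: "small_chain d \<delta> k (sdiv m k x)" using small_representative[OF x] by blast
    note X = sdiv_cycle(1)[OF x, of m] m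
    let ?c = "cap2 k k \<mu> (dual_cochain D k (sdiv m k x))"
    have "Poly_Mapping.keys ?c \<subseteq> F"
      unfolding cap2_lin F_def
      by (rule order_trans[OF keys_lin]) (auto split: if_splits)
    then have "?c \<in> T" unfolding T_def using lin_id[of ?c] unfolding lin_def
      by (intro image_eqI[where x = "Poly_Mapping.keys ?c"]) auto
    moreover have "homology_class2 k M x = homology_class2 k M ?c"
      using cap_dual_any[OF \<mu> X] sdiv_cycle(3)[OF x] by (metis homology_class2_eq_iff)
    ultimately show ?thesis by blast
  qed
  then have "homology_class2 k M ` {c. singular_cycle2 k M c} \<subseteq> homology_class2 k M ` T" by blast
  moreover have "finite (homology_class2 k M ` T)" unfolding T_def using F by simp
  ultimately show ?thesis by (rule finite_subset)
qed

end

section \<open>Almost embedded complexes\<close>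

lemma vertex_map_geometric_face:
  assumes K: "\<forall>\<tau>\<in>K. \<forall>\<sigma>\<subseteq>\<tau>. \<sigma> \<noteq> {} \<longrightarrow> \<sigma> \<in> K"
    and L: "L \<noteq> []" "set L \<in> K" and x: "x \<in> standard_simplex (length L - 1)"
  shows "vertex_map L x \<in> geometric_face K (set L)"
proof -
  have A: "{..<length L} = {..length L - 1}" using L(1) by (cases L) auto
  have x': "\<And>i. 0 \<le> x i" "sum x {..<length L} = 1"
    using x by (auto simp: standard_simplex_def A)
  let ?y = "vertex_map L x"
  have nn: "0 \<le> ?y v" for v unfolding vertex_map_def using x' by (intro sum_nonneg) auto
  have z: "?y v = 0" if "v \<notin> set L" for v
    unfolding vertex_map_def using that by (intro sum.neutral) (fastforce dest: nth_mem)
  have sub: "{v. ?y v \<noteq> 0} \<subseteq> set L" using z by blast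
  have "(\<Sum>v | ?y v \<noteq> 0. ?y v) = (\<Sum>v\<in>set L. ?y v)"
    using sub by (intro sum.mono_neutral_left) auto
  also have "\<dots> = (\<Sum>j<length L. \<Sum>v\<in>set L. if L ! j = v then x j else 0)"
    unfolding vertex_map_def by (rule sum.swap)
  also have "\<dots> = (\<Sum>j<length L. x j)" by (intro sum.cong refl) auto
  finally have s: "(\<Sum>v | ?y v \<noteq> 0. ?y v) = 1" using x' by simp
  then have "{v. ?y v \<noteq> 0} \<noteq> {}" by (metis sum.empty zero_neq_one)
  then have "{v. ?y v \<noteq> 0} \<in> K" using K L(2) sub by blast
  then show ?thesis using nn s sub by (simp add: geometric_face_def geometric_realization_def)
qed

lemma singular_simplex_realization:
  assumes K: "\<forall>\<tau>\<in>K. \<forall>\<sigma>\<subseteq>\<tau>. \<sigma> \<noteq> {} \<longrightarrow> \<sigma> \<in> K"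
    and L: "L \<noteq> []" "set L \<in> K" and f: "continuous_map (geometric_realization K) M f"
  shows "singular_simplex (length L - 1) M (list_face f L)"
    and "list_face f L ` standard_simplex (length L - 1) \<subseteq> f ` geometric_face K (set L)"
proof -
  let ?PT = "powertop_real UNIV" and ?S = "standard_simplex (length L - 1)"
  note vg = vertex_map_geometric_face[OF K L]
  have cont: "continuous_map ?PT euclideanreal (\<lambda>x. vertex_map L x v)" for v
    unfolding vertex_map_def
    by (intro continuous_map_sum) (auto intro: continuous_map_product_projection)
  have "vertex_map L x \<in> topspace (geometric_realization K)" if "x \<in> ?S" for x
    using vg[OF that] by (simp add: geometric_face_def)
  then have "continuous_map (subtopology ?PT ?S) (geometric_realization K) (vertex_map L)"
    unfolding geometric_realization_def continuous_map_in_subtopology continuous_map_componentwise_UNIV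
    using cont by (auto intro: continuous_map_from_subtopology)
  then have "continuous_map (subtopology ?PT ?S) M (f \<circ> vertex_map L)"
    using f by (rule continuous_map_compose)
  then show "singular_simplex (length L - 1) M (list_face f L)"
    by (simp add: singular_simplex_def list_face_def o_def)
  show "list_face f L ` ?S \<subseteq> f ` geometric_face K (set L)"
    using vg by (auto simp: list_face_def)
qed

lemma compact_separated:
  assumes d: "compatible_metric M d" and H: "Hausdorff_space M"
    and A: "compactin M A" and B: "compactin M B" and AB: "A \<inter> B = {}"
  shows "\<exists>e>0. \<forall>x\<in>A. \<forall>y\<in>B. e \<le> d x y"
proof -
  have sub: "A \<subseteq> topspace M" "B \<subseteq> topspace M" using A B compactin_subset_topspace by blast+
  have "openin M (topspace M - B)" using compactin_imp_closedin[OF H B] by blast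
  moreover have "\<forall>W x. openin M W \<longrightarrow> x \<in> W \<longrightarrow> (\<exists>e>0. \<forall>y\<in>topspace M. d x y < e \<longrightarrow> y \<in> W)"
    using d unfolding compatible_metric_def by (elim conjE)
  moreover have "\<forall>x\<in>A. x \<in> topspace M - B" using AB sub(1) by blast
  ultimately have "\<forall>x\<in>A. \<exists>r>0. \<forall>y\<in>topspace M. d x y < r \<longrightarrow> y \<in> topspace M - B"
    by meson
  then obtain r where r: "\<And>x. x \<in> A \<Longrightarrow> r x > 0"
    "\<And>x y. x \<in> A \<Longrightarrow> y \<in> topspace M \<Longrightarrow> d x y < r x \<Longrightarrow> y \<notin> B" by (metis DiffD2)
  let ?U = "\<lambda>x. {y \<in> topspace M. d x y < r x / 2}"
  have "\<forall>U\<in>?U ` A. openin M U" using compatible_metricD(4)[OF d] by blast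
  moreover have "A \<subseteq> \<Union>(?U ` A)"
  proof
    fix x assume x: "x \<in> A"
    then have "x \<in> ?U x" using compatible_metricD(1)[OF d] r(1)[OF x] sub(1) by auto
    then show "x \<in> \<Union>(?U ` A)" using x by blast
  qed
  ultimately obtain F where F: "finite F" "F \<subseteq> ?U ` A" "A \<subseteq> \<Union>F" using A unfolding compactin_def by meson
  obtain S where S: "S \<subseteq> A" "finite S" "F = ?U ` S" using finite_subset_image[OF F(1,2)] by blast
  note S = S(2,1) F(3)[unfolded S(3)]
  define e where "e = Min (insert 1 ((\<lambda>x. r x / 2) ` S))"
  have e1: "e > 0" using S(1,2) r(1) by (auto simp: e_def Min_gr_iff)
  have e2: "e \<le> r s / 2" if "s \<in> S" for s unfolding e_def using S(1) that by (intro Min_le) auto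
  note e = e1 e2
  have "e \<le> d x y" if x: "x \<in> A" and y: "y \<in> B" for x y
  proof (rule ccontr)
    assume "\<not> e \<le> d x y"
    moreover obtain s where s: "s \<in> S" "d s x < r s / 2" using S(3) x by blast
    ultimately have "d s y < r s" using compatible_metricD(3)[OF d, of s y x] e(2)[OF s(1)] by linarith
    then show False using r(2)[of s y] s(1) S(2) y sub(2) by blast
  qed
  then show ?thesis using e(1) by blast
qed

lemma sdiv_sum: "sdiv m p (\<Sum>i\<in>I. c i) = (\<Sum>i\<in>I. sdiv m p (c i))"
proof -
  have "sdiv m p 0 = sdiv m p 0 + sdiv m p (0 :: 'a chain2)" using sdiv_add[of m p 0 0] by simp
  then have "sdiv m p (0 :: 'a chain2) = 0" by simp
  then show ?thesis by (induction I rule: infinite_finite_induct) (simp_all add: sdiv_add)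
qed

lemma augmentation_sdiv:
  assumes "singular_chain2 0 X c"
  shows "lin (\<lambda>_. 1 :: bit) (sdiv m 0 c) = lin (\<lambda>_. 1) c"
proof (rule sdiv_homotopy[of m])
  fix h :: "nat \<Rightarrow> 'a chain2 \<Rightarrow> 'a chain2"
  assume h: "\<And>p X c. singular_chain2 p X c \<Longrightarrow>
       chain_boundary2 (Suc p) (h p c) + h (p - 1) (chain_boundary2 p c) = sdiv m p c + c" "\<And>p. h p 0 = 0"
  have e: "sdiv m 0 c + c = chain_boundary2 (Suc 0) (h 0 c)"
    using h(1)[OF assms] h(2) by simp
  have "lin (\<lambda>_. 1 :: bit) (chain_boundary2 (Suc 0) (h 0 c)) = lin (\<lambda>\<sigma>. 0) (h 0 c)"
    unfolding chain_boundary2_lin lin_lin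
    by (rule lin_cong) (simp add: bdry_def lin_add)
  then show "lin (\<lambda>_. 1 :: bit) (sdiv m 0 c) = lin (\<lambda>_. 1) c"
    unfolding e[symmetric] lin_add by (simp add: add_eq_0_iff_eq)
qed

lemma cup_i_sum:
  "cup_i m p q r (\<lambda>\<rho>. \<Sum>i\<in>I. g i \<rho>) \<psi> \<sigma> = (\<Sum>i\<in>I. cup_i m p q r (g i) \<psi> \<sigma>)"
  "cup_i m p q r \<psi> (\<lambda>\<rho>. \<Sum>i\<in>I. g i \<rho>) \<sigma> = (\<Sum>i\<in>I. cup_i m p q r \<psi> (g i) \<sigma>)"
proof -
  have e: "(\<lambda>\<rho>. \<Sum>i\<in>I. g i \<rho>) = (\<lambda>\<rho>. lin (\<lambda>i. g i \<rho>) (\<Sum>i\<in>I. gen2 i))"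
    by (simp add: lin_sum)
  show "cup_i m p q r (\<lambda>\<rho>. \<Sum>i\<in>I. g i \<rho>) \<psi> \<sigma> = (\<Sum>i\<in>I. cup_i m p q r (g i) \<psi> \<sigma>)"
    "cup_i m p q r \<psi> (\<lambda>\<rho>. \<Sum>i\<in>I. g i \<rho>) \<sigma> = (\<Sum>i\<in>I. cup_i m p q r \<psi> (g i) \<sigma>)"
    unfolding e cup_i_lin by (simp_all add: lin_sum)
qed

text \<open>The factor 3: a simplex of \<mu> has diameter below \<eta>, and being within \<eta> of
  each of two faces it would bridge a distance below 3 \<eta>. \<open>N\<close> is one number of
  subdivisions that makes all faces small.\<close>

locale embedded_complex = local_dual M k d \<eta> \<delta> D
  for M :: "'a topology" and k d \<eta> \<delta> D +
  fixes K :: "'v set set" and f :: "('v \<Rightarrow> real) \<Rightarrow> 'a" and N :: nat and \<mu> :: "'a chain2"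
  assumes K: "\<forall>\<tau>\<in>K. \<forall>\<sigma>\<subseteq>\<tau>. \<sigma> \<noteq> {} \<longrightarrow> \<sigma> \<in> K"
    and card_K: "\<And>\<tau>. \<tau> \<in> K \<Longrightarrow> card \<tau> \<le> Suc k"
    and f: "continuous_map (geometric_realization K) M f"
    and \<mu>: "fundamental_cycle2 (2 * k) M \<mu>" "small_chain d \<eta> (2 * k) \<mu>"
    and small: "\<And>L. L \<noteq> [] \<Longrightarrow> distinct L \<Longrightarrow> set L \<in> K \<Longrightarrow>
      small_chain d \<delta> (length L - 1) (sdiv N (length L - 1) (gen2 (list_face f L)))"
    and separated: "\<And>L L' x y. \<lbrakk>L \<noteq> []; L' \<noteq> []; distinct L; distinct L'; set L \<in> K; set L' \<in> K; set
        L \<inter> set L' = {};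
      x \<in> list_face f L ` standard_simplex (length L - 1); y \<in> list_face f L' ` standard_simplex
          (length L' - 1)\<rbrakk>
      \<Longrightarrow> 3 * \<eta> \<le> d x y"

lemma embedded_complex_exists:
  assumes k: "k \<ge> 1" and M: "closed_manifold (2 * k) M" and f: "almost_embedding K M f"
    and fin: "finite K" "\<And>\<tau>. \<tau> \<in> K \<Longrightarrow> finite \<tau>"
    and K: "\<forall>\<tau>\<in>K. \<forall>\<sigma>\<subseteq>\<tau>. \<sigma> \<noteq> {} \<longrightarrow> \<sigma> \<in> K"
    and card_K: "\<And>\<tau>. \<tau> \<in> K \<Longrightarrow> card \<tau> \<le> Suc k"
  obtains d \<eta> \<delta> D N \<mu> where "embedded_complex M k d \<eta> \<delta> D K f N \<mu>"
proof -
  have fc: "continuous_map (geometric_realization K) M f" using f by (simp add: almost_embedding_def)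
  have H: "Hausdorff_space M" using M by (simp add: closed_manifold_def)
  obtain d where d: "compatible_metric M d" using closed_manifold_metric[OF M] by blast
  define LL where "LL = {L. L \<noteq> [] \<and> distinct L \<and> set L \<in> K}"
  have "LL \<subseteq> {L. set L \<subseteq> \<Union>K \<and> distinct L}" by (auto simp: LL_def)
  moreover have "finite (\<Union>K)" using fin by (rule finite_Union)
  ultimately have LLfin: "finite LL" using finite_subset_distinct finite_subset by blast
  let ?I = "\<lambda>L. list_face f L ` standard_simplex (length L - 1)"
  have simp: "singular_simplex (length L - 1) M (list_face f L)" "?I L \<subseteq> f ` geometric_face K (set
      L)" if "L \<in> LL" for L
    using singular_simplex_realization[where K = K and L = L, OF K _ _ fc] that by (auto simp: LL_def)
  have cpt: "compactin M (?I L)" if "L \<in> LL" for L using compactin_singular_simplex[OF simp(1)[OF that]] .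
  have "\<forall>p\<in>LL \<times> LL. \<exists>e>0. set (fst p) \<inter> set (snd p) = {} \<longrightarrow> (\<forall>x\<in>?I (fst p). \<forall>y\<in>?I (snd p). e \<le> d x y)"
  proof
    fix p assume p: "p \<in> LL \<times> LL"
    show "\<exists>e>0. set (fst p) \<inter> set (snd p) = {} \<longrightarrow> (\<forall>x\<in>?I (fst p). \<forall>y\<in>?I (snd p). e \<le> d x y)"
    proof (cases "set (fst p) \<inter> set (snd p) = {}")
      case True
      have pp: "fst p \<in> LL" "snd p \<in> LL" using p by auto
      then have "f ` geometric_face K (set (fst p)) \<inter> f ` geometric_face K (set (snd p)) = {}"
        using f True by (simp add: almost_embedding_def LL_def)
      then have "?I (fst p) \<inter> ?I (snd p) = {}" using simp(2)[OF pp(1)] simp(2)[OF pp(2)] by blast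
      then show ?thesis using compact_separated[OF d H cpt[OF pp(1)] cpt[OF pp(2)]] by blast
    qed (auto intro: exI[of _ 1])
  qed
  then obtain e where e: "\<And>p. p \<in> LL \<times> LL \<Longrightarrow> e p > 0"
    "\<And>p x y. p \<in> LL \<times> LL \<Longrightarrow> set (fst p) \<inter> set (snd p) = {} \<Longrightarrow> x \<in> ?I (fst p) \<Longrightarrow> y \<in> ?I (snd p) \<Longrightarrow> e p \<le> d x y"
    by metis
  \<comment> \<open>One separation for all disjoint pairs of faces, positive because there are
    finitely many. It is fixed before \<eta>, \<delta> and \<open>D\<close>, which depend on
    it.\<close>
  define \<epsilon> where "\<epsilon> = Min (insert 1 (e ` (LL \<times> LL)))"
  have \<epsilon>1: "\<epsilon> > 0" using LLfin e(1) by (auto simp: \<epsilon>_def Min_gr_iff)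
  have \<epsilon>2: "\<epsilon> \<le> e p" if "p \<in> LL \<times> LL" for p
    unfolding \<epsilon>_def using LLfin that by (intro Min_le) auto
  note \<epsilon> = \<epsilon>1 \<epsilon>2
  have \<epsilon>3: "\<epsilon> / 3 > 0" using \<epsilon>(1) by simp
  obtain \<eta> \<delta> D where \<eta>: "\<eta> \<le> \<epsilon> / 3" and LD: "local_dual M k d \<eta> \<delta> D"
    by (rule local_dual_exists[OF k M d \<epsilon>3])
  interpret local_dual M k d \<eta> \<delta> D by (rule LD)
  obtain \<mu>0 where \<mu>0: "fundamental_cycle2 (2 * k) M \<mu>0" by (rule fundamental_cycle)
  then have "singular_chain2 (2 * k) M \<mu>0" by (simp add: fundamental_cycle2_def singular_cycle2_def)
  then obtain m where m: "small_chain d \<eta> (2 * k) (sdiv m (2 * k) \<mu>0)"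
    using sdiv_small_chain[OF metric pos(2)] by blast
  have "\<forall>L\<in>LL. \<exists>m. \<forall>j\<ge>m. small_chain d \<delta> (length L - 1) (sdiv j (length L - 1) (gen2 (list_face f L)))"
  proof
    fix L assume "L \<in> LL"
    then have "singular_chain2 (length L - 1) M (gen2 (list_face f L))" using simp(1) by simp
    from sdiv_small_chain[OF metric pos(1) this]
    show "\<exists>m. \<forall>j\<ge>m. small_chain d \<delta> (length L - 1) (sdiv j (length L - 1) (gen2 (list_face f L)))" by meson
  qed
  then obtain h where h: "\<And>L j. L \<in> LL \<Longrightarrow> h L \<le> j \<Longrightarrow>
    small_chain d \<delta> (length L - 1) (sdiv j (length L - 1) (gen2 (list_face f L)))" by metis
  \<comment> \<open>The sum is a common upper bound of the thresholds of all faces.\<close>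
  define N where "N = (\<Sum>L\<in>LL. h L)"
  have N: "h L \<le> N" if "L \<in> LL" for L unfolding N_def using LLfin that by (intro member_le_sum) auto
  have "embedded_complex M k d \<eta> \<delta> D K f N (sdiv m (2 * k) \<mu>0)"
  proof (intro embedded_complex.intro LD embedded_complex_axioms.intro)
    fix L L' x y
    assume h: "L \<noteq> []" "L' \<noteq> []" "distinct L" "distinct L'" "set L \<in> K" "set L' \<in> K" "set L \<inter> set L' = {}"
      and xy: "x \<in> ?I L" "y \<in> ?I L'"
    then have "(L, L') \<in> LL \<times> LL" by (auto simp: LL_def)
    then show "3 * \<eta> \<le> d x y" using e(2)[of "(L, L')" x y] \<epsilon>(2)[of "(L, L')"] h xy \<eta> by simp
  next
    fix L assume "L \<noteq> []" "distinct L" "set L \<in> K"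
    then have "L \<in> LL" by (simp add: LL_def)
    then show "small_chain d \<delta> (length L - 1) (sdiv N (length L - 1) (gen2 (list_face f L)))"
      using h N by blast
  qed (use K card_K fc fundamental_cycle_sdiv[OF \<mu>0] m in auto)
  then show thesis using that by blast
qed

context embedded_complex
begin

text \<open>The empty list gets the chain 0, so that deleting the only vertex of a face yields 0, in
  accordance with the boundary of a 0-simplex.\<close>

definition face_chain :: "'v list \<Rightarrow> 'a chain2" where
  "face_chain L = (if L = [] then 0 else sdiv N (length L - 1) (gen2 (list_face f L)))"

definition face_dual :: "'v list \<Rightarrow> 'a cochain2" where
  "face_dual L = dual_cochain D (length L - 1) (face_chain L)"

definition codim :: "'v list \<Rightarrow> nat" where
  "codim L = 2 * k - (length L - 1)"

text \<open>The cup-\<open>(m - 1)\<close> product of the local duals of two faces; it extends the intersection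
  numbers of faces (case \<open>m = 1\<close>) to pairs of faces with common vertices.\<close>

definition tower :: "nat \<Rightarrow> 'v list \<Rightarrow> 'v list \<Rightarrow> bit" where
  "tower m L L' = lin (cup_i m (2 * k) (codim L) (codim L') (face_dual L) (face_dual L')) \<mu>"

definition is_face :: "'v list \<Rightarrow> bool" where
  "is_face L \<longleftrightarrow> L = [] \<or> distinct L \<and> set L \<in> K"

lemma face_simplex:
  assumes "is_face L" "L \<noteq> []"
  shows "singular_simplex (length L - 1) M (list_face f L)" "length L - 1 \<le> k"
proof -
  show "singular_simplex (length L - 1) M (list_face f L)"
    using singular_simplex_realization(1)[where K = K and L = L, OF K _ _ f] assms by (auto simp: is_face_def)
  show "length L - 1 \<le> k"
    using assms card_K[of "set L"] distinct_card[of L] by (auto simp: is_face_def)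
qed

lemma face_chain:
  assumes L: "is_face L"
  shows "singular_chain2 (length L - 1) (subtopology M (list_face f L ` standard_simplex (length L -
      1))) (face_chain L)"
    and "singular_chain2 (length L - 1) M (face_chain L)"
    and "small_chain d \<delta> (length L - 1) (face_chain L)"
proof -
  let ?p = "length L - 1"
  show 1: "singular_chain2 ?p (subtopology M (list_face f L ` standard_simplex ?p)) (face_chain L)"
  proof (cases "L = []")
    case False
    show ?thesis unfolding face_chain_def if_not_P[OF False]
      by (rule sdiv_chain) (use face_simplex[OF L False] in \<open>simp add: singular_simplex_subtopology\<close>)
  qed (simp add: face_chain_def)
  then show "singular_chain2 ?p M (face_chain L)" by (rule singular_chain2_sub)
  show "small_chain d \<delta> ?p (face_chain L)"
    using small[of L] L by (auto simp: face_chain_def is_face_def small_chain_def)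
qed

lemma face_dual_Nil: "face_dual [] \<rho> = 0"
  by (simp add: face_dual_def face_chain_def dual_cochain_def)

lemma face_dual_support:
  assumes L: "is_face L" and \<rho>: "singular_simplex (codim L) M \<rho>" "face_dual L \<rho> \<noteq> 0"
  shows "L \<noteq> []" "\<exists>x\<in>\<rho> ` standard_simplex (codim L). \<exists>y\<in>list_face f L ` standard_simplex (length L -
      1). d x y < \<eta>"
proof -
  let ?p = "length L - 1"
  show ne: "L \<noteq> []" using \<rho>(2) face_dual_Nil by blast
  obtain \<sigma> where \<sigma>: "\<sigma> \<in> Poly_Mapping.keys (face_chain L)" "D ?p \<sigma> \<rho> \<noteq> 0"
    using \<rho>(2) unfolding face_dual_def dual_cochain_def lin_def by (meson sum.neutral)
  have s: "singular_simplex ?p M \<sigma>" "dsmall d \<delta> (\<sigma> ` standard_simplex ?p)"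
    using face_chain(2,3)[OF L] \<sigma>(1) by (auto simp: singular_chain2_def small_chain_def)
  have im: "\<sigma> ` standard_simplex ?p \<subseteq> list_face f L ` standard_simplex ?p"
    using face_chain(1)[OF L] \<sigma>(1) unfolding singular_chain2_subtopology by blast
  obtain x y where "x \<in> \<rho> ` standard_simplex (codim L)" "y \<in> \<sigma> ` standard_simplex ?p" "d x y < \<eta>"
    using dual_systemD(2)[OF dual face_simplex(2)[OF L ne] s, OF \<rho>(1)[unfolded codim_def] \<sigma>(2)]
    by (auto simp: codim_def)
  then show "\<exists>x\<in>\<rho> ` standard_simplex (codim L). \<exists>y\<in>list_face f L ` standard_simplex ?p. d x y < \<eta>"
    using im by blast
qed

lemma list_face_dual_support:
  assumes L: "is_face L" and \<sigma>: "singular_simplex p M \<sigma>" and A: "set A \<subseteq> {..p}" "length A = Suc (codim L)"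
    and nz: "face_dual L (list_face \<sigma> A) \<noteq> 0"
  shows "L \<noteq> []" "\<exists>x\<in>\<sigma> ` standard_simplex p. \<exists>y\<in>list_face f L ` standard_simplex (length L - 1). d x y < \<eta>"
proof -
  have A0: "A \<noteq> []" using A(2) by auto
  have sl: "singular_simplex (codim L) M (list_face \<sigma> A)" "list_face \<sigma> A ` standard_simplex (codim
      L) \<subseteq> \<sigma> ` standard_simplex p"
    using singular_simplex_list_face[OF \<sigma> A0 A(1)] A(2) by auto
  note s = face_dual_support[OF L sl(1) nz]
  show "L \<noteq> []" by (rule s(1))
  show "\<exists>x\<in>\<sigma> ` standard_simplex p. \<exists>y\<in>list_face f L ` standard_simplex (length L - 1). d x y < \<eta>"
    using s(2) sl(2) by blast
qed

text \<open>Only supports enter, so the vanishing holds for every \<open>m\<close>: a nonzero term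
  would put one small simplex of \<mu> near both faces.\<close>

lemma tower_disjoint:
  assumes L: "is_face L" and L': "is_face L'" and dis: "set L \<inter> set L' = {}"
  shows "tower m L L' = 0"
proof -
  have "lin (cup_i m (2 * k) (codim L) (codim L') (face_dual L) (face_dual L')) \<mu> = lin (\<lambda>_. 0) \<mu>"
  proof (rule lin_cong, rule cup_i_eq_0, rule ccontr)
    fix \<sigma> A B
    assume \<sigma>: "\<sigma> \<in> Poly_Mapping.keys \<mu>" and A: "set A \<subseteq> {..2 * k}" "length A = Suc (codim L)"
      and B: "set B \<subseteq> {..2 * k}" "length B = Suc (codim L')"
      and nz: "\<not> (face_dual L (list_face \<sigma> A) = 0 \<or> face_dual L' (list_face \<sigma> B) = 0)"
    have s: "singular_simplex (2 * k) M \<sigma>"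
      using \<mu>(1) \<sigma> by (auto simp: fundamental_cycle2_def singular_cycle2_def singular_chain2_def)
    have sm: "dsmall d \<eta> (\<sigma> ` standard_simplex (2 * k))" using \<mu>(2) \<sigma> by (simp add: small_chain_def)
    have nz1: "face_dual L (list_face \<sigma> A) \<noteq> 0" and nz2: "face_dual L' (list_face \<sigma> B) \<noteq> 0" using nz by auto
    note sL = list_face_dual_support[OF L s A nz1] and sL' = list_face_dual_support[OF L' s B nz2]
    obtain x y where x: "x \<in> \<sigma> ` standard_simplex (2 * k)"
      and y: "y \<in> list_face f L ` standard_simplex (length L - 1)" "d x y < \<eta>"
      using sL(2) by blast
    obtain x' y' where x': "x' \<in> \<sigma> ` standard_simplex (2 * k)"
      and y': "y' \<in> list_face f L' ` standard_simplex (length L' - 1)" "d x' y' < \<eta>"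
      using sL'(2) by blast
    have "d x x' < \<eta>" using sm x x' unfolding dsmall_def by blast
    moreover have "3 * \<eta> \<le> d y y'"
      by (rule separated[of L L']) (use L L' sL(1) sL'(1) dis y y' in \<open>auto simp: is_face_def\<close>)
    ultimately show False
      using y(2) y'(2) compatible_metricD(2)[OF metric, of x y] compatible_metricD(3)[OF metric, of y y' x]
        compatible_metricD(3)[OF metric, of x y' x'] by linarith
  qed
  then show ?thesis by (simp add: tower_def)
qed

lemma boundary_face_chain:
  assumes L: "is_face L" "L \<noteq> []"
  shows "chain_boundary2 (length L - 1) (face_chain L) = (\<Sum>i<length L. face_chain (take i L @ drop (Suc i) L))"
proof (cases "length L = 1")
  case True
  then show ?thesis by (cases L) (auto simp: face_chain_def)
next
  case False
  then have l: "length L \<ge> 2" using L(2) by (cases L) (auto simp: Suc_le_eq)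
  let ?p = "length L - 1"
  have e: "{..<length L} = {..?p}" using l by auto
  have sf: "singular_face ?p i (list_face f L) = list_face f (take i L @ drop (Suc i) L)" if "i \<le> ?p" for i
    by (rule singular_face_list_face[OF l]) (use that l in linarith)
  have "chain_boundary2 ?p (face_chain L) = sdiv N (?p - 1) (bdry ?p (list_face f L))"
    using sdiv_boundary[of ?p M "gen2 (list_face f L)" N] face_simplex(1)[OF L] L(2)
      by (simp add: face_chain_def)
  also have "bdry ?p (list_face f L) = (\<Sum>i<length L. gen2 (list_face f (take i L @ drop (Suc i) L)))"
    unfolding bdry_def e using l sf by simp
  also have "sdiv N (?p - 1) \<dots>
      = (\<Sum>i<length L. sdiv N (?p - 1) (gen2 (list_face f (take i L @ drop (Suc i) L))))"
    by (rule sdiv_sum)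
  also have "\<dots> = (\<Sum>i<length L. face_chain (take i L @ drop (Suc i) L))"
    by (intro sum.cong refl) (use l in \<open>auto simp: face_chain_def\<close>)
  finally show ?thesis .
qed

lemma codim_remove:
  assumes "is_face L" "i < length L" "length L \<ge> 2"
  shows "codim (take i L @ drop (Suc i) L) = Suc (codim L)"
proof -
  have "L \<noteq> []" using assms(2) by auto
  then show ?thesis using face_simplex(2)[OF assms(1)] assms(2,3) by (simp add: codim_def)
qed

lemma cobd_face_dual:
  assumes L: "is_face L" "L \<noteq> []" and \<rho>: "singular_simplex (Suc (codim L)) M \<rho>"
  shows "cobd (codim L) (face_dual L) \<rho> = (\<Sum>i<length L. face_dual (take i L @ drop (Suc i) L) \<rho>)"
proof -
  have "cobd (codim L) (face_dual L) \<rho>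
      = dual_cochain D (length L - 1 - 1) (chain_boundary2 (length L - 1) (face_chain L)) \<rho>"
    unfolding codim_def face_dual_def
    by (rule cobd_dual_cochain[OF dual face_simplex(2)[OF L] face_chain(2,3)[OF L(1)] \<rho>[unfolded codim_def]])
  also have "\<dots> = (\<Sum>i<length L. face_dual (take i L @ drop (Suc i) L) \<rho>)"
    unfolding boundary_face_chain[OF L] dual_cochain_def face_dual_def lin_sum
    by (intro sum.cong refl) simp
  finally show ?thesis .
qed

lemma tower_cobd:
  assumes L: "is_face L" "L \<noteq> []"
  shows "lin (cup_i m (2 * k) (Suc (codim L)) r (cobd (codim L) (face_dual L)) \<psi>) \<mu> =
      (\<Sum>i<length L. lin (cup_i m (2 * k) (codim (take i L @ drop (Suc i) L)) r (face_dual (take i L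
          @ drop (Suc i) L)) \<psi>) \<mu>)"
    and "lin (cup_i m (2 * k) r (Suc (codim L)) \<psi> (cobd (codim L) (face_dual L))) \<mu> =
      (\<Sum>i<length L. lin (cup_i m (2 * k) r (codim (take i L @ drop (Suc i) L)) \<psi> (face_dual (take i
          L @ drop (Suc i) L))) \<mu>)"
proof -
  have \<mu>': "singular_chain2 (2 * k) M \<mu>" using \<mu>(1) by (simp add: fundamental_cycle2_def singular_cycle2_def)
  have z: "cup_i m (2 * k) q r (face_dual []) \<psi> \<sigma> = 0" "cup_i m (2 * k) r q \<psi> (face_dual []) \<sigma> = 0" for q \<sigma>
    by (rule cup_i_eq_0, simp add: face_dual_Nil)+
  have l1: "L' = []" if "length L = 1" "i < length L" "L' = take i L @ drop (Suc i) L" for i L'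
    using that by auto
  \<comment> \<open>Deleting the only vertex breaks the degree count, as \<open>codim []\<close> is
    2k and not 2k + 1. The product is 0 in either degree, since the dual of the empty list is
    0.\<close>
  have cd: "codim (take i L @ drop (Suc i) L) = Suc (codim L) \<or> take i L @ drop (Suc i) L = []"
    if "i < length L" for i
  proof (cases "length L \<ge> 2")
    case True
    then show ?thesis using codim_remove[OF L(1) that] by blast
  next
    case False
    then have "length L = 1" using that by linarith
    then show ?thesis using l1[OF _ that refl] by blast
  qed
  have "lin (cup_i m (2 * k) (Suc (codim L)) r (cobd (codim L) (face_dual L)) \<psi>) \<mu> =
      lin (cup_i m (2 * k) (Suc (codim L)) r (\<lambda>\<rho>. \<Sum>i<length L. face_dual (take i L @ drop (Suc i) L) \<rho>) \<psi>) \<mu>"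
    by (rule lin_eq[OF \<mu>'], erule cup_i_cong) (simp_all add: cobd_face_dual[OF L])
  also have "\<dots> = (\<Sum>i<length L. lin (cup_i m (2 * k) (Suc (codim L)) r (face_dual (take i L @ drop
      (Suc i) L)) \<psi>) \<mu>)"
    unfolding cup_i_sum lin_sum_fun ..
  also have "\<dots> = (\<Sum>i<length L. lin (cup_i m (2 * k) (codim (take i L @ drop (Suc i) L)) r (face_dual
      (take i L @ drop (Suc i) L)) \<psi>) \<mu>)"
  proof (intro sum.cong refl lin_cong)
    fix i \<sigma> assume "i \<in> {..<length L}"
    then show "cup_i m (2 * k) (Suc (codim L)) r (face_dual (take i L @ drop (Suc i) L)) \<psi> \<sigma> =
        cup_i m (2 * k) (codim (take i L @ drop (Suc i) L)) r (face_dual (take i L @ drop (Suc i) L)) \<psi> \<sigma>"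
      using cd[of i] z(1) by (metis lessThan_iff)
  qed
  finally show "lin (cup_i m (2 * k) (Suc (codim L)) r (cobd (codim L) (face_dual L)) \<psi>) \<mu> =
      (\<Sum>i<length L. lin (cup_i m (2 * k) (codim (take i L @ drop (Suc i) L)) r (face_dual (take i L
          @ drop (Suc i) L)) \<psi>) \<mu>)" .
  have "lin (cup_i m (2 * k) r (Suc (codim L)) \<psi> (cobd (codim L) (face_dual L))) \<mu> =
      lin (cup_i m (2 * k) r (Suc (codim L)) \<psi> (\<lambda>\<rho>. \<Sum>i<length L. face_dual (take i L @ drop (Suc i) L) \<rho>)) \<mu>"
    by (rule lin_eq[OF \<mu>'], erule cup_i_cong) (simp_all add: cobd_face_dual[OF L])
  also have "\<dots> = (\<Sum>i<length L. lin (cup_i m (2 * k) r (Suc (codim L)) \<psi> (face_dual (take i L @ drop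
      (Suc i) L))) \<mu>)"
    unfolding cup_i_sum lin_sum_fun ..
  also have "\<dots> = (\<Sum>i<length L. lin (cup_i m (2 * k) r (codim (take i L @ drop (Suc i) L)) \<psi>
      (face_dual (take i L @ drop (Suc i) L))) \<mu>)"
  proof (intro sum.cong refl lin_cong)
    fix i \<sigma> assume "i \<in> {..<length L}"
    then show "cup_i m (2 * k) r (Suc (codim L)) \<psi> (face_dual (take i L @ drop (Suc i) L)) \<sigma> =
        cup_i m (2 * k) r (codim (take i L @ drop (Suc i) L)) \<psi> (face_dual (take i L @ drop (Suc i) L)) \<sigma>"
      using cd[of i] z(2) by (metis lessThan_iff)
  qed
  finally show "lin (cup_i m (2 * k) r (Suc (codim L)) \<psi> (cobd (codim L) (face_dual L))) \<mu> =
      (\<Sum>i<length L. lin (cup_i m (2 * k) r (codim (take i L @ drop (Suc i) L)) \<psi> (face_dual (take i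
          L @ drop (Suc i) L))) \<mu>)" .
qed

lemma tower_Nil: "tower m [] L = 0" "tower m L [] = 0"
proof -
  have "cup_i m (2 * k) q r (face_dual []) \<psi> \<sigma> = 0" "cup_i m (2 * k) r q \<psi> (face_dual []) \<sigma> = 0" for q r \<psi> \<sigma>
    by (rule cup_i_eq_0, simp add: face_dual_Nil)+
  then show "tower m [] L = 0" "tower m L [] = 0" by (simp_all add: tower_def lin_def)
qed

text \<open>The coboundary of the dual of a face is the dual of its boundary, so the Leibniz rule
  for cochains on the cycle \<mu> becomes a rule for faces.\<close>

lemma tower_leibniz:
  assumes L: "is_face L" and L': "is_face L'"
  shows "(\<Sum>i<length L. tower m (take i L @ drop (Suc i) L) L')
      + (\<Sum>i<length L'. tower m L (take i L' @ drop (Suc i) L')) =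
    (if m = 0 then 0 else tower (m - 1) L L' + tower (m - 1) L' L)"
proof (cases "L = [] \<or> L' = []")
  case True
  then show ?thesis by (auto simp: tower_Nil)
next
  case False
  then have ne: "L \<noteq> []" "L' \<noteq> []" by auto
  obtain p where p: "2 * k = Suc p" using k by (cases "2 * k") auto
  have "chain_boundary2 (Suc p) \<mu> = 0" using \<mu>(1) by (simp add: fundamental_cycle2_def singular_cycle2_def p)
  from cup_i_leibniz[OF this, of m "codim L" "codim L'" "face_dual L" "face_dual L'"]
  show ?thesis unfolding p[symmetric] tower_cobd[OF L ne(1)] tower_cobd[OF L' ne(2)] tower_def .
qed

text \<open>The dual of a vertex has top degree 2k, so with 2k + 1 switches its product with itself
  is the dual again, by \<open>cup_i_top\<close>. Its value on \<mu> is the augmentation of the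
  subdivided vertex, by the normalization of \<open>D 0\<close>.\<close>

lemma tower_vertex:
  assumes v: "{v} \<in> K"
  shows "tower (Suc (2 * k)) [v] [v] = 1"
proof -
  have L: "is_face [v]" using v by (simp add: is_face_def)
  have \<mu>': "singular_chain2 (2 * k) M \<mu>" using \<mu>(1) by (simp add: fundamental_cycle2_def singular_cycle2_def)
  have s: "singular_simplex 0 M \<sigma>" "dsmall d \<delta> (\<sigma> ` standard_simplex 0)"
    if "\<sigma> \<in> Poly_Mapping.keys (face_chain [v])" for \<sigma>
    using face_chain(2,3)[OF L] that by (auto simp: singular_chain2_def small_chain_def)
  have "tower (Suc (2 * k)) [v] [v] = lin (face_dual [v]) \<mu>"
    unfolding tower_def codim_def
  proof (simp del: mult_Suc, rule lin_eq[OF \<mu>'])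
    fix \<sigma> assume "singular_simplex (2 * k) M \<sigma>"
    then show "cup_i (Suc (2 * k)) (2 * k) (2 * k) (2 * k) (face_dual [v]) (face_dual [v]) \<sigma> = face_dual [v] \<sigma>"
      by (cases "face_dual [v] \<sigma>") (simp_all add: cup_i_top)
  qed
  also have "\<dots> = lin (\<lambda>\<sigma>. lin (D 0 \<sigma>) \<mu>) (face_chain [v])"
    by (simp add: face_dual_def lin_dual_cochain)
  also have "\<dots> = lin (\<lambda>\<sigma>. 1) (face_chain [v])"
    by (rule lin_cong) (use dual_systemD(3)[OF dual _ s refl \<mu>(1)] in simp)
  also have "\<dots> = lin (\<lambda>\<sigma>. 1) (gen2 (list_face f [v]))"
    using augmentation_sdiv[of M "gen2 (list_face f [v])" N] face_simplex(1)[OF L] by (simp add: face_chain_def)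
  finally show ?thesis by simp
qed

text \<open>After \<open>N\<close> subdivisions both cycles are small sums of face chains, hence
  their dual cocycles are sums of face duals and the cup product expands bilinearly.\<close>

lemma intersection_form2_tower:
  assumes I: "finite I" "\<And>i. i \<in> I \<Longrightarrow> is_face (g i) \<and> length (g i) = Suc k"
    and J: "finite J" "\<And>j. j \<in> J \<Longrightarrow> is_face (h j) \<and> length (h j) = Suc k"
    and cI: "singular_cycle2 k M (\<Sum>i\<in>I. gen2 (list_face f (g i)))"
    and cJ: "singular_cycle2 k M (\<Sum>j\<in>J. gen2 (list_face f (h j)))"
  shows "intersection_form2 k M (homology_class2 k M (\<Sum>i\<in>I. gen2 (list_face f (g i))))
      (homology_class2 k M (\<Sum>j\<in>J. gen2 (list_face f (h j)))) = (\<Sum>i\<in>I. \<Sum>j\<in>J. tower 1 (g i) (h j))"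
proof -
  have fc: "face_chain L = sdiv N k (gen2 (list_face f L))" if "is_face L \<and> length L = Suc k" for L
    using that by (auto simp: face_chain_def)
  have sm: "small_chain d \<delta> k (\<Sum>i\<in>I. face_chain (g i))"
    if "\<And>i. i \<in> I \<Longrightarrow> is_face (g i) \<and> length (g i) = Suc k" for I g
  proof -
    have "Poly_Mapping.keys (\<Sum>i\<in>I. face_chain (g i)) \<subseteq> (\<Union>i\<in>I. Poly_Mapping.keys (face_chain (g i)))"
      by (rule keys_sum)
    moreover have "small_chain d \<delta> k (face_chain (g i))" if "i \<in> I" for i
      using face_chain(3)[of "g i"] \<open>\<And>i. i \<in> I \<Longrightarrow> is_face (g i) \<and> length (g i) = Suc k\<close>[OF that] by simp
    ultimately show ?thesis unfolding small_chain_def by blast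
  qed
  have e: "sdiv N k (\<Sum>i\<in>I. gen2 (list_face f (g i))) = (\<Sum>i\<in>I. face_chain (g i))"
    if "\<And>i. i \<in> I \<Longrightarrow> is_face (g i) \<and> length (g i) = Suc k" for I g
    unfolding sdiv_sum by (intro sum.cong refl) (simp add: fc that)
  define X where "X = (\<Sum>i\<in>I. face_chain (g i))"
  define Y where "Y = (\<Sum>j\<in>J. face_chain (h j))"
  have X: "singular_cycle2 k M X" "small_chain d \<delta> k X"
    using sdiv_cycle(1)[OF cI, of N] sm[of I g] e[of I g] I(2) by (simp_all add: X_def)
  have Y: "singular_cycle2 k M Y" "small_chain d \<delta> k Y"
    using sdiv_cycle(1)[OF cJ, of N] sm[of J h] e[of J h] J(2) by (simp_all add: Y_def)
  have dX: "dual_cochain D k X = (\<lambda>\<rho>. \<Sum>i\<in>I. face_dual (g i) \<rho>)"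
    unfolding X_def dual_cochain_def lin_sum face_dual_def using I(2) by (intro ext sum.cong refl) simp
  have dY: "dual_cochain D k Y = (\<lambda>\<rho>. \<Sum>j\<in>J. face_dual (h j) \<rho>)"
    unfolding Y_def dual_cochain_def lin_sum face_dual_def using J(2) by (intro ext sum.cong refl) simp
  have "intersection_form2 k M (homology_class2 k M (\<Sum>i\<in>I. gen2 (list_face f (g i))))
      (homology_class2 k M (\<Sum>j\<in>J. gen2 (list_face f (h j)))) =
      intersection_form2 k M (homology_class2 k M X) (homology_class2 k M Y)"
    using sdiv_cycle(3)[OF cI, of N] sdiv_cycle(3)[OF cJ, of N] e[of I g] e[of J h] I(2) J(2)
      by (simp add: X_def Y_def)
  also have "\<dots> = lin (cup2 k k (dual_cochain D k X) (dual_cochain D k Y)) \<mu>"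
    by (rule intersection_form2_eqI[OF \<mu>(1) dual_cocycle[OF X] dual_cocycle[OF Y] cap_dual_any[OF
        \<mu>(1) X] cap_dual_any[OF \<mu>(1) Y]])
  also have "\<dots> = (\<Sum>i\<in>I. \<Sum>j\<in>J. lin (cup_i 1 (2 * k) k k (face_dual (g i)) (face_dual (h j))) \<mu>)"
    unfolding cup2_cup_i mult_2[symmetric] dX dY cup_i_sum lin_sum_fun ..
  also have "\<dots> = (\<Sum>i\<in>I. \<Sum>j\<in>J. tower 1 (g i) (h j))"
    unfolding tower_def codim_def using I(2) J(2) by (intro sum.cong refl) simp
  finally show ?thesis .
qed

end

section \<open>The van Kampen number\<close>

definition unequal_pairs :: "(nat \<times> nat) set" where
  "unequal_pairs = {(1, 2), (2, 3), (3, 1), (2, 1), (3, 2), (1, 3)}"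

text \<open>Runs over pairs of words with letters in [3] that differ at every position of
  \<open>I\<close>, that is, over faces that are disjoint in those factors of the join. Recursion on
  positions lets one factor be eliminated at a time.\<close>

fun pair_sum :: "nat list \<Rightarrow> ((nat \<Rightarrow> nat) \<Rightarrow> (nat \<Rightarrow> nat) \<Rightarrow> 'm::char2) \<Rightarrow> (nat \<Rightarrow> nat) \<Rightarrow> (nat \<Rightarrow> nat) \<Rightarrow> 'm" where
  "pair_sum [] g a b = g a b"
| "pair_sum (i # I) g a b = (\<Sum>e\<in>unequal_pairs. pair_sum I g (a(i := fst e)) (b(i := snd e)))"

lemma sum_unequal_pairs:
  "(\<Sum>e\<in>unequal_pairs. h (fst e) (snd e)) = h 1 2 + h 2 3 + h 3 1 + h 2 1 + h 3 2 + h 1 (3::nat)"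
  for h :: "nat \<Rightarrow> nat \<Rightarrow> 'm::char2"
  by (simp add: unequal_pairs_def add.assoc)

lemma unequal_pairsD: "(x, y) \<in> unequal_pairs \<Longrightarrow> x \<noteq> y \<and> x \<in> {1..3} \<and> y \<in> {1..3}"
  by (auto simp: unequal_pairs_def)

lemma pair_sum_cong:
  assumes "\<And>a' b'. \<lbrakk>\<And>j. j \<notin> set I \<Longrightarrow> a' j = a j \<and> b' j = b j; \<And>j. j \<in> set I \<Longrightarrow> (a' j, b' j) \<in> unequal_pairs\<rbrakk> \<Longrightarrow>
    g a' b' = h a' b'"
  shows "pair_sum I g a b = pair_sum I h a b"
  using assms
proof (induction I arbitrary: a b)
  case (Cons i I)
  have "pair_sum I g (a(i := fst e)) (b(i := snd e)) = pair_sum I h (a(i := fst e)) (b(i := snd e))"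
    if e: "e \<in> unequal_pairs" for e
  proof (rule Cons.IH)
    fix a' b'
    assume h: "\<And>j. j \<notin> set I \<Longrightarrow> a' j = (a(i := fst e)) j \<and> b' j = (b(i := snd e)) j"
      "\<And>j. j \<in> set I \<Longrightarrow> (a' j, b' j) \<in> unequal_pairs"
    show "g a' b' = h a' b'"
    proof (rule Cons.prems)
      fix j
      show "a' j = a j \<and> b' j = b j" if "j \<notin> set (i # I)" using h(1)[of j] that by simp
      show "(a' j, b' j) \<in> unequal_pairs" if "j \<in> set (i # I)"
        using h(1)[of j] h(2)[of j] that e by (cases "j \<in> set I") auto
    qed
  qed
  then show ?case by simp
qed simp

lemma pair_sum_zero [simp]: "pair_sum I (\<lambda>a b. 0) a b = 0"
  by (induction I arbitrary: a b) simp_all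

lemma pair_sum_add: "pair_sum I (\<lambda>a b. g a b + h a b) a b = pair_sum I g a b + pair_sum I h a b"
  by (induction I arbitrary: a b) (simp_all add: sum.distrib)

lemma pair_sum_sum: "pair_sum I (\<lambda>a b. \<Sum>i\<in>S. g i a b) a b = (\<Sum>i\<in>S. pair_sum I (g i) a b)"
  by (induction S rule: infinite_finite_induct) (simp_all add: pair_sum_add)

lemma pair_sum_swap: "pair_sum I (\<lambda>a b. g b a) a b = pair_sum I g b a"
proof (induction I arbitrary: a b)
  case (Cons i I)
  have "(\<Sum>e\<in>unequal_pairs. pair_sum I g (b(i := snd e)) (a(i := fst e))) =
      (\<Sum>e\<in>unequal_pairs. pair_sum I g (b(i := fst e)) (a(i := snd e)))"
    unfolding sum_unequal_pairs[of "\<lambda>x y. pair_sum I g (b(i := x)) (a(i := y))"]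
      sum_unequal_pairs[of "\<lambda>x y. pair_sum I g (b(i := y)) (a(i := x))"]
    by (simp add: ac_simps)
  then show ?case by (simp only: pair_sum.simps Cons.IH)
qed simp

lemma pair_sum_upd:
  "i \<notin> set I \<Longrightarrow> pair_sum I (\<lambda>a b. g (a(i := v)) b) a b = pair_sum I g (a(i := v)) b"
  "i \<notin> set I \<Longrightarrow> pair_sum I (\<lambda>a b. g a (b(i := v))) a b = pair_sum I g a (b(i := v))"
  by (induction I arbitrary: a b) (auto simp: fun_upd_twist)

text \<open>If the left word loses its letter at \<open>i\<close>, each remaining pair of words occurs twice.\<close>

lemma pair_sum_cancel:
  assumes "i \<in> set I" "distinct I"
  shows "pair_sum I (\<lambda>a b. g (a(i := 0)) b) a b = 0"
  using assms
proof (induction I arbitrary: a b)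
  case (Cons j I)
  show ?case
  proof (cases "i = j")
    case True
    have "pair_sum I (\<lambda>a b. g (a(i := 0)) b) (a(j := x)) (b(j := y))
        = pair_sum I g (a(j := 0)) (b(j := y))" for x y
      using pair_sum_upd(1)[of i I g 0 "a(j := x)" "b(j := y)"] Cons.prems(2) True by simp
    then have "pair_sum (j # I) (\<lambda>a b. g (a(i := 0)) b) a b =
        (\<Sum>e\<in>unequal_pairs. pair_sum I g (a(j := 0)) (b(j := snd e)))"
      unfolding pair_sum.simps by (intro sum.cong refl)
    also have "\<dots> = 0"
      unfolding sum_unequal_pairs[of "\<lambda>x y. pair_sum I g (a(j := 0)) (b(j := y))"]
      by (simp add: ac_simps add_self add_left_self)
    finally show ?thesis .
  next
    case False
    then show ?thesis using Cons by simp
  qed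
qed simp

text \<open>Letters stand for the vertices in [3]; any other value, in practice 0, marks a factor in
  which the face has no vertex.\<close>

definition letter :: "nat \<Rightarrow> bool" where
  "letter x \<longleftrightarrow> x \<in> {1..3}"

definition base_word :: "nat \<Rightarrow> nat \<Rightarrow> nat \<Rightarrow> nat" where
  "base_word c x = (\<lambda>i. if i = 1 then 1 else if i = c then x else 0)"

text \<open>The formal properties of the numbers \<open_u_i>-free: words replace faces, so the
  reduction is pure combinatorics. As a locale it also applies to \<open>U\<close> with exchanged
  arguments, which turns statements about deletions on the left into statements about the
  right.\<close>

locale van_kampen_tower =
  fixes k :: nat and U :: "nat \<Rightarrow> (nat \<Rightarrow> nat) \<Rightarrow> (nat \<Rightarrow> nat) \<Rightarrow> bit"
  assumes disjoint: "\<And>m a b. (\<And>i. i \<in> {1..k+1} \<Longrightarrow> letter (a i) \<Longrightarrow> a i \<noteq> b i) \<Longrightarrow> U m a b = 0"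
    and leibniz: "\<And>m a b. (\<Sum>i\<in>{1..k+1}. if letter (a i) then U (Suc m) (a(i := 0)) b else 0) +
      (\<Sum>i\<in>{1..k+1}. if letter (b i) then U (Suc m) a (b(i := 0)) else 0) = U m a b + U m b a"
    and vertex: "U (Suc (2 * k)) (\<lambda>i. if i = 1 then 1 else 0) (\<lambda>i. if i = 1 then 1 else 0) = 1"
begin

text \<open>
  The sum of \<open>U m\<close> over the pairs of words \<open>1 0 \<dots> 0 x \<dots>\<close> and \<open>1 0 \<dots> 0 y \<dots>\<close> with \<open>x\<close>, \<open>y\<close> at
  position \<open>c\<close> and unequal letters after it.  By the Leibniz rule swapping \<open>x\<close> and \<open>y\<close> costs the
  deletion of either; all other deletions cancel in pairs or leave disjoint words.  Applied to
  \<open>12\<close>, \<open>23\<close>, \<open>31\<close> and then to \<open>01\<close>, \<open>02\<close>, \<open>03\<close>, this erases position \<open>c\<close> and raises \<open>m\<close> by 2.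
\<close>

definition partial_sum :: "nat \<Rightarrow> nat \<Rightarrow> nat \<Rightarrow> nat \<Rightarrow> bit" where
  "partial_sum c m x y = pair_sum [Suc c..<k+2] (U m) (base_word c x) (base_word c y)"

lemma deletion_sum:
  assumes c: "2 \<le> c" "c \<le> k + 1" and xy: "x \<noteq> y" "x \<le> 3"
  shows "(\<Sum>i\<in>{1..k+1}. pair_sum [Suc c..<k+2] (\<lambda>a b. if letter (a i) then U m (a(i := 0)) b else 0)
      (base_word c x) (base_word c y)) = (if x = 0 then 0 else partial_sum c m 0 y)"
proof -
  let ?I = "[Suc c..<k+2]"
  let ?D = "\<lambda>i a b. if letter (a i) then U m (a(i := 0)) b else 0"
  have z: "pair_sum ?I (?D i) (base_word c x) (base_word c y) = 0" if i: "i \<in> {1..k+1}" "i \<noteq> c" for i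
  proof (cases "i \<in> set ?I")
    case True
    have "pair_sum ?I (?D i) (base_word c x) (base_word c y) =
        pair_sum ?I (\<lambda>a b. U m (a(i := 0)) b) (base_word c x) (base_word c y)"
    proof (rule pair_sum_cong)
      fix a' b' assume "\<And>j. j \<in> set ?I \<Longrightarrow> (a' j, b' j) \<in> unequal_pairs"
      then have "letter (a' i)" using unequal_pairsD True unfolding letter_def by blast
      then show "?D i a' b' = U m (a'(i := 0)) b'" by simp
    qed
    also have "\<dots> = 0" by (rule pair_sum_cancel[OF True]) simp
    finally show ?thesis .
  next
    case False
    have "pair_sum ?I (?D i) (base_word c x) (base_word c y)
        = pair_sum ?I (\<lambda>a b. 0) (base_word c x) (base_word c y)"
    proof (rule pair_sum_cong)
      fix a' b'
      assume h: "\<And>j. j \<notin> set ?I \<Longrightarrow> a' j = base_word c x j \<and> b' j = base_word c y j"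
        "\<And>j. j \<in> set ?I \<Longrightarrow> (a' j, b' j) \<in> unequal_pairs"
      show "?D i a' b' = 0"
      proof (cases "i = 1")
        \<comment> \<open>Without its letter at 1 the left word meets the right one nowhere: the
          letters at \<open>c\<close> differ, and those after \<open>c\<close> are unequal.\<close>
        case True
        have "U m (a'(i := 0)) b' = 0"
        proof (rule disjoint)
          fix j assume j: "j \<in> {1..k+1}" "letter ((a'(i := 0)) j)"
          then have ji: "j \<noteq> i" by (auto simp: letter_def)
          show "(a'(i := 0)) j \<noteq> b' j"
          proof (cases "j \<in> set ?I")
            case True
            then show ?thesis using unequal_pairsD[OF h(2)] ji by simp
          next
            case False
            then show ?thesis using h(1)[OF False] j ji True xy(1)
              by (auto simp: base_word_def letter_def split: if_splits)
          qed
        qed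
        then show ?thesis by simp
      next
        case i1: False
        then show ?thesis using h(1)[OF False] i(2) by (simp add: base_word_def letter_def)
      qed
    qed
    then show ?thesis by simp
  qed
  have "(\<Sum>i\<in>{1..k+1}. pair_sum ?I (?D i) (base_word c x) (base_word c y)) =
      pair_sum ?I (?D c) (base_word c x) (base_word c y)"
    using z c by (subst sum.remove[of _ c]) auto
  also have "\<dots> = (if x = 0 then 0 else partial_sum c m 0 y)"
  proof -
    have "pair_sum ?I (?D c) (base_word c x) (base_word c y) =
        pair_sum ?I (\<lambda>a b. if x = 0 then 0 else U m (a(c := 0)) b) (base_word c x) (base_word c y)"
    proof (rule pair_sum_cong)
      fix a' b' assume "\<And>j. j \<notin> set ?I \<Longrightarrow> a' j = base_word c x j \<and> b' j = base_word c y j"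
      from this[of c] have "a' c = x" using c by (simp add: base_word_def)
      then show "?D c a' b' = (if x = 0 then 0 else U m (a'(c := 0)) b')" using xy(2) by (auto simp: letter_def)
    qed
    also have "\<dots> = (if x = 0 then 0 else pair_sum ?I (U m) ((base_word c x)(c := 0)) (base_word c y))"
      by (simp add: pair_sum_upd del: upt_Suc)
    also have "(base_word c x)(c := 0) = base_word c 0" using c by (auto simp: base_word_def)
    finally show ?thesis by (simp add: partial_sum_def)
  qed
  finally show ?thesis .
qed

lemma partial_sum_swap:
  assumes c: "2 \<le> c" "c \<le> k + 1" and xy: "x \<noteq> y" "x \<le> 3" "y \<le> 3"
  shows "partial_sum c m x y + partial_sum c m y x =
    (if x = 0 then 0 else partial_sum c (Suc m) 0 y) + (if y = 0 then 0 else partial_sum c (Suc m) x 0)"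
proof -
  let ?I = "[Suc c..<k+2]" and ?x = "base_word c x" and ?y = "base_word c y"
  have sw: "partial_sum c m x' y' = pair_sum ?I (\<lambda>a b. U m b a) (base_word c y') (base_word c x')" for m x' y'
    unfolding partial_sum_def by (rule pair_sum_swap[symmetric])
  have "partial_sum c m x y + partial_sum c m y x = pair_sum ?I (\<lambda>a b. U m a b + U m b a) ?x ?y"
    unfolding pair_sum_add sw[of m y x] by (simp add: partial_sum_def)
  also have "\<dots> = (\<Sum>i\<in>{1..k+1}. pair_sum ?I (\<lambda>a b. if letter (a i) then U (Suc m) (a(i := 0)) b else 0) ?x ?y) +
      (\<Sum>i\<in>{1..k+1}. pair_sum ?I (\<lambda>a b. if letter (b i) then U (Suc m) a (b(i := 0)) else 0) ?x ?y)"
    unfolding leibniz[symmetric] pair_sum_add pair_sum_sum ..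
  also have "(\<Sum>i\<in>{1..k+1}. pair_sum ?I (\<lambda>a b. if letter (a i) then U (Suc m) (a(i := 0)) b else 0) ?x ?y) =
      (if x = 0 then 0 else partial_sum c (Suc m) 0 y)"
    by (rule deletion_sum[OF c xy(1,2)])
  also have "(\<Sum>i\<in>{1..k+1}. pair_sum ?I (\<lambda>a b. if letter (b i) then U (Suc m) a (b(i := 0)) else 0) ?x ?y) =
      (if y = 0 then 0 else partial_sum c (Suc m) x 0)"
  proof -
    \<comment> \<open>Deletions on the right are deletions on the left for \<open>U\<close> with its
      arguments exchanged, and the assumptions are symmetric under this exchange.\<close>
    interpret flip: van_kampen_tower k "\<lambda>m a b. U m b a"
    proof unfold_locales
      fix m a b
      show "U m b a = 0" if "\<And>i. i \<in> {1..k+1} \<Longrightarrow> letter (a i) \<Longrightarrow> a i \<noteq> b i"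
        by (rule disjoint) (use that in fastforce)
      show "(\<Sum>i\<in>{1..k+1}. if letter (a i) then U (Suc m) b (a(i := 0)) else 0) +
        (\<Sum>i\<in>{1..k+1}. if letter (b i) then U (Suc m) (b(i := 0)) a else 0) = U m b a + U m a b"
        using leibniz[where m = m and a = b and b = a] by (simp only: add.commute)
    qed (rule vertex)
    have "flip.partial_sum c (Suc m) 0 x = partial_sum c (Suc m) x 0"
      unfolding flip.partial_sum_def partial_sum_def by (rule pair_sum_swap)
    moreover have "(\<Sum>i\<in>{1..k+1}. pair_sum ?I (\<lambda>a b. if letter (b i) then U (Suc m) a (b(i := 0))
        else 0) ?x ?y) =
      (\<Sum>i\<in>{1..k+1}. pair_sum ?I (\<lambda>a b. if letter (a i) then U (Suc m) b (a(i := 0)) else 0) ?y ?x)"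
      by (rule sum.cong[OF refl]) (rule pair_sum_swap)
    ultimately show ?thesis using flip.deletion_sum[OF c xy(1)[symmetric] xy(3), of "Suc m"] by simp
  qed
  finally show ?thesis .
qed

lemma pair_sum_step:
  assumes c: "2 \<le> c" "c \<le> k + 1"
  shows "pair_sum [c..<k+2] (U m) (base_word c 0) (base_word c 0) = partial_sum c (m + 2) 0 0"
proof -
  note p = partial_sum_swap[OF c]
  have b: "(base_word c 0)(c := x) = base_word c x" for x using c by (auto simp: base_word_def)
  have e: "[c..<k+2] = c # [Suc c..<k+2]" using c by (simp add: upt_rec)
  have "pair_sum [c..<k+2] (U m) (base_word c 0) (base_word c 0) =
      (partial_sum c m 1 2 + partial_sum c m 2 1) + (partial_sum c m 2 3 + partial_sum c m 3 2) +
      (partial_sum c m 3 1 + partial_sum c m 1 3)"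
    unfolding e pair_sum.simps b partial_sum_def[symmetric] sum_unequal_pairs by (simp only: ac_simps)
  \<comment> \<open>Swapping along 12, 23, 31 leaves 0y for y = 2, 3, 1 and x0 for x = 1, 2, 3,
    which are regrouped by letter.\<close>
  also have "\<dots> = (partial_sum c (Suc m) 0 1 + partial_sum c (Suc m) 1 0) +
      (partial_sum c (Suc m) 0 2 + partial_sum c (Suc m) 2 0) + (partial_sum c (Suc m) 0 3 +
          partial_sum c (Suc m) 3 0)"
    using p[of 1 2 m] p[of 2 3 m] p[of 3 1 m] by (simp add: ac_simps)
  \<comment> \<open>Each group is a swap of 0 with a letter, which deletes that letter and always
    gives the same term; three copies make one.\<close>
  also have "\<dots> = partial_sum c (Suc (Suc m)) 0 0"
    using p[of 0 1 "Suc m"] p[of 0 2 "Suc m"] p[of 0 3 "Suc m"] by (simp add: add_self)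
  finally show ?thesis by simp
qed

lemma pair_sum_telescope:
  "2 \<le> c \<Longrightarrow> c \<le> k + 2 \<Longrightarrow> pair_sum [c..<k+2] (U m) (base_word c 0) (base_word c 0) =
     U (m + 2 * (k + 2 - c)) (base_word c 0) (base_word c 0)"
proof (induction "k + 2 - c" arbitrary: c m)
  case 0
  then show ?case by simp
next
  case (Suc j)
  have c: "c \<le> k + 1" using Suc.hyps(2) by simp
  have b: "base_word (Suc c) 0 = base_word c 0" by (auto simp: base_word_def)
  have "pair_sum [c..<k+2] (U m) (base_word c 0) (base_word c 0) =
      pair_sum [Suc c..<k+2] (U (m + 2)) (base_word (Suc c) 0) (base_word (Suc c) 0)"
    unfolding pair_sum_step[OF Suc.prems(1) c] partial_sum_def b ..
  also have "\<dots> = U (m + 2 + 2 * (k + 2 - Suc c)) (base_word (Suc c) 0) (base_word (Suc c) 0)"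
    by (rule Suc.hyps(1)) (use Suc.hyps(2) Suc.prems(1) c in auto)
  also have "m + 2 + 2 * (k + 2 - Suc c) = m + 2 * (k + 2 - c)" using c by simp
  finally show ?case unfolding b .
qed

lemma van_kampen_number:
  "pair_sum [2..<k+2] (U 1) (\<lambda>i. if i = 1 then 1 else 0) (\<lambda>i. if i = 1 then 1 else 0) = 1"
proof -
  have b: "base_word 2 0 = (\<lambda>i. if i = 1 then 1 else 0)" by (auto simp: base_word_def)
  show ?thesis using pair_sum_telescope[of 2 1] vertex unfolding b by simp
qed

end

section \<open>From octahedra to words\<close>

lemma sum_PiE_insert:
  assumes "i \<notin> S"
  shows "(\<Sum>a\<in>PiE (insert i S) T. H a) = (\<Sum>x\<in>T i. \<Sum>a\<in>PiE S T. H (a(i := x)))"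
proof -
  have "(\<Sum>a\<in>PiE (insert i S) T. H a) = (\<Sum>z\<in>T i \<times> PiE S T. H ((\<lambda>(y, g). g(i := y)) z))"
    unfolding PiE_insert_eq by (rule sum.reindex_cong[OF inj_combinator[OF assms] refl]) simp
  then show ?thesis by (simp add: sum.cartesian_product case_prod_beta)
qed

text \<open>At one position the factors {1, 2}, {1, 3} and the factors {1, 3}, {1, 2} contribute
  eight pairs of letters. The pair 11 occurs twice and cancels; the other six are the unequal pairs.
  The expression \<open>5 - s i\<close> exchanges 2 and 3.\<close>

lemma pair_sum_octahedra:
  "distinct I \<Longrightarrow> (\<Sum>s\<in>PiE (set I) (\<lambda>_. {2, 3}). \<Sum>a\<in>PiE (set I) (\<lambda>i. {1, s i}). \<Sum>b\<in>PiE (set I) (\<lambda>i. {1, 5 - s i}).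
     g (override_on a0 a (set I)) (override_on b0 b (set I))) = pair_sum I g a0 b0"
proof (induction I arbitrary: a0 b0)
  case (Cons i I)
  let ?J = "set I"
  have iJ: "i \<notin> ?J" and dI: "distinct I" using Cons.prems by auto
  have ov: "override_on a0 (a(i := x)) (insert i ?J) = override_on (a0(i := x)) a ?J"
    for a0 a :: "nat \<Rightarrow> nat" and x
    using iJ by (auto simp: override_on_def fun_eq_iff)
  have fam: "PiE ?J (\<lambda>j. {1, (s(i := t)) j}) = PiE ?J (\<lambda>j. {1, s j})"
    "PiE ?J (\<lambda>j. {1, 5 - (s(i := t)) j}) = PiE ?J (\<lambda>j. {1, 5 - s j})" for s :: "nat \<Rightarrow> nat" and t
    using iJ by (auto intro!: PiE_cong)
  let ?S = "PiE ?J (\<lambda>_. {2, 3 :: nat})" and ?A = "\<lambda>s. PiE ?J (\<lambda>j. {1, s j :: nat})"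
    and ?C = "\<lambda>s. PiE ?J (\<lambda>j. {1, 5 - s j :: nat})"
  let ?G = "\<lambda>x y s a b. g (override_on (a0(i := x)) a ?J) (override_on (b0(i := y)) b ?J)"
  have "(\<Sum>s\<in>PiE (set (i # I)) (\<lambda>_. {2, 3}). \<Sum>a\<in>PiE (set (i # I)) (\<lambda>i. {1, s i}). \<Sum>b\<in>PiE (set (i #
      I)) (\<lambda>i. {1, 5 - s i}).
     g (override_on a0 a (set (i # I))) (override_on b0 b (set (i # I)))) =
    (\<Sum>t\<in>{2, 3}. \<Sum>s\<in>?S. \<Sum>x\<in>{1, t}. \<Sum>a\<in>?A s. \<Sum>y\<in>{1, 5 - t}. \<Sum>b\<in>?C s. ?G x y s a b)"
    unfolding list.set sum_PiE_insert[OF iJ] fam ov fun_upd_same ..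
  also have "\<dots> = (\<Sum>t\<in>{2, 3}. \<Sum>x\<in>{1, t}. \<Sum>y\<in>{1, 5 - t}. \<Sum>s\<in>?S. \<Sum>a\<in>?A s. \<Sum>b\<in>?C s. ?G x y s a b)"
  proof (rule sum.cong[OF refl])
    fix t :: nat
    have "(\<Sum>s\<in>?S. \<Sum>x\<in>{1, t}. \<Sum>a\<in>?A s. \<Sum>y\<in>{1, 5 - t}. \<Sum>b\<in>?C s. ?G x y s a b) =
      (\<Sum>s\<in>?S. \<Sum>x\<in>{1, t}. \<Sum>y\<in>{1, 5 - t}. \<Sum>a\<in>?A s. \<Sum>b\<in>?C s. ?G x y s a b)"
      by (intro sum.cong refl) (rule sum.swap)
    also have "\<dots> = (\<Sum>x\<in>{1, t}. \<Sum>s\<in>?S. \<Sum>y\<in>{1, 5 - t}. \<Sum>a\<in>?A s. \<Sum>b\<in>?C s. ?G x y s a b)"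
      by (rule sum.swap)
    also have "\<dots> = (\<Sum>x\<in>{1, t}. \<Sum>y\<in>{1, 5 - t}. \<Sum>s\<in>?S. \<Sum>a\<in>?A s. \<Sum>b\<in>?C s. ?G x y s a b)"
      by (intro sum.cong refl) (rule sum.swap)
    finally show "(\<Sum>s\<in>?S. \<Sum>x\<in>{1, t}. \<Sum>a\<in>?A s. \<Sum>y\<in>{1, 5 - t}. \<Sum>b\<in>?C s. ?G x y s a b) =
      (\<Sum>x\<in>{1, t}. \<Sum>y\<in>{1, 5 - t}. \<Sum>s\<in>?S. \<Sum>a\<in>?A s. \<Sum>b\<in>?C s. ?G x y s a b)" .
  qed
  also have "\<dots> = (\<Sum>t\<in>{2, 3}. \<Sum>x\<in>{1, t}. \<Sum>y\<in>{1, 5 - t}. pair_sum I g (a0(i := x)) (b0(i := y)))"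
    unfolding Cons.IH[OF dI] ..
  also have "\<dots> = pair_sum (i # I) g a0 b0"
    unfolding pair_sum.simps sum_unequal_pairs[of "\<lambda>x y. pair_sum I g (a0(i := x)) (b0(i := y))"]
    by (simp add: ac_simps add_self add_left_self)
  finally show ?case .
qed simp

lemma sum_remove_nth:
  assumes "distinct L"
  shows "(\<Sum>i<length L. h (take i L @ drop (Suc i) L)) = (\<Sum>x\<in>set L. h (removeAll x L))"
proof -
  have r: "removeAll (L ! i) L = take i L @ drop (Suc i) L" if i: "i < length L" for i
  proof -
    have e: "L = take i L @ L ! i # drop (Suc i) L" by (rule id_take_nth_drop[OF i])
    have d: "distinct (take i L @ L ! i # drop (Suc i) L)" using assms e by simp
    have "removeAll (L ! i) L = removeAll (L ! i) (take i L @ L ! i # drop (Suc i) L)"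
      by (rule arg_cong[OF e])
    also have "\<dots> = take i L @ drop (Suc i) L" using d by (simp add: removeAll_id)
    finally show ?thesis .
  qed
  have "(\<Sum>x\<in>set L. h (removeAll x L)) = (\<Sum>i<length L. h (removeAll (L ! i) L))"
    using sum.reindex_bij_betw[OF bij_betw_nth[OF assms refl refl], of "\<lambda>x. h (removeAll x L)"] by simp
  then show ?thesis by (simp add: r)
qed

text \<open>The vertices are listed by increasing position, so that erasing a letter of the word
  removes one entry of the list and keeps the order of the others.\<close>

definition word_list :: "nat \<Rightarrow> (nat \<Rightarrow> nat) \<Rightarrow> (nat \<times> nat) list" where
  "word_list k a = map (\<lambda>i. (i, a i)) (filter (\<lambda>i. letter (a i)) [1..<k+2])"

lemma set_word_list: "set (word_list k a) = (\<lambda>i. (i, a i)) ` {i \<in> {1..k+1}. letter (a i)}"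
  by (auto simp: word_list_def simp del: upt_Suc)

lemma distinct_word_list: "distinct (word_list k a)"
  by (auto simp: word_list_def distinct_map inj_on_def simp del: upt_Suc)

lemma removeAll_word_list:
  assumes "letter (a i)"
  shows "removeAll (i, a i) (word_list k a) = word_list k (a(i := 0))"
proof -
  have "removeAll (i, a i) (word_list k a) = map (\<lambda>j. (j, a j)) (filter (\<lambda>j. letter (a j)
      \<and> (i, a i) \<noteq> (j, a j)) [1..<k+2])"
    by (simp add: word_list_def removeAll_filter_not_eq filter_map o_def conj_commute del: upt_Suc)
  also have "filter (\<lambda>j. letter (a j) \<and> (i, a i) \<noteq> (j, a j)) [1..<k+2]
      = filter (\<lambda>j. letter ((a(i := 0)) j)) [1..<k+2]"
    by (rule filter_cong[OF refl]) (auto simp: letter_def)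
  also have "map (\<lambda>j. (j, a j)) \<dots> = word_list k (a(i := 0))"
    unfolding word_list_def
      by (rule map_cong[OF refl]) (auto simp: letter_def split: if_splits simp del: upt_Suc)
  finally show ?thesis .
qed

lemma sum_word_list:
  "(\<Sum>i<length (word_list k a). h (take i (word_list k a) @ drop (Suc i) (word_list k a))) =
    (\<Sum>i\<in>{1..k+1}. if letter (a i) then h (word_list k (a(i := 0))) else 0)"
proof -
  have "(\<Sum>x\<in>set (word_list k a). h (removeAll x (word_list k a))) =
      (\<Sum>i\<in>{i \<in> {1..k+1}. letter (a i)}. h (removeAll (i, a i) (word_list k a)))"
    unfolding set_word_list by (subst sum.reindex) (auto simp: inj_on_def)
  also have "\<dots> = (\<Sum>i\<in>{i \<in> {1..k+1}. letter (a i)}. h (word_list k (a(i := 0))))"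
    by (intro sum.cong refl) (simp add: removeAll_word_list)
  also have "\<dots> = (\<Sum>i\<in>{1..k+1}. if letter (a i) then h (word_list k (a(i := 0))) else 0)"
    by (rule sum.inter_filter) simp
  finally show ?thesis unfolding sum_remove_nth[OF distinct_word_list] .
qed

lemma word_list_cong:
  assumes "\<And>i. i \<in> {1..k+1} \<Longrightarrow> a i = b i"
  shows "word_list k a = word_list k b"
proof -
  have "filter (\<lambda>i. letter (a i)) [1..<k+2] = filter (\<lambda>i. letter (b i)) [1..<k+2]"
    by (rule filter_cong[OF refl]) (use assms in auto)
  then show ?thesis unfolding word_list_def using assms by (auto intro!: map_cong simp del: upt_Suc)
qed

definition face_list :: "nat \<Rightarrow> (nat \<times> nat) set \<Rightarrow> (nat \<times> nat) list" where
  "face_list k \<tau> = map (\<lambda>i. (i, THE c. (i, c) \<in> \<tau>)) [1..<k+2]"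

lemma face_list_span_face: "face_list k (span_face k a) = map (\<lambda>i. (i, a i)) [1..<k+2]"
  unfolding face_list_def by (rule map_cong[OF refl]) (auto simp: span_face_def image_iff simp del: upt_Suc)

lemma face_list:
  "length (face_list k \<tau>) = Suc k" "distinct (face_list k \<tau>)"
  "set (face_list k (span_face k a)) = span_face k a"
proof -
  show "length (face_list k \<tau>) = Suc k" by (simp add: face_list_def)
  show "distinct (face_list k \<tau>)" by (auto simp: face_list_def distinct_map inj_on_def simp del: upt_Suc)
  show "set (face_list k (span_face k a)) = span_face k a"
    unfolding face_list_span_face by (auto simp: span_face_def simp del: upt_Suc)
qed

lemma face_list_word_list:
  assumes "\<And>i. i \<in> {1..k+1} \<Longrightarrow> letter (a i)"
  shows "face_list k (span_face k a) = word_list k a"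
proof -
  have "filter (\<lambda>i. letter (a i)) [1..<k+2] = [1..<k+2]"
    by (rule filter_True) (use assms in auto)
  then show ?thesis by (simp only: face_list_span_face word_list_def)
qed

lemma span_face_cong: "(\<And>i. i \<in> {1..k+1} \<Longrightarrow> a i = b i) \<Longrightarrow> span_face k a = span_face k b"
  by (simp add: span_face_def)

lemma octahedron_of_image: "octahedron_of k p = span_face k ` PiE {1..k+1} p"
proof
  show "octahedron_of k p \<subseteq> span_face k ` PiE {1..k+1} p"
  proof
    fix \<tau> assume "\<tau> \<in> octahedron_of k p"
    then obtain a where a: "\<tau> = span_face k a" "\<forall>i\<in>{1..k+1}. a i \<in> p i" unfolding octahedron_of_def by blast
    have "\<tau> = span_face k (restrict a {1..k+1})" unfolding a(1) by (rule span_face_cong) simp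
    moreover have "restrict a {1..k+1} \<in> PiE {1..k+1} p" using a(2) by auto
    ultimately show "\<tau> \<in> span_face k ` PiE {1..k+1} p" by blast
  qed
  show "span_face k ` PiE {1..k+1} p \<subseteq> octahedron_of k p"
    by (auto simp: octahedron_of_def PiE_iff)
qed

lemma inj_on_span_face: "inj_on (span_face k) (PiE {1..k+1} p)"
proof (rule inj_onI)
  fix a b assume ab: "a \<in> PiE {1..k+1} p" "b \<in> PiE {1..k+1} p" "span_face k a = span_face k b"
  show "a = b"
  proof (rule PiE_ext[OF ab(1,2)])
    fix i assume "i \<in> {1..k+1}"
    then have "(i, a i) \<in> span_face k b" unfolding ab(3)[symmetric] by (simp add: span_face_def)
    then show "a i = b i" by (auto simp: span_face_def)
  qed
qed

lemma sum_octahedron_of: "(\<Sum>\<tau>\<in>octahedron_of k p. h \<tau>) = (\<Sum>a\<in>PiE {1..k+1} p. h (span_face k a))"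
  unfolding octahedron_of_image by (rule sum.reindex_cong[OF inj_on_span_face refl refl])

lemma octahedraE:
  assumes "P \<in> octahedra n k"
  obtains p where "P = octahedron_of k p" "\<And>i. i \<in> {1..k+1} \<Longrightarrow> p i \<subseteq> {1..n} \<and> card (p i) = 2"
    "\<And>i. i \<in> {1..k+1} \<Longrightarrow> factor P i = p i"
proof -
  obtain p where p: "P = octahedron_of k p" "\<forall>i\<in>{1..k+1}. p i \<subseteq> {1..n} \<and> card (p i) = 2"
    using assms unfolding octahedra_def by blast
  then have "\<forall>i\<in>{1..k+1}. p i \<noteq> {}" by fastforce
  then show thesis using that p factor_octahedron_of by blast
qed

lemma octahedron_faces:
  assumes P: "P \<in> octahedra n k"
  shows "finite P" "\<tau> \<in> P \<Longrightarrow> set (face_list k \<tau>) = \<tau> \<and> \<tau> \<in> join_complex n k"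
proof -
  obtain p where p: "P = octahedron_of k p" "\<And>i. i \<in> {1..k+1} \<Longrightarrow> p i \<subseteq> {1..n} \<and> card (p i) = 2"
    "\<And>i. i \<in> {1..k+1} \<Longrightarrow> factor P i = p i"
    using octahedraE[OF P] by blast
  have "finite (p i)" if "i \<in> {1..k+1}" for i using p(2)[OF that] by (meson finite_atLeastAtMost finite_subset)
  then show "finite P" unfolding p(1) octahedron_of_image by (intro finite_imageI finite_PiE) auto
  assume "\<tau> \<in> P"
  then obtain a where a: "\<tau> = span_face k a" "\<forall>i\<in>{1..k+1}. a i \<in> p i" unfolding p(1) octahedron_of_def by blast
  have "\<forall>i\<in>{1..k+1}. a i \<in> {1..n}" using a(2) p(2) by blast
  moreover have "(1, a 1) \<in> \<tau>" unfolding a(1) span_face_def by auto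
  ultimately have "\<tau> \<in> join_complex n k" unfolding join_complex_def a(1) by blast
  then show "set (face_list k \<tau>) = \<tau> \<and> \<tau> \<in> join_complex n k" using face_list(3) a(1) by simp
qed

lemma join_complex_closed: "\<forall>\<tau>\<in>join_complex n k. \<forall>\<sigma>\<subseteq>\<tau>. \<sigma> \<noteq> {} \<longrightarrow> \<sigma> \<in> join_complex n k"
  unfolding join_complex_def by blast

lemma join_complex_face:
  assumes "\<tau> \<in> join_complex n k"
  shows "finite \<tau>" "card \<tau> \<le> Suc k"
proof -
  obtain a where a: "\<tau> \<subseteq> span_face k a" using assms by (auto simp: join_complex_def)
  have f: "finite (span_face k a)" by (simp add: span_face_def)
  show "finite \<tau>" using a f by (rule finite_subset)
  have "card \<tau> \<le> card (span_face k a)" using f a by (rule card_mono)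
  also have "\<dots> \<le> card {1..k+1}" unfolding span_face_def by (rule card_image_le) simp
  finally show "card \<tau> \<le> Suc k" by simp
qed

lemma finite_join_complex: "finite (join_complex n k)"
proof (rule finite_subset)
  show "join_complex n k \<subseteq> Pow ({1..k+1} \<times> {1..n})"
    unfolding join_complex_def span_face_def by blast
qed simp

section \<open>Intersection numbers of octahedra\<close>

locale embedded_join = embedded_complex M k d \<eta> \<delta> D "join_complex n k" f N \<mu>
  for M :: "'a topology" and k d \<eta> \<delta> D and n :: nat and f N \<mu> +
  assumes n: "n \<ge> 3"
begin

lemma is_face_word_list: "is_face (word_list k a)"
proof (cases "word_list k a = []")
  case False
  \<comment> \<open>Absent letters are filled in by 1 to obtain a full face containing the given
    one; n \<ge> 3 makes all letters vertices.\<close>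
  define a' where "a' = (\<lambda>i. if letter (a i) then a i else 1)"
  have "\<forall>i\<in>{1..k+1}. a' i \<in> {1..n}" using n by (auto simp: a'_def letter_def)
  moreover have "set (word_list k a) \<subseteq> span_face k a'" by (auto simp: set_word_list span_face_def a'_def)
  moreover have "set (word_list k a) \<noteq> {}" using False by simp
  ultimately have "set (word_list k a) \<in> join_complex n k" unfolding join_complex_def by blast
  then show ?thesis using distinct_word_list by (simp add: is_face_def)
qed (simp add: is_face_def)

lemma tower_words: "van_kampen_tower k (\<lambda>m a b. tower m (word_list k a) (word_list k b))"
proof unfold_locales
  fix m a b
  show "tower m (word_list k a) (word_list k b) = 0"
    if h: "\<And>i. i \<in> {1..k+1} \<Longrightarrow> letter (a i) \<Longrightarrow> a i \<noteq> b i"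
  proof (rule tower_disjoint[OF is_face_word_list is_face_word_list])
    show "set (word_list k a) \<inter> set (word_list k b) = {}" using h by (auto simp: set_word_list)
  qed
  show "(\<Sum>i\<in>{1..k+1}. if letter (a i) then tower (Suc m) (word_list k (a(i := 0))) (word_list k b) else 0) +
      (\<Sum>i\<in>{1..k+1}. if letter (b i) then tower (Suc m) (word_list k a) (word_list k (b(i := 0))) else 0) =
      tower m (word_list k a) (word_list k b) + tower m (word_list k b) (word_list k a)"
    using tower_leibniz[OF is_face_word_list[of a] is_face_word_list[of b], of "Suc m"]
    unfolding sum_word_list[where h = "\<lambda>L. tower (Suc m) L (word_list k b)"]
      sum_word_list[where h = "tower (Suc m) (word_list k a)"] by simp
next
  have "filter (\<lambda>i. letter (if i = 1 then 1 else 0)) [1..<k+2] = [1]"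
  proof -
    have "[1..<k+2] = 1 # [Suc 1..<k+2]" by (rule upt_conv_Cons) simp
    moreover have "filter (\<lambda>i. letter (if i = 1 then 1 else 0)) [2..<k+2] = []"
      by (auto simp: filter_empty_conv letter_def)
    ultimately show ?thesis unfolding Suc_1 by (simp add: letter_def del: upt_Suc)
  qed
  then have w: "word_list k (\<lambda>i. if i = 1 then 1 else 0) = [(1, 1)]" by (simp add: word_list_def)
  have "set (word_list k (\<lambda>i. if i = 1 then 1 else 0)) \<in> join_complex n k"
    using is_face_word_list[of "\<lambda>i. if i = 1 then 1 else 0"] unfolding w by (simp add: is_face_def)
  then have "{(1, 1)} \<in> join_complex n k" unfolding w by simp
  then show "tower (Suc (2 * k)) (word_list k (\<lambda>i. if i = 1 then 1 else 0)) (word_list k (\<lambda>i. if i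
      = 1 then 1 else 0)) = 1"
    unfolding w by (rule tower_vertex)
qed

sublocale words: van_kampen_tower k "\<lambda>m a b. tower m (word_list k a) (word_list k b)"
  by (rule tower_words)

definition octahedral_cycle :: "octahedron \<Rightarrow> 'a chain2" where
  "octahedral_cycle P = (\<Sum>\<tau>\<in>P. gen2 (list_face f (face_list k \<tau>)))"

lemma is_face_face_list:
  assumes "P \<in> octahedra n k" "\<tau> \<in> P"
  shows "is_face (face_list k \<tau>)" "length (face_list k \<tau>) = Suc k"
  using octahedron_faces(2)[OF assms] face_list(1,2)[of k \<tau>] by (auto simp: is_face_def)

text \<open>Deleting the vertex at a fixed position forgets which of the two vertices of that factor
  was chosen, so the faces cancel in pairs.\<close>

lemma octahedral_cycle:
  assumes P: "P \<in> octahedra n k"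
  shows "singular_cycle2 k M (octahedral_cycle P)"
  unfolding singular_cycle2_def
proof
  have s: "singular_simplex k M (list_face f (face_list k \<tau>))" if "\<tau> \<in> P" for \<tau>
    using face_simplex(1)[OF is_face_face_list(1)[OF P that]] is_face_face_list(2)[OF P that] by fastforce
  show "singular_chain2 k M (octahedral_cycle P)"
    unfolding octahedral_cycle_def by (rule singular_chain2_sum) (simp add: s)
  obtain p where p: "P = octahedron_of k p" "\<And>i. i \<in> {1..k+1} \<Longrightarrow> p i \<subseteq> {1..n} \<and> card (p i) = 2"
    "\<And>i. i \<in> {1..k+1} \<Longrightarrow> factor P i = p i"
    using octahedraE[OF P] by blast
  let ?L = "\<lambda>a. map (\<lambda>i. (i, a i)) [1..<k+2]"
  have b: "bdry k (list_face f (?L a)) = (\<Sum>i\<le>k. gen2 (list_face f (take i (?L a) @ drop (Suc i) (?L a))))" for a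
  proof -
    have l: "length (?L a) = Suc k" by simp
    have "singular_face k i (list_face f (?L a))
        = list_face f (take i (?L a) @ drop (Suc i) (?L a))" if "i \<le> k" for i
      using singular_face_list_face[of "?L a" i f] that k unfolding l by simp
    then show ?thesis using k by (simp add: bdry_def del: upt_Suc)
  qed
  have z: "(\<Sum>a\<in>PiE {1..k+1} p. gen2 (list_face f (take i (?L a) @ drop (Suc i) (?L a)))) = 0"
    if i: "i \<le> k" for i
  proof -
    let ?h = "\<lambda>a. gen2 (list_face f (take i (?L a) @ drop (Suc i) (?L a)))"
    have "?h (a(Suc i := x)) = ?h a" for a x
    proof -
      have "take i (?L (a(Suc i := x))) = take i (?L a)" "drop (Suc i) (?L (a(Suc i := x)))
          = drop (Suc i) (?L a)"
        unfolding take_map drop_map using i by (auto simp del: upt_Suc)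
      then show ?thesis by simp
    qed
    moreover have "{1..k+1} = insert (Suc i) ({1..k+1} - {Suc i})" using i by auto
    moreover obtain x y where "p (Suc i) = {x, y}" "x \<noteq> y"
      using p(2)[of "Suc i"] i by (auto simp: card_2_iff)
    ultimately show ?thesis
      using sum_PiE_insert[of "Suc i" "{1..k+1} - {Suc i}" ?h p] by (simp add: add_self)
  qed
  have "octahedral_cycle P = (\<Sum>a\<in>PiE {1..k+1} p. gen2 (list_face f (?L a)))"
    unfolding octahedral_cycle_def p(1) sum_octahedron_of face_list_span_face ..
  then have "chain_boundary2 k (octahedral_cycle P) =
      (\<Sum>a\<in>PiE {1..k+1} p. \<Sum>i\<le>k. gen2 (list_face f (take i (?L a) @ drop (Suc i) (?L a))))"
    unfolding chain_boundary2_lin by (simp only: lin_sum lin_gen2 b)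
  also have "\<dots> = (\<Sum>i\<le>k. \<Sum>a\<in>PiE {1..k+1} p. gen2 (list_face f (take i (?L a) @ drop (Suc i) (?L a))))"
    by (rule sum.swap)
  also have "\<dots> = 0" by (rule sum.neutral, rule ballI, rule z) simp
  finally show "chain_boundary2 k (octahedral_cycle P) = 0" .
qed

definition octahedral_class :: "octahedron \<Rightarrow> 'a chain2 set" where
  "octahedral_class P = homology_class2 k M (octahedral_cycle P)"

lemma intersection_octahedra:
  assumes P: "P \<in> octahedra n k" and Q: "Q \<in> octahedra n k"
  shows "intersection_form2 k M (octahedral_class P) (octahedral_class Q) =
    (\<Sum>\<tau>\<in>P. \<Sum>\<upsilon>\<in>Q. tower 1 (face_list k \<tau>) (face_list k \<upsilon>))"
  unfolding octahedral_class_def octahedral_cycle_def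
  by (rule intersection_form2_tower)
    (use octahedron_faces(1) is_face_face_list octahedral_cycle[unfolded octahedral_cycle_def] P Q in blast)+

lemma octahedral_class_sym_diff:
  assumes "X \<in> octahedra n k" "Y \<in> octahedra n k"
  shows "octahedral_cycle (sym_diff X Y) = octahedral_cycle X + octahedral_cycle Y"
  unfolding octahedral_cycle_def using octahedron_faces(1) assms by (intro sum_sym_diff)

text \<open>Each pair of opposite octahedra is listed once by requiring its first member to have the
  first factor \<open>{1, 2}\<close>; the remaining factors are \<open>{1, s i}\<close> and \<open>{1, 5 - s i}\<close>.\<close>

definition first_octahedron :: "(nat \<Rightarrow> nat) \<Rightarrow> octahedron" where
  "first_octahedron s = octahedron_of k (\<lambda>i. if i = 1 then {1, 2} else {1, s i})"

definition second_octahedron :: "(nat \<Rightarrow> nat) \<Rightarrow> octahedron" where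
  "second_octahedron s = octahedron_of k (\<lambda>i. if i = 1 then {1, 3} else {1, 5 - s i})"

lemma octahedron_of_cong: "(\<And>i. i \<in> {1..k+1} \<Longrightarrow> p i = q i) \<Longrightarrow> octahedron_of k p = octahedron_of k q"
  by (simp add: octahedron_of_def)

lemma opposite_octahedra:
  assumes s: "s \<in> PiE {2..k+1} (\<lambda>_. {2, 3})"
  shows "first_octahedron s \<in> octahedra n k" "second_octahedron s \<in> octahedra n k"
    "i \<in> {1..k+1} \<Longrightarrow> factor (first_octahedron s) i = (if i = 1 then {1, 2} else {1, s i})"
    "i \<in> {1..k+1} \<Longrightarrow> factor (second_octahedron s) i = (if i = 1 then {1, 3} else {1, 5 - s i})"
proof -
  have s': "s i = 2 \<or> s i = 3" if "i \<in> {1..k+1}" "i \<noteq> 1" for i using s that by (auto simp: PiE_iff)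
  let ?p = "\<lambda>i. if i = 1 then {1, 2} else {1, s i}" and ?q = "\<lambda>i. if i = 1 then {1, 3} else {1, 5 - s i}"
  have pi: "(?p i \<subseteq> {1..n} \<and> card (?p i) = 2) \<and> (?q i \<subseteq> {1..n} \<and> card (?q i) = 2)" if i: "i \<in> {1..k+1}" for i
  proof (cases "i = 1")
    case False
    then show ?thesis using s'[OF i False] n by (elim disjE) simp_all
  qed (use n in simp)
  have p: "\<forall>i\<in>{1..k+1}. ?p i \<subseteq> {1..n} \<and> card (?p i) = 2" "\<forall>i\<in>{1..k+1}. ?q i \<subseteq> {1..n} \<and> card (?q i) = 2"
    using pi by blast+
  show "first_octahedron s \<in> octahedra n k" "second_octahedron s \<in> octahedra n k"
    unfolding octahedra_def first_octahedron_def second_octahedron_def using p by blast+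
  have ne: "\<forall>i\<in>{1..k+1}. ?p i \<noteq> {}" "\<forall>i\<in>{1..k+1}. ?q i \<noteq> {}" by simp_all
  show "i \<in> {1..k+1} \<Longrightarrow> factor (first_octahedron s) i = ?p i"
    unfolding first_octahedron_def by (rule factor_octahedron_of[OF ne(1)])
  show "i \<in> {1..k+1} \<Longrightarrow> factor (second_octahedron s) i = ?q i"
    unfolding second_octahedron_def by (rule factor_octahedron_of[OF ne(2)])
qed

definition opposite_pairs :: "octahedron set set" where
  "opposite_pairs = {{P, Q} | P Q. P \<in> octahedra n k \<and> Q \<in> octahedra n k \<and>
     (\<forall>i\<in>{1..k+1}. factor P i \<subseteq> {1..3} \<and> factor Q i \<subseteq> {1..3} \<and> factor P i \<inter> factor Q i = {1})}"

lemma opposite_factors: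
  fixes A B :: "nat set"
  assumes A: "A \<subseteq> {1..3}" "card A = 2" and B: "B \<subseteq> {1..3}" "card B = 2" and AB: "A \<inter> B = {1}"
  shows "A = {1, 2} \<and> B = {1, 3} \<or> A = {1, 3} \<and> B = {1, 2}"
proof -
  have one: "1 \<in> A" "1 \<in> B" using AB by auto
  have "card (A - {1}) = 1" "card (B - {1}) = 1" using A(2) B(2) one by simp_all
  then obtain x y where "A - {1} = {x}" "B - {1} = {y}" by (meson card_1_singletonE)
  then have x: "A = {1, x}" "x \<noteq> 1" and y: "B = {1, y}" "y \<noteq> 1" using one by auto
  have "x \<in> {1..3}" "y \<in> {1..3}" using x y A(1) B(1) by blast+
  then have "x = 2 \<or> x = 3" "y = 2 \<or> y = 3" using x(2) y(2) by auto
  moreover have "x \<noteq> y" using AB x y by blast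
  ultimately show ?thesis using x(1) y(1) by auto
qed

lemma opposite_pair_cases:
  assumes P: "P \<in> octahedra n k" and Q: "Q \<in> octahedra n k"
    and PQ: "\<forall>i\<in>{1..k+1}. factor P i \<subseteq> {1..3} \<and> factor Q i \<subseteq> {1..3} \<and> factor P i \<inter> factor Q i = {1}"
    and 2: "factor P 1 = {1, 2}"
  shows "\<exists>s\<in>PiE {2..k+1} (\<lambda>_. {2, 3}). P = first_octahedron s \<and> Q = second_octahedron s"
proof -
  obtain p where p: "P = octahedron_of k p" "\<And>i. i \<in> {1..k+1} \<Longrightarrow> p i \<subseteq> {1..n} \<and> card (p i) = 2"
    "\<And>i. i \<in> {1..k+1} \<Longrightarrow> factor P i = p i" using octahedraE[OF P] by blast
  obtain q where q: "Q = octahedron_of k q" "\<And>i. i \<in> {1..k+1} \<Longrightarrow> q i \<subseteq> {1..n} \<and> card (q i) = 2"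
    "\<And>i. i \<in> {1..k+1} \<Longrightarrow> factor Q i = q i" using octahedraE[OF Q] by blast
  have pq: "p i = {1, 2} \<and> q i = {1, 3} \<or> p i = {1, 3} \<and> q i = {1, 2}" if i: "i \<in> {1..k+1}" for i
    using PQ[rule_format, OF i] p(2)[OF i] q(2)[OF i] unfolding p(3)[OF i] q(3)[OF i]
    by (intro opposite_factors) auto
  define s where "s = restrict (\<lambda>i. if p i = {1, 2} then 2 else 3 :: nat) {2..k+1}"
  have s: "s \<in> PiE {2..k+1} (\<lambda>_. {2, 3})" by (auto simp: s_def)
  have p1: "p 1 = {1, 2}" using 2 p(3)[of 1] by simp
  have ne: "{1, 3} \<noteq> {1, 2 :: nat}" by (auto simp: doubleton_eq_iff)
  have e: "p i = (if i = 1 then {1, 2} else {1, s i}) \<and> q i = (if i = 1 then {1, 3} else {1, 5 - s i})"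
    if i: "i \<in> {1..k+1}" for i
  proof (cases "i = 1")
    case True
    then show ?thesis using p1 pq[OF i] ne by auto
  next
    case False
    then have "s i = (if p i = {1, 2} then 2 else 3)" using i by (simp add: s_def)
    then show ?thesis using pq[OF i] ne False by auto
  qed
  have "P = first_octahedron s" unfolding p(1) first_octahedron_def
    by (rule octahedron_of_cong) (use e in blast)
  moreover have "Q = second_octahedron s" unfolding q(1) second_octahedron_def
    by (rule octahedron_of_cong) (use e in blast)
  ultimately show ?thesis using s by blast
qed

lemma bij_betw_opposite_pairs:
  "bij_betw (\<lambda>s. {first_octahedron s, second_octahedron s}) (PiE {2..k+1} (\<lambda>_. {2, 3})) opposite_pairs"
  unfolding bij_betw_def
proof
  let ?S = "PiE {2..k+1} (\<lambda>_. {2, 3 :: nat})"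
  have one: "(1 :: nat) \<in> {1..k+1}" by simp
  have ne: "{1, 3} \<noteq> {1, 2 :: nat}" by (auto simp: doubleton_eq_iff)
  show "inj_on (\<lambda>s. {first_octahedron s, second_octahedron s}) ?S"
  proof (rule inj_onI)
    fix s t assume s: "s \<in> ?S" and t: "t \<in> ?S"
      and st: "{first_octahedron s, second_octahedron s} = {first_octahedron t, second_octahedron t}"
    note fs = opposite_octahedra(3,4)[OF s] and ft = opposite_octahedra(3,4)[OF t]
    have "first_octahedron s \<noteq> second_octahedron t"
      using fs(1)[OF one] ft(2)[OF one] ne by (metis (full_types))
    then have "first_octahedron s = first_octahedron t" using st by (auto simp: doubleton_eq_iff)
    then have f: "factor (first_octahedron s) i = factor (first_octahedron t) i" for i by simp
    show "s = t"
    proof (rule PiE_ext[OF s t])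
      fix i assume i: "i \<in> {2..k+1}"
      then have i': "i \<in> {1..k+1}" "i \<noteq> 1" by auto
      have "{1, s i} = {1, t i}" using f[of i] unfolding fs(1)[OF i'(1)] ft(1)[OF i'(1)] using i'(2) by simp
      moreover have "s i \<noteq> 1" "t i \<noteq> 1" using PiE_mem[OF s i] PiE_mem[OF t i] by auto
      ultimately show "s i = t i" by (auto simp: doubleton_eq_iff)
    qed
  qed
  show "(\<lambda>s. {first_octahedron s, second_octahedron s}) ` ?S = opposite_pairs"
  proof
    show "(\<lambda>s. {first_octahedron s, second_octahedron s}) ` ?S \<subseteq> opposite_pairs"
    proof
      fix E assume "E \<in> (\<lambda>s. {first_octahedron s, second_octahedron s}) ` ?S"
      then obtain s where s: "s \<in> ?S" and E: "E = {first_octahedron s, second_octahedron s}" by blast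
      note o = opposite_octahedra[OF s]
      have "factor (first_octahedron s) i \<subseteq> {1..3} \<and> factor (second_octahedron s) i \<subseteq> {1..3} \<and>
          factor (first_octahedron s) i \<inter> factor (second_octahedron s) i = {1}" if i: "i \<in> {1..k+1}" for i
      proof (cases "i = 1")
        case True
        then show ?thesis unfolding o(3)[OF i] o(4)[OF i] by auto
      next
        case False
        then have "s i = 2 \<or> s i = 3" using s i by (auto simp: PiE_iff)
        then show ?thesis unfolding o(3)[OF i] o(4)[OF i] using False by auto
      qed
      then have "\<forall>i\<in>{1..k+1}. factor (first_octahedron s) i \<subseteq> {1..3} \<and> factor (second_octahedron s) i \<subseteq> {1..3} \<and>
          factor (first_octahedron s) i \<inter> factor (second_octahedron s) i = {1}" by (rule ballI)
      then show "E \<in> opposite_pairs" unfolding opposite_pairs_def E mem_Collect_eq using o(1,2)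
        by (intro exI[of _ "first_octahedron s"] exI[of _ "second_octahedron s"] conjI refl)
    qed
    show "opposite_pairs \<subseteq> (\<lambda>s. {first_octahedron s, second_octahedron s}) ` ?S"
    proof
      fix E assume "E \<in> opposite_pairs"
      then obtain P Q where E: "E = {P, Q}" and P: "P \<in> octahedra n k" and Q: "Q \<in> octahedra n k"
        and PQ: "\<forall>i\<in>{1..k+1}. factor P i \<subseteq> {1..3} \<and> factor Q i \<subseteq> {1..3} \<and> factor P i \<inter> factor Q i = {1}"
        unfolding opposite_pairs_def by blast
      have QP: "\<forall>i\<in>{1..k+1}. factor Q i \<subseteq> {1..3} \<and> factor P i \<subseteq> {1..3} \<and> factor Q i \<inter> factor P i = {1}"
        using PQ by (simp add: Int_commute)
      have "card (factor P 1) = 2" "card (factor Q 1) = 2"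
        using octahedraE[OF P] octahedraE[OF Q] one by metis+
      then have "factor P 1 = {1, 2} \<or> factor Q 1 = {1, 2}"
        using opposite_factors[of "factor P 1" "factor Q 1"] PQ one by blast
      then show "E \<in> (\<lambda>s. {first_octahedron s, second_octahedron s}) ` ?S"
      proof
        assume "factor P 1 = {1, 2}"
        then show ?thesis using opposite_pair_cases[OF P Q PQ] E by blast
      next
        assume "factor Q 1 = {1, 2}"
        then show ?thesis using opposite_pair_cases[OF Q P QP] E by blast
      qed
    qed
  qed
qed

text \<open>Expanded into faces and summed over all opposite pairs, the factors after the first turn
  into unequal letters by \<open>pair_sum_octahedra\<close>; the first factor is treated
  separately.\<close>

lemma van_kampen_sum:
  "(\<Sum>s\<in>PiE {2..k+1} (\<lambda>_. {2, 3}). intersection_form2 k M (octahedral_class (first_octahedron s))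
      (octahedral_class (second_octahedron s))) = 1"
proof -
  let ?S = "PiE {2..k+1} (\<lambda>_. {2, 3 :: nat})" and ?J = "{2..k+1}" and ?v = "\<lambda>_::nat. 0::nat"
  let ?U = "\<lambda>a b. tower 1 (word_list k a) (word_list k b)"
  let ?A = "\<lambda>s. PiE ?J (\<lambda>i. {1, s i :: nat})" and ?C = "\<lambda>s. PiE ?J (\<lambda>i. {1, 5 - s i :: nat})"
    and ?T = "\<lambda>x y a b. ?U (override_on (?v(1 := x)) a ?J) (override_on (?v(1 := y)) b ?J)"
  have J: "set [2..<k+2] = ?J" "{1..k+1} = insert 1 ?J" "1 \<notin> ?J" by auto
  have ov: "word_list k (a(1 := x)) = word_list k (override_on (?v(1 := x)) a ?J)" for a x
    by (rule word_list_cong) (auto simp: override_on_def)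
  have fam: "PiE ?J (\<lambda>i. if i = 1 then A else B i) = PiE ?J B" for A and B :: "nat \<Rightarrow> nat set"
    by (rule PiE_cong) auto
  have "intersection_form2 k M (octahedral_class (first_octahedron s)) (octahedral_class
      (second_octahedron s)) =
      (\<Sum>x\<in>{1, 2}. \<Sum>y\<in>{1, 3}. \<Sum>a\<in>?A s. \<Sum>b\<in>?C s.
        ?T x y a b)" if s: "s \<in> ?S" for s
  proof -
    let ?p = "\<lambda>i. if i = 1 then {1, 2} else {1, s i}" and ?q = "\<lambda>i. if i = 1 then {1, 3} else {1, 5 - s i}"
    note o = opposite_octahedra[OF s]
    have s': "s i = 2 \<or> s i = 3" if "i \<in> {1..k+1}" "i \<noteq> 1" for i using s that by (auto simp: PiE_iff)
    have w: "face_list k (span_face k a) = word_list k a" if "a \<in> PiE {1..k+1} ?p \<or> a \<in> PiE {1..k+1} ?q" for a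
    proof (rule face_list_word_list)
      fix i assume i: "i \<in> {1..k+1}"
      then have "a i \<in> ?p i \<or> a i \<in> ?q i"
        using that PiE_mem[of a "{1..k+1}" ?p i] PiE_mem[of a "{1..k+1}" ?q i] by blast
      then show "letter (a i)" using s'[OF i] by (auto simp: letter_def split: if_splits)
    qed
    have "intersection_form2 k M (octahedral_class (first_octahedron s)) (octahedral_class
        (second_octahedron s)) =
        (\<Sum>a\<in>PiE {1..k+1} ?p. \<Sum>b\<in>PiE {1..k+1} ?q. tower 1 (face_list k (span_face k a)) (face_list k
            (span_face k b)))"
      unfolding intersection_octahedra[OF o(1,2)]
        unfolding first_octahedron_def second_octahedron_def sum_octahedron_of ..
    also have "\<dots> = (\<Sum>a\<in>PiE {1..k+1} ?p. \<Sum>b\<in>PiE {1..k+1} ?q. ?U a b)"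
      by (intro sum.cong refl arg_cong2[where f = "tower 1"]) (rule w, blast)+
    also have "\<dots> = (\<Sum>x\<in>{1, 2}. \<Sum>a\<in>?A s. \<Sum>y\<in>{1, 3}. \<Sum>b\<in>?C s. ?U (a(1 := x)) (b(1 := y)))"
      unfolding J(2) sum_PiE_insert[OF J(3)] fam by simp
    also have "\<dots> = (\<Sum>x\<in>{1, 2}. \<Sum>y\<in>{1, 3}. \<Sum>a\<in>?A s. \<Sum>b\<in>?C s. ?U (a(1 := x)) (b(1 := y)))"
      by (intro sum.cong refl) (rule sum.swap)
    finally show ?thesis unfolding ov .
  qed
  then have "(\<Sum>s\<in>?S. intersection_form2 k M (octahedral_class (first_octahedron s))
      (octahedral_class (second_octahedron s))) =
      (\<Sum>s\<in>?S. \<Sum>x\<in>{1, 2}. \<Sum>y\<in>{1, 3}. \<Sum>a\<in>?A s. \<Sum>b\<in>?C s.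
        ?T x y a b)"
    by (intro sum.cong refl) blast
  also have "\<dots> = (\<Sum>x\<in>{1, 2}. \<Sum>s\<in>?S. \<Sum>y\<in>{1, 3}. \<Sum>a\<in>?A s. \<Sum>b\<in>?C s.
        ?T x y a b)"
    by (rule sum.swap)
  also have "\<dots> = (\<Sum>x\<in>{1, 2}. \<Sum>y\<in>{1, 3}. \<Sum>s\<in>?S. \<Sum>a\<in>?A s. \<Sum>b\<in>?C s.
        ?T x y a b)"
    by (intro sum.cong refl) (rule sum.swap)
  also have "\<dots> = (\<Sum>x\<in>{1, 2}. \<Sum>y\<in>{1, 3}. pair_sum [2..<k+2] ?U (?v(1 := x)) (?v(1 := y)))"
    using pair_sum_octahedra[of "[2..<k+2]" ?U] unfolding J(1) by simp
  \<comment> \<open>Of the four choices in the first factor only the common vertex 1 remains: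
    otherwise the words differ at every position and the faces are disjoint.\<close>
  also have "\<dots> = pair_sum [2..<k+2] ?U (?v(1 := 1)) (?v(1 := 1))"
  proof -
    have z: "pair_sum [2..<k+2] ?U (?v(1 := x)) (?v(1 := y)) = 0" if xy: "x \<noteq> y" for x y
    proof -
      have "pair_sum [2..<k+2] ?U (?v(1 := x)) (?v(1 := y))
          = pair_sum [2..<k+2] (\<lambda>a b. 0) (?v(1 := x)) (?v(1 := y))"
      proof (rule pair_sum_cong, rule words.disjoint)
        fix a b i
        assume h: "\<And>j. j \<notin> set [2..<k+2] \<Longrightarrow> a j = (?v(1 := x)) j \<and> b j = (?v(1 := y)) j"
          "\<And>j. j \<in> set [2..<k+2] \<Longrightarrow> (a j, b j) \<in> unequal_pairs" and i: "i \<in> {1..k+1}"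
        show "a i \<noteq> b i"
        proof (cases "i = 1")
          case True
          then show ?thesis using h(1)[of 1] xy by simp
        next
          case False
          then have "i \<in> set [2..<k+2]" using i by (simp del: upt_Suc)
          then show ?thesis using unequal_pairsD[OF h(2)] by blast
        qed
      qed
      then show ?thesis by simp
    qed
    show ?thesis using z[of 1 3] z[of 2 1] z[of 2 3] by simp
  qed
  also have "?v(1 := 1) = (\<lambda>i. if i = 1 then 1 else 0)" by auto
  also have "pair_sum [2..<k+2] ?U \<dots> \<dots> = 1" by (rule words.van_kampen_number)
  finally show ?thesis .
qed

text \<open>Stated for any \<open>A\<close> that agrees with the intersection numbers on octahedra,
  because the entries of the matrix product are identified with them only there.\<close>

lemma nk_matrix_intersection:
  assumes A: "\<And>P Q. P \<in> octahedra n k \<Longrightarrow> Q \<in> octahedra n k \<Longrightarrow>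
    A P Q = intersection_form2 k M (octahedral_class P) (octahedral_class Q)"
  shows "nk_matrix n k A"
  unfolding nk_matrix_def
proof (intro conjI ballI impI)
  fix P Q assume P: "P \<in> octahedra n k" and Q: "Q \<in> octahedra n k"
  show "A P Q = A Q P"
    unfolding A[OF P Q] A[OF Q P] octahedral_class_def
    by (rule intersection_form2_commute[OF octahedral_cycle[OF P] octahedral_cycle[OF Q]])
  assume dis: "vertex_disjoint k P Q"
  have "tower 1 (face_list k \<tau>) (face_list k \<upsilon>) = 0" if \<tau>: "\<tau> \<in> P" and \<upsilon>: "\<upsilon> \<in> Q" for \<tau> \<upsilon>
  proof (rule tower_disjoint[OF is_face_face_list(1)[OF P \<tau>] is_face_face_list(1)[OF Q \<upsilon>]])
    have e: "set (face_list k \<tau>) = \<tau>" "set (face_list k \<upsilon>) = \<upsilon>"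
      using octahedron_faces(2)[OF P \<tau>] octahedron_faces(2)[OF Q \<upsilon>] by auto
    have "False" if x: "x \<in> \<tau>" "x \<in> \<upsilon>" for x
    proof -
      obtain i c where ic: "x = (i, c)" by (cases x)
      have "(i, c) \<in> set (face_list k \<tau>)" using x(1) e(1) ic by simp
      then have "i \<in> {1..k+1}" by (auto simp: face_list_def simp del: upt_Suc)
      moreover have "c \<in> factor P i" "c \<in> factor Q i"
        using x \<tau> \<upsilon> unfolding factor_def ic by blast+
      ultimately show False using dis unfolding vertex_disjoint_def by blast
    qed
    then show "set (face_list k \<tau>) \<inter> set (face_list k \<upsilon>) = {}" unfolding e by blast
  qed
  then show "A P Q = 0" unfolding A[OF P Q] intersection_octahedra[OF P Q] by simp
next
  fix P X Y Q
  assume P: "P \<in> octahedra n k" and X: "X \<in> octahedra n k" and Y: "Y \<in> octahedra n k" and Q: "Q \<in> octahedra n k"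
    and e: "P = sym_diff X Y"
  show "A P Q = A X Q + A Y Q"
    unfolding A[OF P Q] A[OF X Q] A[OF Y Q] octahedral_class_def
    unfolding e octahedral_class_sym_diff[OF X Y]
    by (rule intersection_form2_add[OF octahedral_cycle[OF X] octahedral_cycle[OF Y] octahedral_cycle[OF Q]])
next
  let ?S = "PiE {2..k+1} (\<lambda>_. {2, 3 :: nat})"
  have en: "entry_at A {first_octahedron s, second_octahedron s} =
      intersection_form2 k M (octahedral_class (first_octahedron s)) (octahedral_class
          (second_octahedron s))" if s: "s \<in> ?S" for s
  proof -
    note o = opposite_octahedra(1,2)[OF s]
    have c: "A (first_octahedron s) (second_octahedron s) = A (second_octahedron s) (first_octahedron s)"
      unfolding A[OF o] A[OF o(2,1)] octahedral_class_def
      by (rule intersection_form2_commute[OF octahedral_cycle[OF o(1)] octahedral_cycle[OF o(2)]])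
    show ?thesis unfolding entry_at_pair[of A, OF c] by (rule A[OF o])
  qed
  have "(\<Sum>E\<in>opposite_pairs. entry_at A E) = (\<Sum>s\<in>?S. entry_at A {first_octahedron s, second_octahedron s})"
    by (rule sum.reindex_bij_betw[OF bij_betw_opposite_pairs, symmetric])
  also have "\<dots> = 1" using van_kampen_sum by (simp add: en)
  finally show "(\<Sum>E\<in>{{P, Q} | P Q. P \<in> octahedra n k \<and> Q \<in> octahedra n k \<and>
      (\<forall>i\<in>{1..k+1}. factor P i \<subseteq> {1..3} \<and> factor Q i \<subseteq> {1..3} \<and> factor P i \<inter> factor Q i = {1})}.
          entry_at A E) = 1"
    unfolding opposite_pairs_def .
qed

end

section \<open>Symmetric forms over the two-element field\<close>

text \<open>The form lives on representatives, with \<open>cls\<close> recording their classes.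
  Bases are chosen among cycles, and finiteness of the set of classes bounds their size; the
  quotient space itself enters only when its dimension is computed.\<close>

locale bit_form =
  fixes Z :: "'g::char2 set" and B :: "'g \<Rightarrow> 'g \<Rightarrow> bit" and cls :: "'g \<Rightarrow> 'c"
  assumes zero: "0 \<in> Z" and add: "\<And>x y. x \<in> Z \<Longrightarrow> y \<in> Z \<Longrightarrow> x + y \<in> Z"
    and B_add: "\<And>x y z. x \<in> Z \<Longrightarrow> y \<in> Z \<Longrightarrow> z \<in> Z \<Longrightarrow> B (x + y) z = B x z + B y z"
    and B_sym: "\<And>x y. x \<in> Z \<Longrightarrow> y \<in> Z \<Longrightarrow> B x y = B y x"
    and finite_cls: "finite (cls ` Z)"
    and B_cls: "\<And>x y z. x \<in> Z \<Longrightarrow> y \<in> Z \<Longrightarrow> z \<in> Z \<Longrightarrow> cls x = cls y \<Longrightarrow> B x z = B y z"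
begin

text \<open>Orthonormal vectors have \<open>p\<close> the identity; for hyperbolic pairs \<open>p\<close> swaps \<open>2i\<close> and \<open>2i + 1\<close>.\<close>

definition gram :: "(nat \<Rightarrow> nat) \<Rightarrow> nat \<Rightarrow> (nat \<Rightarrow> 'g) \<Rightarrow> bool" where
  "gram p r v \<longleftrightarrow> (\<forall>i<r. v i \<in> Z \<and> p i < r \<and> p (p i) = i) \<and>
     (\<forall>i<r. \<forall>j<r. B (v i) (v j) = (if j = p i then 1 else 0))"

text \<open>The orthogonal complement of the family lies in the radical. For a family with
  \<open>gram\<close>, in a form that is nondegenerate on classes, this makes the classes of the
  family a basis.\<close>

definition complete :: "nat \<Rightarrow> (nat \<Rightarrow> 'g) \<Rightarrow> bool" where
  "complete r v \<longleftrightarrow> (\<forall>x\<in>Z. (\<forall>i<r. B x (v i) = 0) \<longrightarrow> (\<forall>y\<in>Z. B x y = 0))"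

lemma gramD:
  assumes "gram p r v"
  shows "i < r \<Longrightarrow> v i \<in> Z" "i < r \<Longrightarrow> p i < r" "i < r \<Longrightarrow> p (p i) = i"
    "i < r \<Longrightarrow> j < r \<Longrightarrow> B (v i) (v j) = (if j = p i then 1 else 0)"
  using assms by (auto simp: gram_def)

lemma B_add_right: "x \<in> Z \<Longrightarrow> y \<in> Z \<Longrightarrow> z \<in> Z \<Longrightarrow> B z (x + y) = B z x + B z y"
  by (simp add: B_sym[of z] B_add add)

lemma B_zero: "z \<in> Z \<Longrightarrow> B 0 z = 0"
  using B_add[OF zero zero, of z] by simp

lemma sum_mem: "(\<And>i. i \<in> I \<Longrightarrow> w i \<in> Z) \<Longrightarrow> (\<Sum>i\<in>I. w i) \<in> Z"
  by (rule sum_closed_aux) (auto intro: zero add)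

lemma B_sum: "(\<And>i. i \<in> I \<Longrightarrow> w i \<in> Z) \<Longrightarrow> z \<in> Z \<Longrightarrow> B (\<Sum>i\<in>I. w i) z = (\<Sum>i\<in>I. B (w i) z)"
proof (induction I rule: infinite_finite_induct)
  case (insert i I)
  then show ?case using B_add[of "w i" "\<Sum>i\<in>I. w i" z] sum_mem[of I w] by simp
qed (simp_all add: B_zero)

text \<open>The family is dual to itself up to \<open>p\<close>: pairing with \<open>v (p j)\<close>
  reads off the coefficient at \<open>j\<close>.\<close>

lemma gram_coefficient:
  assumes g: "gram p r v" and j: "j < r"
  shows "B (\<Sum>i<r. if c i = 0 then 0 else v i) (v (p j)) = (c j :: bit)"
proof -
  have "B (\<Sum>i<r. if c i = 0 then 0 else v i) (v (p j)) = (\<Sum>i<r. B (if c i = 0 then 0 else v i) (v (p j)))"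
    by (rule B_sum) (use gramD[OF g] j zero in auto)
  also have "\<dots> = (\<Sum>i<r. if i = j then c j else 0)"
  proof (rule sum.cong[OF refl])
    fix i assume "i \<in> {..<r}"
    then have i: "i < r" by simp
    have "p j = p i \<longleftrightarrow> i = j" using gramD(3)[OF g i] gramD(3)[OF g j] by metis
    then show "B (if c i = 0 then 0 else v i) (v (p j)) = (if i = j then c j else 0)"
      using gramD(4)[OF g i gramD(2)[OF g j]] B_zero[OF gramD(1)[OF g gramD(2)[OF g j]]]
      by (cases "c i"; cases "c j"; auto)
  qed
  also have "\<dots> = c j" using j by simp
  finally show ?thesis .
qed

definition projection :: "(nat \<Rightarrow> nat) \<Rightarrow> nat \<Rightarrow> (nat \<Rightarrow> 'g) \<Rightarrow> 'g \<Rightarrow> 'g" where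
  "projection p r v x = (\<Sum>i<r. if B x (v (p i)) = 0 then 0 else v i)"

lemma projection:
  assumes g: "gram p r v" and x: "x \<in> Z"
  shows "projection p r v x \<in> Z" "j < r \<Longrightarrow> B (x + projection p r v x) (v j) = 0"
proof -
  show m: "projection p r v x \<in> Z"
    unfolding projection_def by (rule sum_mem) (use gramD[OF g] zero in auto)
  assume j: "j < r"
  have "B (projection p r v x) (v (p (p j))) = B x (v (p (p j)))"
    unfolding projection_def by (rule gram_coefficient[OF g gramD(2)[OF g j]])
  then show "B (x + projection p r v x) (v j) = 0"
    using B_add[OF x m gramD(1)[OF g j]] gramD(3)[OF g j] by (simp add: add_self)
qed

text \<open>\<open>v (p i)\<close> pairs to 1 with \<open>v i\<close> and to 0 with all other
  members, so the members lie in different classes.\<close>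

lemma gram_bound:
  assumes g: "gram p r v"
  shows "inj_on (\<lambda>i. cls (v i)) {..<r}" "r \<le> card (cls ` Z)"
proof -
  show inj: "inj_on (\<lambda>i. cls (v i)) {..<r}"
  proof (rule inj_onI)
    fix i j assume "i \<in> {..<r}" "j \<in> {..<r}" and e: "cls (v i) = cls (v j)"
    then have i: "i < r" and j: "j < r" by auto
    have "B (v i) (v (p i)) = B (v j) (v (p i))"
      by (rule B_cls[OF gramD(1)[OF g i] gramD(1)[OF g j] gramD(1)[OF g gramD(2)[OF g i]] e])
    then have "p i = p j" using gramD(4)[OF g i gramD(2)[OF g i]] gramD(4)[OF g j gramD(2)[OF g i]]
      by (auto split: if_splits)
    then have "p (p i) = p (p j)" by (rule arg_cong)
    then show "i = j" unfolding gramD(3)[OF g i] gramD(3)[OF g j] .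
  qed
  have "card {..<r} \<le> card (cls ` Z)"
    by (rule card_inj_on_le[OF inj _ finite_cls]) (use gramD(1)[OF g] in auto)
  then show "r \<le> card (cls ` Z)" by simp
qed

lemma gram_maximal:
  assumes "gram p r0 v0" "Q r0"
  shows "\<exists>r v. gram p r v \<and> Q r \<and> (\<forall>s w. gram p s w \<longrightarrow> Q s \<longrightarrow> s \<le> r)"
proof -
  let ?P = "\<lambda>r. Q r \<and> (\<exists>v. gram p r v)"
  have "?P r0" using assms by blast
  moreover have "\<forall>r. ?P r \<longrightarrow> r < Suc (card (cls ` Z))" using gram_bound(2) le_imp_less_Suc by blast
  ultimately have "\<exists>r. ?P r \<and> (\<forall>s. ?P s \<longrightarrow> s \<le> r)" by (rule ex_has_greatest_nat)
  then show ?thesis by blast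
qed

text \<open>Projecting the partner of \<open>x\<close> off the family does not change its pairing
  with \<open>x\<close>, since \<open>x\<close> is already orthogonal to the family.\<close>

lemma incomplete_pair:
  assumes g: "gram p r v" and nc: "\<not> complete r v"
  obtains x y where "x \<in> Z" "y \<in> Z" "\<And>i. i < r \<Longrightarrow> B x (v i) = 0" "\<And>i. i < r \<Longrightarrow> B y (v i) = 0" "B x y = 1"
proof -
  obtain x y where x: "x \<in> Z" "\<And>i. i < r \<Longrightarrow> B x (v i) = 0" and y: "y \<in> Z" "B x y \<noteq> 0"
    using nc unfolding complete_def by blast
  let ?q = "projection p r v y"
  have q: "?q \<in> Z" by (rule projection(1)[OF g y(1)])
  have "B x ?q = (\<Sum>i<r. B (if B y (v (p i)) = 0 then 0 else v i) x)"
    unfolding B_sym[OF x(1) q] unfolding projection_def by (rule B_sum) (use gramD[OF g] zero x in auto)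
  also have "\<dots> = 0"
    using x gramD(1)[OF g] B_sym[OF x(1)] by (intro sum.neutral) (auto simp: B_zero)
  finally have "B x (y + ?q) = 1" using B_add_right[OF y(1) q x(1)] y(2) by (simp add: bit_not_zero_iff)
  then show thesis using that[OF x(1) add[OF y(1) q] x(2) projection(2)[OF g y(1)]] by blast
qed

text \<open>A hyperbolic plane next to an orthonormal vector \<open>v\<close> is traded for three orthonormal vectors
  \<open>v + x\<close>, \<open>v + y\<close>, \<open>v + x + y\<close>.\<close>

lemma orthonormal_complete:
  assumes "\<exists>x\<in>Z. B x x = 1"
  obtains r v where "gram (\<lambda>i. i) r v" "complete r v"
proof -
  obtain x0 where x0: "x0 \<in> Z" "B x0 x0 = 1" using assms by blast
  have g1: "gram (\<lambda>i. i) 1 (\<lambda>_. x0)" using x0 by (simp add: gram_def)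
  obtain r v where g: "gram (\<lambda>i. i) r v" and mx0: "\<forall>s w. gram (\<lambda>i. i) s w \<longrightarrow> s \<le> r"
    using gram_maximal[where Q = "\<lambda>_. True", OF g1] by auto
  have mx: "s \<le> r" if "gram (\<lambda>i. i) s w" for s w using mx0 that by blast
  have r: "0 < r" using mx[OF g1] by simp
  note v = gramD(1)[OF g] and vv = gramD(4)[OF g]
  have "complete r v"
  proof (rule ccontr)
    assume "\<not> complete r v"
    then obtain x y where xy: "x \<in> Z" "y \<in> Z" and x: "\<And>i. i < r \<Longrightarrow> B x (v i) = 0"
      and y: "\<And>i. i < r \<Longrightarrow> B y (v i) = 0" and b: "B x y = 1"
      using incomplete_pair[OF g] by metis
    \<comment> \<open>By maximality no vector orthogonal to the family has square 1.\<close>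
    have alt: "B z z = 0" if z: "z \<in> Z" "\<And>i. i < r \<Longrightarrow> B z (v i) = 0" for z
    proof (rule ccontr)
      assume "B z z \<noteq> 0"
      then have zz: "B z z = 1" by (simp add: bit_not_zero_iff)
      have z': "B (v i) z = 0" if "i < r" for i using B_sym[OF z(1) v[OF that]] z(2)[OF that] by simp
      have "gram (\<lambda>i. i) (Suc r) (v(r := z))"
        using v vv z z' zz by (auto simp: gram_def less_Suc_eq)
      then show False using mx by fastforce
    qed
    have xx: "B x x = 0" and yy: "B y y = 0" using alt xy x y by blast+
    have x': "B (v i) x = 0" if "i < r" for i using B_sym[OF xy(1) v[OF that]] x[OF that] by simp
    have y': "B (v i) y = 0" if "i < r" for i using B_sym[OF xy(2) v[OF that]] y[OF that] by simp
    have b': "B y x = 1" using B_sym[OF xy] b by simp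
    define u where "u = v 0"
    have u: "u \<in> Z" "B u u = 1" "B u x = 0" "B u y = 0" "B x u = 0" "B y u = 0"
      using v vv x' y' x y r by (auto simp: u_def)
    have ui: "B u (v i) = 0" "B (v i) u = 0" if "i < r" "i \<noteq> 0" for i
      using vv[of 0 i] vv[of i 0] that r by (auto simp: u_def)
    \<comment> \<open>Each new vector has square 1, since \<open>u\<close> has and the added vectors
      have square 0 and are orthogonal to \<open>u\<close>; two different ones pair to 1 + 1 =
      0.\<close>
    define w where "w = v(0 := u + x, r := u + y, Suc r := u + x + y)"
    have w: "w 0 = u + x" "w r = u + y" "w (Suc r) = u + x + y" "\<And>i. i \<noteq> 0 \<Longrightarrow> i < r \<Longrightarrow> w i = v i"
      using r by (auto simp: w_def)
    note bl = B_add B_add_right add xy u xx yy b b' x x' y y' ui add_self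
    have mem: "w i \<in> Z" if "i < Suc (Suc r)" for i
      using that w u(1) xy v by (cases "i = 0") (auto simp: less_Suc_eq add)
    have "B (w i) (w j) = (if j = i then 1 else 0)" if i: "i < Suc (Suc r)" and j: "j < Suc (Suc r)" for i j
    proof -
      have "i = 0 \<or> i = r \<or> i = Suc r \<or> i \<noteq> 0 \<and> i < r" using i by linarith
      moreover have "j = 0 \<or> j = r \<or> j = Suc r \<or> j \<noteq> 0 \<and> j < r" using j by linarith
      ultimately show ?thesis
        using r by (elim disjE conjE; simp add: w bl v vv)
    qed
    then have "gram (\<lambda>i. i) (Suc (Suc r)) w" using mem by (simp add: gram_def)
    then show False using mx by fastforce
  qed
  then show thesis using that g by blast
qed

definition flip :: "nat \<Rightarrow> nat" where
  "flip i = (if even i then Suc i else i - 1)"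

text \<open>When all squares vanish, a pair with product 1 spans a hyperbolic plane; one orthogonal
  to the family could be appended to it, against maximality.\<close>

lemma hyperbolic_complete:
  assumes alt: "\<forall>x\<in>Z. B x x = 0"
  obtains r v where "gram flip r v" "complete r v" "even r"
proof -
  have g0: "gram flip 0 (\<lambda>_. 0)" by (simp add: gram_def)
  obtain r v where g: "gram flip r v" and ev: "even r" and mx0: "\<forall>s w. gram flip s w \<longrightarrow> even s \<longrightarrow> s \<le> r"
    using gram_maximal[where Q = even, OF g0] by auto
  have mx: "s \<le> r" if "gram flip s w" "even s" for s w using mx0 that by blast
  note v = gramD(1)[OF g] and vv = gramD(4)[OF g] and f = gramD(2,3)[OF g]
  have "complete r v"
  proof (rule ccontr)
    assume "\<not> complete r v"
    then obtain x y where xy: "x \<in> Z" "y \<in> Z" and x: "\<And>i. i < r \<Longrightarrow> B x (v i) = 0"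
      and y: "\<And>i. i < r \<Longrightarrow> B y (v i) = 0" and b: "B x y = 1"
      using incomplete_pair[OF g] by metis
    have x': "B (v i) x = 0" if "i < r" for i using B_sym[OF xy(1) v[OF that]] x[OF that] by simp
    have y': "B (v i) y = 0" if "i < r" for i using B_sym[OF xy(2) v[OF that]] y[OF that] by simp
    have b': "B y x = 1" using B_sym[OF xy] b by simp
    have xx: "B x x = 0" "B y y = 0" using alt xy by auto
    define w where "w = v(r := x, Suc r := y)"
    have w: "w r = x" "w (Suc r) = y" "\<And>i. i < r \<Longrightarrow> w i = v i" by (auto simp: w_def)
    \<comment> \<open>Evenness of \<open>r\<close> is kept along so that \<open>flip\<close> pairs
      exactly the two new indices.\<close>
    have fr: "flip r = Suc r" "flip (Suc r) = r" using ev by (auto simp: flip_def)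
    have 1: "w i \<in> Z \<and> flip i < Suc (Suc r) \<and> flip (flip i) = i" if i: "i < Suc (Suc r)" for i
    proof -
      consider "i = r" | "i = Suc r" | "i < r" using i by linarith
      then show ?thesis by cases (use xy v f[of i] in \<open>auto simp: w fr\<close>)
    qed
    have 2: "B (w i) (w j) = (if j = flip i then 1 else 0)" if i: "i < Suc (Suc r)"
      and j: "j < Suc (Suc r)" for i j
    proof -
      have "i = r \<or> i = Suc r \<or> i < r" using i by linarith
      moreover have "j = r \<or> j = Suc r \<or> j < r" using j by linarith
      moreover have "i < r \<Longrightarrow> flip i \<noteq> r" "i < r \<Longrightarrow> flip i \<noteq> Suc r" using f(1)[of i] by auto
      ultimately show ?thesis
        by (elim disjE; simp add: w fr xx b b' x x' y y' vv)
    qed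
    have "gram flip (Suc (Suc r)) w" using 1 2 by (simp add: gram_def)
    then show False using mx ev by fastforce
  qed
  then show thesis using that g ev by blast
qed

text \<open>The entry of the product of \<open>Omega\<close> with the coordinate matrices.
  \<open>x\<close> may be replaced by its projection to the family, because the difference lies in
  the radical.\<close>

lemma gram_expand:
  assumes g: "gram p r v" and c: "complete r v" and x: "x \<in> Z" and y: "y \<in> Z"
  shows "B x y = (\<Sum>i<r. B x (v (p i)) * B y (v i))"
proof -
  have q: "projection p r v x \<in> Z" by (rule projection(1)[OF g x])
  have "B (x + projection p r v x) y = 0"
    using c add[OF x q] projection(2)[OF g x] y unfolding complete_def by blast
  then have "B x y = B (projection p r v x) y" using B_add[OF x q y] by (simp add: add_eq_0_iff_eq)
  also have "\<dots> = (\<Sum>i<r. B (if B x (v (p i)) = 0 then 0 else v i) y)"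
    unfolding projection_def by (rule B_sum) (use gramD[OF g] zero y in auto)
  also have "\<dots> = (\<Sum>i<r. B x (v (p i)) * B y (v i))"
  proof (rule sum.cong[OF refl])
    fix i assume "i \<in> {..<r}"
    then have "B (v i) y = B y (v i)" using B_sym gramD(1)[OF g] y by blast
    then show "B (if B x (v (p i)) = 0 then 0 else v i) y = B x (v (p i)) * B y (v i)"
      using B_zero[OF y] by (cases "B x (v (p i))") auto
  qed
  finally show ?thesis .
qed

end

section \<open>Coordinates on the middle homology\<close>

context local_dual
begin

abbreviation cycles :: "'a chain2 set" where
  "cycles \<equiv> {c. singular_cycle2 k M c}"

abbreviation pairing :: "'a chain2 \<Rightarrow> 'a chain2 \<Rightarrow> bit" where
  "pairing x y \<equiv> intersection_form2 k M (homology_class2 k M x) (homology_class2 k M y)"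

sublocale form: bit_form cycles pairing "homology_class2 k M"
proof unfold_locales
  show "0 \<in> cycles" by (simp add: singular_cycle2_def)
  show "x + y \<in> cycles" if "x \<in> cycles" "y \<in> cycles" for x y
    using that by (simp add: singular_cycle2_def singular_chain2_add chain_boundary2_add)
  show "pairing (x + y) z = pairing x z + pairing y z" if "x \<in> cycles" "y \<in> cycles" "z \<in> cycles" for x y z
    using intersection_form2_add that by blast
  show "pairing x y = pairing y x" if "x \<in> cycles" "y \<in> cycles" for x y
    using intersection_form2_commute that by blast
  show "finite (homology_class2 k M ` cycles)" by (rule finite_homology2)
qed simp

lemma homology_class2_eqI:
  assumes x: "x \<in> cycles" and y: "y \<in> cycles" and p: "\<And>z. z \<in> cycles \<Longrightarrow> pairing (x + y) z = 0"
  shows "homology_class2 k M x = homology_class2 k M y"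
proof (rule ccontr)
  assume "homology_class2 k M x \<noteq> homology_class2 k M y"
  then have nb: "\<not> singular_boundary2 k M (x + y)" by (simp add: homology_class2_eq_iff)
  have "singular_cycle2 k M (x + y)" using form.add[OF x y] by simp
  then obtain z where "singular_cycle2 k M z" "pairing (x + y) z = 1"
    using intersection_form2_nondegenerate[OF _ nb] by blast
  then show False using p[of z] by simp
qed

text \<open>Pairing with \<open>v (p j)\<close> gives independence of the classes. A class equals
  that of its projection by completeness and nondegeneracy, which gives spanning.\<close>

lemma betti2_gram:
  assumes g: "form.gram p r v" and c: "form.complete r v"
  shows "betti2 k M = r"
proof -
  let ?h = "homology_class2 k M" and ?H = "homology2 k M"
  interpret V: vectorspace "class_ring :: bit ring" ?H by (rule vectorspace_homology2)
  have car: "carrier ?H = ?h ` cycles" and zero: "\<zero>\<^bsub>?H\<^esub> = ?h 0" by (simp_all add: homology2_def)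
  have ring0: "\<zero>\<^bsub>class_ring\<^esub> = (0 :: bit)" by (simp add: class_ring_simps)
  note v = form.gramD(1)[OF g]
  define A where "A = (\<lambda>i. ?h (v i)) ` {..<r}"
  have inj: "inj_on (\<lambda>i. ?h (v i)) {..<r}" by (rule form.gram_bound(1)[OF g])
  have A: "finite A" "A \<subseteq> carrier ?H" using v by (auto simp: A_def car)
  have sum: "finite I \<Longrightarrow> (\<And>i. i \<in> I \<Longrightarrow> w i \<in> cycles) \<Longrightarrow> finsum ?H (\<lambda>i. ?h (w i)) I = ?h (\<Sum>i\<in>I. w i)"
    for I and w :: "nat \<Rightarrow> 'a chain2"
  proof (induction I rule: finite_induct)
    case empty
    then show ?case by (simp add: zero)
  next
    case (insert i I)
    have "(\<lambda>i. ?h (w i)) \<in> I \<rightarrow> carrier ?H" "?h (w i) \<in> carrier ?H" using insert.prems by (auto simp: car)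
    then have "finsum ?H (\<lambda>i. ?h (w i)) (insert i I) = ?h (w i) \<oplus>\<^bsub>?H\<^esub> finsum ?H (\<lambda>i. ?h (w i)) I"
      by (rule V.finsum_insert[OF insert.hyps(1,2)])
    also have "finsum ?H (\<lambda>i. ?h (w i)) I = ?h (\<Sum>i\<in>I. w i)" using insert by blast
    also have "?h (w i) \<oplus>\<^bsub>?H\<^esub> \<dots> = ?h (\<Sum>i\<in>insert i I. w i)"
      using insert.hyps by (simp add: homology2_add)
    finally show ?case .
  qed
  have lc: "V.lincomb a A = ?h (\<Sum>i<r. if a (?h (v i)) = 0 then 0 else v i)" for a
  proof -
    have m: "(if a (?h (v i)) = 0 then 0 else v i) \<in> cycles" if "i < r" for i using v[OF that] form.zero by auto
    have e: "a (?h (v i)) \<odot>\<^bsub>?H\<^esub> ?h (v i) = ?h (if a (?h (v i)) = 0 then 0 else v i)" for i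
      by (rule homology2_smult)
    have "V.lincomb a A = finsum ?H (\<lambda>u. a u \<odot>\<^bsub>?H\<^esub> u) A" by (simp only: V.lincomb_def)
    also have "\<dots> = finsum ?H (\<lambda>i. a (?h (v i)) \<odot>\<^bsub>?H\<^esub> ?h (v i)) {..<r}"
      unfolding A_def by (rule V.finsum_reindex[OF _ inj]) (use m in \<open>auto simp: e car\<close>)
    also have "\<dots> = ?h (\<Sum>i<r. if a (?h (v i)) = 0 then 0 else v i)"
      unfolding e by (rule sum) (use m in auto)
    finally show ?thesis .
  qed
  have "V.basis A"
    unfolding V.basis_def
  proof (intro conjI)
    show "A \<subseteq> carrier ?H" by (rule A(2))
    show "V.lin_indpt A"
    proof (rule V.finite_lin_indpt2[OF A])
      fix a :: "'a chain2 set \<Rightarrow> bit" assume a: "V.lincomb a A = \<zero>\<^bsub>?H\<^esub>"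
      let ?s = "\<Sum>i<r. if a (?h (v i)) = 0 then 0 else v i"
      have s: "?s \<in> cycles" by (rule form.sum_mem) (use v form.zero in auto)
      have "?h ?s = ?h 0" using a unfolding lc zero .
      then have s0: "pairing ?s z = 0" if "z \<in> cycles" for z
        using form.B_zero[OF that] by simp
      show "\<forall>u\<in>A. a u = \<zero>\<^bsub>class_ring\<^esub>"
      proof
        fix u assume "u \<in> A"
        then obtain j where j: "j < r" "u = ?h (v j)" by (auto simp: A_def)
        have "pairing ?s (v (p j)) = a (?h (v j))" by (rule form.gram_coefficient[OF g j(1)])
        then show "a u = \<zero>\<^bsub>class_ring\<^esub>"
          using s0[OF v[OF form.gramD(2)[OF g j(1)]]] j(2) by (simp add: ring0)
      qed
    qed
    show "V.gen_set A"
    proof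
      show "V.span A \<subseteq> carrier ?H" by (rule V.span_is_subset2[OF A(2)])
      show "carrier ?H \<subseteq> V.span A"
      proof
        fix y assume "y \<in> carrier ?H"
        then obtain x where x: "x \<in> cycles" "y = ?h x" by (auto simp: car)
        \<comment> \<open>A coefficient function must depend on the class only;
          \<open>inv_into\<close> recovers the index of the member that represents it.\<close>
        define a where "a = (\<lambda>u. pairing x (v (p (inv_into {..<r} (\<lambda>i. ?h (v i)) u))))"
        have ai: "a (?h (v i)) = pairing x (v (p i))" if "i < r" for i
          using inv_into_f_f[OF inj, of i] that by (simp add: a_def)
        have "V.lincomb a A = ?h (form.projection p r v x)"
          unfolding lc form.projection_def
            by (rule arg_cong[where f = ?h], rule sum.cong[OF refl]) (simp add: ai)
        also have "\<dots> = y"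
          unfolding x(2)
        proof (rule homology_class2_eqI)
          show q: "form.projection p r v x \<in> cycles" by (rule form.projection(1)[OF g x(1)])
          fix z assume "z \<in> cycles"
          then show "pairing (form.projection p r v x + x) z = 0"
            using c form.add[OF x(1) q] form.projection(2)[OF g x(1)]
            unfolding form.complete_def add.commute[of "form.projection p r v x"] by blast
        qed (rule x(1))
        finally have "V.lincomb a A = y" .
        moreover have "V.span A = {V.lincomb a A | a. a \<in> A \<rightarrow> carrier class_ring}" by (rule V.finite_span[OF A])
        moreover have "a \<in> A \<rightarrow> carrier class_ring" by (simp add: class_ring_simps)
        ultimately show "y \<in> V.span A" by blast
      qed
    qed
  qed
  then have "V.dim = card A" by (rule V.dim_basis[OF A(1)])
  also have "\<dots> = r" unfolding A_def using card_image[OF inj] by simp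
  finally show ?thesis by (simp add: betti2_def)
qed

end

text \<open>A block is split off at the upper left, so the remaining indices shift by 2 and keep
  their parity.\<close>

lemma hyperbolic_block:
  "dim_row (diag_block_mat (replicate s (mat_of_rows_list 2 [[0, 1], [1, 0 :: bit]]))) = 2 * s \<and>
   dim_col (diag_block_mat (replicate s (mat_of_rows_list 2 [[0, 1], [1, 0 :: bit]]))) = 2 * s \<and>
   (\<forall>i<2 * s. \<forall>j<2 * s. diag_block_mat (replicate s (mat_of_rows_list 2 [[0, 1], [1, 0 :: bit]])) $$ (i, j) =
     (if j = (if even i then Suc i else i - 1) then 1 else 0))"
proof (induction s)
  case (Suc s)
  let ?H = "mat_of_rows_list 2 [[0, 1], [1, 0 :: bit]]"
  let ?D = "diag_block_mat (replicate s ?H)"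
  have D: "dim_row ?D = 2 * s" "dim_col ?D = 2 * s"
    and D': "\<And>i j. i < 2 * s \<Longrightarrow> j < 2 * s \<Longrightarrow> ?D $$ (i, j) = (if j
        = (if even i then Suc i else i - 1) then 1 else 0)"
    using Suc.IH by blast+
  have H: "dim_row ?H = 2" "dim_col ?H = 2" by (simp_all add: mat_of_rows_list_def)
  have e: "diag_block_mat (replicate (Suc s) ?H) = four_block_mat ?H (0\<^sub>m 2 (2 * s)) (0\<^sub>m (2 * s) 2) ?D"
    by (simp add: Let_def H D)
  show ?case
    unfolding e
  proof (intro conjI allI impI)
  show "dim_row (four_block_mat ?H (0\<^sub>m 2 (2 * s)) (0\<^sub>m (2 * s) 2) ?D) = 2 * Suc s"
    "dim_col (four_block_mat ?H (0\<^sub>m 2 (2 * s)) (0\<^sub>m (2 * s) 2) ?D) = 2 * Suc s"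
    by (simp_all add: H D)
  fix i j assume i: "i < 2 * Suc s" and j: "j < 2 * Suc s"
  have Hij: "?H $$ (i, j) = (if j = (if even i then Suc i else i - 1) then 1 else 0)" if "i < 2" "j < 2"
  proof -
    have "i = 0 \<or> i = 1" "j = 0 \<or> j = 1" using that by auto
    then show ?thesis by (auto simp: mat_of_rows_list_def)
  qed
  have Dij: "?D $$ (i - 2, j - 2) = (if j = (if even i then Suc i else i - 1) then 1 else 0)"
    if ij: "\<not> i < 2" "\<not> j < 2"
  proof -
    have "?D $$ (i - 2, j - 2) = (if j - 2 = (if even (i - 2) then Suc (i - 2) else i - 2 - 1) then 1 else 0)"
      by (rule D') (use i j ij in auto)
    moreover have "even (i - 2) = even i" using ij by simp
    moreover have "j - 2 = (if even i then Suc (i - 2) else i - 2 - 1) \<longleftrightarrow> j = (if even i then Suc i else i - 1)"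
      using ij by (cases "even i"; cases "i = 2"; cases "i = 3") auto
    ultimately show ?thesis by simp
  qed
  have off: "j \<noteq> (if even i then Suc i else i - 1)" if "(i < 2) \<noteq> (j < 2)"
  proof -
    have "i < 2 \<longleftrightarrow> (if even i then Suc i else i - 1) < 2"
      by (cases "i = 0"; cases "i = 1"; cases "i = 2"; cases "even i") auto
    then show ?thesis using that by metis
  qed
  show "four_block_mat ?H (0\<^sub>m 2 (2 * s)) (0\<^sub>m (2 * s) 2) ?D $$ (i, j) = (if j
      = (if even i then Suc i else i - 1) then 1 else 0)"
    by (subst index_mat_four_block(1)) (use i j Hij Dij off in \<open>auto simp: H D\<close>)
  qed
qed simp

lemma quadratic_form_entry:
  fixes W :: "bit mat" and Y :: "nat \<Rightarrow> nat \<Rightarrow> bit"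
  assumes W: "dim_row W = r" "dim_col W = r"
    and Wp: "\<forall>i<r. \<forall>j<r. W $$ (i, j) = (if j = p i then 1 else 0)"
    and p: "\<And>i. i < r \<Longrightarrow> p i < r" and ab: "a < m" "b < m"
  shows "(transpose_mat (mat r m (\<lambda>(i, j). Y i j)) * W * mat r m (\<lambda>(i, j). Y i j)) $$ (a, b) =
    (\<Sum>i<r. Y i a * Y (p i) b)"
proof -
  let ?Y = "mat r m (\<lambda>(i, j). Y i j)"
  have 1: "(transpose_mat ?Y * W) $$ (a, j) = (\<Sum>i<r. Y i a * (if j = p i then 1 else 0))" if j: "j < r" for j
    using ab j W by (simp add: scalar_prod_def Wp lessThan_atLeast0)
  have "(transpose_mat ?Y * W * ?Y) $$ (a, b) = (\<Sum>j<r. (transpose_mat ?Y * W) $$ (a, j) * Y j b)"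
    using ab W by (simp add: scalar_prod_def lessThan_atLeast0 del: index_mult_mat(1))
      (simp add: scalar_prod_def lessThan_atLeast0)
  also have "\<dots> = (\<Sum>j<r. \<Sum>i<r. if j = p i then Y i a * Y j b else 0)"
    by (intro sum.cong refl) (simp add: 1 sum_distrib_right if_distrib if_distribR cong: if_cong)
  also have "\<dots> = (\<Sum>i<r. \<Sum>j<r. if j = p i then Y i a * Y j b else 0)" by (rule sum.swap)
  also have "\<dots> = (\<Sum>i<r. Y i a * Y (p i) b)" by (intro sum.cong refl) (simp add: p)
  finally show ?thesis .
qed

context local_dual
begin

text \<open>The two cases in the definition of \<open>Omega\<close> are those of orthonormal and of
  hyperbolic families; in the second, evenness of \<open>r\<close> makes the division by 2
  exact.\<close>

lemma Omega_gram:
  obtains p r v where "form.gram p r v" "form.complete r v" "betti2 k M = r"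
    "dim_row (Omega k M) = r" "dim_col (Omega k M) = r"
    "\<forall>i<r. \<forall>j<r. Omega k M $$ (i, j) = (if j = p i then 1 else 0)"
proof (cases "\<exists>x\<in>carrier (homology2 k M). intersection_form2 k M x x = 1")
  case True
  then have O: "Omega k M = 1\<^sub>m (betti2 k M)" by (simp add: Omega_def)
  have "\<exists>x\<in>cycles. pairing x x = 1" using True by (auto simp: homology2_def)
  then obtain r v where g: "form.gram (\<lambda>i. i) r v" and c: "form.complete r v"
    using form.orthonormal_complete by blast
  have b: "betti2 k M = r" by (rule betti2_gram[OF g c])
  show thesis by (rule that[OF g c b]) (simp_all add: O b eq_commute)
next
  case False
  then have O: "Omega k M = diag_block_mat (replicate (betti2 k M div 2) (mat_of_rows_list 2 [[0, 1], [1, 0]]))"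
    by (simp add: Omega_def)
  have "\<forall>x\<in>cycles. pairing x x = 0" using False by (auto simp: homology2_def bit_not_one_iff)
  then obtain r v where g: "form.gram form.flip r v" and c: "form.complete r v" and ev: "even r"
    using form.hyperbolic_complete by blast
  have b: "betti2 k M = r" by (rule betti2_gram[OF g c])
  have r: "2 * (r div 2) = r" using ev by simp
  note H = hyperbolic_block[of "r div 2", unfolded r]
  show thesis by (rule that[OF g c b]) (simp_all add: O b H form.flip_def)
qed

end

theorem theorem1p8:
  fixes M :: "'a topology" and k n :: nat and e :: "octahedron \<Rightarrow> nat"
  assumes "k \<ge> 1"
    and "n \<ge> 3"
    and "closed_manifold (2 * k) M"
    and "\<exists>f. almost_embedding (join_complex n k) M f"
    and "bij_betw e (octahedra n k) {..<(n choose 2) ^ (k + 1)}"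
  shows "\<exists>Y \<in> carrier_mat (betti2 k M) ((n choose 2) ^ (k + 1)).
           nk_matrix n k (\<lambda>P Q. (transpose_mat Y * Omega k M * Y) $$ (e P, e Q))"
proof -
  obtain f where f: "almost_embedding (join_complex n k) M f" using assms(4) by blast
  have fin: "finite \<tau>" and card: "card \<tau> \<le> Suc k" if "\<tau> \<in> join_complex n k" for \<tau>
    using join_complex_face[OF that] by blast+
  obtain d \<eta> \<delta> D N \<mu> where E: "embedded_complex M k d \<eta> \<delta> D (join_complex n k) f N \<mu>"
    using embedded_complex_exists[OF assms(1,3) f finite_join_complex fin join_complex_closed card] by blast
  interpret embedded_join M k d \<eta> \<delta> D n f N \<mu>
    by (intro embedded_join.intro E embedded_join_axioms.intro assms(2))
  obtain p r v where g: "form.gram p r v" and c: "form.complete r v" and b: "betti2 k M = r"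
    and W: "dim_row (Omega k M) = r" "dim_col (Omega k M) = r"
      "\<forall>i<r. \<forall>j<r. Omega k M $$ (i, j) = (if j = p i then 1 else 0)"
    by (rule Omega_gram)
  let ?m = "(n choose 2) ^ (k + 1)"
  \<comment> \<open>The coordinate of a class along \<open>v i\<close> is its pairing with
    \<open>v (p i)\<close>.\<close>
  define Y where "Y = (\<lambda>i j. pairing (octahedral_cycle (inv_into (octahedra n k) e j)) (v (p i)))"
  let ?Y = "mat r ?m (\<lambda>(i, j). Y i j)"
  have inj: "inj_on e (octahedra n k)" using assms(5) by (rule bij_betw_imp_inj_on)
  have "nk_matrix n k (\<lambda>P Q. (transpose_mat ?Y * Omega k M * ?Y) $$ (e P, e Q))"
  proof (rule nk_matrix_intersection)
    fix P Q assume P: "P \<in> octahedra n k" and Q: "Q \<in> octahedra n k"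
    have eP: "e P < ?m" "e Q < ?m" using assms(5) P Q by (auto simp: bij_betw_def)
    have cP: "octahedral_cycle P \<in> cycles" and cQ: "octahedral_cycle Q \<in> cycles"
      using octahedral_cycle P Q by auto
    have "(transpose_mat ?Y * Omega k M * ?Y) $$ (e P, e Q) = (\<Sum>i<r. Y i (e P) * Y (p i) (e Q))"
      by (rule quadratic_form_entry[OF W form.gramD(2)[OF g] eP])
    also have "\<dots> = (\<Sum>i<r. pairing (octahedral_cycle P) (v (p i)) * pairing (octahedral_cycle Q) (v i))"
      by (intro sum.cong refl) (simp add: Y_def inv_into_f_f[OF inj P] inv_into_f_f[OF inj Q]
          form.gramD(3)[OF g])
    also have "\<dots> = pairing (octahedral_cycle P) (octahedral_cycle Q)"
      by (rule form.gram_expand[OF g c cP cQ, symmetric])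
    finally show "(transpose_mat ?Y * Omega k M * ?Y) $$ (e P, e Q) =
        intersection_form2 k M (octahedral_class P) (octahedral_class Q)"
      by (simp add: octahedral_class_def)
  qed
  then show ?thesis unfolding b by (intro bexI[of _ ?Y]) auto
qed

end
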